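(* Every morphism in the category $\mathcal{PE}$ of second order parabolic equations, from an object with underlying manifold $T\times X\times\Omega$ to an object with underlying manifold $T'\times X'\times\Omega'$, is of the form $$(t,x,u)\mapsto\bigl(t'(t),\,x'(t,x),\,u'(t,x,u)\bigr)$$ with submersive $t'(t)$, $x'(t,x)$, $u'(t,x,u)$. Isomorphisms in the category $\mathcal{PE}$ are exactly the diffeomorphisms of this form.
   Context: Jets. For a smooth manifold $N$ and $0<m<\dim N$, $J^k_m(N)$ is the bundle over $N$ of $k$-jets of $m$-dimensional submanifolds of $N$ (the fibre over $x$ is the set of equivalence classes of smooth $m$-dimensional submanifolds through $x$ under $k$-th order contact at $x$). Let $F\colon N\to N'$ be a smooth surjective submersion. A subset $L\subset N$ is $F$-projected if $L=F^{-1}(F(L))$. $J^k_{m,F}(N)\subset J^k_m(N)$ consists of the $k$-jets of all $m$-dimensional $F$-projected submanifolds of $N$. With $m'=m-\dim N+\dim N'$, the map $F^k\colon J^k_{m,F}(N)\to J^k_{m'}(N')$ sends the $k$-jet at $x$ of an $F$-projected submanifold $L$ to the $k$-jet at $F(x)$ of $F(L)$. Category $\mathcal{PDE}$. Objects: pairs $(N,E)$ with $N$ a smooth manifold and $E\subset J^k_m(N)$ a subset, for some integers $k,m\ge1$. A morphism $(N,E)\to(N',E')$ is a smooth surjective submersion $F\colon N\to N'$ such that $E'\subset J^k_{m'}(N')$ and $E\cap J^k_{m,F}(N)=(F^k)^{-1}(E')$. Composition is composition of maps; identities are identity maps. Category $\mathcal{PE}$. It is the full subcategory of $\mathcal{PDE}$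 whose objects are pairs $(N,E)$ with $N=T\times X\times\Omega$, where $X$ is a connected smooth manifold, $T,\Omega\subseteq\mathbb R$ are open intervals (bounded, semibounded or unbounded), and $E$ is the extended version of an equation $u_t=Lu$ for a function $u(t,x)$ with values in $\Omega$, i.e. the closure in $J^2_{n+1}(N)$, $n=\dim X$, of the set of 2-jets of graphs of functions satisfying the equation at the given point. Here, in a neighborhood of each point, in some (and then arbitrary) local coordinates $(x^i)$ on $X$, $$Lu=\sum_{i,j}b^{ij}(t,x,u)u_{ij}+\sum_{i,j}c^{ij}(t,x,u)u_iu_j+\sum_i b^i(t,x,u)u_i+q(t,x,u),$$ where subscripts $i$ denote partial derivatives with respect to $x^i$, $b^{ij}=b^{ji}$ is positive definite, and $c^{ij}=c^{ji}$.
   Formalization: That a diffeomorphism of this form is an isomorphism onto some object is stated for increasing t'(t) only (t ↦ −t makes the leading part negative definite); X and X' have dimension at least 1 (for points, u_t = 0 with (t,u) ↦ (t+u,u) is a counterexample). *)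

theory Defs
  imports "HOL-Analysis.Analysis"
begin

section \<open>Smooth functions on open subsets of Euclidean spaces\<close>

text \<open>\<open>iter_deriv [v\<^sub>1, \<dots>, v\<^sub>r] f x\<close> is the iterated directional derivative
  \<open>D_v\<^sub>1 (\<dots> (D_v\<^sub>r f)) x\<close>. On an open set, a function is of class \<open>C\<^sup>\<infinity>\<close> iff all its iterated
  directional derivatives are (Frechet) differentiable; \<open>smooth_on\<close> is only used for open sets.\<close>

primrec iter_deriv ::
  "'a::euclidean_space list \<Rightarrow> ('a \<Rightarrow> 'b::real_normed_vector) \<Rightarrow> 'a \<Rightarrow> 'b" where
  "iter_deriv [] f = f"
| "iter_deriv (v # vs) f = (\<lambda>x. frechet_derivative (iter_deriv vs f) (at x) v)"

definition smooth_on :: "'a::euclidean_space set \<Rightarrow> ('a \<Rightarrow> 'b::real_normed_vector) \<Rightarrow> bool" where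
  "smooth_on S f \<longleftrightarrow> (\<forall>x\<in>S. \<forall>vs. iter_deriv vs f differentiable (at x))"


section \<open>Smooth manifolds\<close>

text \<open>A chart \<open>(U, \<phi>)\<close> has domain \<open>U\<close>; the values of \<open>\<phi>\<close> outside \<open>U\<close> are irrelevant. A smooth manifold
  of dimension \<open>DIM('e)\<close> is given by an atlas \<open>A\<close> of charts with values in \<open>'e\<close>. Its underlying space
  is the open set \<open>carrier A\<close> of a Hausdorff second countable space, and its maximal atlas is
  \<open>smooth_charts A\<close>.\<close>

type_synonym ('a, 'e) chart = "'a set \<times> ('a \<Rightarrow> 'e)"

definition is_chart ::
  "('a::{t2_space,second_countable_topology}, 'e::euclidean_space) chart \<Rightarrow> bool" where
  "is_chart = (\<lambda>(U, \<phi>). open U \<and> open (\<phi> ` U) \<and> homeomorphism U (\<phi> ` U) \<phi> (inv_into U \<phi>))"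

definition smooth_compatible ::
  "('a::{t2_space,second_countable_topology}, 'e::euclidean_space) chart \<Rightarrow> ('a, 'e) chart \<Rightarrow> bool" where
  "smooth_compatible = (\<lambda>(U, \<phi>) (V, \<psi>).
     smooth_on (\<phi> ` (U \<inter> V)) (\<psi> \<circ> inv_into U \<phi>) \<and>
     smooth_on (\<psi> ` (U \<inter> V)) (\<phi> \<circ> inv_into V \<psi>))"

definition carrier :: "('a, 'e) chart set \<Rightarrow> 'a set" where
  "carrier A = \<Union> (fst ` A)"

definition smooth_manifold ::
  "('a::{t2_space,second_countable_topology}, 'e::euclidean_space) chart set \<Rightarrow> bool" where
  "smooth_manifold A \<longleftrightarrow> (\<forall>c\<in>A. is_chart c) \<and> (\<forall>c\<in>A. \<forall>d\<in>A. smooth_compatible c d)"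

definition smooth_charts ::
  "('a::{t2_space,second_countable_topology}, 'e::euclidean_space) chart set \<Rightarrow> ('a, 'e) chart set" where
  "smooth_charts A = {c. is_chart c \<and> fst c \<subseteq> carrier A \<and> (\<forall>d\<in>A. smooth_compatible c d)}"

definition open_set_manifold :: "'e::euclidean_space set \<Rightarrow> ('e, 'e) chart set" where
  "open_set_manifold S = {(S, \<lambda>x. x)}"

definition prod_manifold ::
  "('a, 'e) chart set \<Rightarrow> ('b, 'f) chart set \<Rightarrow> ('a \<times> 'b, 'e \<times> 'f) chart set" where
  "prod_manifold A B = {(U \<times> V, map_prod \<phi> \<psi>) | U \<phi> V \<psi>. (U, \<phi>) \<in> A \<and> (V, \<psi>) \<in> B}"

definition open_submanifold :: "('a, 'e) chart set \<Rightarrow> 'a set \<Rightarrow> ('a, 'e) chart set" where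
  "open_submanifold A D = {(U \<inter> D, \<phi>) | U \<phi>. (U, \<phi>) \<in> A}"

text \<open>Maps between manifolds are total functions of which only the restriction to the carrier matters.\<close>

definition smooth_map ::
  "('a::{t2_space,second_countable_topology}, 'e::euclidean_space) chart set \<Rightarrow>
   ('b::{t2_space,second_countable_topology}, 'f::euclidean_space) chart set \<Rightarrow> ('a \<Rightarrow> 'b) \<Rightarrow> bool" where
  "smooth_map A B F \<longleftrightarrow>
     F ` carrier A \<subseteq> carrier B \<and> continuous_on (carrier A) F \<and>
     (\<forall>(U, \<phi>)\<in>A. \<forall>(V, \<psi>)\<in>B. smooth_on (\<phi> ` (U \<inter> F -` V)) (\<psi> \<circ> F \<circ> inv_into U \<phi>))"

definition submersion ::
  "('a::{t2_space,second_countable_topology}, 'e::euclidean_space) chart set \<Rightarrow>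
   ('b::{t2_space,second_countable_topology}, 'f::euclidean_space) chart set \<Rightarrow> ('a \<Rightarrow> 'b) \<Rightarrow> bool" where
  "submersion A B F \<longleftrightarrow>
     smooth_map A B F \<and>
     (\<forall>(U, \<phi>)\<in>A. \<forall>(V, \<psi>)\<in>B. \<forall>p\<in>U \<inter> F -` V.
        surj (frechet_derivative (\<psi> \<circ> F \<circ> inv_into U \<phi>) (at (\<phi> p))))"

definition diffeomorphism ::
  "('a::{t2_space,second_countable_topology}, 'e::euclidean_space) chart set \<Rightarrow>
   ('b::{t2_space,second_countable_topology}, 'f::euclidean_space) chart set \<Rightarrow> ('a \<Rightarrow> 'b) \<Rightarrow> bool" where
  "diffeomorphism A B F \<longleftrightarrow>
     smooth_map A B F \<and> bij_betw F (carrier A) (carrier B) \<and>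
     smooth_map B A (inv_into (carrier A) F)"


section \<open>Submanifolds and their jets\<close>

definition slice_chart ::
  "('a::{t2_space,second_countable_topology}, 'e::euclidean_space) chart set \<Rightarrow>
   'a set \<Rightarrow> 'e set \<Rightarrow> ('a, 'e) chart \<Rightarrow> bool" where
  "slice_chart A L S = (\<lambda>(U, \<phi>). (U, \<phi>) \<in> smooth_charts A \<and> \<phi> ` (U \<inter> L) = \<phi> ` U \<inter> S)"

definition submanifold ::
  "('a::{t2_space,second_countable_topology}, 'e::euclidean_space) chart set \<Rightarrow> nat \<Rightarrow> 'a set \<Rightarrow> bool" where
  "submanifold A m L \<longleftrightarrow>
     L \<subseteq> carrier A \<and>
     (\<forall>p\<in>L. \<exists>S U \<phi>. subspace S \<and> dim S = m \<and> slice_chart A L S (U, \<phi>) \<and> p \<in> U)"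

text \<open>A slice chart \<open>(U, \<phi>)\<close> for \<open>L\<close> along \<open>S\<close> yields the local parametrization \<open>inv_into U \<phi>\<close> of \<open>L\<close>,
  defined on an open subset of \<open>S\<close>. The following is its derivative at (the parameter of) \<open>x\<close> in the
  directions \<open>vs\<close>, written in the chart \<open>\<psi>\<close>. For \<open>vs\<close> ranging over the lists in \<open>S\<close> of length at most
  \<open>k\<close>, these form the \<open>k\<close>-jet of the parametrization at \<open>x\<close>.\<close>

definition param_deriv ::
  "('a \<Rightarrow> 'e) \<Rightarrow> ('a, 'e::euclidean_space) chart \<Rightarrow> 'a \<Rightarrow> 'e list \<Rightarrow> 'e" where
  "param_deriv \<psi> = (\<lambda>(U, \<phi>) x vs. iter_deriv vs (\<psi> \<circ> inv_into U \<phi>) (\<phi> x))"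

text \<open>Contact of order \<open>k\<close> at \<open>x\<close>: there are local parametrizations with the same \<open>k\<close>-jet at \<open>x\<close>.\<close>

definition contact ::
  "('a::{t2_space,second_countable_topology}, 'e::euclidean_space) chart set \<Rightarrow>
   nat \<Rightarrow> 'a \<Rightarrow> 'a set \<Rightarrow> 'a set \<Rightarrow> bool" where
  "contact A k x L L' \<longleftrightarrow>
     (\<exists>S U \<phi> U' \<phi>' V \<psi>.
        subspace S \<and> slice_chart A L S (U, \<phi>) \<and> slice_chart A L' S (U', \<phi>') \<and>
        (V, \<psi>) \<in> smooth_charts A \<and> x \<in> U \<inter> U' \<inter> V \<and>
        (\<forall>vs. set vs \<subseteq> S \<and> length vs \<le> k \<longrightarrow>
           param_deriv \<psi> (U, \<phi>) x vs = param_deriv \<psi> (U', \<phi>') x vs))"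

type_synonym 'a jet = "'a \<times> 'a set set"

definition jet ::
  "('a::{t2_space,second_countable_topology}, 'e::euclidean_space) chart set \<Rightarrow>
   nat \<Rightarrow> nat \<Rightarrow> 'a \<Rightarrow> 'a set \<Rightarrow> 'a jet" where
  "jet A k m x L = (x, {L'. submanifold A m L' \<and> x \<in> L' \<and> contact A k x L L'})"

definition jet_space ::
  "('a::{t2_space,second_countable_topology}, 'e::euclidean_space) chart set \<Rightarrow>
   nat \<Rightarrow> nat \<Rightarrow> 'a jet set" where
  "jet_space A k m = {jet A k m x L | x L. submanifold A m L \<and> x \<in> L}"

text \<open>The topology of \<open>jet_space A k m\<close> is the quotient topology under the surjective submersion from
  the space of \<open>k\<close>-jets of local parametrizations of \<open>m\<close>-dimensional submanifolds. So a set \<open>Q\<close> of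
  jets is open iff, whenever a parametrization has its jet in \<open>Q\<close>, so do all parametrizations whose
  derivatives up to order \<open>k\<close> (in a chart \<open>\<psi>\<close>) are sufficiently close.\<close>

definition nearby_jets ::
  "('a::{t2_space,second_countable_topology}, 'e::euclidean_space) chart set \<Rightarrow>
   nat \<Rightarrow> nat \<Rightarrow> 'e set \<Rightarrow> ('a, 'e) chart \<Rightarrow> ('a, 'e) chart \<Rightarrow> 'a \<Rightarrow> real \<Rightarrow> 'a jet set" where
  "nearby_jets A k m S = (\<lambda>(V, \<psi>) (U, \<phi>) x \<epsilon>.
     {jet A k m x' L' | x' L' U' \<phi>'.
        submanifold A m L' \<and> slice_chart A L' S (U', \<phi>') \<and> x' \<in> L' \<inter> U' \<inter> V \<and>
        (\<forall>vs. set vs \<subseteq> S \<inter> sphere 0 1 \<and> length vs \<le> k \<longrightarrow>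
           dist (param_deriv \<psi> (U, \<phi>) x vs) (param_deriv \<psi> (U', \<phi>') x' vs) < \<epsilon>)})"

definition jet_open ::
  "('a::{t2_space,second_countable_topology}, 'e::euclidean_space) chart set \<Rightarrow>
   nat \<Rightarrow> nat \<Rightarrow> 'a jet set \<Rightarrow> bool" where
  "jet_open A k m Q \<longleftrightarrow>
     Q \<subseteq> jet_space A k m \<and>
     (\<forall>S L x U \<phi> V \<psi>.
        subspace S \<and> submanifold A m L \<and> slice_chart A L S (U, \<phi>) \<and> (V, \<psi>) \<in> smooth_charts A \<and>
        x \<in> L \<inter> U \<inter> V \<and> jet A k m x L \<in> Q \<longrightarrow>
        (\<exists>\<epsilon>>0. nearby_jets A k m S (V, \<psi>) (U, \<phi>) x \<epsilon> \<subseteq> Q))"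

definition jet_topology ::
  "('a::{t2_space,second_countable_topology}, 'e::euclidean_space) chart set \<Rightarrow>
   nat \<Rightarrow> nat \<Rightarrow> 'a jet topology" where
  "jet_topology A k m = topology (jet_open A k m)"

lemma nearby_jets_mono: "\<epsilon> \<le> \<delta> \<Longrightarrow> nearby_jets A k m S d c x \<epsilon> \<subseteq> nearby_jets A k m S d c x \<delta>"
  unfolding nearby_jets_def split_beta
  by (intro Collect_mono ex_mono conj_mono imp_mono all_mono impI) (auto elim: less_le_trans)

lemma jet_openD:
  assumes "jet_open A k m Q" "subspace S" "submanifold A m L" "slice_chart A L S (U, \<phi>)"
    "(V, \<psi>) \<in> smooth_charts A" "x \<in> L \<inter> U \<inter> V" "jet A k m x L \<in> Q"
  shows "\<exists>\<epsilon>>0. nearby_jets A k m S (V, \<psi>) (U, \<phi>) x \<epsilon> \<subseteq> Q"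
  by (rule assms(1)[unfolded jet_open_def, THEN conjunct2, THEN spec[of _ S], THEN spec[of _ L],
        THEN spec[of _ x], THEN spec[of _ U], THEN spec[of _ \<phi>], THEN spec[of _ V],
        THEN spec[of _ \<psi>], THEN mp])
    (intro conjI assms(2-))

lemma istopology_jet_open: "istopology (jet_open A k m)"
  unfolding istopology_def
proof (intro conjI allI impI)
  fix Q R assume QR: "jet_open A k m Q" "jet_open A k m R"
  show "jet_open A k m (Q \<inter> R)"
    unfolding jet_open_def
  proof (intro conjI allI impI)
    show "Q \<inter> R \<subseteq> jet_space A k m" using QR by (auto simp: jet_open_def)
  next
    fix S L x U \<phi> V \<psi>
    assume "subspace S \<and> submanifold A m L \<and> slice_chart A L S (U, \<phi>) \<and>
      (V, \<psi>) \<in> smooth_charts A \<and> x \<in> L \<inter> U \<inter> V \<and> jet A k m x L \<in> Q \<inter> R"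
    then have *: "subspace S" "submanifold A m L" "slice_chart A L S (U, \<phi>)"
        "(V, \<psi>) \<in> smooth_charts A" "x \<in> L \<inter> U \<inter> V"
      and mem: "jet A k m x L \<in> Q" "jet A k m x L \<in> R" by simp_all
    let ?N = "nearby_jets A k m S (V, \<psi>) (U, \<phi>) x"
    from jet_openD[OF QR(1) * mem(1)] obtain d where d: "d > 0" "?N d \<subseteq> Q" by blast
    from jet_openD[OF QR(2) * mem(2)] obtain e where e: "e > 0" "?N e \<subseteq> R" by blast
    have "?N (min d e) \<subseteq> Q \<inter> R"
      by (intro Int_greatest order_trans[OF nearby_jets_mono d(2)] order_trans[OF nearby_jets_mono e(2)])
        simp_all
    with d e show "\<exists>\<epsilon>>0. ?N \<epsilon> \<subseteq> Q \<inter> R" by (intro exI[of _ "min d e"]) simp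
  qed
next
  fix \<K> assume K: "\<forall>Q\<in>\<K>. jet_open A k m Q"
  show "jet_open A k m (\<Union>\<K>)"
    unfolding jet_open_def
  proof (intro conjI allI impI)
    show "\<Union>\<K> \<subseteq> jet_space A k m" using K by (auto simp: jet_open_def)
  next
    fix S L x U \<phi> V \<psi>
    assume "subspace S \<and> submanifold A m L \<and> slice_chart A L S (U, \<phi>) \<and>
      (V, \<psi>) \<in> smooth_charts A \<and> x \<in> L \<inter> U \<inter> V \<and> jet A k m x L \<in> \<Union>\<K>"
    then have *: "subspace S" "submanifold A m L" "slice_chart A L S (U, \<phi>)"
        "(V, \<psi>) \<in> smooth_charts A" "x \<in> L \<inter> U \<inter> V"
      and "jet A k m x L \<in> \<Union>\<K>" by simp_all
    then obtain Q where Q: "Q \<in> \<K>" "jet A k m x L \<in> Q" by blast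
    from jet_openD[OF K[rule_format, OF Q(1)] * Q(2)] obtain d where "d > 0" "nearby_jets A k m S (V, \<psi>) (U, \<phi>) x d \<subseteq> Q"
      by blast
    with Q(1) show "\<exists>\<epsilon>>0. nearby_jets A k m S (V, \<psi>) (U, \<phi>) x \<epsilon> \<subseteq> \<Union>\<K>" by blast
  qed
qed

lemma openin_jet_topology: "openin (jet_topology A k m) = jet_open A k m"
  unfolding jet_topology_def by (rule topology_inverse'[OF istopology_jet_open])

text \<open>\<open>F\<close>-projected submanifolds, their jets \<open>J\<^sup>k_{m,F}\<close>, and the map \<open>F\<^sup>k\<close>, where
  \<open>m' = m - dim N + dim N'\<close>.\<close>

definition projected :: "('a, 'e) chart set \<Rightarrow> ('a \<Rightarrow> 'b) \<Rightarrow> 'a set \<Rightarrow> bool" where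
  "projected A F L \<longleftrightarrow> L = carrier A \<inter> F -` (F ` L)"

definition projected_jet_space ::
  "('a::{t2_space,second_countable_topology}, 'e::euclidean_space) chart set \<Rightarrow>
   ('a \<Rightarrow> 'b) \<Rightarrow> nat \<Rightarrow> nat \<Rightarrow> 'a jet set" where
  "projected_jet_space A F k m =
     {jet A k m x L | x L. submanifold A m L \<and> projected A F L \<and> x \<in> L}"

definition jet_map ::
  "('a::{t2_space,second_countable_topology}, 'e::euclidean_space) chart set \<Rightarrow>
   ('b::{t2_space,second_countable_topology}, 'f::euclidean_space) chart set \<Rightarrow>
   ('a \<Rightarrow> 'b) \<Rightarrow> nat \<Rightarrow> nat \<Rightarrow> nat \<Rightarrow> 'a jet \<Rightarrow> 'b jet" where
  "jet_map A B F k m m' j =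
     (THE j'. \<exists>x L. submanifold A m L \<and> projected A F L \<and> x \<in> L \<and>
        j = jet A k m x L \<and> j' = jet B k m' (F x) (F ` L))"


section \<open>The category of partial differential equations\<close>

text \<open>The integers \<open>k\<close> and \<open>m\<close>, which are determined by \<open>E\<close> unless \<open>E\<close> is empty, are treated as part
  of the data of an object.\<close>

definition pde_object ::
  "('a::{t2_space,second_countable_topology}, 'e::euclidean_space) chart set \<Rightarrow>
   nat \<Rightarrow> nat \<Rightarrow> 'a jet set \<Rightarrow> bool" where
  "pde_object A k m E \<longleftrightarrow>
     smooth_manifold A \<and> 1 \<le> k \<and> 1 \<le> m \<and> m < DIM('e) \<and> E \<subseteq> jet_space A k m"

definition pde_morphism ::
  "('a::{t2_space,second_countable_topology}, 'e::euclidean_space) chart set \<Rightarrow> 'a jet set \<Rightarrow>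
   ('b::{t2_space,second_countable_topology}, 'f::euclidean_space) chart set \<Rightarrow> 'b jet set \<Rightarrow>
   nat \<Rightarrow> nat \<Rightarrow> ('a \<Rightarrow> 'b) \<Rightarrow> bool" where
  "pde_morphism A E B E' k m F \<longleftrightarrow>
     pde_object A k m E \<and> submersion A B F \<and> F ` carrier A = carrier B \<and>
     (\<exists>m'. m' + DIM('e) = m + DIM('f) \<and> pde_object B k m' E' \<and>
        E \<inter> projected_jet_space A F k m =
          {j \<in> projected_jet_space A F k m. jet_map A B F k m m' j \<in> E'})"


section \<open>The category of second order parabolic equations\<close>

definition nonempty_open_interval :: "real set \<Rightarrow> bool" where
  "nonempty_open_interval I \<longleftrightarrow> open I \<and> is_interval I \<and> I \<noteq> {}"

definition connected_manifold ::
  "('a::{t2_space,second_countable_topology}, 'e::euclidean_space) chart set \<Rightarrow> bool" where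
  "connected_manifold A \<longleftrightarrow> smooth_manifold A \<and> connected (carrier A) \<and> carrier A \<noteq> {}"

text \<open>The manifolds \<open>T \<times> X\<close> and \<open>T \<times> X \<times> \<Omega>\<close>, where \<open>X\<close> is the manifold with atlas \<open>A\<close>.\<close>

definition time_space ::
  "real set \<Rightarrow> ('a, 'e) chart set \<Rightarrow> (real \<times> 'a, real \<times> 'e) chart set" where
  "time_space T A = prod_manifold (open_set_manifold T) A"

definition total_space ::
  "real set \<Rightarrow> ('a, 'e) chart set \<Rightarrow> real set \<Rightarrow>
   (real \<times> 'a \<times> real, real \<times> 'e \<times> real) chart set" where
  "total_space T A \<Omega> =
     prod_manifold (open_set_manifold T) (prod_manifold A (open_set_manifold \<Omega>))"

definition local_function ::
  "real set \<Rightarrow> ('a::{t2_space,second_countable_topology}, 'e::euclidean_space) chart set \<Rightarrow> real set \<Rightarrow>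
   (real \<times> 'a) set \<Rightarrow> (real \<times> 'a \<Rightarrow> real) \<Rightarrow> bool" where
  "local_function T A \<Omega> D u \<longleftrightarrow>
     open D \<and> D \<subseteq> carrier (time_space T A) \<and>
     smooth_map (open_submanifold (time_space T A) D) (open_set_manifold \<Omega>) u"

definition graph :: "(real \<times> 'a) set \<Rightarrow> (real \<times> 'a \<Rightarrow> real) \<Rightarrow> (real \<times> 'a \<times> real) set" where
  "graph D u = {(t, x, u (t, x)) | t x. (t, x) \<in> D}"

text \<open>Partial derivatives of \<open>u(t, x)\<close> at \<open>(t, x)\<close> with respect to the local coordinates
  \<open>x\<^sup>i = \<phi> x \<bullet> i\<close>, \<open>i \<in> Basis\<close>.\<close>

definition space_deriv ::
  "('a, 'e::euclidean_space) chart \<Rightarrow> 'e list \<Rightarrow> (real \<times> 'a \<Rightarrow> real) \<Rightarrow> real \<Rightarrow> 'a \<Rightarrow> real" where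
  "space_deriv = (\<lambda>(U, \<phi>) is u t x. iter_deriv is (\<lambda>y. u (t, inv_into U \<phi> y)) (\<phi> x))"

text \<open>An operator \<open>L\<close> maps a function (near \<open>(t, x)\<close>) to its value at \<open>(t, x)\<close>. The coefficients
  \<open>b\<close>, \<open>c\<close>, \<open>d\<close>, \<open>q\<close> of its local expression (\<open>d\<close> being that of the first order term) are
  functions of \<open>(t, \<phi> x, u)\<close>.\<close>

definition parabolic_operator ::
  "real set \<Rightarrow> ('a::{t2_space,second_countable_topology}, 'e::euclidean_space) chart set \<Rightarrow> real set \<Rightarrow>
   ((real \<times> 'a \<Rightarrow> real) \<Rightarrow> real \<Rightarrow> 'a \<Rightarrow> real) \<Rightarrow> bool" where
  "parabolic_operator T A \<Omega> L \<longleftrightarrow>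
     (\<forall>t\<^sub>0\<in>T. \<forall>x\<^sub>0\<in>carrier A. \<forall>u\<^sub>0\<in>\<Omega>.
        \<exists>U \<phi> W (b :: 'e \<Rightarrow> 'e \<Rightarrow> real \<times> 'e \<times> real \<Rightarrow> real)
          (c :: 'e \<Rightarrow> 'e \<Rightarrow> real \<times> 'e \<times> real \<Rightarrow> real)
          (d :: 'e \<Rightarrow> real \<times> 'e \<times> real \<Rightarrow> real) (q :: real \<times> 'e \<times> real \<Rightarrow> real).
          (U, \<phi>) \<in> smooth_charts A \<and> x\<^sub>0 \<in> U \<and>
          open W \<and> W \<subseteq> T \<times> \<phi> ` U \<times> \<Omega> \<and> (t\<^sub>0, \<phi> x\<^sub>0, u\<^sub>0) \<in> W \<and>
          (\<forall>i\<in>Basis. \<forall>j\<in>Basis. smooth_on W (b i j) \<and> smooth_on W (c i j)) \<and>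
          (\<forall>i\<in>Basis. smooth_on W (d i)) \<and> smooth_on W q \<and>
          (\<forall>w\<in>W. \<forall>i\<in>Basis. \<forall>j\<in>Basis. b i j w = b j i w \<and> c i j w = c j i w) \<and>
          (\<forall>w\<in>W. \<forall>\<xi>. \<xi> \<noteq> 0 \<longrightarrow> (\<Sum>i\<in>Basis. \<Sum>j\<in>Basis. b i j w * (\<xi> \<bullet> i) * (\<xi> \<bullet> j)) > 0) \<and>
          (\<forall>D u t x. local_function T A \<Omega> D u \<and> (t, x) \<in> D \<and> x \<in> U \<and> (t, \<phi> x, u (t, x)) \<in> W \<longrightarrow>
             L u t x =
               (\<Sum>i\<in>Basis. \<Sum>j\<in>Basis.
                  b i j (t, \<phi> x, u (t, x)) * space_deriv (U, \<phi>) [i, j] u t x) +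
               (\<Sum>i\<in>Basis. \<Sum>j\<in>Basis.
                  c i j (t, \<phi> x, u (t, x)) *
                  space_deriv (U, \<phi>) [i] u t x * space_deriv (U, \<phi>) [j] u t x) +
               (\<Sum>i\<in>Basis. d i (t, \<phi> x, u (t, x)) * space_deriv (U, \<phi>) [i] u t x) +
               q (t, \<phi> x, u (t, x))))"

definition extended_equation ::
  "real set \<Rightarrow> ('a::{t2_space,second_countable_topology}, 'e::euclidean_space) chart set \<Rightarrow> real set \<Rightarrow>
   ((real \<times> 'a \<Rightarrow> real) \<Rightarrow> real \<Rightarrow> 'a \<Rightarrow> real) \<Rightarrow> (real \<times> 'a \<times> real) jet set" where
  "extended_equation T A \<Omega> L =
     jet_topology (total_space T A \<Omega>) 2 (DIM('e) + 1) closure_of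
       {jet (total_space T A \<Omega>) 2 (DIM('e) + 1) (t, x, u (t, x)) (graph D u) | D u t x.
          local_function T A \<Omega> D u \<and> (t, x) \<in> D \<and> deriv (\<lambda>s. u (s, x)) t = L u t x}"

definition pe_manifold ::
  "real set \<Rightarrow> ('a::{t2_space,second_countable_topology}, 'e::euclidean_space) chart set \<Rightarrow> real set \<Rightarrow>
   bool" where
  "pe_manifold T A \<Omega> \<longleftrightarrow>
     nonempty_open_interval T \<and> connected_manifold A \<and> nonempty_open_interval \<Omega>"

definition pe_object ::
  "real set \<Rightarrow> ('a::{t2_space,second_countable_topology}, 'e::euclidean_space) chart set \<Rightarrow> real set \<Rightarrow>
   (real \<times> 'a \<times> real) jet set \<Rightarrow> bool" where
  "pe_object T A \<Omega> E \<longleftrightarrow>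
     pe_manifold T A \<Omega> \<and> (\<exists>L. parabolic_operator T A \<Omega> L \<and> E = extended_equation T A \<Omega> L)"

definition pe_morphism ::
  "real set \<Rightarrow> ('a::{t2_space,second_countable_topology}, 'e::euclidean_space) chart set \<Rightarrow> real set \<Rightarrow>
   (real \<times> 'a \<times> real) jet set \<Rightarrow>
   real set \<Rightarrow> ('b::{t2_space,second_countable_topology}, 'f::euclidean_space) chart set \<Rightarrow> real set \<Rightarrow>
   (real \<times> 'b \<times> real) jet set \<Rightarrow>
   (real \<times> 'a \<times> real \<Rightarrow> real \<times> 'b \<times> real) \<Rightarrow> bool" where
  "pe_morphism T A \<Omega> E T' A' \<Omega>' E' F \<longleftrightarrow>
     pe_object T A \<Omega> E \<and> pe_object T' A' \<Omega>' E' \<and>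
     pde_morphism (total_space T A \<Omega>) E (total_space T' A' \<Omega>') E' 2 (DIM('e) + 1) F"

definition pe_isomorphism ::
  "real set \<Rightarrow> ('a::{t2_space,second_countable_topology}, 'e::euclidean_space) chart set \<Rightarrow> real set \<Rightarrow>
   (real \<times> 'a \<times> real) jet set \<Rightarrow>
   real set \<Rightarrow> ('b::{t2_space,second_countable_topology}, 'f::euclidean_space) chart set \<Rightarrow> real set \<Rightarrow>
   (real \<times> 'b \<times> real) jet set \<Rightarrow>
   (real \<times> 'a \<times> real \<Rightarrow> real \<times> 'b \<times> real) \<Rightarrow> bool" where
  "pe_isomorphism T A \<Omega> E T' A' \<Omega>' E' F \<longleftrightarrow>
     pe_morphism T A \<Omega> E T' A' \<Omega>' E' F \<and>
     (\<exists>G. pe_morphism T' A' \<Omega>' E' T A \<Omega> E G \<and>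
        (\<forall>p\<in>carrier (total_space T A \<Omega>). G (F p) = p) \<and>
        (\<forall>p\<in>carrier (total_space T' A' \<Omega>'). F (G p) = p))"

text \<open>\<open>F\<close> is the map \<open>(t, x, u) \<mapsto> (\<tau>(t), \<theta>(t, x), \<eta>(t, x, u))\<close> with submersive \<open>\<tau>\<close>, \<open>\<theta>\<close>, \<open>\<eta>\<close>.\<close>

definition triangular_form ::
  "real set \<Rightarrow> ('a::{t2_space,second_countable_topology}, 'e::euclidean_space) chart set \<Rightarrow> real set \<Rightarrow>
   real set \<Rightarrow> ('b::{t2_space,second_countable_topology}, 'f::euclidean_space) chart set \<Rightarrow> real set \<Rightarrow>
   (real \<times> 'a \<times> real \<Rightarrow> real \<times> 'b \<times> real) \<Rightarrow>
   (real \<Rightarrow> real) \<Rightarrow> (real \<times> 'a \<Rightarrow> 'b) \<Rightarrow> (real \<times> 'a \<times> real \<Rightarrow> real) \<Rightarrow> bool" where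
  "triangular_form T A \<Omega> T' A' \<Omega>' F \<tau> \<theta> \<eta> \<longleftrightarrow>
     submersion (open_set_manifold T) (open_set_manifold T') \<tau> \<and>
     submersion (time_space T A) A' \<theta> \<and>
     submersion (total_space T A \<Omega>) (open_set_manifold \<Omega>') \<eta> \<and>
     (\<forall>t\<in>T. \<forall>x\<in>carrier A. \<forall>u\<in>\<Omega>. F (t, x, u) = (\<tau> t, \<theta> (t, x), \<eta> (t, x, u)))"

end

theory Submission
  imports Defs
begin

text \<open>A second order jet of hypersurfaces is a pair \<open>(\<alpha>, H)\<close>, the first and second derivative of a local defining function
 \<open>\<rho>\<close>, modulo rescaling \<open>\<rho>\<close> and modulo the values of \<open>H\<close> off the kernel of \<open>\<alpha>\<close>. A jet with \<open>\<alpha>(\<partial>\<^sub>u) \<noteq> 0\<close> lies in the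
 equation iff a polynomial \<open>pol\<close> in \<open>(\<alpha>, H)\<close> vanishes, because \<open>pol \<noteq> 0\<close> is an open condition. If \<open>F\<close> is a morphism and
 \<open>g\<close> a function on the target, then \<open>pol = 0\<close> for \<open>g\<close> is equivalent to \<open>pol = 0\<close> for \<open>g \<circ> F\<close>. Adding a multiple of
 \<open>dt'\<^sup>2\<close> to the Hessian of \<open>g\<close> does not change the first condition, which forces \<open>t'\<close> to depend on \<open>t\<close> only, by
 positivity of \<open>b\<close>; varying the coefficients of \<open>dt'\<close> and of the squares of the \<open>dx'\<^sup>k\<close> similarly forces \<open>x'\<close> not to depend on
 \<open>u\<close>. Conversely, under a diffeomorphism of this form the polynomial \<open>pol\<close> of an equation becomes a multiple of that of an
 equation of the same type, with leading coefficients divided by the derivative of \<open>t'(t)\<close>; the closures correspond since a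
 diffeomorphism transports the topology of the jet spaces.\<close>

section \<open>Smooth functions\<close>

text \<open>The polynomial decides membership only at jets that are not vertical, so comparing the
  two sides of a morphism needs a covector that is nonzero on \<open>\<partial>\<^sub>u\<close> of
  the target and on the image of \<open>\<partial>\<^sub>u\<close> under the derivative
  \<open>D\<close> of \<open>F\<close>. None exists where \<open>D\<close> kills
  \<open>\<partial>\<^sub>u\<close>. If this happened on an open set, all pulled back jets there
  would be vertical, with a Hessian that vanishes on \<open>\<partial>\<^sub>u\<close>; enough of
  these lie in the closure, whereas \<open>pol = 0\<close> fails for some of the target jets they
  come from. So the points where \<open>D\<close> does not kill \<open>\<partial>\<^sub>u\<close>
  are dense, and \<open>t' = t'(t)\<close> extends from them by continuity. In the converse,
  \<open>t'\<close> must increase to keep the pushed leading coefficients positive definite. An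
  equation is given by one operator on the whole manifold, so the locally pushed coefficients have
  to be tied together by an operator that is defined without charts. Vertical jets of the pushed
  equation are known only as limits, so the correspondence is proved for jets of graphs
  first.\<close>

lemma frechet_derivative_cong_ev:
 assumes "eventually (\<lambda>y. f y = g y) (nhds x)"
 shows "frechet_derivative f (at x) = frechet_derivative g (at x)"
proof -
 obtain S where S: "open S" "x \<in> S" "\<And>y. y \<in> S ==> f y = g y"
  using assms unfolding eventually_nhds by blast
 have "(f has_derivative h) (at x) \<longleftrightarrow> (g has_derivative h) (at x)" for h
  using S has_derivative_transform_within_open[of f h x UNIV S g]
   has_derivative_transform_within_open[of g h x UNIV S f] by auto
 then show ?thesis unfolding frechet_derivative_def by simp
qed

lemma differentiable_cong_ev:
 assumes "eventually (\<lambda>y. f y = g y) (nhds x)"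
 shows "f differentiable (at x) \<longleftrightarrow> g differentiable (at x)"
proof -
 obtain S where S: "open S" "x \<in> S" "\<And>y. y \<in> S ==> f y = g y"
  using assms unfolding eventually_nhds by blast
 then show ?thesis unfolding differentiable_def
  using has_derivative_transform_within_open[of f _ x UNIV S g]
   has_derivative_transform_within_open[of g _ x UNIV S f] by auto
qed

lemma iter_deriv_cong_on:
 assumes "open S" "\<And>y. y \<in> S ==> f y = g y" "x \<in> S"
 shows "iter_deriv vs f x = iter_deriv vs g x"
 using assms(3)
proof (induction vs arbitrary: x)
 case (Cons v vs)
 have "eventually (\<lambda>y. iter_deriv vs f y = iter_deriv vs g y) (nhds x)"
  using Cons assms(1) eventually_nhds by blast
 from frechet_derivative_cong_ev[OF this] show ?case by simp
qed (simp add: assms)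

lemma iter_deriv_append: "iter_deriv (vs @ ws) f = iter_deriv vs (iter_deriv ws f)"
 by (induction vs) auto

section \<open>First and second directional derivatives\<close>

definition D1 :: "('a::euclidean_space => 'b::real_normed_vector) => 'a => 'a => 'b" where
 "D1 f x v = frechet_derivative f (at x) v"

definition D2 :: "('a::euclidean_space => 'b::real_normed_vector) => 'a => 'a => 'a => 'b" where
 "D2 f x v w = D1 (\<lambda>y. D1 f y w) x v"

lemma iter_deriv_1: "iter_deriv [v] f x = D1 f x v"
 by (simp add: D1_def)

lemma iter_deriv_2: "iter_deriv [v, w] f x = D2 f x v w"
 by (simp add: D1_def D2_def)

lemma D1_eqI: "(f has_derivative f') (at x) ==> D1 f x = f'"
 unfolding D1_def using frechet_derivative_at by (metis eta_contract_eq)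

lemma D1_const: "D1 (\<lambda>x. c) x v = 0"
 by (simp add: D1_def)

lemma D1_works: "f differentiable (at x) ==> (f has_derivative D1 f x) (at x)"
 unfolding D1_def using frechet_derivative_works by (metis eta_contract_eq)

lemma D1_cong_ev: "eventually (\<lambda>y. f y = g y) (nhds x) ==> D1 f x = D1 g x"
 unfolding D1_def using frechet_derivative_cong_ev by metis

lemma D2_cong_ev:
 assumes "eventually (\<lambda>y. f y = g y) (nhds x)"
 shows "D2 f x = D2 g x"
proof -
 have "eventually (\<lambda>y. D1 f y = D1 g y) (nhds x)"
  using assms by (subst (asm) eventually_eventually[symmetric]) (auto elim: eventually_mono dest: D1_cong_ev)
 then have "eventually (\<lambda>y. D1 f y w = D1 g y w) (nhds x)" for w
  by (rule eventually_mono) simp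
 from D1_cong_ev[OF this] show ?thesis by (intro ext) (simp add: D2_def)
qed

section \<open>Differentiability classes of finite order\<close>

text \<open>\<open>smooth_on\<close> cut off at order \<open>n\<close>. Product and chain rules
  express a derivative by functions of one order less, so closure properties go by induction on
  \<open>n\<close>.\<close>

definition ck :: "nat => 'a::euclidean_space set => ('a => 'b::real_normed_vector) => bool" where
 "ck n S f \<longleftrightarrow> (\<forall>x\<in>S. \<forall>vs. length vs < n --> iter_deriv vs f differentiable (at x))"

lemma ck_0 [simp]: "ck 0 S f"
 by (simp add: ck_def)

text \<open>The list of directions is taken apart at its end: the last entry is the direction
  differentiated first, so \<open>\<lambda>x. D1 f x v\<close> takes over the role of
  \<open>f\<close> with a shorter list.\<close>

lemma ck_Suc: "ck (Suc n) S f \<longleftrightarrow> (\<forall>x\<in>S. f differentiable (at x)) \<and> (\<forall>v. ck n S (\<lambda>x. D1 f x v))"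
proof -
 have *: "iter_deriv vs (\<lambda>x. D1 f x v) = iter_deriv (vs @ [v]) f" for v vs
  by (simp add: iter_deriv_append D1_def)
 show ?thesis
 proof (intro iffI conjI ballI allI)
  fix x assume "ck (Suc n) S f" "x \<in> S"
  then have "iter_deriv [] f differentiable (at x)" unfolding ck_def by (metis list.size(3) zero_less_Suc)
  then show "f differentiable (at x)" by simp
 next
  fix v assume "ck (Suc n) S f"
  then show "ck n S (\<lambda>x. D1 f x v)" unfolding ck_def * by simp
 next
  assume A: "(\<forall>x\<in>S. f differentiable (at x)) \<and> (\<forall>v. ck n S (\<lambda>x. D1 f x v))"
  show "ck (Suc n) S f" unfolding ck_def
  proof (intro ballI allI impI)
   fix x vs assume x: "x \<in> S" and l: "length (vs :: 'a list) < Suc n"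
   show "iter_deriv vs f differentiable (at x)"
   proof (cases vs rule: rev_cases)
    case Nil then show ?thesis using A x by simp
   next
    case (snoc ws w)
    then show ?thesis using A x l *[of ws w, symmetric] unfolding ck_def by auto
   qed
  qed
 qed
qed

lemma ck_mono: "ck n S f ==> m \<le> n ==> T \<subseteq> S ==> ck m T f"
 unfolding ck_def by (meson less_le_trans subsetD)

lemma ck_SucD: "ck (Suc n) S f ==> ck n S f"
 by (erule ck_mono) auto

lemma ck_cong:
 assumes "open S" "\<And>x. x \<in> S ==> f x = g x"
 shows "ck n S f \<longleftrightarrow> ck n S g"
proof -
 have "iter_deriv vs f differentiable (at x) \<longleftrightarrow> iter_deriv vs g differentiable (at x)" if "x \<in> S" for x vs
  by (rule differentiable_cong_ev, rule eventually_mono[OF eventually_nhds_in_open[OF assms(1) that]])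
   (rule iter_deriv_cong_on[OF assms])
 then show ?thesis unfolding ck_def by auto
qed

lemma smooth_on_ck: "smooth_on S f \<longleftrightarrow> (\<forall>n. ck n S f)"
 unfolding smooth_on_def ck_def by blast

lemma ck_add: "open S ==> ck n S f ==> ck n S g ==> ck n S (\<lambda>x. f x + g x)"
proof (induction n arbitrary: f g)
 case (Suc n)
 have d: "f differentiable (at x)" "g differentiable (at x)" if "x \<in> S" for x
  using Suc.prems that by (auto simp: ck_Suc)
 have "D1 (\<lambda>x. f x + g x) x v = D1 f x v + D1 g x v" if "x \<in> S" for x v
  using d[OF that] D1_eqI[OF has_derivative_add[OF D1_works[OF d(1)[OF that]] D1_works[OF d(2)[OF that]]]] by simp
 then have "ck n S (\<lambda>x. D1 (\<lambda>x. f x + g x) x v)" for v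
  using Suc.IH[of "\<lambda>x. D1 f x v" "\<lambda>x. D1 g x v"] Suc.prems
  by (subst ck_cong[OF Suc.prems(1)]) (auto simp: ck_Suc)
 then show ?case using d by (simp add: ck_Suc)
qed simp

text \<open>One lemma for products, scalar multiples and inner products: the derivative of
  \<open>h (f x) (g x)\<close> is again a sum of two terms of this shape.\<close>

lemma ck_bilinear:
 assumes "bounded_bilinear h"
 shows "open S ==> ck n S f ==> ck n S g ==> ck n S (\<lambda>x. h (f x) (g x))"
proof (induction n arbitrary: f g)
 case (Suc n)
 have d: "f differentiable (at x)" "g differentiable (at x)" if "x \<in> S" for x
  using Suc.prems that by (auto simp: ck_Suc)
 have hd: "((\<lambda>x. h (f x) (g x)) has_derivative (\<lambda>v. h (f x) (D1 g x v) + h (D1 f x v) (g x))) (at x)" if "x \<in> S" for x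
  using bounded_bilinear.FDERIV[OF assms D1_works[OF d(1)[OF that]] D1_works[OF d(2)[OF that]]] .
 have "ck n S (\<lambda>x. D1 (\<lambda>x. h (f x) (g x)) x v)" for v
 proof (subst ck_cong[OF Suc.prems(1)])
  show "D1 (\<lambda>x. h (f x) (g x)) x v = h (f x) (D1 g x v) + h (D1 f x v) (g x)" if "x \<in> S" for x
   using D1_eqI[OF hd[OF that]] by simp
  show "ck n S (\<lambda>x. h (f x) (D1 g x v) + h (D1 f x v) (g x))"
   by (intro ck_add Suc) (use Suc.prems in \<open>auto simp: ck_Suc intro: ck_SucD\<close>)
 qed
 then show ?case using hd by (auto simp: ck_Suc differentiable_def)
qed simp

lemma ck_const: "ck n S (\<lambda>x. c)"
proof (induction n arbitrary: c)
 case (Suc n)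
 have "D1 (\<lambda>x. c) x v = 0" for x v :: 'a by (simp add: D1_def)
 then show ?case using Suc[of 0] by (simp add: ck_Suc)
qed simp

lemma ck_linear: "bounded_linear L ==> ck n S L"
proof (cases n)
 case (Suc m)
 assume L: "bounded_linear L"
 have d: "(L has_derivative L) (at x)" for x
  using bounded_linear_imp_has_derivative[OF L] .
 have "D1 L x v = L v" for x v by (simp add: D1_eqI[OF d])
 then show ?thesis using d Suc by (auto simp: ck_Suc ck_const differentiable_def)
qed simp

lemma ck_sum: "open S ==> (\<And>i. i \<in> I ==> ck n S (f i)) ==> ck n S (\<lambda>x. \<Sum>i\<in>I. f i x)"
 by (induction I rule: infinite_finite_induct) (auto simp: ck_const intro!: ck_add)

lemma D1_basis_sum:
 fixes f :: "'a::euclidean_space => 'b::real_normed_vector"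
 assumes "f differentiable (at x)"
 shows "D1 f x v = (\<Sum>i\<in>Basis. (v \<bullet> i) *\<^sub>R D1 f x i)"
proof -
 have l: "linear (D1 f x)" using D1_works[OF assms] has_derivative_linear by blast
 have "D1 f x v = D1 f x (\<Sum>i\<in>Basis. (v \<bullet> i) *\<^sub>R i)" by (simp add: euclidean_representation)
 also have "\<dots> = (\<Sum>i\<in>Basis. (v \<bullet> i) *\<^sub>R D1 f x i)"
  by (simp add: linear_sum[OF l] linear_cmul[OF l])
 finally show ?thesis .
qed

text \<open>The derivative \<open>D1 f (g x) (D1 g x v)\<close> depends on \<open>x\<close> also
  through its direction; expanding the direction in the basis turns it into a finite sum of products
  to which the induction hypothesis applies.\<close>

lemma ck_compose:
 fixes f :: "'b::euclidean_space => 'c::real_normed_vector" and g :: "'a::euclidean_space => 'b"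
 shows "open S ==> open T ==> g ` S \<subseteq> T ==> ck n T f ==> ck n S g ==> ck n S (\<lambda>x. f (g x))"
proof (induction n arbitrary: f g)
 case (Suc n)
 have d: "f differentiable (at (g x))" "g differentiable (at x)" if "x \<in> S" for x
  using Suc.prems that by (auto simp: ck_Suc)
 have hd: "((\<lambda>x. f (g x)) has_derivative (\<lambda>v. D1 f (g x) (D1 g x v))) (at x)" if "x \<in> S" for x
  using diff_chain_at[OF D1_works[OF d(2)[OF that]] D1_works[OF d(1)[OF that]]] by (simp add: o_def)
 have "ck n S (\<lambda>x. D1 (\<lambda>x. f (g x)) x v)" for v
 proof (subst ck_cong[OF Suc.prems(1)])
  show "D1 (\<lambda>x. f (g x)) x v = (\<Sum>i\<in>Basis. (D1 g x v \<bullet> i) *\<^sub>R D1 f (g x) i)" if "x \<in> S" for x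
   using D1_eqI[OF hd[OF that]] D1_basis_sum[OF d(1)[OF that], of "D1 g x v"] by simp
  have "ck n S (\<lambda>x. D1 f (g x) i)" for i
   by (rule Suc.IH[of g "\<lambda>y. D1 f y i"]) (use Suc.prems in \<open>auto simp: ck_Suc intro: ck_SucD\<close>)
  moreover have "ck n S (\<lambda>x. D1 g x v \<bullet> i)" for i
   using ck_bilinear[OF bounded_bilinear_inner Suc.prems(1), of n "\<lambda>x. D1 g x v" "\<lambda>x. i"] Suc.prems
   by (auto simp: ck_Suc ck_const)
  ultimately show "ck n S (\<lambda>x. \<Sum>i\<in>Basis. (D1 g x v \<bullet> i) *\<^sub>R D1 f (g x) i)"
   by (intro ck_sum ck_bilinear[OF bounded_bilinear_scaleR] Suc.prems(1))
 qed
 then show ?case using hd by (auto simp: ck_Suc differentiable_def)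
qed simp

text \<open>The derivative of the inverse is a polynomial in the inverse itself, which raises the
  order by one at each step.\<close>

lemma ck_inverse: "ck n {x::real. x \<noteq> 0} inverse"
proof (induction n)
 case (Suc n)
 have o: "open {x::real. x \<noteq> 0}" by (simp add: open_Collect_neq)
 have hd: "(inverse has_derivative (\<lambda>v. (inverse x * inverse x) * (- v))) (at x)" if "x \<noteq> 0" for x :: real
  using has_derivative_inverse'[OF that, of UNIV] by (simp add: algebra_simps)
 have "ck n {x::real. x \<noteq> 0} (\<lambda>x. D1 inverse x v)" for v
 proof (subst ck_cong[OF o])
  show "D1 inverse x v = (inverse x * inverse x) * (-v)" if "x \<in> {x::real. x \<noteq> 0}" for x
   using D1_eqI[OF hd] that by simp
  show "ck n {x::real. x \<noteq> 0} (\<lambda>x. (inverse x * inverse x) * (-v))"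
   by (intro ck_bilinear[OF bounded_bilinear_mult] o Suc ck_const)
 qed
 then show ?case using hd by (auto simp: ck_Suc differentiable_def)
qed simp

section \<open>Smoothness at a point\<close>

text \<open>Smoothness on some neighbourhood, not at the single point. This is an open condition,
  and sums and compositions can be formed without keeping track of domains.\<close>

definition smooth_at :: "('a::euclidean_space => 'b::real_normed_vector) => 'a => bool" where
 "smooth_at f x \<longleftrightarrow> (\<exists>S. open S \<and> x \<in> S \<and> smooth_on S f)"

lemma smooth_on_iff: "open S ==> smooth_on S f \<longleftrightarrow> (\<forall>x\<in>S. smooth_at f x)"
 unfolding smooth_at_def by (auto simp: smooth_on_def)

lemma smooth_at_cong_ev:
 assumes "eventually (\<lambda>y. f y = g y) (nhds x)"
 shows "smooth_at f x \<longleftrightarrow> smooth_at g x"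
proof -
 have *: "smooth_at g x" if A: "smooth_at f x" "eventually (\<lambda>y. f y = g y) (nhds x)" for f g :: "'a => 'b"
 proof -
  obtain S where S: "open S" "x \<in> S" "smooth_on S f" using A(1) unfolding smooth_at_def by blast
  obtain T where T: "open T" "x \<in> T" "\<And>y. y \<in> T ==> f y = g y" using A(2) unfolding eventually_nhds by blast
  have "ck n (S \<inter> T) g" for n
   using S T ck_cong[of "S \<inter> T" f g n] ck_mono[of n S f n "S \<inter> T"] by (auto simp: smooth_on_ck)
  then show ?thesis unfolding smooth_at_def smooth_on_ck using S T by (metis IntI open_Int)
 qed
 have "eventually (\<lambda>y. g y = f y) (nhds x)" using assms by (rule eventually_mono) simp
 then show ?thesis using *[of f g] *[of g f] assms by blast
qed

lemma smooth_at_transform: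
 "smooth_at f x ==> eventually (\<lambda>y. f y = g y) (nhds x) ==> smooth_at g x"
 by (rule iffD1[OF smooth_at_cong_ev])

lemma smooth_at_eventually: "smooth_at f x ==> eventually (\<lambda>y. smooth_at f y) (nhds x)"
 unfolding smooth_at_def eventually_nhds by blast

lemma smooth_at_diffble: "smooth_at f x ==> f differentiable (at x)"
 unfolding smooth_at_def smooth_on_def by (metis iter_deriv.simps(1))

lemma smooth_at_isCont: "smooth_at f x ==> isCont f x"
 by (simp add: differentiable_imp_continuous_within smooth_at_diffble)

lemma smooth_at_D1_works: "smooth_at f x ==> (f has_derivative D1 f x) (at x)"
 by (simp add: D1_works smooth_at_diffble)

lemma smooth_at_D1: "smooth_at f x ==> smooth_at (\<lambda>y. D1 f y v) x"
 unfolding smooth_at_def smooth_on_ck by (metis ck_Suc)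

named_theorems smooth_intros

lemma smooth_at_const [smooth_intros]: "smooth_at (\<lambda>x. c) x"
 unfolding smooth_at_def smooth_on_ck using ck_const by blast

lemma smooth_at_linear: "bounded_linear L ==> smooth_at L x"
 unfolding smooth_at_def smooth_on_ck using ck_linear by blast

lemma smooth_at_ident [smooth_intros]: "smooth_at (\<lambda>x. x) x"
 by (simp add: smooth_at_linear)

lemma smooth_at_bilinear:
 assumes h: "bounded_bilinear h" and f: "smooth_at f x" and g: "smooth_at g x"
 shows "smooth_at (\<lambda>x. h (f x) (g x)) x"
proof -
 obtain S T where "open S" "x \<in> S" "smooth_on S f" "open T" "x \<in> T" "smooth_on T g"
  using f g unfolding smooth_at_def by blast
 then show ?thesis unfolding smooth_at_def smooth_on_ck
  by (intro exI[of _ "S \<inter> T"]) (auto intro!: ck_bilinear[OF h] intro: ck_mono)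
qed

lemma smooth_at_compose:
 assumes g: "smooth_at g x" and f: "smooth_at f (g x)"
 shows "smooth_at (\<lambda>x. f (g x)) x"
proof -
 obtain S where S: "open S" "x \<in> S" "smooth_on S g" using g unfolding smooth_at_def by blast
 obtain T where T: "open T" "g x \<in> T" "smooth_on T f" using f unfolding smooth_at_def by blast
 have "continuous_on S g"
  by (meson S(1,3) continuous_at_imp_continuous_on smooth_at_isCont smooth_on_iff)
 then have o: "open (S \<inter> g -` T)" using S T by (simp add: continuous_on_open_vimage Int_commute[of S])
 have "ck n (S \<inter> g -` T) (\<lambda>x. f (g x))" for n
  by (rule ck_compose[OF o T(1)]) (use S T in \<open>auto simp: smooth_on_ck intro: ck_mono\<close>)
 then show ?thesis unfolding smooth_at_def smooth_on_ck using o S T by blast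
qed

lemma smooth_at_linear_compose:
 "bounded_linear L ==> smooth_at f x ==> smooth_at (\<lambda>x. L (f x)) x" for f :: "'a::euclidean_space => 'b::euclidean_space"
 using smooth_at_compose smooth_at_linear by blast

lemma smooth_at_add [smooth_intros]: "smooth_at f x ==> smooth_at g x ==> smooth_at (\<lambda>x. f x + g x) x"
proof -
 assume f: "smooth_at f x" and g: "smooth_at g x"
 obtain S T where "open S" "x \<in> S" "smooth_on S f" "open T" "x \<in> T" "smooth_on T g"
  using f g unfolding smooth_at_def by blast
 then show ?thesis unfolding smooth_at_def smooth_on_ck
  by (intro exI[of _ "S \<inter> T"]) (auto intro!: ck_add intro: ck_mono)
qed

lemma smooth_at_sum [smooth_intros]: "(\<And>i. i \<in> I ==> smooth_at (f i) x) ==> smooth_at (\<lambda>x. \<Sum>i\<in>I. f i x) x"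
 by (induction I rule: infinite_finite_induct) (auto intro!: smooth_intros)

lemmas smooth_at_scaleR [smooth_intros] = smooth_at_bilinear[OF bounded_bilinear_scaleR]
lemmas smooth_at_mult [smooth_intros] = smooth_at_bilinear[OF bounded_bilinear_mult]
lemmas smooth_at_inner [smooth_intros] = smooth_at_bilinear[OF bounded_bilinear_inner]

lemma smooth_at_minus [smooth_intros]: "smooth_at f x ==> smooth_at (\<lambda>x. - f x) x"
 using smooth_at_scaleR[OF smooth_at_const[of "-1"], of f x] by simp

lemma smooth_at_diff [smooth_intros]: "smooth_at f x ==> smooth_at g x ==> smooth_at (\<lambda>x. f x - g x) x"
 using smooth_at_add[OF _ smooth_at_minus, of f x g] by simp

lemma smooth_at_fst [smooth_intros]: "smooth_at f x ==> smooth_at (\<lambda>x. fst (f x)) x"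
 for f :: "'a::euclidean_space => 'b::euclidean_space \<times> 'c::euclidean_space"
 by (rule smooth_at_linear_compose[OF bounded_linear_fst])

lemma smooth_at_snd [smooth_intros]: "smooth_at f x ==> smooth_at (\<lambda>x. snd (f x)) x"
 for f :: "'a::euclidean_space => 'b::euclidean_space \<times> 'c::euclidean_space"
 by (rule smooth_at_linear_compose[OF bounded_linear_snd])

lemma smooth_at_Pair [smooth_intros]:
 fixes f :: "'a::euclidean_space => 'b::euclidean_space" and g :: "'a => 'c::euclidean_space"
 assumes "smooth_at f x" "smooth_at g x"
 shows "smooth_at (\<lambda>x. (f x, g x)) x"
proof -
 have "smooth_at (\<lambda>x. (f x, 0::'c) + (0::'b, g x)) x"
  by (intro smooth_at_add smooth_at_linear_compose[of "\<lambda>y. (y, 0)"] smooth_at_linear_compose[of "\<lambda>y. (0, y)"] assms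
    bounded_linear_Pair bounded_linear_ident bounded_linear_zero)
 then show ?thesis by simp
qed

lemma smooth_at_inverse [smooth_intros]:
 fixes f :: "'a::euclidean_space => real"
 assumes "smooth_at f x" "f x \<noteq> 0"
 shows "smooth_at (\<lambda>x. inverse (f x)) x"
 by (rule smooth_at_compose[OF assms(1)], unfold smooth_at_def smooth_on_ck, rule exI[of _ "{x. x \<noteq> 0}"])
  (use assms ck_inverse in \<open>auto simp: open_Collect_neq\<close>)

lemma smooth_at_divide [smooth_intros]:
 fixes f :: "'a::euclidean_space => real"
 shows "smooth_at f x ==> smooth_at g x ==> g x \<noteq> 0 ==> smooth_at (\<lambda>x. f x / g x) x"
 using smooth_at_mult[OF _ smooth_at_inverse, of f x g] by (simp add: divide_inverse)

lemma eventually_smooth_at_compose: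
 assumes "smooth_at g x" "eventually P (nhds (g x))"
 shows "eventually (\<lambda>y. P (g y)) (nhds x)"
 using smooth_at_isCont[OF assms(1)] assms(2)
 by (simp add: eventually_compose_filterlim isCont_def tendsto_at_iff_tendsto_nhds)

text \<open>Joint smoothness of the derivative in base point and direction, which the tangent map in
  the inverse function theorem needs.\<close>

lemma smooth_at_D1_compose [smooth_intros]:
 fixes f :: "'b::euclidean_space => 'c::real_normed_vector" and g :: "'a::euclidean_space => 'b"
 assumes f: "smooth_at f (g x)" and g: "smooth_at g x" and v: "smooth_at v x"
 shows "smooth_at (\<lambda>y. D1 f (g y) (v y)) x"
proof -
 have "eventually (\<lambda>y. smooth_at f (g y)) (nhds x)"
  by (rule eventually_smooth_at_compose[OF g smooth_at_eventually[OF f]])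
 then have "eventually (\<lambda>y. D1 f (g y) (v y) = (\<Sum>i\<in>Basis. (v y \<bullet> i) *\<^sub>R D1 f (g y) i)) (nhds x)"
  by (rule eventually_mono) (intro D1_basis_sum smooth_at_diffble)
 moreover have "smooth_at (\<lambda>y. (\<Sum>i\<in>Basis. (v y \<bullet> i) *\<^sub>R D1 f (g y) i)) x"
  by (intro smooth_intros v smooth_at_compose[of g x "\<lambda>z. D1 f z i" for i] smooth_at_D1 f g)
 ultimately show ?thesis by (rule iffD2[OF smooth_at_cong_ev])
qed

lemma smooth_at_D2 [smooth_intros]:
 fixes f :: "'b::euclidean_space => 'c::real_normed_vector" and g :: "'a::euclidean_space => 'b"
 assumes "smooth_at f (g x)" "smooth_at g x"
 shows "smooth_at (\<lambda>y. D2 f (g y) v w) x"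
 unfolding D2_def by (intro smooth_intros smooth_at_D1 assms)

lemma linear_D1: "smooth_at f x ==> linear (D1 f x)"
 using smooth_at_D1_works has_derivative_linear by blast

lemma linear_D2_1: "smooth_at f x ==> linear (\<lambda>v. D2 f x v w)"
 unfolding D2_def by (intro linear_D1[unfolded eta_contract_eq] smooth_at_D1)

section \<open>Rules for first and second derivatives\<close>

lemma D1_add: "smooth_at f x ==> smooth_at g x ==> D1 (\<lambda>x. f x + g x) x v = D1 f x v + D1 g x v"
 by (simp add: D1_eqI[OF has_derivative_add[OF smooth_at_D1_works smooth_at_D1_works]])

lemma D1_scaleR: "smooth_at f x ==> D1 (\<lambda>x. c *\<^sub>R f x) x v = c *\<^sub>R D1 f x v"
 by (simp add: D1_eqI[OF has_derivative_scaleR_right[OF smooth_at_D1_works]])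

lemma D2_add:
 assumes "smooth_at f x" "smooth_at g x"
 shows "D2 (\<lambda>x. f x + g x) x v w = D2 f x v w + D2 g x v w"
proof -
 have "eventually (\<lambda>y. D1 (\<lambda>x. f x + g x) y w = D1 f y w + D1 g y w) (nhds x)"
  using smooth_at_eventually[OF assms(1)] smooth_at_eventually[OF assms(2)]
  by eventually_elim (rule D1_add)
 from D1_cong_ev[OF this] show ?thesis unfolding D2_def
  by (simp add: D1_add smooth_at_D1 assms)
qed

text \<open>Linearity in the direction that is differentiated first: the linearity of
  \<open>D1 f y\<close> holds for all \<open>y\<close> near \<open>x\<close>, so it may be
  differentiated at \<open>x\<close>.\<close>

lemma linear_D2_2:
 assumes "smooth_at f x" shows "linear (D2 f x v)"
proof (rule linearI)
 have ev: "eventually (\<lambda>y. linear (D1 f y)) (nhds x)"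
  using smooth_at_eventually[OF assms] by (rule eventually_mono) (rule linear_D1)
 show "D2 f x v (a + b) = D2 f x v a + D2 f x v b" for a b
 proof -
  have "eventually (\<lambda>y. D1 f y (a + b) = D1 f y a + D1 f y b) (nhds x)"
   using ev by (rule eventually_mono) (rule linear_add)
  from D1_cong_ev[OF this] show ?thesis unfolding D2_def
   by (simp add: D1_add smooth_at_D1 assms)
 qed
 show "D2 f x v (c *\<^sub>R b) = c *\<^sub>R D2 f x v b" for c b
 proof -
  have "eventually (\<lambda>y. D1 f y (c *\<^sub>R b) = c *\<^sub>R D1 f y b) (nhds x)"
   using ev by (rule eventually_mono) (rule linear_cmul)
  from D1_cong_ev[OF this] show ?thesis unfolding D2_def
   by (simp add: D1_scaleR smooth_at_D1 assms)
 qed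
qed

lemma D1_compose:
 assumes "g differentiable (at x)" "f differentiable (at (g x))"
 shows "D1 (\<lambda>x. f (g x)) x v = D1 f (g x) (D1 g x v)"
 using D1_eqI[OF diff_chain_at[OF D1_works[OF assms(1)] D1_works[OF assms(2)]]] by (simp add: o_def)

lemma D1_chain: "smooth_at g x ==> smooth_at f (g x) ==> D1 (\<lambda>x. f (g x)) x v = D1 f (g x) (D1 g x v)"
 by (intro D1_compose smooth_at_diffble)

lemma D1_bilinear:
 assumes "bounded_bilinear h" "f differentiable (at x)" "g differentiable (at x)"
 shows "D1 (\<lambda>x. h (f x) (g x)) x v = h (f x) (D1 g x v) + h (D1 f x v) (g x)"
 using D1_eqI[OF bounded_bilinear.FDERIV[OF assms(1) D1_works[OF assms(2)] D1_works[OF assms(3)]]] by simp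

lemma D1_sum: "(\<And>i. i \<in> I ==> smooth_at (f i) x) ==> D1 (\<lambda>x. \<Sum>i\<in>I. f i x) x v = (\<Sum>i\<in>I. D1 (f i) x v)"
proof (induction I rule: infinite_finite_induct)
 case (insert i I)
 then have "D1 (\<lambda>x. f i x + (\<Sum>i\<in>I. f i x)) x v = D1 (f i) x v + (\<Sum>i\<in>I. D1 (f i) x v)"
  by (subst D1_add) (auto intro!: smooth_intros)
 with insert show ?case by simp
qed (auto simp: D1_def)

text \<open>The direction \<open>D1 g y w\<close> varies with \<open>y\<close>; a basis expansion
  separates it from the base point, so that the product rule yields both terms.\<close>

lemma D2_compose:
 fixes f :: "'b::euclidean_space => 'c::real_normed_vector" and g :: "'a::euclidean_space => 'b"
 assumes g: "smooth_at g x" and f: "smooth_at f (g x)"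
 shows "D2 (\<lambda>x. f (g x)) x v w = D2 f (g x) (D1 g x v) (D1 g x w) + D1 f (g x) (D2 g x v w)"
proof -
 have ev: "eventually (\<lambda>y. smooth_at g y \<and> smooth_at f (g y)) (nhds x)"
  using smooth_at_eventually[OF g] eventually_smooth_at_compose[OF g smooth_at_eventually[OF f]] by eventually_elim simp
 then have "eventually (\<lambda>y. D1 (\<lambda>x. f (g x)) y w = (\<Sum>i\<in>Basis. (D1 g y w \<bullet> i) *\<^sub>R D1 f (g y) i)) (nhds x)"
  by (rule eventually_mono) (auto simp: D1_compose smooth_at_diffble D1_basis_sum[symmetric])
 then have "D2 (\<lambda>x. f (g x)) x v w = D1 (\<lambda>y. \<Sum>i\<in>Basis. (D1 g y w \<bullet> i) *\<^sub>R D1 f (g y) i) x v"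
  unfolding D2_def by (rule D1_cong_ev[THEN fun_cong])
 also have "\<dots> = (\<Sum>i\<in>Basis. (D1 g x w \<bullet> i) *\<^sub>R D2 f (g x) (D1 g x v) i + (D2 g x v w \<bullet> i) *\<^sub>R D1 f (g x) i)"
 proof (subst D1_sum)
  show "smooth_at (\<lambda>y. (D1 g y w \<bullet> i) *\<^sub>R D1 f (g y) i) x" for i
   by (intro smooth_intros smooth_at_D1 f g)
  have 1: "D1 (\<lambda>y. D1 f (g y) i) x v = D2 f (g x) (D1 g x v) i" for i
   unfolding D2_def by (rule D1_compose[of g x "\<lambda>z. D1 f z i"]) (auto intro!: smooth_at_diffble smooth_at_D1 f g)
  have 2: "D1 (\<lambda>y. D1 g y w \<bullet> i) x v = D2 g x v w \<bullet> i" for i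
   unfolding D2_def by (subst D1_bilinear[OF bounded_bilinear_inner])
    (auto intro!: smooth_at_diffble smooth_at_D1 g simp: D1_const)
  have "D1 (\<lambda>y. (D1 g y w \<bullet> i) *\<^sub>R D1 f (g y) i) x v = (D1 g x w \<bullet> i) *\<^sub>R D2 f (g x) (D1 g x v) i + (D2 g x v w \<bullet> i) *\<^sub>R D1 f (g x) i" for i
   by (subst D1_bilinear[OF bounded_bilinear_scaleR]) (auto intro!: smooth_at_diffble smooth_intros smooth_at_D1 f g simp: 1 2)
  then show "(\<Sum>i\<in>Basis. D1 (\<lambda>y. (D1 g y w \<bullet> i) *\<^sub>R D1 f (g y) i) x v) = (\<Sum>i\<in>Basis. (D1 g x w \<bullet> i) *\<^sub>R D2 f (g x) (D1 g x v) i + (D2 g x v w \<bullet> i) *\<^sub>R D1 f (g x) i)"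
   by simp
 qed
 finally have eq: "D2 (\<lambda>x. f (g x)) x v w = (\<Sum>i\<in>Basis. (D1 g x w \<bullet> i) *\<^sub>R D2 f (g x) (D1 g x v) i + (D2 g x v w \<bullet> i) *\<^sub>R D1 f (g x) i)" .
 have "(\<Sum>i\<in>Basis. (D1 g x w \<bullet> i) *\<^sub>R D2 f (g x) (D1 g x v) i) = D2 f (g x) (D1 g x v) (D1 g x w)"
 proof -
  have l: "linear (D2 f (g x) (D1 g x v))" using linear_D2_2[OF f] .
  have "D2 f (g x) (D1 g x v) (D1 g x w) = D2 f (g x) (D1 g x v) (\<Sum>i\<in>Basis. (D1 g x w \<bullet> i) *\<^sub>R i)" by (simp add: euclidean_representation)
  then show ?thesis by (simp only: linear_sum[OF l] linear_cmul[OF l])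
 qed
 moreover have "(\<Sum>i\<in>Basis. (D2 g x v w \<bullet> i) *\<^sub>R D1 f (g x) i) = D1 f (g x) (D2 g x v w)"
  by (simp add: D1_basis_sum[symmetric] smooth_at_diffble f)
 ultimately show ?thesis by (simp add: eq sum.distrib)
qed

lemma D1_linear: "bounded_linear L ==> D1 L x = L"
 using D1_eqI bounded_linear_imp_has_derivative by blast

lemma D2_linear: "bounded_linear L ==> D2 L x v w = 0"
 by (simp add: D2_def D1_linear) (simp add: D1_def)

lemma D1_linear_compose:
 fixes f :: "'a::euclidean_space => 'b::euclidean_space"
 assumes "bounded_linear L" "smooth_at f x"
 shows "D1 (\<lambda>x. L (f x)) x v = L (D1 f x v)"
 using D1_compose[OF smooth_at_diffble[OF assms(2)] smooth_at_diffble[OF smooth_at_linear[OF assms(1)]]]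
 by (simp add: D1_linear[OF assms(1)])

lemma D2_linear_compose:
 fixes f :: "'a::euclidean_space => 'b::euclidean_space"
 assumes "bounded_linear L" "smooth_at f x"
 shows "D2 (\<lambda>x. L (f x)) x v w = L (D2 f x v w)"
 using D2_compose[OF assms(2) smooth_at_linear[OF assms(1)]]
 by (simp add: D1_linear[OF assms(1)] D2_linear[OF assms(1)])

lemma D2_basis_sum:
 fixes f :: "'a::euclidean_space => 'b::real_normed_vector"
 assumes "smooth_at f x"
 shows "D2 f x v w = (\<Sum>j\<in>Basis. \<Sum>k\<in>Basis. ((v \<bullet> j) * (w \<bullet> k)) *\<^sub>R D2 f x j k)"
proof -
 have l: "linear (\<lambda>v. D2 f x v w)" for w using linear_D2_1[OF assms] .
 have l2: "linear (D2 f x v)" for v using linear_D2_2[OF assms] .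
 have "D2 f x v w = D2 f x (\<Sum>j\<in>Basis. (v \<bullet> j) *\<^sub>R j) w" by (simp add: euclidean_representation)
 also have "\<dots> = (\<Sum>j\<in>Basis. (v \<bullet> j) *\<^sub>R D2 f x j w)"
  by (simp add: linear_sum[OF l] linear_cmul[OF l])
 also have "\<dots> = (\<Sum>j\<in>Basis. (v \<bullet> j) *\<^sub>R D2 f x j (\<Sum>k\<in>Basis. (w \<bullet> k) *\<^sub>R k))"
  by (simp add: euclidean_representation)
 also have "\<dots> = (\<Sum>j\<in>Basis. \<Sum>k\<in>Basis. ((v \<bullet> j) * (w \<bullet> k)) *\<^sub>R D2 f x j k)"
  by (simp only: linear_sum[OF l2] linear_cmul[OF l2] scaleR_sum_right scaleR_scaleR)
 finally show ?thesis .
qed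

section \<open>The inverse function theorem for smooth maps\<close>

text \<open>\<open>inverse_function_theorem\<close> asks for a derivative that is continuous as a
  map into bounded linear maps; in finite dimension continuity on each basis vector is
  enough.\<close>

lemma C1_inverse_function:
 fixes f :: "'a::euclidean_space => 'a"
 assumes f: "smooth_at f x0" and inj: "\<And>v. D1 f x0 v = 0 ==> v = 0" and N: "open N" "x0 \<in> N"
 obtains U V g where "open U" "x0 \<in> U" "U \<subseteq> N" "open V" "homeomorphism U V f g"
  "\<And>x. x \<in> U ==> smooth_at f x" "\<And>y. y \<in> V ==> g differentiable (at y)"
proof -
 obtain S where S: "open S" "x0 \<in> S" "\<And>x. x \<in> S ==> smooth_at f x"
  using smooth_at_eventually[OF f] unfolding eventually_nhds by blast
 let ?f' = "\<lambda>x. Blinfun (D1 f x)"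
 have bl: "blinfun_apply (?f' x) = D1 f x" if "x \<in> S" for x
  using linear_D1[OF S(3)[OF that]] by (simp add: bounded_linear_Blinfun_apply linear_conv_bounded_linear)
 have cont: "continuous_on (S \<inter> N) ?f'"
 proof (rule continuous_on_blinfun_componentwise)
  fix i :: 'a
  have "continuous_on (S \<inter> N) (\<lambda>x. D1 f x i)"
   using S(3) by (auto intro!: continuous_at_imp_continuous_on smooth_at_isCont smooth_at_D1)
  then show "continuous_on (S \<inter> N) (\<lambda>x. ?f' x i)"
   by (rule continuous_on_eq) (simp add: bl)
 qed
 have "inj (D1 f x0)" using linear_injective_0[OF linear_D1[OF f]] inj by blast
 then obtain h where h: "linear h" "h \<circ> D1 f x0 = id"
  using linear_injective_left_inverse[OF linear_D1[OF f]] by blast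
 have "Blinfun h o\<^sub>L ?f' x0 = id_blinfun"
  by (rule blinfun_eqI) (use h in \<open>simp add: bl[OF S(2)] bounded_linear_Blinfun_apply linear_conv_bounded_linear pointfree_idE\<close>)
 from inverse_function_theorem[OF _ _ cont _ this] S N bl obtain U V g g' where
  UV: "open U" "U \<subseteq> S \<inter> N" "x0 \<in> U" "open V" "homeomorphism U V f g"
  "\<And>y. y \<in> V ==> (g has_derivative (g' y)) (at y)"
  by (metis IntI IntD1 open_Int smooth_at_D1_works)
 show ?thesis
 proof (rule that[OF UV(1,3) _ UV(4,5)])
  show "U \<subseteq> N" "\<And>x. x \<in> U ==> smooth_at f x" using UV S by auto
  show "\<And>y. y \<in> V ==> g differentiable (at y)" using UV(6) differentiable_def by blast
 qed
qed

text \<open>The inverse given by the \<open>C\<^sup>1\<close> theorem is differentiable. Applying that theorem to the tangent map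
 \<open>(x, \<xi>) \<mapsto> (f x, Df(x) \<xi>)\<close> shows that the derivative of the inverse is differentiable as well, and then
 the formula for its derivative bootstraps to all orders.\<close>

lemma smooth_inverse_function:
 fixes f :: "'a::euclidean_space => 'a"
 assumes f: "smooth_at f x0" and inj: "\<And>v. D1 f x0 v = 0 ==> v = 0" and N: "open N" "x0 \<in> N"
 obtains U g where "open U" "x0 \<in> U" "U \<subseteq> N" "open (f ` U)" "\<And>x. x \<in> U ==> smooth_at f x"
  "\<And>x. x \<in> U ==> g (f x) = x" "\<And>y. y \<in> f ` U ==> smooth_at g y"
proof -
 obtain U1 V1 g where 1: "open U1" "x0 \<in> U1" "U1 \<subseteq> N" "open V1" "homeomorphism U1 V1 f g"
  "\<And>x. x \<in> U1 ==> smooth_at f x" "\<And>y. y \<in> V1 ==> g differentiable (at y)"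
  using C1_inverse_function[OF f inj N] by metis
 have gf: "g (f x) = x" if "x \<in> U1" for x using 1(5) that by (simp add: homeomorphism_def)
 have fg: "f (g y) = y" "g y \<in> U1" if "y \<in> V1" for y using 1(5) that by (auto simp: homeomorphism_def)
 have fU: "f x \<in> V1" if "x \<in> U1" for x using 1(5) that by (auto simp: homeomorphism_def)
 have dgf: "D1 g y (D1 f (g y) b) = b" if "y \<in> V1" for y b
 proof -
  have "D1 (\<lambda>x. g (f x)) (g y) b = D1 (\<lambda>x. x) (g y) b"
   by (rule D1_cong_ev[THEN fun_cong], rule eventually_mono[OF eventually_nhds_in_open[OF 1(1) fg(2)[OF that]]]) (rule gf)
  then show ?thesis using D1_compose[of f "g y" g] 1(7) fg that 1(6)
   by (simp add: smooth_at_diffble D1_linear)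
 qed
 have dfg: "D1 f (g y) (D1 g y b) = b" if "y \<in> V1" for y b
 proof -
  have "D1 (\<lambda>x. f (g x)) y b = D1 (\<lambda>x. x) y b"
   by (rule D1_cong_ev[THEN fun_cong], rule eventually_mono[OF eventually_nhds_in_open[OF 1(4) that]]) (rule fg)
  then show ?thesis using D1_compose[of g y f] 1(7) fg that 1(6)
   by (simp add: smooth_at_diffble D1_linear)
 qed
 have lg: "linear (D1 g y)" if "y \<in> V1" for y
  using D1_works[OF 1(7)[OF that]] has_derivative_linear by blast
 let ?h = "\<lambda>p. (f (fst p), D1 f (fst p) (snd p))"
 have hs: "smooth_at ?h (x0, 0)"
  by (intro smooth_intros smooth_at_compose[of fst _ f]) (auto simp: f smooth_at_linear bounded_linear_fst)
 \<comment> \<open>The derivative of the tangent map at \<open>(x0, 0)\<close> is injective: its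
   first component is \<open>D1 f x0 a\<close>, so \<open>a = 0\<close>, and on the remaining
   directions \<open>(0, b)\<close> it is \<open>D1 f x0 b\<close>, because the map is linear on the
   fibre over \<open>x0\<close>.\<close>
 have hinj: "c = 0" if "D1 ?h (x0, 0) c = 0" for c
 proof -
  obtain a b where c: "c = (a, b)" by fastforce
  have s2: "smooth_at (\<lambda>p. D1 f (fst p) (snd p)) (x0, 0)"
   by (intro smooth_intros) (auto simp: f)
  have "D1 (\<lambda>p. fst (?h p)) (x0, 0) c = 0"
   using D1_linear_compose[OF bounded_linear_fst hs] that by simp
  moreover have "D1 (\<lambda>p. f (fst p)) (x0, 0) c = D1 f x0 a"
   using D1_compose[of fst "(x0, 0::'a)" f c] f c
   by (simp add: D1_linear bounded_linear_fst bounded_linear_imp_differentiable smooth_at_diffble)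
  ultimately have a: "a = 0" using inj by simp
  have sh: "smooth_at (\<lambda>b::'a. (x0, b)) 0" by (intro smooth_intros)
  have "D1 (\<lambda>b. (x0, b)) 0 b = (0, b)"
   by (subst D1_eqI[of _ "\<lambda>b. (0, b)"]) (auto intro!: derivative_eq_intros)
  then have "D1 (\<lambda>b. snd (?h (x0, b))) 0 b = snd (D1 ?h (x0, 0) (0, b))"
   using D1_compose[of "\<lambda>b. (x0, b)" 0 "\<lambda>p. snd (?h p)" b] sh D1_linear_compose[OF bounded_linear_snd hs] s2
   by (simp add: smooth_at_diffble)
  moreover have "D1 (\<lambda>b. snd (?h (x0, b))) 0 b = D1 f x0 b"
   using D1_linear[of "D1 f x0" 0] linear_D1[OF f] by (simp add: linear_conv_bounded_linear)
  ultimately show ?thesis using that inj a c by (simp add: prod_eq_iff)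
 qed
 obtain U2 V2 k where 2: "open U2" "(x0, 0) \<in> U2" "U2 \<subseteq> U1 \<times> UNIV" "open V2" "homeomorphism U2 V2 ?h k"
  "\<And>y. y \<in> V2 ==> k differentiable (at y)"
 proof (rule C1_inverse_function[OF hs, of "U1 \<times> UNIV"])
  show "open (U1 \<times> (UNIV :: 'a set))" "(x0, 0) \<in> U1 \<times> (UNIV :: 'a set)" using 1 by (auto intro: open_Times)
 qed (blast intro: hinj, blast intro: that)
 have "?h (x0, 0) \<in> V2" using 2(2,5) unfolding homeomorphism_def by blast
 then have "(f x0, 0) \<in> V2" using linear_0[OF linear_D1[OF f]] by simp
 then obtain Va Vb where ab: "open Va" "open Vb" "f x0 \<in> Va" "0 \<in> Vb" "Va \<times> Vb \<subseteq> V2"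
  using open_prod_elim[OF 2(4)] by (metis SigmaE2 mem_Sigma_iff)
 define V where "V = Va \<inter> V1"
 have V: "open V" "f x0 \<in> V" "V \<subseteq> V1" using ab 1 fU by (auto simp: V_def)
 \<comment> \<open>The inverse \<open>k\<close> of the tangent map has to be the tangent map of
   \<open>g\<close>; hence the derivative of \<open>g\<close> inherits differentiability from
   \<open>k\<close>.\<close>
 have E: "D1 g y v = snd (k (y, v))" if "y \<in> V" "v \<in> Vb" for y v
 proof -
  have "(y, v) \<in> V2" using that ab V_def by auto
  then have "?h (k (y, v)) = (y, v)" "k (y, v) \<in> U2" using 2(5) by (auto simp: homeomorphism_def)
  then have "f (fst (k (y, v))) = y" "D1 f (fst (k (y, v))) (snd (k (y, v))) = v" "fst (k (y, v)) \<in> U1"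
   using 2(3) by auto
  then show ?thesis using gf dgf[of y] that V by (metis subsetD)
 qed
 have dE: "(\<lambda>y. D1 g y v) differentiable (at y)" if y: "y \<in> V" for v y
 proof -
  obtain e where e: "e > 0" "ball 0 e \<subseteq> Vb" using ab(2,4) open_contains_ball by blast
  \<comment> \<open>\<open>E\<close> only covers directions in the neighbourhood \<open>Vb\<close>
    of 0; this factor brings \<open>v\<close> into the ball of radius \<open>e\<close>, and
    linearity of \<open>D1 g y\<close> removes it again.\<close>
  define c where "c = e / (2 * (norm v + 1))"
  have n: "norm v + 1 > 0" using norm_ge_zero[of v] by linarith
  have c: "c > 0" using e n by (simp add: c_def)
  have "norm (c *\<^sub>R v) = e * (norm v / (2 * (norm v + 1)))" using c e by (simp add: c_def)
  also have "\<dots> < e * 1" using e n by (intro mult_strict_left_mono) (auto simp: field_simps)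
  finally have cv: "c *\<^sub>R v \<in> Vb" using e by auto
  have "(y, c *\<^sub>R v) \<in> V2" using y cv ab V_def by auto
  then have "(\<lambda>y. snd (k (y, c *\<^sub>R v))) differentiable (at y)"
   using differentiable_compose[OF bounded_linear_imp_differentiable[OF bounded_linear_snd],
     of "\<lambda>y. k (y, c *\<^sub>R v)" y UNIV] differentiable_compose[OF 2(6), of "\<lambda>y. (y, c *\<^sub>R v)" y UNIV]
   by (auto intro: smooth_at_diffble smooth_intros)
  then have "(\<lambda>y. (1/c) *\<^sub>R snd (k (y, c *\<^sub>R v))) differentiable (at y)"
   using differentiable_scaleR differentiable_const by blast
  moreover have "eventually (\<lambda>y. D1 g y v = (1/c) *\<^sub>R snd (k (y, c *\<^sub>R v))) (nhds y)"
  proof (rule eventually_mono[OF eventually_nhds_in_open[OF V(1) y]])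
   fix z assume z: "z \<in> V"
   have "D1 g z (c *\<^sub>R v) = c *\<^sub>R D1 g z v" using lg z V by (simp add: linear_cmul subset_iff)
   then show "D1 g z v = (1/c) *\<^sub>R snd (k (z, c *\<^sub>R v))" using E[OF z cv] c
    by (metis divide_inverse inverse_inverse_eq less_numeral_extra(3) mult_1 real_vector_affinity_eq scaleR_cancel_left scaleR_one scaleR_scaleR left_inverse)
  qed
  ultimately show ?thesis by (rule iffD2[OF differentiable_cong_ev, rotated])
 qed
 \<comment> \<open>Obtained by differentiating \<open>D1 f (g y) (D1 g y v) = v\<close>. The right
   side involves only second derivatives of \<open>f\<close> at \<open>g y\<close> and first
   derivatives of \<open>g\<close>, so it has the order of smoothness already known for
   these.\<close>
 have ddE: "D1 (\<lambda>y. D1 g y v) y w =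
  - (\<Sum>j\<in>Basis. \<Sum>l\<in>Basis. ((D1 g y w \<bullet> j) * (D1 g y v \<bullet> l)) *\<^sub>R (\<Sum>i\<in>Basis. (D2 f (g y) j l \<bullet> i) *\<^sub>R D1 g y i))"
  if y: "y \<in> V" for v w y
 proof -
  have yV: "y \<in> V1" using y V by auto
  have sf: "smooth_at f (g y)" using 1(6) fg yV by auto
  have d1: "(\<lambda>y. D1 f (g y) i) differentiable (at y)" for i
   using differentiable_compose[of "\<lambda>z. D1 f z i" g y UNIV] 1(7)[OF yV] smooth_at_diffble[OF smooth_at_D1[OF sf]] by simp
  have d2: "(\<lambda>y. D1 g y v \<bullet> i) differentiable (at y)" for i
   using dE[OF y] by (intro differentiable_inner) auto
  have D1a: "D1 (\<lambda>y. D1 f (g y) i) y w = D2 f (g y) (D1 g y w) i" for i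
   unfolding D2_def by (rule D1_compose[of g y "\<lambda>z. D1 f z i", OF 1(7)[OF yV] smooth_at_diffble[OF smooth_at_D1[OF sf]]])
  have D1b: "D1 (\<lambda>y. D1 g y v \<bullet> i) y w = D1 (\<lambda>y. D1 g y v) y w \<bullet> i" for i
   by (subst D1_bilinear[OF bounded_bilinear_inner]) (auto intro!: dE y simp: D1_const)
  have D1c: "D1 (\<lambda>y. (D1 g y v \<bullet> i) *\<^sub>R D1 f (g y) i) y w =
   (D1 g y v \<bullet> i) *\<^sub>R D2 f (g y) (D1 g y w) i + (D1 (\<lambda>y. D1 g y v) y w \<bullet> i) *\<^sub>R D1 f (g y) i" for i
   by (subst D1_bilinear[OF bounded_bilinear_scaleR d2 d1]) (simp add: D1a D1b)
  have "((\<lambda>y. \<Sum>i\<in>Basis. (D1 g y v \<bullet> i) *\<^sub>R D1 f (g y) i) has_derivative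
    (\<lambda>w. \<Sum>i\<in>Basis. D1 (\<lambda>y. (D1 g y v \<bullet> i) *\<^sub>R D1 f (g y) i) y w)) (at y)"
   by (intro has_derivative_sum D1_works[unfolded eta_contract_eq] differentiable_scaleR d1 d2)
  moreover have "((\<lambda>y. \<Sum>i\<in>Basis. (D1 g y v \<bullet> i) *\<^sub>R D1 f (g y) i) has_derivative (\<lambda>w. 0)) (at y)"
  proof (rule has_derivative_transform_within_open[OF has_derivative_const[of v] V(1) y])
   fix z assume "z \<in> V"
   then have "z \<in> V1" using V by auto
   then show "v = (\<Sum>i\<in>Basis. (D1 g z v \<bullet> i) *\<^sub>R D1 f (g z) i)"
    using dfg[of z v] D1_basis_sum[of f "g z" "D1 g z v"] 1(6)[OF fg(2)] by (simp add: smooth_at_diffble)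
  qed
  ultimately have "(\<lambda>w. \<Sum>i\<in>Basis. D1 (\<lambda>y. (D1 g y v \<bullet> i) *\<^sub>R D1 f (g y) i) y w) = (\<lambda>w. 0)"
   by (rule has_derivative_unique)
  then have "(\<Sum>i\<in>Basis. D1 (\<lambda>y. (D1 g y v \<bullet> i) *\<^sub>R D1 f (g y) i) y w) = 0"
   by (rule fun_cong)
  then have "(\<Sum>i\<in>Basis. (D1 g y v \<bullet> i) *\<^sub>R D2 f (g y) (D1 g y w) i) + D1 f (g y) (D1 (\<lambda>y. D1 g y v) y w) = 0"
   by (simp add: D1c sum.distrib D1_basis_sum[OF smooth_at_diffble[OF sf], of "D1 (\<lambda>y. D1 g y v) y w"])
  moreover have "(\<Sum>i\<in>Basis. (D1 g y v \<bullet> i) *\<^sub>R D2 f (g y) (D1 g y w) i) = D2 f (g y) (D1 g y w) (D1 g y v)"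
   using linear_sum[OF linear_D2_2[OF sf, of "D1 g y w"], of "\<lambda>i. (D1 g y v \<bullet> i) *\<^sub>R i" Basis]
   by (simp add: euclidean_representation linear_cmul[OF linear_D2_2[OF sf]])
  ultimately have *: "D1 f (g y) (D1 (\<lambda>y. D1 g y v) y w) = - D2 f (g y) (D1 g y w) (D1 g y v)"
   by (simp add: eq_neg_iff_add_eq_0 add.commute)
  have "D1 (\<lambda>y. D1 g y v) y w = D1 g y (- D2 f (g y) (D1 g y w) (D1 g y v))"
   by (subst dgf[OF yV, of "D1 (\<lambda>y. D1 g y v) y w", symmetric]) (simp only: *)
  also have "\<dots> = - (\<Sum>j\<in>Basis. \<Sum>l\<in>Basis. ((D1 g y w \<bullet> j) * (D1 g y v \<bullet> l)) *\<^sub>R D1 g y (D2 f (g y) j l))"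
   by (subst D2_basis_sum[OF sf]) (simp add: linear_neg[OF lg[OF yV]] linear_sum[OF lg[OF yV]] linear_cmul[OF lg[OF yV]])
  finally show ?thesis by (simp only: D1_basis_sum[OF 1(7)[OF yV], of "D2 f (g y) j l" for j l])
 qed
 have ckf: "ck n U1 f" for n using 1(1,6) smooth_on_iff smooth_on_ck by blast
 have ckD2: "ck n U1 (\<lambda>x. D2 f x j l)" for n j l
  using ckf[of "Suc (Suc n)"] unfolding D2_def by (simp add: ck_Suc)
 \<comment> \<open>\<open>g\<close> and its first derivatives are kept at the same order:
   \<open>ddE\<close> raises the order of the derivatives, and the derivatives raise that of
   \<open>g\<close>.\<close>
 have main: "ck n V g \<and> (\<forall>v. ck n V (\<lambda>y. D1 g y v))" for n
 proof (induction n)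
  case (Suc n)
  have s: "g ` V \<subseteq> U1" using fg V by auto
  have a: "ck (Suc n) V g" using Suc 1(7) V by (auto simp: ck_Suc)
  have b: "ck (Suc n) V (\<lambda>y. D1 g y v)" for v
  proof (subst ck_Suc, intro conjI allI ballI dE)
   fix w
   show "ck n V (\<lambda>y. D1 (\<lambda>y. D1 g y v) y w)"
   proof (subst ck_cong[OF V(1) ddE])
    have i: "ck n V (\<lambda>y. D1 g y v \<bullet> j)" for v j
     by (intro ck_bilinear[OF bounded_bilinear_inner V(1)] ck_const) (use Suc in auto)
    have d: "ck n V (\<lambda>y. D2 f (g y) j l \<bullet> k)" for j l k
     by (intro ck_bilinear[OF bounded_bilinear_inner V(1)] ck_const ck_compose[OF V(1) 1(1) s ckD2]) (use Suc in auto)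
    have "ck n V (\<lambda>y. (-1) *\<^sub>R (\<Sum>j\<in>Basis. \<Sum>l\<in>Basis. ((D1 g y w \<bullet> j) * (D1 g y v \<bullet> l)) *\<^sub>R (\<Sum>i\<in>Basis. (D2 f (g y) j l \<bullet> i) *\<^sub>R D1 g y i)))"
     by (intro ck_bilinear[OF bounded_bilinear_scaleR V(1)] ck_bilinear[OF bounded_bilinear_mult V(1)] ck_sum[OF V(1)] ck_const i d)
      (use Suc in auto)
    then show "ck n V (\<lambda>y. - (\<Sum>j\<in>Basis. \<Sum>l\<in>Basis. ((D1 g y w \<bullet> j) * (D1 g y v \<bullet> l)) *\<^sub>R (\<Sum>i\<in>Basis. (D2 f (g y) j l \<bullet> i) *\<^sub>R D1 g y i)))"
     by simp
   qed
  qed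
  show ?case using a b by simp
 qed simp
 have sg: "smooth_at g y" if "y \<in> V" for y
  using main that V(1) unfolding smooth_at_def smooth_on_ck by blast
 have cf: "continuous_on U1 f" using 1(5) by (simp add: homeomorphism_def)
 have fV: "f ` (U1 \<inter> f -` V) = V"
 proof
  show "V \<subseteq> f ` (U1 \<inter> f -` V)"
  proof
   fix y assume "y \<in> V"
   then have "y = f (g y)" "g y \<in> U1 \<inter> f -` V" using fg V by auto
   then show "y \<in> f ` (U1 \<inter> f -` V)" by blast
  qed
 qed auto
 show ?thesis
 proof (rule that[of "U1 \<inter> f -` V" g])
  show "open (U1 \<inter> f -` V)" using cf 1(1) V(1) by (simp add: continuous_on_open_vimage Int_commute[of U1])
  show "open (f ` (U1 \<inter> f -` V))" "\<And>y. y \<in> f ` (U1 \<inter> f -` V) ==> smooth_at g y" using fV V sg by auto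
 qed (use 1 V gf in auto)
qed

section \<open>Charts\<close>

lemma is_chartD:
 assumes "is_chart (U, \<phi>)"
 shows "open U" "open (\<phi> ` U)" "continuous_on U \<phi>" "inj_on \<phi> U" "continuous_on (\<phi> ` U) (inv_into U \<phi>)"
  "\<And>p. p \<in> U ==> inv_into U \<phi> (\<phi> p) = p"
proof -
 show "open U" "open (\<phi> ` U)" "continuous_on U \<phi>" "continuous_on (\<phi> ` U) (inv_into U \<phi>)"
  and *: "\<And>p. p \<in> U ==> inv_into U \<phi> (\<phi> p) = p"
  using assms by (auto simp: is_chart_def homeomorphism_def)
 show "inj_on \<phi> U" using * by (metis inj_on_inverseI)
qed

text \<open>Any continuous left inverse \<open>g\<close> agrees on the image with the inverse chosen
  by \<open>inv_into\<close>.\<close>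

lemma is_chartI:
 assumes "open U" "open (\<phi> ` U)" "continuous_on U \<phi>" "continuous_on (\<phi> ` U) g" "\<And>p. p \<in> U ==> g (\<phi> p) = p"
 shows "is_chart (U, \<phi>)"
proof -
 have i: "inj_on \<phi> U" using assms(5) by (metis inj_on_inverseI)
 have "continuous_on (\<phi> ` U) (inv_into U \<phi>)"
  by (rule continuous_on_eq[OF assms(4)]) (auto simp: i assms(5))
 then show ?thesis using assms i by (auto simp: is_chart_def homeomorphism_def)
qed

lemma chart_image_open:
 assumes "is_chart (U, \<phi>)" "open W"
 shows "open (\<phi> ` (U \<inter> W))"
proof -
 note c = is_chartD[OF assms(1)]
 have "\<phi> ` (U \<inter> W) = inv_into U \<phi> -` W \<inter> \<phi> ` U" using c(6) by auto
 then show ?thesis using c(2,5) assms(2) by (simp add: continuous_on_open_vimage)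
qed

lemma eventually_chart:
 assumes c: "is_chart (U, \<phi>)" and p: "p \<in> U" and ev: "eventually P (nhds p)"
 shows "eventually (\<lambda>y. P (inv_into U \<phi> y) \<and> inv_into U \<phi> y \<in> U \<and> \<phi> (inv_into U \<phi> y) = y) (nhds (\<phi> p))"
proof -
 obtain W where W: "open W" "p \<in> W" "\<And>q. q \<in> W ==> P q" using ev unfolding eventually_nhds by blast
 have "eventually (\<lambda>y. y \<in> \<phi> ` (U \<inter> W)) (nhds (\<phi> p))"
  using chart_image_open[OF c W(1)] p W(2) by (intro eventually_nhds_in_open) auto
 then show ?thesis by (rule eventually_mono) (auto simp: is_chartD(6)[OF c] W(3))
qed

lemma eventually_chart_pull:
 assumes c: "is_chart (U, \<phi>)" and p: "p \<in> U" and ev: "eventually P (nhds (\<phi> p))"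
 shows "eventually (\<lambda>q. q \<in> U \<and> P (\<phi> q)) (nhds p)"
proof -
 obtain W where W: "open W" "\<phi> p \<in> W" "\<And>q. q \<in> W ==> P q" using ev unfolding eventually_nhds by blast
 have "open (\<phi> -` W \<inter> U)" using is_chartD[OF c] W(1) by (simp add: continuous_on_open_vimage)
 then show ?thesis unfolding eventually_nhds using p W by (intro exI[of _ "\<phi> -` W \<inter> U"]) auto
qed

section \<open>Transition maps and the maximal atlas\<close>

lemma smooth_compatible_iff:
 assumes "is_chart (U, \<phi>)" "is_chart (V, \<psi>)"
 shows "smooth_compatible (U, \<phi>) (V, \<psi>) \<longleftrightarrow>
  (\<forall>p\<in>U \<inter> V. smooth_at (\<lambda>y. \<psi> (inv_into U \<phi> y)) (\<phi> p) \<and> smooth_at (\<lambda>y. \<phi> (inv_into V \<psi> y)) (\<psi> p))"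
proof -
 have "open (\<phi> ` (U \<inter> V))" "open (\<psi> ` (U \<inter> V))"
  using chart_image_open[OF assms(1), of V] chart_image_open[OF assms(2), of U] is_chartD(1)[OF assms(1)] is_chartD(1)[OF assms(2)]
  by (auto simp: Int_commute)
 then show ?thesis unfolding smooth_compatible_def by (auto simp: smooth_on_iff o_def)
qed

lemma smooth_charts_is_chart: "(U, \<phi>) \<in> smooth_charts A ==> is_chart (U, \<phi>)"
 by (simp add: smooth_charts_def)

lemma smooth_charts_carrier: "(U, \<phi>) \<in> smooth_charts A ==> U \<subseteq> carrier A"
 by (auto simp: smooth_charts_def)

lemma atlas_subset_smooth_charts: "smooth_manifold A ==> A \<subseteq> smooth_charts A"
 by (force simp: smooth_charts_def smooth_manifold_def carrier_def)

text \<open>\<open>smooth_charts\<close> only compares a chart with those of the atlas, so the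
  transition is factored through an atlas chart at \<open>p\<close>.\<close>

lemma smooth_charts_transition:
 assumes A: "smooth_manifold A" and c: "(U, \<phi>) \<in> smooth_charts A" and d: "(V, \<psi>) \<in> smooth_charts A"
  and p: "p \<in> U" "p \<in> V"
 shows "smooth_at (\<lambda>y. \<psi> (inv_into U \<phi> y)) (\<phi> p)"
proof -
 obtain W \<kappa> where w: "(W, \<kappa>) \<in> A" "p \<in> W" using smooth_charts_carrier[OF c] p by (auto simp: carrier_def)
 have cw: "is_chart (W, \<kappa>)" using w A by (auto simp: smooth_manifold_def)
 note cU = smooth_charts_is_chart[OF c] and cV = smooth_charts_is_chart[OF d]
 have 1: "smooth_at (\<lambda>y. \<kappa> (inv_into U \<phi> y)) (\<phi> p)"
  using c w p smooth_compatible_iff[OF cU cw] by (auto simp: smooth_charts_def)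
 have 2: "smooth_at (\<lambda>y. \<psi> (inv_into W \<kappa> y)) (\<kappa> p)"
  using d w p smooth_compatible_iff[OF cV cw] by (auto simp: smooth_charts_def)
 have "smooth_at (\<lambda>y. \<psi> (inv_into W \<kappa> (\<kappa> (inv_into U \<phi> y)))) (\<phi> p)"
  by (rule smooth_at_compose[of "\<lambda>y. \<kappa> (inv_into U \<phi> y)" _ "\<lambda>y. \<psi> (inv_into W \<kappa> y)"])
   (use 1 2 is_chartD(6)[OF cU p(1)] in auto)
 moreover have "eventually (\<lambda>y. \<psi> (inv_into W \<kappa> (\<kappa> (inv_into U \<phi> y))) = \<psi> (inv_into U \<phi> y)) (nhds (\<phi> p))"
  by (rule eventually_mono[OF eventually_chart[OF cU p(1) eventually_nhds_in_open[OF is_chartD(1)[OF cw] w(2)]]])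
   (simp add: is_chartD(6)[OF cw])
 ultimately show ?thesis by (rule smooth_at_transform)
qed

text \<open>It is enough to compare with one chart of the maximal atlas near each point, since the
  transitions inside the maximal atlas are smooth.\<close>

lemma smooth_chartsI:
 assumes A: "smooth_manifold A" and c: "is_chart (U, \<phi>)" and sub: "U \<subseteq> carrier A"
  and ex: "\<And>p. p \<in> U ==> \<exists>V \<psi>. (V, \<psi>) \<in> smooth_charts A \<and> p \<in> V \<and>
   smooth_at (\<lambda>y. \<psi> (inv_into U \<phi> y)) (\<phi> p) \<and> smooth_at (\<lambda>y. \<phi> (inv_into V \<psi> y)) (\<psi> p)"
 shows "(U, \<phi>) \<in> smooth_charts A"
proof -
 have "smooth_compatible (U, \<phi>) (W, \<kappa>)" if w: "(W, \<kappa>) \<in> A" for W \<kappa>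
 proof -
  have wA: "(W, \<kappa>) \<in> smooth_charts A" using atlas_subset_smooth_charts[OF A] w by blast
  note cw = smooth_charts_is_chart[OF wA]
  show ?thesis
  proof (subst smooth_compatible_iff[OF c cw], intro ballI conjI)
   fix p assume p: "p \<in> U \<inter> W"
   then obtain V \<psi> where v: "(V, \<psi>) \<in> smooth_charts A" "p \<in> V"
    "smooth_at (\<lambda>y. \<psi> (inv_into U \<phi> y)) (\<phi> p)" "smooth_at (\<lambda>y. \<phi> (inv_into V \<psi> y)) (\<psi> p)" using ex[of p] by blast
   note cv = smooth_charts_is_chart[OF v(1)]
   have "smooth_at (\<lambda>y. \<kappa> (inv_into V \<psi> (\<psi> (inv_into U \<phi> y)))) (\<phi> p)"
    by (rule smooth_at_compose[of "\<lambda>y. \<psi> (inv_into U \<phi> y)" _ "\<lambda>y. \<kappa> (inv_into V \<psi> y)"])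
     (use v p is_chartD(6)[OF c] smooth_charts_transition[OF A v(1) wA] in auto)
   moreover have "eventually (\<lambda>y. \<kappa> (inv_into V \<psi> (\<psi> (inv_into U \<phi> y))) = \<kappa> (inv_into U \<phi> y)) (nhds (\<phi> p))"
    by (rule eventually_mono[OF eventually_chart[OF c _ eventually_nhds_in_open[OF is_chartD(1)[OF cv] v(2)]]])
     (use p in \<open>auto simp: is_chartD(6)[OF cv]\<close>)
   ultimately show "smooth_at (\<lambda>y. \<kappa> (inv_into U \<phi> y)) (\<phi> p)" by (rule smooth_at_transform)
   have "smooth_at (\<lambda>y. \<phi> (inv_into V \<psi> (\<psi> (inv_into W \<kappa> y)))) (\<kappa> p)"
    by (rule smooth_at_compose[of "\<lambda>y. \<psi> (inv_into W \<kappa> y)" _ "\<lambda>y. \<phi> (inv_into V \<psi> y)"])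
     (use v p is_chartD(6)[OF cw] smooth_charts_transition[OF A wA v(1)] in auto)
   moreover have "eventually (\<lambda>y. \<phi> (inv_into V \<psi> (\<psi> (inv_into W \<kappa> y))) = \<phi> (inv_into W \<kappa> y)) (nhds (\<kappa> p))"
    by (rule eventually_mono[OF eventually_chart[OF cw _ eventually_nhds_in_open[OF is_chartD(1)[OF cv] v(2)]]])
     (use p in \<open>auto simp: is_chartD(6)[OF cv]\<close>)
   ultimately show "smooth_at (\<lambda>y. \<phi> (inv_into W \<kappa> y)) (\<kappa> p)" by (rule smooth_at_transform)
  qed
 qed
 then show ?thesis using c sub by (auto simp: smooth_charts_def)
qed

lemma open_carrier: "smooth_manifold A ==> open (carrier A)"
 unfolding carrier_def smooth_manifold_def by (auto simp: is_chart_def split_beta)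

lemma chart_at_point:
 assumes "smooth_manifold A" "p \<in> carrier A"
 obtains U \<phi> where "(U, \<phi>) \<in> smooth_charts A" "(U, \<phi>) \<in> A" "p \<in> U"
 using assms atlas_subset_smooth_charts by (force simp: carrier_def)

lemma transition_inverse:
 assumes A: "smooth_manifold A" and c: "(U, \<phi>) \<in> smooth_charts A" and d: "(V, \<psi>) \<in> smooth_charts A"
  and p: "p \<in> U" "p \<in> V"
 shows "D1 (\<lambda>y. \<psi> (inv_into U \<phi> y)) (\<phi> p) (D1 (\<lambda>y. \<phi> (inv_into V \<psi> y)) (\<psi> p) v) = v"
proof -
 note cU = smooth_charts_is_chart[OF c] and cV = smooth_charts_is_chart[OF d]
 have 1: "smooth_at (\<lambda>y. \<psi> (inv_into U \<phi> y)) (\<phi> p)" "smooth_at (\<lambda>y. \<phi> (inv_into V \<psi> y)) (\<psi> p)"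
  using smooth_charts_transition[OF A] c d p by auto
 have e: "\<phi> (inv_into V \<psi> (\<psi> p)) = \<phi> p" using is_chartD(6)[OF cV p(2)] by simp
 have "D1 (\<lambda>y. \<psi> (inv_into U \<phi> (\<phi> (inv_into V \<psi> y)))) (\<psi> p) v = D1 (\<lambda>y. y) (\<psi> p) v"
  by (rule D1_cong_ev[THEN fun_cong], rule eventually_mono[OF eventually_chart[OF cV p(2) eventually_nhds_in_open[OF is_chartD(1)[OF cU] p(1)]]])
   (simp add: is_chartD(6)[OF cU])
 then show ?thesis
  using D1_compose[of "\<lambda>y. \<phi> (inv_into V \<psi> y)" "\<psi> p" "\<lambda>y. \<psi> (inv_into U \<phi> y)"] 1
  by (simp add: e smooth_at_diffble D1_linear)
qed

section \<open>Smooth maps and submersions in arbitrary charts\<close>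

text \<open>\<open>smooth_map\<close> tests only charts of the two atlases; transition maps on both
  sides carry this over to the maximal atlases.\<close>

lemma smooth_map_at:
 assumes A: "smooth_manifold A" and B: "smooth_manifold B" and F: "smooth_map A B F"
  and c: "(U, \<phi>) \<in> smooth_charts A" and d: "(V, \<psi>) \<in> smooth_charts B" and p: "p \<in> U" "F p \<in> V"
 shows "smooth_at (\<lambda>y. \<psi> (F (inv_into U \<phi> y))) (\<phi> p)"
proof -
 have pc: "p \<in> carrier A" using smooth_charts_carrier[OF c] p by auto
 obtain W \<kappa> where w: "(W, \<kappa>) \<in> smooth_charts A" "(W, \<kappa>) \<in> A" "p \<in> W" using chart_at_point[OF A pc] .
 have "F p \<in> carrier B" using F pc by (auto simp: smooth_map_def)
 then obtain W' \<kappa>' where w': "(W', \<kappa>') \<in> smooth_charts B" "(W', \<kappa>') \<in> B" "F p \<in> W'" using chart_at_point[OF B] by blast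
 note cU = smooth_charts_is_chart[OF c] and cV = smooth_charts_is_chart[OF d] and cW = smooth_charts_is_chart[OF w(1)]
  and cW' = smooth_charts_is_chart[OF w'(1)]
 have cont: "isCont F p" using F open_carrier[OF A] pc unfolding smooth_map_def by (metis continuous_on_eq_continuous_at)
 have "open (F -` W' \<inter> carrier A)" using F open_carrier[OF A] is_chartD(1)[OF cW'] unfolding smooth_map_def
  by (metis continuous_on_open_vimage)
 then have "open (\<kappa> ` (W \<inter> (F -` W' \<inter> carrier A)))" by (rule chart_image_open[OF cW])
 moreover have "W \<inter> (F -` W' \<inter> carrier A) = W \<inter> F -` W'" using smooth_charts_carrier[OF w(1)] by auto
 ultimately have o: "open (\<kappa> ` (W \<inter> F -` W'))" by simp
 have "smooth_on (\<kappa> ` (W \<inter> F -` W')) (\<kappa>' \<circ> F \<circ> inv_into W \<kappa>)" using F w w' by (auto simp: smooth_map_def)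
 then have s: "smooth_at (\<lambda>y. \<kappa>' (F (inv_into W \<kappa> y))) (\<kappa> p)"
  using w w' by (simp add: smooth_on_iff[OF o] o_def)
 have s2: "smooth_at (\<lambda>y. \<kappa>' (F (inv_into W \<kappa> (\<kappa> (inv_into U \<phi> y))))) (\<phi> p)"
  by (rule smooth_at_compose[OF smooth_charts_transition[OF A c w(1) p(1) w(3)], of "\<lambda>y. \<kappa>' (F (inv_into W \<kappa> y))"])
   (simp add: is_chartD(6)[OF cU p(1)] s)
 have e: "\<kappa>' (F (inv_into W \<kappa> (\<kappa> (inv_into U \<phi> (\<phi> p))))) = \<kappa>' (F p)"
  by (simp add: is_chartD(6)[OF cU p(1)] is_chartD(6)[OF cW w(3)])
 have s3: "smooth_at (\<lambda>y. \<psi> (inv_into W' \<kappa>' (\<kappa>' (F (inv_into W \<kappa> (\<kappa> (inv_into U \<phi> y))))))) (\<phi> p)"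
  by (rule smooth_at_compose[OF s2, of "\<lambda>y. \<psi> (inv_into W' \<kappa>' y)"])
   (simp only: e, rule smooth_charts_transition[OF B w'(1) d w'(3) p(2)])
 have "eventually (\<lambda>q. q \<in> W \<and> F q \<in> W') (nhds p)"
  using eventually_nhds_in_open[OF is_chartD(1)[OF cW] w(3)]
   eventually_compose_filterlim[OF eventually_nhds_in_open[OF is_chartD(1)[OF cW'] w'(3)] cont[unfolded isCont_def tendsto_at_iff_tendsto_nhds]]
  by eventually_elim simp
 then have "eventually (\<lambda>y. \<psi> (inv_into W' \<kappa>' (\<kappa>' (F (inv_into W \<kappa> (\<kappa> (inv_into U \<phi> y)))))) = \<psi> (F (inv_into U \<phi> y))) (nhds (\<phi> p))"
  by (intro eventually_mono[OF eventually_chart[OF cU p(1)]]) (auto simp: is_chartD(6)[OF cW] is_chartD(6)[OF cW'])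
 then show ?thesis using s3 by (rule smooth_at_transform[rotated])
qed

lemma smooth_mapD:
 assumes "smooth_map A B F"
 shows "p \<in> carrier A ==> F p \<in> carrier B" "smooth_manifold A ==> p \<in> carrier A ==> isCont F p"
proof -
 show "p \<in> carrier A ==> F p \<in> carrier B" using assms by (auto simp: smooth_map_def)
 show "isCont F p" if "smooth_manifold A" "p \<in> carrier A"
  using assms open_carrier[OF that(1)] that(2) unfolding smooth_map_def by (metis continuous_on_eq_continuous_at)
qed

text \<open>Conversely one pair of charts around each point and its image suffices; continuity keeps
  nearby points inside these charts.\<close>

lemma smooth_mapI:
 assumes A: "smooth_manifold A" and B: "smooth_manifold B" and img: "\<And>p. p \<in> carrier A ==> F p \<in> carrier B"
  and cont: "\<And>p. p \<in> carrier A ==> isCont F p"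
  and ex: "\<And>p. p \<in> carrier A ==> \<exists>U \<phi> V \<psi>. (U, \<phi>) \<in> smooth_charts A \<and> (V, \<psi>) \<in> smooth_charts B \<and> p \<in> U \<and> F p \<in> V \<and>
   smooth_at (\<lambda>y. \<psi> (F (inv_into U \<phi> y))) (\<phi> p)"
 shows "smooth_map A B F"
proof -
 have cn: "continuous_on (carrier A) F" using cont by (simp add: continuous_at_imp_continuous_on)
 have "smooth_on (\<kappa> ` (W \<inter> F -` W')) (\<kappa>' \<circ> F \<circ> inv_into W \<kappa>)" if w: "(W, \<kappa>) \<in> A" and w': "(W', \<kappa>') \<in> B" for W \<kappa> W' \<kappa>'
 proof -
  have wA: "(W, \<kappa>) \<in> smooth_charts A" and wB: "(W', \<kappa>') \<in> smooth_charts B"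
   using w w' atlas_subset_smooth_charts[OF A] atlas_subset_smooth_charts[OF B] by auto
  note cW = smooth_charts_is_chart[OF wA] and cW' = smooth_charts_is_chart[OF wB]
  have "open (F -` W' \<inter> carrier A)" using cn open_carrier[OF A] is_chartD(1)[OF cW']
   by (metis continuous_on_open_vimage)
  then have "open (\<kappa> ` (W \<inter> (F -` W' \<inter> carrier A)))" by (rule chart_image_open[OF cW])
  moreover have "W \<inter> (F -` W' \<inter> carrier A) = W \<inter> F -` W'" using smooth_charts_carrier[OF wA] by auto
  ultimately have o: "open (\<kappa> ` (W \<inter> F -` W'))" by simp
  have "smooth_at (\<lambda>y. \<kappa>' (F (inv_into W \<kappa> y))) (\<kappa> p)" if p: "p \<in> W" "F p \<in> W'" for p
  proof -
   have pc: "p \<in> carrier A" using p smooth_charts_carrier[OF wA] by auto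
   obtain U \<phi> V \<psi> where u: "(U, \<phi>) \<in> smooth_charts A" "(V, \<psi>) \<in> smooth_charts B" "p \<in> U" "F p \<in> V"
    "smooth_at (\<lambda>y. \<psi> (F (inv_into U \<phi> y))) (\<phi> p)" using ex[OF pc] by blast
   note cU = smooth_charts_is_chart[OF u(1)] and cV = smooth_charts_is_chart[OF u(2)]
   have s2: "smooth_at (\<lambda>y. \<psi> (F (inv_into U \<phi> (\<phi> (inv_into W \<kappa> y))))) (\<kappa> p)"
    by (rule smooth_at_compose[OF smooth_charts_transition[OF A wA u(1) p(1) u(3)], of "\<lambda>y. \<psi> (F (inv_into U \<phi> y))"])
     (simp add: is_chartD(6)[OF cW p(1)] u)
   have e: "\<psi> (F (inv_into U \<phi> (\<phi> (inv_into W \<kappa> (\<kappa> p))))) = \<psi> (F p)"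
    by (simp add: is_chartD(6)[OF cU u(3)] is_chartD(6)[OF cW p(1)])
   have s3: "smooth_at (\<lambda>y. \<kappa>' (inv_into V \<psi> (\<psi> (F (inv_into U \<phi> (\<phi> (inv_into W \<kappa> y))))))) (\<kappa> p)"
    by (rule smooth_at_compose[OF s2, of "\<lambda>y. \<kappa>' (inv_into V \<psi> y)"])
     (simp only: e, rule smooth_charts_transition[OF B u(2) wB u(4) p(2)])
   have "eventually (\<lambda>q. q \<in> U \<and> F q \<in> V) (nhds p)"
    using eventually_nhds_in_open[OF is_chartD(1)[OF cU] u(3)]
     eventually_compose_filterlim[OF eventually_nhds_in_open[OF is_chartD(1)[OF cV] u(4)] cont[OF pc, unfolded isCont_def tendsto_at_iff_tendsto_nhds]]
    by eventually_elim simp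
   then have "eventually (\<lambda>y. \<kappa>' (inv_into V \<psi> (\<psi> (F (inv_into U \<phi> (\<phi> (inv_into W \<kappa> y)))))) = \<kappa>' (F (inv_into W \<kappa> y))) (nhds (\<kappa> p))"
    by (intro eventually_mono[OF eventually_chart[OF cW p(1)]]) (auto simp: is_chartD(6)[OF cU] is_chartD(6)[OF cV])
   then show ?thesis using s3 by (rule smooth_at_transform[rotated])
  qed
  then show ?thesis by (auto simp: smooth_on_iff[OF o] o_def)
 qed
 then show ?thesis using img cn unfolding smooth_map_def by auto
qed

lemma D1_change_charts:
 assumes A: "smooth_manifold A" and B: "smooth_manifold B" and F: "smooth_map A B F"
  and c: "(U, \<phi>) \<in> smooth_charts A" and d: "(V, \<psi>) \<in> smooth_charts B" and p: "p \<in> U" "F p \<in> V"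
  and c': "(U', \<phi>') \<in> smooth_charts A" and d': "(V', \<psi>') \<in> smooth_charts B" and p': "p \<in> U'" "F p \<in> V'"
 shows "D1 (\<lambda>y. \<psi> (F (inv_into U \<phi> y))) (\<phi> p) v =
  D1 (\<lambda>y. \<psi> (inv_into V' \<psi>' y)) (\<psi>' (F p)) (D1 (\<lambda>y. \<psi>' (F (inv_into U' \<phi>' y))) (\<phi>' p) (D1 (\<lambda>y. \<phi>' (inv_into U \<phi> y)) (\<phi> p) v))"
proof -
 note cU = smooth_charts_is_chart[OF c] and cV = smooth_charts_is_chart[OF d]
  and cU' = smooth_charts_is_chart[OF c'] and cV' = smooth_charts_is_chart[OF d']
 have pc: "p \<in> carrier A" using smooth_charts_carrier[OF c] p by auto
 have e: "inv_into U' \<phi>' (\<phi>' p) = p" "inv_into U \<phi> (\<phi> p) = p" using is_chartD(6) cU' cU p p' by auto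
 have s1: "smooth_at (\<lambda>y. \<phi>' (inv_into U \<phi> y)) (\<phi> p)" by (rule smooth_charts_transition[OF A c c' p(1) p'(1)])
 have s2: "smooth_at (\<lambda>y. \<psi>' (F (inv_into U' \<phi>' y))) (\<phi>' p)" by (rule smooth_map_at[OF A B F c' d' p'])
 have s3: "smooth_at (\<lambda>y. \<psi> (inv_into V' \<psi>' y)) (\<psi>' (F p))" by (rule smooth_charts_transition[OF B d' d p'(2) p(2)])
 have "eventually (\<lambda>q. q \<in> U' \<and> F q \<in> V') (nhds p)"
  using eventually_nhds_in_open[OF is_chartD(1)[OF cU'] p'(1)]
   eventually_compose_filterlim[OF eventually_nhds_in_open[OF is_chartD(1)[OF cV'] p'(2)] smooth_mapD(2)[OF F A pc, unfolded isCont_def tendsto_at_iff_tendsto_nhds]]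
  by eventually_elim simp
 then have "eventually (\<lambda>y. \<psi> (F (inv_into U \<phi> y)) = \<psi> (inv_into V' \<psi>' (\<psi>' (F (inv_into U' \<phi>' (\<phi>' (inv_into U \<phi> y))))))) (nhds (\<phi> p))"
  by (intro eventually_mono[OF eventually_chart[OF cU p(1)]]) (auto simp: is_chartD(6)[OF cU'] is_chartD(6)[OF cV'])
 then have "D1 (\<lambda>y. \<psi> (F (inv_into U \<phi> y))) (\<phi> p) v = D1 (\<lambda>y. \<psi> (inv_into V' \<psi>' (\<psi>' (F (inv_into U' \<phi>' (\<phi>' (inv_into U \<phi> y))))))) (\<phi> p) v"
  using D1_cong_ev by metis
 also have "\<dots> = D1 (\<lambda>y. \<psi> (inv_into V' \<psi>' y)) (\<psi>' (F p)) (D1 (\<lambda>y. \<psi>' (F (inv_into U' \<phi>' (\<phi>' (inv_into U \<phi> y))))) (\<phi> p) v)"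
  using D1_compose[of "\<lambda>y. \<psi>' (F (inv_into U' \<phi>' (\<phi>' (inv_into U \<phi> y))))" "\<phi> p" "\<lambda>y. \<psi> (inv_into V' \<psi>' y)" v]
   smooth_at_compose[OF s1, of "\<lambda>y. \<psi>' (F (inv_into U' \<phi>' y))"] s2 s3 by (simp add: e smooth_at_diffble)
 also have "D1 (\<lambda>y. \<psi>' (F (inv_into U' \<phi>' (\<phi>' (inv_into U \<phi> y))))) (\<phi> p) v = D1 (\<lambda>y. \<psi>' (F (inv_into U' \<phi>' y))) (\<phi>' p) (D1 (\<lambda>y. \<phi>' (inv_into U \<phi> y)) (\<phi> p) v)"
  using D1_compose[of "\<lambda>y. \<phi>' (inv_into U \<phi> y)" "\<phi> p" "\<lambda>y. \<psi>' (F (inv_into U' \<phi>' y))" v] s1 s2 by (simp add: e smooth_at_diffble)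
 finally show ?thesis .
qed

text \<open>Transition maps have surjective derivatives, because \<open>transition_inverse\<close>
  gives right inverses; so surjectivity does not depend on the charts.\<close>

lemma submersion_at:
 assumes A: "smooth_manifold A" and B: "smooth_manifold B" and F: "submersion A B F"
  and c: "(U, \<phi>) \<in> smooth_charts A" and d: "(V, \<psi>) \<in> smooth_charts B" and p: "p \<in> U" "F p \<in> V"
 shows "surj (D1 (\<lambda>y. \<psi> (F (inv_into U \<phi> y))) (\<phi> p))"
proof -
 have sF: "smooth_map A B F" using F by (simp add: submersion_def)
 have pc: "p \<in> carrier A" using smooth_charts_carrier[OF c] p by auto
 obtain W \<kappa> where w: "(W, \<kappa>) \<in> smooth_charts A" "(W, \<kappa>) \<in> A" "p \<in> W" using chart_at_point[OF A pc] .
 obtain W' \<kappa>' where w': "(W', \<kappa>') \<in> smooth_charts B" "(W', \<kappa>') \<in> B" "F p \<in> W'"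
  using chart_at_point[OF B smooth_mapD(1)[OF sF pc]] by blast
 have s: "surj (D1 (\<lambda>y. \<kappa>' (F (inv_into W \<kappa> y))) (\<kappa> p))"
 proof -
  have "surj (frechet_derivative (\<kappa>' \<circ> F \<circ> inv_into W \<kappa>) (at (\<kappa> p)))"
   using F w w' unfolding submersion_def by blast
  moreover have "D1 (\<lambda>y. \<kappa>' (F (inv_into W \<kappa> y))) (\<kappa> p) = frechet_derivative (\<kappa>' \<circ> F \<circ> inv_into W \<kappa>) (at (\<kappa> p))"
   by (rule ext) (simp add: D1_def o_def)
  ultimately show ?thesis by simp
 qed
 have s1: "surj (D1 (\<lambda>y. \<psi> (inv_into W' \<kappa>' y)) (\<kappa>' (F p)))"
  using transition_inverse[OF B w'(1) d w'(3) p(2)] by (rule surjI)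
 have s2: "surj (D1 (\<lambda>y. \<kappa> (inv_into U \<phi> y)) (\<phi> p))"
  using transition_inverse[OF A c w(1) p(1) w(3)] by (rule surjI)
 have "D1 (\<lambda>y. \<psi> (F (inv_into U \<phi> y))) (\<phi> p) = D1 (\<lambda>y. \<psi> (inv_into W' \<kappa>' y)) (\<kappa>' (F p)) \<circ> D1 (\<lambda>y. \<kappa>' (F (inv_into W \<kappa> y))) (\<kappa> p) \<circ> D1 (\<lambda>y. \<kappa> (inv_into U \<phi> y)) (\<phi> p)"
  by (rule ext) (simp add: D1_change_charts[OF A B sF c d p w(1) w'(1) w(3) w'(3)])
 then show ?thesis using s s1 s2 by (metis comp_surj)
qed

lemma submersionI:
 assumes A: "smooth_manifold A" and B: "smooth_manifold B" and F: "smooth_map A B F"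
  and ex: "\<And>p. p \<in> carrier A ==> \<exists>U \<phi> V \<psi>. (U, \<phi>) \<in> smooth_charts A \<and> (V, \<psi>) \<in> smooth_charts B \<and> p \<in> U \<and> F p \<in> V \<and>
   surj (D1 (\<lambda>y. \<psi> (F (inv_into U \<phi> y))) (\<phi> p))"
 shows "submersion A B F"
 unfolding submersion_def
proof (intro conjI F ballI, clarify)
 fix W \<kappa> W' \<kappa>' p assume w: "(W, \<kappa>) \<in> A" and w': "(W', \<kappa>') \<in> B" and p: "p \<in> W" "F p \<in> W'"
 have wA: "(W, \<kappa>) \<in> smooth_charts A" and wB: "(W', \<kappa>') \<in> smooth_charts B"
  using w w' atlas_subset_smooth_charts[OF A] atlas_subset_smooth_charts[OF B] by auto
 have pc: "p \<in> carrier A" using p smooth_charts_carrier[OF wA] by auto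
 obtain U \<phi> V \<psi> where u: "(U, \<phi>) \<in> smooth_charts A" "(V, \<psi>) \<in> smooth_charts B" "p \<in> U" "F p \<in> V"
  "surj (D1 (\<lambda>y. \<psi> (F (inv_into U \<phi> y))) (\<phi> p))" using ex[OF pc] by blast
 have s1: "surj (D1 (\<lambda>y. \<kappa>' (inv_into V \<psi> y)) (\<psi> (F p)))"
  using transition_inverse[OF B u(2) wB u(4) p(2)] by (rule surjI)
 have s2: "surj (D1 (\<lambda>y. \<phi> (inv_into W \<kappa> y)) (\<kappa> p))"
  using transition_inverse[OF A wA u(1) p(1) u(3)] by (rule surjI)
 have "D1 (\<lambda>y. \<kappa>' (F (inv_into W \<kappa> y))) (\<kappa> p) = D1 (\<lambda>y. \<kappa>' (inv_into V \<psi> y)) (\<psi> (F p)) \<circ> D1 (\<lambda>y. \<psi> (F (inv_into U \<phi> y))) (\<phi> p) \<circ> D1 (\<lambda>y. \<phi> (inv_into W \<kappa> y)) (\<kappa> p)"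
  by (rule ext) (simp add: D1_change_charts[OF A B F wA wB p u(1,2,3,4)])
 then have "surj (D1 (\<lambda>y. \<kappa>' (F (inv_into W \<kappa> y))) (\<kappa> p))" using s1 s2 u(5) by (metis comp_surj)
 moreover have "D1 (\<lambda>y. \<kappa>' (F (inv_into W \<kappa> y))) (\<kappa> p) = frechet_derivative (\<kappa>' \<circ> F \<circ> inv_into W \<kappa>) (at (\<kappa> p))"
  by (rule ext) (simp add: D1_def o_def)
 ultimately show "surj (frechet_derivative (\<kappa>' \<circ> F \<circ> inv_into W \<kappa>) (at (\<kappa> p)))" by simp
qed

lemma submersion_localI:
 assumes A: "smooth_manifold A" and B: "smooth_manifold B" and img: "\<And>p. p \<in> carrier A ==> F p \<in> carrier B"
  and cont: "\<And>p. p \<in> carrier A ==> isCont F p"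
  and ex: "\<And>p. p \<in> carrier A ==> \<exists>U \<phi> V \<psi>. (U, \<phi>) \<in> smooth_charts A \<and> (V, \<psi>) \<in> smooth_charts B \<and> p \<in> U \<and> F p \<in> V \<and>
   smooth_at (\<lambda>y. \<psi> (F (inv_into U \<phi> y))) (\<phi> p) \<and> surj (D1 (\<lambda>y. \<psi> (F (inv_into U \<phi> y))) (\<phi> p))"
 shows "submersion A B F"
proof (rule submersionI[OF A B])
 show "smooth_map A B F"
  by (rule smooth_mapI[OF A B img cont]) (assumption, assumption, drule ex, elim exE conjE, intro exI conjI, assumption+)
qed (drule ex, elim exE conjE, intro exI conjI, assumption+)

text \<open>A chart followed by a local diffeomorphism of the model space is again a chart. Its
  inverse is described through the local inverse \<open>g\<close>, since parametrizations of
  submanifolds are inverses of charts.\<close>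

lemma chart_local_diffeo:
 assumes A: "smooth_manifold A" and c: "(V, \<psi>) \<in> smooth_charts A" and p: "p \<in> V"
  and \<Phi>: "smooth_at \<Phi> (\<psi> p)" "\<And>v. D1 \<Phi> (\<psi> p) v = 0 ==> v = 0" and N: "open N" "\<psi> p \<in> N"
 obtains U g where "(U, \<lambda>q. \<Phi> (\<psi> q)) \<in> smooth_charts A" "p \<in> U" "U \<subseteq> V" "\<psi> ` U \<subseteq> N"
  "\<And>q. q \<in> U ==> smooth_at \<Phi> (\<psi> q)"
  "\<And>q. q \<in> U ==> g (\<Phi> (\<psi> q)) = \<psi> q" "\<And>q. q \<in> U ==> smooth_at g (\<Phi> (\<psi> q))"
  "\<And>q. q \<in> U ==> inv_into V \<psi> (g (\<Phi> (\<psi> q))) = q"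
  "\<And>y. y \<in> (\<lambda>q. \<Phi> (\<psi> q)) ` U ==> inv_into U (\<lambda>q. \<Phi> (\<psi> q)) y = inv_into V \<psi> (g y)"
proof -
 note cV = smooth_charts_is_chart[OF c]
 obtain W g where W: "open W" "\<psi> p \<in> W" "W \<subseteq> N \<inter> \<psi> ` V" "open (\<Phi> ` W)" "\<And>x. x \<in> W ==> smooth_at \<Phi> x"
  "\<And>x. x \<in> W ==> g (\<Phi> x) = x" "\<And>y. y \<in> \<Phi> ` W ==> smooth_at g y"
  using smooth_inverse_function[OF \<Phi>, of "N \<inter> \<psi> ` V"] N p is_chartD(2)[OF cV] by (metis IntI imageI open_Int)
 define U where "U = \<psi> -` W \<inter> V"
 have oU: "open U" unfolding U_def using is_chartD[OF cV] W(1) by (simp add: continuous_on_open_vimage)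
 have \<psi>U: "\<psi> ` U = W" using W(3) by (auto simp: U_def)
 have gq: "inv_into V \<psi> (g (\<Phi> (\<psi> q))) = q" if "q \<in> U" for q
  using that W(6) by (simp add: U_def is_chartD(6)[OF cV])
 have im: "(\<lambda>q. \<Phi> (\<psi> q)) ` U = \<Phi> ` W" using \<psi>U by (auto simp: image_image[symmetric])
 have c1: "continuous_on U (\<lambda>q. \<Phi> (\<psi> q))"
 proof (rule continuous_on_compose2[of W \<Phi>])
  show "continuous_on W \<Phi>" using W(5) by (auto intro!: continuous_at_imp_continuous_on smooth_at_isCont)
  show "continuous_on U \<psi>" using is_chartD(3)[OF cV] by (rule continuous_on_subset) (auto simp: U_def)
 qed (simp add: \<psi>U)
 have gW: "g ` (\<Phi> ` W) \<subseteq> \<psi> ` V" using W(3,6) by auto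
 have c2: "continuous_on (\<Phi> ` W) (\<lambda>y. inv_into V \<psi> (g y))"
  by (rule continuous_on_compose2[OF is_chartD(5)[OF cV] _ gW]) (use W(7) in \<open>auto intro!: continuous_at_imp_continuous_on smooth_at_isCont\<close>)
 have ch: "is_chart (U, \<lambda>q. \<Phi> (\<psi> q))"
  by (rule is_chartI[of U _ "\<lambda>y. inv_into V \<psi> (g y)"]) (use oU W(4) c1 c2 gq in \<open>auto simp: im\<close>)
 have inv: "inv_into U (\<lambda>q. \<Phi> (\<psi> q)) y = inv_into V \<psi> (g y)" if "y \<in> (\<lambda>q. \<Phi> (\<psi> q)) ` U" for y
  using that is_chartD(6)[OF ch] gq by auto
 have "(U, \<lambda>q. \<Phi> (\<psi> q)) \<in> smooth_charts A"
 proof (rule smooth_chartsI[OF A ch])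
  show "U \<subseteq> carrier A" using smooth_charts_carrier[OF c] by (auto simp: U_def)
  fix q assume q: "q \<in> U"
  then have qV: "q \<in> V" "\<psi> q \<in> W" by (auto simp: U_def)
  have ev1: "eventually (\<lambda>y. \<psi> (inv_into U (\<lambda>q. \<Phi> (\<psi> q)) y) = g y) (nhds (\<Phi> (\<psi> q)))"
  proof (rule eventually_mono[OF eventually_nhds_in_open[OF W(4)]])
   show "\<Phi> (\<psi> q) \<in> \<Phi> ` W" using qV by simp
   fix y assume "y \<in> \<Phi> ` W"
   then obtain r where r: "r \<in> U" "y = \<Phi> (\<psi> r)" using \<psi>U by auto
   then show "\<psi> (inv_into U (\<lambda>q. \<Phi> (\<psi> q)) y) = g y"
    using is_chartD(6)[OF ch r(1)] W(6) by (simp add: U_def)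
  qed
  have ev2: "eventually (\<lambda>y. \<Phi> (\<psi> (inv_into V \<psi> y)) = \<Phi> y) (nhds (\<psi> q))"
   by (rule eventually_mono[OF eventually_chart[OF cV qV(1), of "\<lambda>_. True"]]) auto
  show "\<exists>V' \<psi>'. (V', \<psi>') \<in> smooth_charts A \<and> q \<in> V' \<and>
   smooth_at (\<lambda>y. \<psi>' (inv_into U (\<lambda>q. \<Phi> (\<psi> q)) y)) (\<Phi> (\<psi> q)) \<and> smooth_at (\<lambda>y. \<Phi> (\<psi> (inv_into V' \<psi>' y))) (\<psi>' q)"
   by (intro exI[of _ V] exI[of _ \<psi>] conjI c qV(1) iffD2[OF smooth_at_cong_ev[OF ev1]] iffD2[OF smooth_at_cong_ev[OF ev2]] W(5,7))
    (use qV in auto)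
 qed
 then show ?thesis
  by (rule that[of U g]) (use W p gq inv in \<open>auto simp: U_def\<close>)
qed

section \<open>Second order jets of hypersurfaces\<close>

definition defining ::
 "('a::{t2_space,second_countable_topology}, 'e::euclidean_space) chart set =>
 'a set => ('a => 'e) => 'a set => 'a => ('e => real) => bool" where
 "defining A V \<psi> L p \<rho> \<longleftrightarrow>
  (V, \<psi>) \<in> smooth_charts A \<and> p \<in> V \<and> p \<in> L \<and> smooth_at \<rho> (\<psi> p) \<and> (\<exists>v. D1 \<rho> (\<psi> p) v \<noteq> 0) \<and>
  eventually (\<lambda>y. inv_into V \<psi> y \<in> L \<longleftrightarrow> \<rho> y = 0) (nhds (\<psi> p))"

text \<open>The pair \<open>(\<alpha>, H)\<close> of the first and second derivative of a defining function is determined by the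
 hypersurface up to this relation.\<close>

definition jet_eq :: "('e => real) => ('e => 'e => real) => ('e => real) => ('e => 'e => real) => bool" where
 "jet_eq \<alpha> H \<alpha>' H' \<longleftrightarrow>
  (\<exists>c. c \<noteq> 0 \<and> (\<forall>v. \<alpha>' v = c * \<alpha> v) \<and> (\<forall>v w. \<alpha> v = 0 --> \<alpha> w = 0 --> H' v w = c * H v w))"

lemma jet_eq_refl: "jet_eq \<alpha> H \<alpha> H"
 unfolding jet_eq_def by (rule exI[of _ 1]) auto

lemma jet_eq_sym: "jet_eq \<alpha> H \<alpha>' H' ==> jet_eq \<alpha>' H' \<alpha> H"
 unfolding jet_eq_def
proof (elim exE conjE)
 fix c assume "c \<noteq> 0" "\<forall>v. \<alpha>' v = c * \<alpha> v" "\<forall>v w. \<alpha> v = 0 --> \<alpha> w = 0 --> H' v w = c * H v w"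
 then show "\<exists>c. c \<noteq> 0 \<and> (\<forall>v. \<alpha> v = c * \<alpha>' v) \<and> (\<forall>v w. \<alpha>' v = 0 --> \<alpha>' w = 0 --> H v w = c * H' v w)"
  by (intro exI[of _ "1/c"]) auto
qed

lemma jet_eq_trans: "jet_eq \<alpha> H \<alpha>' H' ==> jet_eq \<alpha>' H' \<alpha>'' H'' ==> jet_eq \<alpha> H \<alpha>'' H''"
 unfolding jet_eq_def
proof (elim exE conjE)
 fix c d assume "c \<noteq> 0" "\<forall>v. \<alpha>' v = c * \<alpha> v" "\<forall>v w. \<alpha> v = 0 --> \<alpha> w = 0 --> H' v w = c * H v w"
  "d \<noteq> 0" "\<forall>v. \<alpha>'' v = d * \<alpha>' v" "\<forall>v w. \<alpha>' v = 0 --> \<alpha>' w = 0 --> H'' v w = d * H' v w"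
 then show "\<exists>c. c \<noteq> 0 \<and> (\<forall>v. \<alpha>'' v = c * \<alpha> v) \<and> (\<forall>v w. \<alpha> v = 0 --> \<alpha> w = 0 --> H'' v w = c * H v w)"
  by (intro exI[of _ "d * c"]) auto
qed

lemma definingD:
 assumes "defining A V \<psi> L p \<rho>"
 shows "(V, \<psi>) \<in> smooth_charts A" "p \<in> V" "p \<in> L" "smooth_at \<rho> (\<psi> p)" "\<exists>v. D1 \<rho> (\<psi> p) v \<noteq> 0"
  "eventually (\<lambda>y. inv_into V \<psi> y \<in> L \<longleftrightarrow> \<rho> y = 0) (nhds (\<psi> p))" "is_chart (V, \<psi>)" "\<rho> (\<psi> p) = 0"
proof -
 show *: "(V, \<psi>) \<in> smooth_charts A" "p \<in> V" "p \<in> L" "smooth_at \<rho> (\<psi> p)" "\<exists>v. D1 \<rho> (\<psi> p) v \<noteq> 0"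
  and ev: "eventually (\<lambda>y. inv_into V \<psi> y \<in> L \<longleftrightarrow> \<rho> y = 0) (nhds (\<psi> p))" using assms by (auto simp: defining_def)
 show c: "is_chart (V, \<psi>)" using * smooth_charts_is_chart by blast
 show "\<rho> (\<psi> p) = 0" using eventually_nhds_x_imp_x[OF ev] * is_chartD(6)[OF c *(2)] by simp
qed

lemma defining_scale:
 assumes d: "defining A V \<psi> L p \<rho>" and c: "c \<noteq> 0"
 shows "defining A V \<psi> L p (\<lambda>y. c * \<rho> y)"
  "D1 (\<lambda>y. c * \<rho> y) (\<psi> p) v = c * D1 \<rho> (\<psi> p) v" "D2 (\<lambda>y. c * \<rho> y) (\<psi> p) v w = c * D2 \<rho> (\<psi> p) v w"
proof -
 note D = definingD[OF d]
 have L: "bounded_linear ((*) c)" by (rule bounded_linear_mult_right)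
 show 1: "D1 (\<lambda>y. c * \<rho> y) (\<psi> p) v = c * D1 \<rho> (\<psi> p) v" for v by (rule D1_linear_compose[OF L D(4)])
 show "D2 (\<lambda>y. c * \<rho> y) (\<psi> p) v w = c * D2 \<rho> (\<psi> p) v w" by (rule D2_linear_compose[OF L D(4)])
 show "defining A V \<psi> L p (\<lambda>y. c * \<rho> y)"
  using D c unfolding defining_def 1 by (auto intro: smooth_intros)
qed

lemma defining_germ:
 assumes d: "defining A V \<psi> L p \<rho>" and e: "open W" "p \<in> W" "\<And>q. q \<in> W ==> q \<in> L \<longleftrightarrow> q \<in> L'"
 shows "defining A V \<psi> L' p \<rho>"
proof -
 note D = definingD[OF d]
 have "eventually (\<lambda>y. inv_into V \<psi> y \<in> L' \<longleftrightarrow> \<rho> y = 0) (nhds (\<psi> p))"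
  using D(6) eventually_chart[OF D(7,2) eventually_nhds_in_open[OF e(1,2)]]
  by eventually_elim (use e in auto)
 then show ?thesis using D e unfolding defining_def by auto
qed

text \<open>The part \<open>z\<close> of the velocity orthogonal to \<open>S\<close> satisfies
  \<open>z \<bullet> z = 0\<close>, because \<open>z \<bullet> c s\<close> vanishes near 0.\<close>

lemma curve_in_subspace:
 fixes c :: "real => 'e::euclidean_space"
 assumes "smooth_at c 0" "subspace S" "eventually (\<lambda>s. c s \<in> S) (nhds 0)"
 shows "D1 c 0 1 \<in> S"
proof -
 obtain y z where yz: "y \<in> span S" "\<And>w. w \<in> span S ==> orthogonal z w" "D1 c 0 1 = y + z"
  using orthogonal_subspace_decomp_exists[of S] by metis
 have sp: "span S = S" using assms(2) by (simp add: span_eq_iff)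
 have "D1 (\<lambda>s. z \<bullet> c s) 0 1 = D1 (\<lambda>s. 0) (0::real) 1"
  by (rule D1_cong_ev[THEN fun_cong], rule eventually_mono[OF assms(3)]) (use yz sp in \<open>auto simp: orthogonal_def\<close>)
 then have "z \<bullet> D1 c 0 1 = 0"
  using D1_linear_compose[OF bounded_linear_inner_right assms(1)] by (simp add: D1_const)
 then have "z \<bullet> z = 0" using yz by (simp add: inner_add_right orthogonal_def)
 then show ?thesis using yz sp by simp
qed

text \<open>The chart \<open>y \<mapsto> (y - \<psi> p) - \<alpha>(y - \<psi> p) n + \<rho>(y) n\<close> maps \<open>L\<close> to the kernel of \<open>\<alpha>\<close>.\<close>

lemma normal_slice:
 fixes A :: "('a::{t2_space,second_countable_topology}, 'e::euclidean_space) chart set"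
 assumes A: "smooth_manifold A" and d: "defining A V \<psi> L p \<rho>"
  and \<alpha>: "linear \<alpha>" "\<alpha> n = 1" "D1 \<rho> (\<psi> p) n = 1"
 obtains U \<phi> where "slice_chart A L {v. \<alpha> v = 0} (U, \<phi>)" "(U, \<phi>) \<in> smooth_charts A" "p \<in> U" "\<phi> p = 0"
  "\<And>v. D1 (\<psi> \<circ> inv_into U \<phi>) (\<phi> p) v = v - (D1 \<rho> (\<psi> p) v - \<alpha> v) *\<^sub>R n"
  "\<And>v w. D2 (\<psi> \<circ> inv_into U \<phi>) (\<phi> p) v w =
   - D2 \<rho> (\<psi> p) (v - (D1 \<rho> (\<psi> p) v - \<alpha> v) *\<^sub>R n) (w - (D1 \<rho> (\<psi> p) w - \<alpha> w) *\<^sub>R n) *\<^sub>R n"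
  "smooth_at (\<psi> \<circ> inv_into U \<phi>) (\<phi> p)"
proof -
 note D = definingD[OF d]
 define L0 where "L0 y = y - \<alpha> y *\<^sub>R n" for y
 have bl\<alpha>: "bounded_linear \<alpha>" using \<alpha>(1) by (simp add: linear_conv_bounded_linear)
 have L0: "bounded_linear L0" unfolding L0_def
  by (intro bounded_linear_sub bounded_linear_ident bounded_linear_compose[OF bounded_linear_scaleR_left bl\<alpha>])
 define \<Phi> where "\<Phi> y = L0 (y - \<psi> p) + \<rho> y *\<^sub>R n" for y
 have s1: "smooth_at (\<lambda>y. L0 (y - \<psi> p)) (\<psi> p)"
  by (intro smooth_at_linear_compose[OF L0] smooth_intros)
 have s2: "smooth_at (\<lambda>y. \<rho> y *\<^sub>R n) (\<psi> p)" by (intro smooth_intros D)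
 have \<Phi>s: "smooth_at \<Phi> (\<psi> p)" unfolding \<Phi>_def by (intro smooth_at_add s1 s2)
 have lin: "linear (D1 \<rho> (\<psi> p))" using linear_D1 D(4) by blast
 have idd: "(\<lambda>y. y - \<psi> p) = (\<lambda>y. y + (- \<psi> p))" by auto
 have D1i: "D1 (\<lambda>y. y - \<psi> p) (\<psi> p) v = v" for v
  by (subst D1_eqI[of _ "\<lambda>v. v"]) (auto intro!: derivative_eq_intros)
 have D2i: "D2 (\<lambda>y. y - \<psi> p) (\<psi> p) v w = 0" for v w
 proof -
  have "D1 (\<lambda>y. y - \<psi> p) z w = w" for z by (subst D1_eqI[of _ "\<lambda>v. v"]) (auto intro!: derivative_eq_intros)
  then show ?thesis by (simp add: D2_def D1_const)
 qed
 have si: "smooth_at (\<lambda>y. y - \<psi> p) (\<psi> p)" by (intro smooth_intros)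
 have bs: "bounded_linear (\<lambda>r. r *\<^sub>R n)" by (rule bounded_linear_scaleR_left)
 \<comment> \<open>\<open>M\<close> is the derivative of \<open>\<Phi>\<close> and \<open>N\<close>
   its inverse; they are inverse to each other as \<open>D1 \<rho> (\<psi> p)\<close> and
   \<open>\<alpha>\<close> agree on \<open>n\<close>. Beyond that \<open>\<alpha>\<close> is free,
   so hypersurfaces with different tangent spaces can be charted along the same subspace.\<close>
 define M where "M v = v + (D1 \<rho> (\<psi> p) v - \<alpha> v) *\<^sub>R n" for v
 define N where "N v = v - (D1 \<rho> (\<psi> p) v - \<alpha> v) *\<^sub>R n" for v
 have D1\<Phi>: "D1 \<Phi> (\<psi> p) v = M v" for v
  unfolding \<Phi>_def D1_add[OF s1 s2] D1_linear_compose[OF L0 si] D1_linear_compose[OF bs D(4)] D1i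
  by (simp add: M_def L0_def algebra_simps)
 have D2\<Phi>: "D2 \<Phi> (\<psi> p) v w = D2 \<rho> (\<psi> p) v w *\<^sub>R n" for v w
  unfolding \<Phi>_def D2_add[OF s1 s2] D2_linear_compose[OF L0 si] D2_linear_compose[OF bs D(4)] D2i
  by (simp add: L0_def linear_0[OF \<alpha>(1)])
 have NM: "N (M v) = v" "M (N v) = v" for v
  unfolding N_def M_def using \<alpha>
  by (simp_all add: linear_add[OF lin] linear_add[OF \<alpha>(1)] linear_diff[OF lin] linear_diff[OF \<alpha>(1)] linear_cmul[OF lin] linear_cmul[OF \<alpha>(1)])
 have Ml: "linear M" unfolding M_def
  by (auto intro!: linear_compose_add linear_ident linear_compose_sub lin \<alpha>(1) linear_compose[of "\<lambda>v. D1 \<rho> (\<psi> p) v - \<alpha> v" "\<lambda>r. r *\<^sub>R n", unfolded o_def]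
    simp: linear_conv_bounded_linear[of "\<lambda>r. r *\<^sub>R n"] bs)
 have inj: "v = 0" if "D1 \<Phi> (\<psi> p) v = 0" for v
  using NM(1)[of v] that linear_0[OF lin] linear_0[OF \<alpha>(1)] by (simp add: D1\<Phi> N_def)
 obtain W where W: "open W" "\<psi> p \<in> W" "\<And>y. y \<in> W ==> inv_into V \<psi> y \<in> L \<longleftrightarrow> \<rho> y = 0"
  using D(6) unfolding eventually_nhds by blast
 let ?\<phi> = "\<lambda>q. \<Phi> (\<psi> q)"
 obtain U g where U: "(U, ?\<phi>) \<in> smooth_charts A" "p \<in> U" "U \<subseteq> V" "\<psi> ` U \<subseteq> W"
  "\<And>q. q \<in> U ==> smooth_at \<Phi> (\<psi> q)"
  "\<And>q. q \<in> U ==> g (\<Phi> (\<psi> q)) = \<psi> q" "\<And>q. q \<in> U ==> smooth_at g (\<Phi> (\<psi> q))"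
  "\<And>q. q \<in> U ==> inv_into V \<psi> (g (\<Phi> (\<psi> q))) = q"
  "\<And>y. y \<in> (\<lambda>q. \<Phi> (\<psi> q)) ` U ==> inv_into U (\<lambda>q. \<Phi> (\<psi> q)) y = inv_into V \<psi> (g y)"
  by (rule chart_local_diffeo[OF A D(1,2) \<Phi>s _ W(1,2)], erule inj) (rule that, (assumption | blast)+)
 note cU = smooth_charts_is_chart[OF U(1)]
 have \<alpha>\<Phi>: "\<alpha> (\<Phi> y) = \<rho> y" for y
  unfolding \<Phi>_def L0_def by (simp add: linear_add[OF \<alpha>(1)] linear_diff[OF \<alpha>(1)] linear_cmul[OF \<alpha>(1)] \<alpha>)
 have sl: "slice_chart A L {v. \<alpha> v = 0} (U, ?\<phi>)"
 proof -
  have "q \<in> L \<longleftrightarrow> \<alpha> (\<Phi> (\<psi> q)) = 0" if q: "q \<in> U" for q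
  proof -
   have "inv_into V \<psi> (\<psi> q) = q" using q U(3) is_chartD(6)[OF D(7)] by auto
   moreover have "\<psi> q \<in> W" using q U(4) by auto
   ultimately show ?thesis using W(3) by (metis \<alpha>\<Phi>)
  qed
  then show ?thesis unfolding slice_chart_def using U(1) by auto
 qed
 have \<Phi>0: "\<Phi> (\<psi> p) = 0" using D(8) L0 by (simp add: \<Phi>_def linear_simps)
 have evy: "eventually (\<lambda>y. y \<in> ?\<phi> ` U) (nhds (\<Phi> (\<psi> p)))"
  by (rule eventually_nhds_in_open) (use is_chartD(2)[OF cU] U(2) in auto)
 have ev: "eventually (\<lambda>y. (\<psi> \<circ> inv_into U ?\<phi>) y = g y) (nhds (\<Phi> (\<psi> p)))"
  using evy by (rule eventually_mono) (use is_chartD(6)[OF cU] U(6) in auto)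
 have ev2: "eventually (\<lambda>y. \<Phi> (g y) = y) (nhds (\<Phi> (\<psi> p)))"
  using evy by (rule eventually_mono) (use U(6) in auto)
 have sg: "smooth_at g (\<Phi> (\<psi> p))" "g (\<Phi> (\<psi> p)) = \<psi> p" using U by auto
 have D1g: "D1 g (\<Phi> (\<psi> p)) v = N v" for v
 proof -
  have "D1 (\<lambda>y. \<Phi> (g y)) (\<Phi> (\<psi> p)) v = v"
   using D1_cong_ev[OF ev2] by (simp add: D1_linear)
  then have "M (D1 g (\<Phi> (\<psi> p)) v) = v"
   using D1_compose[of g "\<Phi> (\<psi> p)" \<Phi> v] sg \<Phi>s by (simp add: smooth_at_diffble D1\<Phi>)
  then show ?thesis using NM(1) by metis
 qed
 have D2g: "D2 g (\<Phi> (\<psi> p)) v w = - D2 \<rho> (\<psi> p) (N v) (N w) *\<^sub>R n" for v w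
 proof -
  have "D2 (\<lambda>y. \<Phi> (g y)) (\<Phi> (\<psi> p)) v w = 0"
   using D2_cong_ev[OF ev2] by (simp add: D2_linear)
  then have "D2 \<rho> (\<psi> p) (N v) (N w) *\<^sub>R n + M (D2 g (\<Phi> (\<psi> p)) v w) = 0"
   using D2_compose[of g "\<Phi> (\<psi> p)" \<Phi> v w] sg \<Phi>s by (simp add: D1\<Phi> D2\<Phi> D1g)
  then have "M (D2 g (\<Phi> (\<psi> p)) v w) = - D2 \<rho> (\<psi> p) (N v) (N w) *\<^sub>R n"
   by (simp add: eq_neg_iff_add_eq_0 add.commute)
  then have "D2 g (\<Phi> (\<psi> p)) v w = N (- D2 \<rho> (\<psi> p) (N v) (N w) *\<^sub>R n)" using NM(1) by metis
  also have "\<dots> = - D2 \<rho> (\<psi> p) (N v) (N w) *\<^sub>R n"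
   unfolding N_def using \<alpha> by (simp add: linear_neg[OF lin] linear_neg[OF \<alpha>(1)] linear_cmul[OF lin] linear_cmul[OF \<alpha>(1)])
  finally show ?thesis .
 qed
 show ?thesis
 proof (rule that[OF sl U(1,2)])
  show "\<Phi> (\<psi> p) = 0" by (rule \<Phi>0)
  show "D1 (\<psi> \<circ> inv_into U ?\<phi>) (\<Phi> (\<psi> p)) v = v - (D1 \<rho> (\<psi> p) v - \<alpha> v) *\<^sub>R n" for v
   unfolding D1_cong_ev[OF ev] by (simp add: D1g N_def)
  show "D2 (\<psi> \<circ> inv_into U ?\<phi>) (\<Phi> (\<psi> p)) v w =
   - D2 \<rho> (\<psi> p) (v - (D1 \<rho> (\<psi> p) v - \<alpha> v) *\<^sub>R n) (w - (D1 \<rho> (\<psi> p) w - \<alpha> w) *\<^sub>R n) *\<^sub>R n" for v w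
   unfolding D2_cong_ev[OF ev] by (simp add: D2g N_def)
  show "smooth_at (\<psi> \<circ> inv_into U ?\<phi>) (\<Phi> (\<psi> p))"
   using smooth_at_cong_ev[OF ev] sg(1) by blast
 qed
qed

lemma defining_normal:
 assumes d: "defining A V \<psi> L p \<rho>"
 obtains n where "D1 \<rho> (\<psi> p) n = 1"
proof -
 note D = definingD[OF d]
 obtain v where "D1 \<rho> (\<psi> p) v \<noteq> 0" using D(5) by blast
 then have "D1 \<rho> (\<psi> p) ((1 / D1 \<rho> (\<psi> p) v) *\<^sub>R v) = 1"
  by (simp add: linear_cmul[OF linear_D1[OF D(4)]])
 then show ?thesis by (rule that)
qed

lemma dim_kernel:
 fixes \<alpha> :: "'e::euclidean_space => real"
 assumes "linear \<alpha>" "\<alpha> n = 1"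
 shows "subspace {v. \<alpha> v = 0}" "dim {v. \<alpha> v = 0} = DIM('e) - 1"
proof -
 show "subspace {v. \<alpha> v = 0}" using assms(1) by (rule linear_subspace_kernel)
 define a where "a = (\<Sum>i\<in>Basis. \<alpha> i *\<^sub>R i)"
 have \<alpha>a: "\<alpha> v = a \<bullet> v" for v
 proof -
  have "\<alpha> v = \<alpha> (\<Sum>i\<in>Basis. (v \<bullet> i) *\<^sub>R i)" by (simp add: euclidean_representation)
  also have "\<dots> = (\<Sum>i\<in>Basis. (v \<bullet> i) * \<alpha> i)" by (simp add: linear_sum[OF assms(1)] linear_cmul[OF assms(1)])
  also have "\<dots> = a \<bullet> v" by (simp add: a_def inner_sum_left mult.commute inner_commute[of v])
  finally show ?thesis .
 qed
 then have "a \<noteq> 0" using assms(2) by auto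
 then show "dim {v. \<alpha> v = 0} = DIM('e) - 1" unfolding \<alpha>a by (rule dim_hyperplane)
qed

text \<open>In a slice chart, \<open>S\<close> is the tangent space of \<open>L\<close>, and differentiating \<open>\<rho> \<circ> \<gamma> = 0\<close> on \<open>S\<close> gives the
 relation between the derivatives of \<open>\<rho>\<close> and of the parametrization \<open>\<gamma>\<close>.\<close>

lemma slice_tangent:
 fixes A :: "('a::{t2_space,second_countable_topology}, 'e::euclidean_space) chart set"
 assumes A: "smooth_manifold A" and d: "defining A V \<psi> L p \<rho>"
  and s: "slice_chart A L S (U, \<phi>)" "p \<in> U" "subspace S"
 defines "\<gamma> \<equiv> \<lambda>y. \<psi> (inv_into U \<phi> y)"
 shows "D1 \<rho> (\<psi> p) (D1 \<gamma> (\<phi> p) v) = 0 \<longleftrightarrow> v \<in> S"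
  "v \<in> S ==> w \<in> S ==> D2 \<rho> (\<psi> p) (D1 \<gamma> (\<phi> p) v) (D1 \<gamma> (\<phi> p) w) = - D1 \<rho> (\<psi> p) (D2 \<gamma> (\<phi> p) v w)"
proof -
 note D = definingD[OF d]
 have sc: "(U, \<phi>) \<in> smooth_charts A" and slice: "\<phi> ` (U \<inter> L) = \<phi> ` U \<inter> S"
  using s(1) by (auto simp: slice_chart_def)
 note cU = smooth_charts_is_chart[OF sc]
 have L: "q \<in> L \<longleftrightarrow> \<phi> q \<in> S" if "q \<in> U" for q
 proof -
  have "\<phi> q \<in> \<phi> ` (U \<inter> L) \<longleftrightarrow> \<phi> q \<in> S" using slice that by auto
  moreover have "\<phi> q \<in> \<phi> ` (U \<inter> L) \<longleftrightarrow> q \<in> L" using that is_chartD(4)[OF cU] by (auto dest: inj_onD)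
  ultimately show ?thesis by simp
 qed
 have \<gamma>s: "smooth_at \<gamma> (\<phi> p)" unfolding \<gamma>_def by (rule smooth_charts_transition[OF A sc D(1) s(2) D(2)])
 have \<gamma>p: "\<gamma> (\<phi> p) = \<psi> p" using is_chartD(6)[OF cU s(2)] by (simp add: \<gamma>_def)
 have \<phi>p: "\<phi> p \<in> S" using L[OF s(2)] D(3) by simp
 have ev: "eventually (\<lambda>y. \<rho> (\<gamma> y) = 0 \<longleftrightarrow> y \<in> S) (nhds (\<phi> p))"
  using eventually_chart[OF cU s(2) eventually_chart_pull[OF D(7,2,6)]]
  by eventually_elim (use L is_chartD(6)[OF D(7)] in \<open>auto simp: \<gamma>_def\<close>)
 let ?r = "\<lambda>y. \<rho> (\<gamma> y)"
 have rs: "smooth_at ?r (\<phi> p)" using smooth_at_compose[OF \<gamma>s] \<gamma>p D(4) by simp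
 have line: "smooth_at (\<lambda>s::real. \<phi> p + s *\<^sub>R v) 0" for v by (intro smooth_intros)
 have D1line: "D1 (\<lambda>s::real. \<phi> p + s *\<^sub>R v) s t = t *\<^sub>R v" for v s t
  by (subst D1_eqI[of _ "\<lambda>t. t *\<^sub>R v"]) (auto intro!: derivative_eq_intros)
 have zero: "D1 ?r (\<phi> p) v = 0" if v: "v \<in> S" for v
 proof -
  have "eventually (\<lambda>s::real. ?r (\<phi> p + s *\<^sub>R v) = 0) (nhds 0)"
   using eventually_smooth_at_compose[OF line[of v], of "\<lambda>y. \<rho> (\<gamma> y) = 0 \<longleftrightarrow> y \<in> S"] ev \<phi>p v s(3)
   by (simp add: subspace_add subspace_scale)
  then have "D1 (\<lambda>s::real. ?r (\<phi> p + s *\<^sub>R v)) 0 1 = D1 (\<lambda>s::real. 0::real) 0 1"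
    by (rule D1_cong_ev[THEN fun_cong])
  then show ?thesis
   using D1_compose[of "\<lambda>s::real. \<phi> p + s *\<^sub>R v" 0 ?r 1] rs line[of v] by (simp add: smooth_at_diffble D1line D1_const)
 qed
 have D1r: "D1 ?r (\<phi> p) v = D1 \<rho> (\<psi> p) (D1 \<gamma> (\<phi> p) v)" for v
  using D1_compose[of \<gamma> "\<phi> p" \<rho> v] \<gamma>s D(4) by (simp add: \<gamma>p smooth_at_diffble)
 show "D1 \<rho> (\<psi> p) (D1 \<gamma> (\<phi> p) v) = 0 \<longleftrightarrow> v \<in> S"
 proof
  show "v \<in> S ==> D1 \<rho> (\<psi> p) (D1 \<gamma> (\<phi> p) v) = 0" using zero D1r by simp
  assume z: "D1 \<rho> (\<psi> p) (D1 \<gamma> (\<phi> p) v) = 0"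
  let ?\<alpha> = "D1 \<rho> (\<psi> p)" and ?a = "D1 \<gamma> (\<phi> p) v"
  obtain n where n: "?\<alpha> n = 1" using defining_normal[OF d] .
  \<comment> \<open>For a vector in the kernel of the derivative of \<open>\<rho>\<close>, this
    chart provides a curve in \<open>L\<close> with that velocity. In the slice chart along
    \<open>S\<close> the curve runs inside \<open>S\<close>, so its velocity there lies in
    \<open>S\<close>.\<close>
  obtain U1 \<phi>1 where 1: "slice_chart A L {v. ?\<alpha> v = 0} (U1, \<phi>1)" "(U1, \<phi>1) \<in> smooth_charts A" "p \<in> U1" "\<phi>1 p = 0"
   "\<And>v. D1 (\<psi> \<circ> inv_into U1 \<phi>1) (\<phi>1 p) v = v - (?\<alpha> v - ?\<alpha> v) *\<^sub>R n" "smooth_at (\<psi> \<circ> inv_into U1 \<phi>1) (\<phi>1 p)"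
   by (rule normal_slice[OF A d linear_D1[OF D(4)] n n]) (rule that, (assumption | blast)+)
  note c1 = smooth_charts_is_chart[OF 1(2)]
  let ?g = "\<lambda>y. \<psi> (inv_into U1 \<phi>1 y)" and ?k = "\<lambda>y. \<phi> (inv_into V \<psi> y)"
  have kt: "?k (\<psi> p) = \<phi> p" using is_chartD(6)[OF D(7,2)] by simp
  have gt: "?g 0 = \<psi> p" using is_chartD(6)[OF c1 1(3)] 1(4) by simp
  have ks: "smooth_at ?k (\<psi> p)" by (rule smooth_charts_transition[OF A D(1) sc D(2) s(2)])
  have gs: "smooth_at ?g 0" using 1(6,4) by (simp add: o_def)
  have ls: "smooth_at (\<lambda>s::real. s *\<^sub>R ?a) 0" by (intro smooth_intros)
  have gls: "smooth_at (\<lambda>s::real. ?g (s *\<^sub>R ?a)) 0" by (rule smooth_at_compose[OF ls]) (simp add: gs)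
  let ?c = "\<lambda>s::real. ?k (?g (s *\<^sub>R ?a))"
  have cs: "smooth_at ?c 0" by (rule smooth_at_compose[OF gls]) (simp add: gt ks)
  have kg: "D1 ?k (\<psi> p) ?a = v"
   using transition_inverse[OF A D(1) sc D(2) s(2), of v] by (simp add: \<gamma>_def)
  have D1l: "D1 (\<lambda>s::real. s *\<^sub>R ?a) 0 1 = ?a"
   by (subst D1_eqI[of _ "\<lambda>t. t *\<^sub>R ?a"]) (auto intro!: derivative_eq_intros)
  have D1g: "D1 (\<lambda>s::real. ?g (s *\<^sub>R ?a)) 0 1 = ?a"
   using D1_compose[of "\<lambda>s::real. s *\<^sub>R ?a" 0 ?g 1] ls gs 1(4) 1(5)[of ?a] by (simp add: smooth_at_diffble D1l o_def)
  have "D1 ?c 0 1 = v"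
   using D1_compose[of "\<lambda>s::real. ?g (s *\<^sub>R ?a)" 0 ?k 1] gls ks by (simp add: gt smooth_at_diffble D1g kg)
  moreover have "eventually (\<lambda>s. ?c s \<in> S) (nhds 0)"
  proof -
   have L1: "q \<in> L \<longleftrightarrow> ?\<alpha> (\<phi>1 q) = 0" if "q \<in> U1" for q
   proof -
    have "\<phi>1 ` (U1 \<inter> L) = \<phi>1 ` U1 \<inter> {v. ?\<alpha> v = 0}" using 1(1) by (simp add: slice_chart_def)
    then have "\<phi>1 q \<in> \<phi>1 ` (U1 \<inter> L) \<longleftrightarrow> ?\<alpha> (\<phi>1 q) = 0" using that by auto
    moreover have "\<phi>1 q \<in> \<phi>1 ` (U1 \<inter> L) \<longleftrightarrow> q \<in> L" using that is_chartD(4)[OF c1] by (auto dest: inj_onD)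
    ultimately show ?thesis by simp
   qed
   have "eventually (\<lambda>q. q \<in> U \<and> q \<in> V) (nhds p)"
    using eventually_nhds_in_open[OF is_chartD(1)[OF cU] s(2)] eventually_nhds_in_open[OF is_chartD(1)[OF D(7)] D(2)]
    by eventually_elim simp
   from eventually_smooth_at_compose[OF ls, of "\<lambda>y. (inv_into U1 \<phi>1 y \<in> U \<and> inv_into U1 \<phi>1 y \<in> V) \<and>
    inv_into U1 \<phi>1 y \<in> U1 \<and> \<phi>1 (inv_into U1 \<phi>1 y) = y"] eventually_chart[OF c1 1(3) this] 1(4)
   have "eventually (\<lambda>s::real. (inv_into U1 \<phi>1 (s *\<^sub>R ?a) \<in> U \<and> inv_into U1 \<phi>1 (s *\<^sub>R ?a) \<in> V) \<and>
    inv_into U1 \<phi>1 (s *\<^sub>R ?a) \<in> U1 \<and> \<phi>1 (inv_into U1 \<phi>1 (s *\<^sub>R ?a)) = s *\<^sub>R ?a) (nhds 0)" by simp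
   then show ?thesis
   proof (rule eventually_mono)
    fix s :: real let ?q = "inv_into U1 \<phi>1 (s *\<^sub>R ?a)"
    assume q: "(?q \<in> U \<and> ?q \<in> V) \<and> ?q \<in> U1 \<and> \<phi>1 ?q = s *\<^sub>R ?a"
    then have "?q \<in> L" using L1 z by (simp add: linear_cmul[OF linear_D1[OF D(4)]])
    then have "\<phi> ?q \<in> S" using q L by blast
    then show "?k (?g (s *\<^sub>R ?a)) \<in> S" using q is_chartD(6)[OF D(7)] by simp
   qed
  qed
  ultimately show "v \<in> S" using curve_in_subspace[OF cs s(3)] by simp
 qed
 assume v: "v \<in> S" and w: "w \<in> S"
 \<comment> \<open>The first derivative in a direction of \<open>S\<close> vanishes at all nearby
   points of \<open>S\<close>, not only at \<open>\<phi> p\<close>, so it can be differentiated once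
   more along \<open>S\<close>.\<close>
 have evz: "eventually (\<lambda>s::real. D1 ?r (\<phi> p + s *\<^sub>R v) w = 0) (nhds 0)"
 proof -
  obtain O' where O: "open O'" "\<phi> p \<in> O'" "\<And>y. y \<in> O' ==> (\<rho> (\<gamma> y) = 0 \<longleftrightarrow> y \<in> S) \<and> smooth_at ?r y"
   using eventually_conj[OF ev smooth_at_eventually[OF rs]] unfolding eventually_nhds by blast
  have "eventually (\<lambda>s::real. \<phi> p + s *\<^sub>R v \<in> O') (nhds 0)"
   using eventually_smooth_at_compose[OF line[of v], of "\<lambda>y. y \<in> O'"] eventually_nhds_in_open[OF O(1,2)] by simp
  then show ?thesis
  proof (rule eventually_mono)
   fix s :: real assume s': "\<phi> p + s *\<^sub>R v \<in> O'"
   let ?y = "\<phi> p + s *\<^sub>R v"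
   have yS: "?y \<in> S" using \<phi>p v s(3) by (simp add: subspace_add subspace_scale)
   have l2: "smooth_at (\<lambda>t::real. ?y + t *\<^sub>R w) 0" by (intro smooth_intros)
   have "eventually (\<lambda>t::real. ?r (?y + t *\<^sub>R w) = 0) (nhds 0)"
    using eventually_smooth_at_compose[OF l2, of "\<lambda>y. y \<in> O'"] eventually_nhds_in_open[OF O(1) s']
    by (simp, elim eventually_mono) (use O(3) yS w s(3) in \<open>auto simp: subspace_add subspace_scale\<close>)
   then have "D1 (\<lambda>t::real. ?r (?y + t *\<^sub>R w)) 0 1 = D1 (\<lambda>s::real. 0::real) 0 1"
    by (rule D1_cong_ev[THEN fun_cong])
   moreover have "D1 (\<lambda>t::real. ?y + t *\<^sub>R w) 0 1 = w"
    by (subst D1_eqI[of _ "\<lambda>t. t *\<^sub>R w"]) (auto intro!: derivative_eq_intros)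
   ultimately show "D1 ?r ?y w = 0"
    using D1_compose[of "\<lambda>t::real. ?y + t *\<^sub>R w" 0 ?r 1] O(3)[OF s'] l2 by (simp add: smooth_at_diffble D1_const)
  qed
 qed
 have "D1 (\<lambda>s::real. D1 ?r (\<phi> p + s *\<^sub>R v) w) 0 1 = D1 (\<lambda>s::real. 0::real) 0 1"
  by (rule D1_cong_ev[OF evz, THEN fun_cong])
 moreover have "D1 (\<lambda>s::real. D1 ?r (\<phi> p + s *\<^sub>R v) w) 0 1 = D2 ?r (\<phi> p) v w"
  using D1_compose[of "\<lambda>s::real. \<phi> p + s *\<^sub>R v" 0 "\<lambda>y. D1 ?r y w" 1] line[of v] smooth_at_D1[OF rs, of w]
  by (simp add: smooth_at_diffble D1line D2_def)
 ultimately have "D2 ?r (\<phi> p) v w = 0" by (simp add: D1_const)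
 then show "D2 \<rho> (\<psi> p) (D1 \<gamma> (\<phi> p) v) (D1 \<gamma> (\<phi> p) w) = - D1 \<rho> (\<psi> p) (D2 \<gamma> (\<phi> p) v w)"
  using D2_compose[OF \<gamma>s, of \<rho> v w] D(4) by (simp add: \<gamma>p)
qed

section \<open>Hypersurfaces and their defining functions\<close>

text \<open>In codimension one the subspace of a slice chart is a hyperplane; the coordinate along
  its normal, rewritten in \<open>\<psi>\<close>, is a defining function.\<close>

lemma submanifold_defining:
 fixes A :: "('a::{t2_space,second_countable_topology}, 'e::euclidean_space) chart set"
 assumes A: "smooth_manifold A" and L: "submanifold A m L" and m: "DIM('e) = m + 1"
  and c: "(V, \<psi>) \<in> smooth_charts A" and p: "p \<in> L" "p \<in> V"
 obtains \<rho> where "defining A V \<psi> L p \<rho>"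
proof -
 obtain S U \<phi> where s: "subspace S" "dim S = m" "slice_chart A L S (U, \<phi>)" "p \<in> U"
  using L p by (auto simp: submanifold_def)
 have sc: "(U, \<phi>) \<in> smooth_charts A" and slice: "\<phi> ` (U \<inter> L) = \<phi> ` U \<inter> S"
  using s(3) by (auto simp: slice_chart_def)
 note cU = smooth_charts_is_chart[OF sc] and cV = smooth_charts_is_chart[OF c]
 obtain n where n: "n \<noteq> 0" "span S \<subseteq> {x. n \<bullet> x = 0}"
  using lowdim_subset_hyperplane[of S] s(2) m by auto
 have S: "S = {x. n \<bullet> x = 0}"
 proof (rule subspace_dim_equal[OF s(1) subspace_hyperplane])
  show "S \<subseteq> {x. n \<bullet> x = 0}" using n(2) span_superset by blast
  show "dim {x. n \<bullet> x = 0} \<le> dim S" using dim_hyperplane[OF n(1)] s(2) m by simp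
 qed
 have L': "q \<in> L \<longleftrightarrow> n \<bullet> \<phi> q = 0" if "q \<in> U" for q
 proof -
  have "\<phi> q \<in> \<phi> ` (U \<inter> L) \<longleftrightarrow> n \<bullet> \<phi> q = 0" using slice that S by auto
  moreover have "\<phi> q \<in> \<phi> ` (U \<inter> L) \<longleftrightarrow> q \<in> L" using that is_chartD(4)[OF cU] by (auto dest: inj_onD)
  ultimately show ?thesis by simp
 qed
 let ?k = "\<lambda>y. \<phi> (inv_into V \<psi> y)"
 have ks: "smooth_at ?k (\<psi> p)" by (rule smooth_charts_transition[OF A c sc p(2) s(4)])
 have "D1 (\<lambda>y. n \<bullet> ?k y) (\<psi> p) (D1 (\<lambda>y. \<psi> (inv_into U \<phi> y)) (\<phi> p) n) = n \<bullet> n"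
  by (simp add: D1_linear_compose[OF bounded_linear_inner_right ks] transition_inverse[OF A c sc p(2) s(4)])
 then have nz: "\<exists>v. D1 (\<lambda>y. n \<bullet> ?k y) (\<psi> p) v \<noteq> 0" using n(1) by (metis inner_eq_zero_iff)
 have "eventually (\<lambda>y. inv_into V \<psi> y \<in> L \<longleftrightarrow> n \<bullet> ?k y = 0) (nhds (\<psi> p))"
  using eventually_chart[OF cV p(2) eventually_nhds_in_open[OF is_chartD(1)[OF cU] s(4)]]
  by eventually_elim (use L' in auto)
 then have "defining A V \<psi> L p (\<lambda>y. n \<bullet> ?k y)"
  unfolding defining_def using c p nz by (auto intro!: smooth_intros ks)
 then show ?thesis by (rule that)
qed

text \<open>\<open>normal_slice\<close> with the derivative of \<open>\<rho>\<close> itself as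
  \<open>\<alpha>\<close> turns each defining function into a slice chart.\<close>

lemma submanifoldI_defining:
 fixes A :: "('a::{t2_space,second_countable_topology}, 'e::euclidean_space) chart set"
 assumes A: "smooth_manifold A" and m: "DIM('e) = m + 1"
  and d: "\<And>p. p \<in> L ==> \<exists>V \<psi> \<rho>. defining A V \<psi> L p \<rho>"
 shows "submanifold A m L"
 unfolding submanifold_def
proof (intro conjI ballI)
 show "L \<subseteq> carrier A" using d definingD(1,2) smooth_charts_carrier by blast
 fix p assume "p \<in> L"
 then obtain V \<psi> \<rho> where def: "defining A V \<psi> L p \<rho>" using d by blast
 obtain n where n: "D1 \<rho> (\<psi> p) n = 1" using defining_normal[OF def] .
 note l = linear_D1[OF definingD(4)[OF def]]
 obtain U \<phi> where "slice_chart A L {v. D1 \<rho> (\<psi> p) v = 0} (U, \<phi>)" "p \<in> U"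
  by (rule normal_slice[OF A def l n n])
 then show "\<exists>S U \<phi>. subspace S \<and> dim S = m \<and> slice_chart A L S (U, \<phi>) \<and> p \<in> U"
  using dim_kernel[OF l n] m by auto
qed

section \<open>Second order contact in terms of defining functions\<close>

text \<open>The derivatives up to order two in \<open>\<psi>\<close> determine those in
  \<open>\<psi>'\<close>, so jets written in an arbitrary chart can be compared in a fixed
  one.\<close>

lemma param_change_chart:
 assumes A: "smooth_manifold A" and c: "(U, \<phi>) \<in> smooth_charts A" and d: "(V, \<psi>) \<in> smooth_charts A"
  and d': "(V', \<psi>') \<in> smooth_charts A" and p: "p \<in> U" "p \<in> V" "p \<in> V'"
 shows "D1 (\<lambda>y. \<psi>' (inv_into U \<phi> y)) (\<phi> p) v =
   D1 (\<lambda>y. \<psi>' (inv_into V \<psi> y)) (\<psi> p) (D1 (\<lambda>y. \<psi> (inv_into U \<phi> y)) (\<phi> p) v)"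
  "D2 (\<lambda>y. \<psi>' (inv_into U \<phi> y)) (\<phi> p) v w =
   D2 (\<lambda>y. \<psi>' (inv_into V \<psi> y)) (\<psi> p) (D1 (\<lambda>y. \<psi> (inv_into U \<phi> y)) (\<phi> p) v) (D1 (\<lambda>y. \<psi> (inv_into U \<phi> y)) (\<phi> p) w) +
   D1 (\<lambda>y. \<psi>' (inv_into V \<psi> y)) (\<psi> p) (D2 (\<lambda>y. \<psi> (inv_into U \<phi> y)) (\<phi> p) v w)"
proof -
 note cU = smooth_charts_is_chart[OF c] and cV = smooth_charts_is_chart[OF d]
 have ev: "eventually (\<lambda>y. \<psi>' (inv_into U \<phi> y) = \<psi>' (inv_into V \<psi> (\<psi> (inv_into U \<phi> y)))) (nhds (\<phi> p))"
  by (rule eventually_mono[OF eventually_chart[OF cU p(1) eventually_nhds_in_open[OF is_chartD(1)[OF cV] p(2)]]])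
   (simp add: is_chartD(6)[OF cV])
 have s1: "smooth_at (\<lambda>y. \<psi> (inv_into U \<phi> y)) (\<phi> p)" by (rule smooth_charts_transition[OF A c d p(1,2)])
 have s2: "smooth_at (\<lambda>y. \<psi>' (inv_into V \<psi> y)) (\<psi> p)" by (rule smooth_charts_transition[OF A d d' p(2,3)])
 have e: "\<psi> (inv_into U \<phi> (\<phi> p)) = \<psi> p" by (simp add: is_chartD(6)[OF cU p(1)])
 show "D1 (\<lambda>y. \<psi>' (inv_into U \<phi> y)) (\<phi> p) v =
   D1 (\<lambda>y. \<psi>' (inv_into V \<psi> y)) (\<psi> p) (D1 (\<lambda>y. \<psi> (inv_into U \<phi> y)) (\<phi> p) v)"
  using D1_cong_ev[OF ev] D1_compose[of "\<lambda>y. \<psi> (inv_into U \<phi> y)" "\<phi> p" "\<lambda>y. \<psi>' (inv_into V \<psi> y)" v] s1 s2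
  by (simp add: e smooth_at_diffble)
 show "D2 (\<lambda>y. \<psi>' (inv_into U \<phi> y)) (\<phi> p) v w =
   D2 (\<lambda>y. \<psi>' (inv_into V \<psi> y)) (\<psi> p) (D1 (\<lambda>y. \<psi> (inv_into U \<phi> y)) (\<phi> p) v) (D1 (\<lambda>y. \<psi> (inv_into U \<phi> y)) (\<phi> p) w) +
   D1 (\<lambda>y. \<psi>' (inv_into V \<psi> y)) (\<psi> p) (D2 (\<lambda>y. \<psi> (inv_into U \<phi> y)) (\<phi> p) v w)"
  using D2_cong_ev[OF ev] D2_compose[of "\<lambda>y. \<psi> (inv_into U \<phi> y)" "\<phi> p" "\<lambda>y. \<psi>' (inv_into V \<psi> y)" v w] s1 s2
  by (simp add: e)
qed

lemma param_deriv_simps: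
 "param_deriv \<psi> (U, \<phi>) p [] = \<psi> (inv_into U \<phi> (\<phi> p))"
 "param_deriv \<psi> (U, \<phi>) p [v] = D1 (\<lambda>y. \<psi> (inv_into U \<phi> y)) (\<phi> p) v"
 "param_deriv \<psi> (U, \<phi>) p [v, w] = D2 (\<lambda>y. \<psi> (inv_into U \<phi> y)) (\<phi> p) v w"
 unfolding param_deriv_def prod.case iter_deriv_1 iter_deriv_2 by (simp_all add: o_def)

lemma length_le_2_cases:
 assumes "length vs \<le> 2"
 obtains "vs = []" | v where "vs = [v]" | v w where "vs = [v, w]"
 using assms by (cases vs; cases "tl vs"; cases "tl (tl vs)") auto

lemma proportional_kernel:
 fixes \<alpha> \<alpha>' :: "'e::real_vector => real"
 assumes l: "linear \<alpha>" "linear \<alpha>'" and n: "\<alpha> n = 1" and sub: "\<And>v. \<alpha> v = 0 ==> \<alpha>' v = 0"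
 shows "\<alpha>' v = \<alpha>' n * \<alpha> v"
proof -
 have "\<alpha> (v - \<alpha> v *\<^sub>R n) = 0" by (simp add: linear_diff[OF l(1)] linear_cmul[OF l(1)] n)
 then have "\<alpha>' (v - \<alpha> v *\<^sub>R n) = 0" by (rule sub)
 then show ?thesis by (simp add: linear_diff[OF l(2)] linear_cmul[OF l(2)])
qed

text \<open>Parametrizations with equal 2-jets give equal kernels and, by
  \<open>slice_tangent\<close>, Hessians on the kernel that differ by the factor between the
  covectors. Conversely, rescale \<open>\<rho>'\<close> so that the covectors agree; then the charts
  of \<open>normal_slice\<close> with the same \<open>\<alpha>\<close> and \<open>n\<close> have
  parametrizations whose 2-jets coincide on the kernel.\<close>

lemma contact_iff:
 fixes A :: "('a::{t2_space,second_countable_topology}, 'e::euclidean_space) chart set"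
 assumes A: "smooth_manifold A" and d: "defining A V \<psi> L p \<rho>" and d': "defining A V \<psi> L' p \<rho>'"
 shows "contact A 2 p L L' \<longleftrightarrow> jet_eq (D1 \<rho> (\<psi> p)) (D2 \<rho> (\<psi> p)) (D1 \<rho>' (\<psi> p)) (D2 \<rho>' (\<psi> p))"
proof
 note D = definingD[OF d] and D' = definingD[OF d']
 note l = linear_D1[OF D(4)] and l' = linear_D1[OF D'(4)]
 let ?\<alpha> = "D1 \<rho> (\<psi> p)" and ?\<alpha>' = "D1 \<rho>' (\<psi> p)" and ?H = "D2 \<rho> (\<psi> p)" and ?H' = "D2 \<rho>' (\<psi> p)"
 obtain n where n: "?\<alpha> n = 1" using defining_normal[OF d] .
 show "jet_eq ?\<alpha> ?H ?\<alpha>' ?H'" if contact: "contact A 2 p L L'"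
 proof -
  obtain S U \<phi> U' \<phi>' V2 \<psi>2 where c: "subspace S" "slice_chart A L S (U, \<phi>)" "slice_chart A L' S (U', \<phi>')"
   "(V2, \<psi>2) \<in> smooth_charts A" "p \<in> U" "p \<in> U'" "p \<in> V2"
   and pd: "\<And>vs. set vs \<subseteq> S ==> length vs \<le> 2 ==> param_deriv \<psi>2 (U, \<phi>) p vs = param_deriv \<psi>2 (U', \<phi>') p vs"
   using contact unfolding contact_def by blast
  have sU: "(U, \<phi>) \<in> smooth_charts A" "(U', \<phi>') \<in> smooth_charts A" using c(2,3) by (auto simp: slice_chart_def)
  let ?g = "\<lambda>y. \<psi> (inv_into U \<phi> y)" and ?g' = "\<lambda>y. \<psi> (inv_into U' \<phi>' y)"
  have e1: "D1 ?g (\<phi> p) v = D1 ?g' (\<phi>' p) v" if "v \<in> S" for v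
   using pd[of "[v]"] that unfolding param_deriv_simps
   by (simp add: param_change_chart(1)[OF A sU(1) c(4) D(1) c(5,7) D(2)] param_change_chart(1)[OF A sU(2) c(4) D(1) c(6,7) D(2)])
  have e2: "D2 ?g (\<phi> p) v w = D2 ?g' (\<phi>' p) v w" if "v \<in> S" "w \<in> S" for v w
   using pd[of "[v, w]"] pd[of "[v]"] pd[of "[w]"] that unfolding param_deriv_simps
   by (simp add: param_change_chart(2)[OF A sU(1) c(4) D(1) c(5,7) D(2)] param_change_chart(2)[OF A sU(2) c(4) D(1) c(6,7) D(2)])
  note t = slice_tangent[OF A d c(2,5,1)] and t' = slice_tangent[OF A d' c(3,6,1)]
  have lift: "\<exists>a\<in>S. v = D1 ?g (\<phi> p) a" if "?\<alpha> v = 0" for v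
  proof -
   have "D1 ?g (\<phi> p) (D1 (\<lambda>y. \<phi> (inv_into V \<psi> y)) (\<psi> p) v) = v" by (rule transition_inverse[OF A sU(1) D(1) c(5) D(2)])
   then show ?thesis using t(1) that by metis
  qed
  have ker: "?\<alpha>' v = 0" if "?\<alpha> v = 0" for v
   using lift[OF that] t'(1) e1 by auto
  have prp: "?\<alpha>' v = ?\<alpha>' n * ?\<alpha> v" for v by (rule proportional_kernel[OF l l' n ker])
  have nz: "?\<alpha>' n \<noteq> 0" using D'(5) prp by (metis mult_zero_left)
  have "?H' v w = ?\<alpha>' n * ?H v w" if vw: "?\<alpha> v = 0" "?\<alpha> w = 0" for v w
  proof -
   obtain a b where ab: "a \<in> S" "v = D1 ?g (\<phi> p) a" "b \<in> S" "w = D1 ?g (\<phi> p) b" using lift vw by metis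
   then have "?H' v w = - ?\<alpha>' (D2 ?g (\<phi> p) a b)" using t'(2)[of a b] e1 e2 by simp
   also have "\<dots> = ?\<alpha>' n * (- ?\<alpha> (D2 ?g (\<phi> p) a b))" by (subst prp) simp
   finally show ?thesis using t(2)[of a b] ab by simp
  qed
  then show ?thesis unfolding jet_eq_def using nz prp by blast
 qed
 show "contact A 2 p L L'" if eq: "jet_eq ?\<alpha> ?H ?\<alpha>' ?H'"
 proof -
  obtain c where c: "c \<noteq> 0" "\<And>v. ?\<alpha>' v = c * ?\<alpha> v" "\<And>v w. ?\<alpha> v = 0 ==> ?\<alpha> w = 0 ==> ?H' v w = c * ?H v w"
   using eq unfolding jet_eq_def by blast
  have ci: "inverse c \<noteq> 0" using c(1) by simp
  note sc = defining_scale[OF d' ci]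
  have \<alpha>2: "D1 (\<lambda>y. inverse c * \<rho>' y) (\<psi> p) v = ?\<alpha> v" for v using c by (simp add: sc(2))
  have S: "subspace {v. ?\<alpha> v = 0}" by (rule dim_kernel(1)[OF l n])
  obtain U \<phi> where u: "slice_chart A L {v. ?\<alpha> v = 0} (U, \<phi>)" "(U, \<phi>) \<in> smooth_charts A" "p \<in> U"
   "\<And>v. D1 (\<psi> \<circ> inv_into U \<phi>) (\<phi> p) v = v - (?\<alpha> v - ?\<alpha> v) *\<^sub>R n"
   "\<And>v w. D2 (\<psi> \<circ> inv_into U \<phi>) (\<phi> p) v w = - ?H (v - (?\<alpha> v - ?\<alpha> v) *\<^sub>R n) (w - (?\<alpha> w - ?\<alpha> w) *\<^sub>R n) *\<^sub>R n"
   by (rule normal_slice[OF A d l n n]) (rule that, (assumption | blast)+)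
  have n2: "D1 (\<lambda>y. inverse c * \<rho>' y) (\<psi> p) n = 1" by (simp add: \<alpha>2 n)
  obtain U' \<phi>' where u': "slice_chart A L' {v. ?\<alpha> v = 0} (U', \<phi>')" "(U', \<phi>') \<in> smooth_charts A" "p \<in> U'"
   "\<And>v. D1 (\<psi> \<circ> inv_into U' \<phi>') (\<phi>' p) v = v - (D1 (\<lambda>y. inverse c * \<rho>' y) (\<psi> p) v - ?\<alpha> v) *\<^sub>R n"
   "\<And>v w. D2 (\<psi> \<circ> inv_into U' \<phi>') (\<phi>' p) v w =
    - D2 (\<lambda>y. inverse c * \<rho>' y) (\<psi> p) (v - (D1 (\<lambda>y. inverse c * \<rho>' y) (\<psi> p) v - ?\<alpha> v) *\<^sub>R n)
     (w - (D1 (\<lambda>y. inverse c * \<rho>' y) (\<psi> p) w - ?\<alpha> w) *\<^sub>R n) *\<^sub>R n"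
   by (rule normal_slice[OF A sc(1) l n n2]) (rule that, (assumption | blast)+)
  have "param_deriv \<psi> (U, \<phi>) p vs = param_deriv \<psi> (U', \<phi>') p vs"
   if vs: "set vs \<subseteq> {v. ?\<alpha> v = 0}" "length vs \<le> 2" for vs
   using vs(2)
  proof (cases rule: length_le_2_cases)
   case 1
   then show ?thesis using is_chartD(6)[OF smooth_charts_is_chart[OF u(2)] u(3)] is_chartD(6)[OF smooth_charts_is_chart[OF u'(2)] u'(3)] by (simp add: param_deriv_simps)
  next
   case (2 v)
   then show ?thesis using u(4)[of v] u'(4)[of v] by (simp add: param_deriv_simps \<alpha>2 o_def)
  next
   case (3 v w)
   then have "?\<alpha> v = 0" "?\<alpha> w = 0" using vs by auto
   then have "?H' v w = c * ?H v w" by (rule c(3))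
   then show ?thesis using u(5)[of v w] u'(5)[of v w] c(1) 3 by (simp add: param_deriv_simps \<alpha>2 sc(3) o_def)
  qed
  then show ?thesis
   unfolding contact_def using S u(1,3) u'(1,3) D(1,2) by blast
 qed
qed

lemma defining_unique:
 assumes A: "smooth_manifold A" and d: "defining A V \<psi> L p \<rho>" and d': "defining A V \<psi> L p \<rho>'"
 shows "jet_eq (D1 \<rho> (\<psi> p)) (D2 \<rho> (\<psi> p)) (D1 \<rho>' (\<psi> p)) (D2 \<rho>' (\<psi> p))"
 using contact_iff[OF A d d] contact_iff[OF A d d'] jet_eq_refl by blast

text \<open>A jet is the set of hypersurfaces in contact with the given one. By
  \<open>contact_iff\<close> contact inherits symmetry and transitivity from \<open>jet_eq\<close>,
  hence its classes are separated by the pair of derivatives.\<close>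

lemma jet_eq_iff:
 fixes A :: "('a::{t2_space,second_countable_topology}, 'e::euclidean_space) chart set"
 assumes A: "smooth_manifold A" and m: "DIM('e) = m + 1"
  and d: "defining A V \<psi> L p \<rho>" and d': "defining A V \<psi> L' p \<rho>'" and L': "submanifold A m L'"
 shows "jet A 2 m p L = jet A 2 m p L' \<longleftrightarrow>
  jet_eq (D1 \<rho> (\<psi> p)) (D2 \<rho> (\<psi> p)) (D1 \<rho>' (\<psi> p)) (D2 \<rho>' (\<psi> p))"
proof
 assume "jet A 2 m p L = jet A 2 m p L'"
 moreover have "L' \<in> snd (jet A 2 m p L')"
  using L' definingD(3)[OF d'] contact_iff[OF A d' d'] jet_eq_refl by (auto simp: jet_def)
 ultimately have "contact A 2 p L L'" by (auto simp: jet_def)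
 then show "jet_eq (D1 \<rho> (\<psi> p)) (D2 \<rho> (\<psi> p)) (D1 \<rho>' (\<psi> p)) (D2 \<rho>' (\<psi> p))"
  using contact_iff[OF A d d'] by blast
next
 assume e: "jet_eq (D1 \<rho> (\<psi> p)) (D2 \<rho> (\<psi> p)) (D1 \<rho>' (\<psi> p)) (D2 \<rho>' (\<psi> p))"
 have "contact A 2 p L M \<longleftrightarrow> contact A 2 p L' M" if M: "submanifold A m M" "p \<in> M" for M
 proof -
  obtain \<sigma> where s: "defining A V \<psi> M p \<sigma>"
   using submanifold_defining[OF A M(1) m definingD(1)[OF d] M(2) definingD(2)[OF d]] .
  show ?thesis using contact_iff[OF A d s] contact_iff[OF A d' s] e jet_eq_sym jet_eq_trans by metis
 qed
 then show "jet A 2 m p L = jet A 2 m p L'" unfolding jet_def by blast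
qed

section \<open>Submersions and jets\<close>

text \<open>A submersion has surjective derivatives, so the composite with \<open>F\<close> still
  has nonzero differential.\<close>

lemma pullback_defining:
 assumes A: "smooth_manifold A" and B: "smooth_manifold B" and F: "submersion A B F"
  and d: "defining B W \<kappa> L' (F p) g" and c: "(V, \<psi>) \<in> smooth_charts A" and p: "p \<in> V"
 shows "defining A V \<psi> (carrier A \<inter> F -` L') p (\<lambda>y. g (\<kappa> (F (inv_into V \<psi> y))))" (is ?def)
  "D1 (\<lambda>y. g (\<kappa> (F (inv_into V \<psi> y)))) (\<psi> p) v = D1 g (\<kappa> (F p)) (D1 (\<lambda>y. \<kappa> (F (inv_into V \<psi> y))) (\<psi> p) v)"
  "D2 (\<lambda>y. g (\<kappa> (F (inv_into V \<psi> y)))) (\<psi> p) v w =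
   D2 g (\<kappa> (F p)) (D1 (\<lambda>y. \<kappa> (F (inv_into V \<psi> y))) (\<psi> p) v) (D1 (\<lambda>y. \<kappa> (F (inv_into V \<psi> y))) (\<psi> p) w) +
   D1 g (\<kappa> (F p)) (D2 (\<lambda>y. \<kappa> (F (inv_into V \<psi> y))) (\<psi> p) v w)"
proof -
 note D = definingD[OF d] and cV = smooth_charts_is_chart[OF c]
 have sF: "smooth_map A B F" using F by (simp add: submersion_def)
 let ?F = "\<lambda>y. \<kappa> (F (inv_into V \<psi> y))"
 have s: "smooth_at ?F (\<psi> p)" by (rule smooth_map_at[OF A B sF c D(1) p D(2)])
 have e: "?F (\<psi> p) = \<kappa> (F p)" by (simp add: is_chartD(6)[OF cV p])
 have sg: "smooth_at (\<lambda>y. g (?F y)) (\<psi> p)" by (rule smooth_at_compose[OF s]) (simp only: e D(4))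
 show D1: "D1 (\<lambda>y. g (?F y)) (\<psi> p) v = D1 g (\<kappa> (F p)) (D1 ?F (\<psi> p) v)" for v
  using D1_compose[of ?F "\<psi> p" g v] s D(4) by (simp add: e smooth_at_diffble)
 show "D2 (\<lambda>y. g (?F y)) (\<psi> p) v w = D2 g (\<kappa> (F p)) (D1 ?F (\<psi> p) v) (D1 ?F (\<psi> p) w) + D1 g (\<kappa> (F p)) (D2 ?F (\<psi> p) v w)"
  using D2_compose[OF s, of g v w] D(4) by (simp add: e)
 have pc: "p \<in> carrier A" using smooth_charts_carrier[OF c] p by auto
 have cont: "isCont F p" by (rule smooth_mapD(2)[OF sF A pc])
 have "eventually (\<lambda>r. r \<in> W \<and> (inv_into W \<kappa> (\<kappa> r) \<in> L' \<longleftrightarrow> g (\<kappa> r) = 0)) (nhds (F p))"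
  by (rule eventually_chart_pull[OF D(7,2,6)])
 then have "eventually (\<lambda>q. F q \<in> W \<and> (inv_into W \<kappa> (\<kappa> (F q)) \<in> L' \<longleftrightarrow> g (\<kappa> (F q)) = 0)) (nhds p)"
  by (rule eventually_compose_filterlim[OF _ cont[unfolded isCont_def tendsto_at_iff_tendsto_nhds]])
 from eventually_chart[OF cV p this] have ev: "eventually (\<lambda>y. inv_into V \<psi> y \<in> carrier A \<inter> F -` L' \<longleftrightarrow> g (?F y) = 0) (nhds (\<psi> p))"
  by (rule eventually_mono) (use smooth_charts_carrier[OF c] in \<open>auto simp: is_chartD(6)[OF D(7)]\<close>)
 obtain v where v: "D1 g (\<kappa> (F p)) v \<noteq> 0" using D(5) by blast
 obtain u where "v = D1 ?F (\<psi> p) u"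
  using submersion_at[OF A B F c D(1) p D(2)] by (meson surjD)
 then have "D1 (\<lambda>y. g (?F y)) (\<psi> p) u \<noteq> 0" using v by (simp add: D1)
 then show ?def unfolding defining_def using c p pc D(3) sg ev by blast
qed

text \<open>Provides hypersurfaces with prescribed derivatives at a point. The zero set is cut down
  to an open set on which the chosen directional derivative stays nonzero.\<close>

lemma zero_set_submanifold:
 fixes B :: "('b::{t2_space,second_countable_topology}, 'f::euclidean_space) chart set"
 assumes B: "smooth_manifold B" and m: "DIM('f) = m + 1" and c: "(W, \<kappa>) \<in> smooth_charts B" and q: "q \<in> W"
  and g: "smooth_at g (\<kappa> q)" "g (\<kappa> q) = 0" "D1 g (\<kappa> q) v \<noteq> (0::real)"
 obtains L where "submanifold B m L" "defining B W \<kappa> L q g"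
proof -
 note cW = smooth_charts_is_chart[OF c]
 have "eventually (\<lambda>r. r \<in> - {0}) (nhds (D1 g (\<kappa> q) v))" using g(3) by (intro eventually_nhds_in_open) auto
 from eventually_smooth_at_compose[OF smooth_at_D1[OF g(1)] this]
 have "eventually (\<lambda>y. D1 g y v \<noteq> 0) (nhds (\<kappa> q))" by simp
 from eventually_conj[OF smooth_at_eventually[OF g(1)] this]
 obtain O' where O: "open O'" "\<kappa> q \<in> O'" "\<And>y. y \<in> O' ==> smooth_at g y \<and> D1 g y v \<noteq> 0"
  unfolding eventually_nhds by blast
 define L where "L = {r \<in> W. \<kappa> r \<in> O' \<and> g (\<kappa> r) = 0}"
 have d: "defining B W \<kappa> L r g" if r: "r \<in> L" for r
 proof -
  have rW: "r \<in> W" "\<kappa> r \<in> O'" using r by (auto simp: L_def)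
  have "eventually (\<lambda>y. inv_into W \<kappa> y \<in> L \<longleftrightarrow> g y = 0) (nhds (\<kappa> r))"
   using eventually_chart[OF cW rW(1), of "\<lambda>_. True"] eventually_nhds_in_open[OF O(1) rW(2)]
   by (simp, elim eventually_elim2) (auto simp: L_def)
  then show ?thesis unfolding defining_def using c rW r O(3) by blast
 qed
 have qL: "q \<in> L" using q O(2) g(2) by (simp add: L_def)
 have "submanifold B m L" by (rule submanifoldI_defining[OF B m]) (use d in blast)
 then show ?thesis by (rule that[OF _ d[OF qL]])
qed

text \<open>With a right inverse \<open>C\<close> of the derivative \<open>D\<close> of \<open>F\<close>, the map
 \<open>\<Theta> y = C (F y - F y\<^sub>0) + (y - y\<^sub>0) - C (D (y - y\<^sub>0))\<close> straightens \<open>F\<close>: its inverse yields both a local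
 section of \<open>F\<close> and curves in the fibre with arbitrary velocity in the kernel of \<open>D\<close>.\<close>

lemma projected_image_defining:
 fixes A :: "('a::{t2_space,second_countable_topology}, 'e::euclidean_space) chart set"
  and B :: "('b::{t2_space,second_countable_topology}, 'f::euclidean_space) chart set"
 assumes A: "smooth_manifold A" and B: "smooth_manifold B" and F: "submersion A B F"
  and m: "DIM('e) = m + 1" and L: "submanifold A m L" "projected A F L" and p: "p \<in> L"
  and d: "(W, \<kappa>) \<in> smooth_charts B" "F p \<in> W"
 obtains g where "defining B W \<kappa> (F ` L) (F p) g"
proof -
 have sF: "smooth_map A B F" using F by (simp add: submersion_def)
 have pc: "p \<in> carrier A" using L(1) p by (auto simp: submanifold_def)
 obtain V \<psi> where c: "(V, \<psi>) \<in> smooth_charts A" "p \<in> V" using chart_at_point[OF A pc] by metis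
 note cV = smooth_charts_is_chart[OF c(1)] and cW = smooth_charts_is_chart[OF d(1)]
 obtain \<rho> where \<rho>: "defining A V \<psi> L p \<rho>" using submanifold_defining[OF A L(1) m c(1) p c(2)] .
 note R = definingD[OF \<rho>]
 let ?F = "\<lambda>y. \<kappa> (F (inv_into V \<psi> y))" and ?y0 = "\<psi> p" and ?z0 = "\<kappa> (F p)"
 let ?D = "D1 ?F ?y0"
 have Fs: "smooth_at ?F ?y0" by (rule smooth_map_at[OF A B sF c(1) d(1) c(2) d(2)])
 have F0: "?F ?y0 = ?z0" by (simp add: is_chartD(6)[OF cV c(2)])
 have lD: "linear ?D" by (rule linear_D1[OF Fs])
 obtain C where C: "linear C" "?D \<circ> C = id"
  using linear_surjective_right_inverse[OF lD submersion_at[OF A B F c(1) d(1) c(2) d(2)]] by blast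
 have DC: "?D (C z) = z" for z using C(2) by (metis comp_apply id_apply)
 have bC: "bounded_linear C" and bD: "bounded_linear ?D" using C(1) lD by (auto simp: linear_conv_bounded_linear)
 have bCD: "bounded_linear (\<lambda>y. C (?D y))" by (rule bounded_linear_compose[OF bC bD])
 define \<Theta> where "\<Theta> y = C (?F y - ?z0) + ((y - ?y0) - C (?D (y - ?y0)))" for y
 have s1: "smooth_at (\<lambda>y. C (?F y - ?z0)) ?y0" by (intro smooth_at_linear_compose[OF bC] smooth_intros Fs)
 have s2: "smooth_at (\<lambda>y. (y - ?y0) - C (?D (y - ?y0))) ?y0"
  by (intro smooth_intros smooth_at_linear_compose[OF bCD])
 have \<Theta>s: "smooth_at \<Theta> ?y0" unfolding \<Theta>_def by (intro smooth_at_add s1 s2)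
 have d1: "D1 (\<lambda>y. C (?F y - ?z0)) ?y0 v = C (?D v)" for v
 proof -
  have "D1 (\<lambda>y. ?F y + (- ?z0)) ?y0 v = ?D v" using D1_add[OF Fs smooth_at_const, of "- ?z0" v] by (simp add: D1_const)
  then show ?thesis using D1_linear_compose[OF bC, of "\<lambda>y. ?F y - ?z0" ?y0 v] Fs by (simp add: smooth_intros)
 qed
 have d2: "D1 (\<lambda>y. (y - ?y0) - C (?D (y - ?y0))) ?y0 v = v - C (?D v)" for v
 proof -
  have b: "bounded_linear (\<lambda>y. y - C (?D y))" by (intro bounded_linear_sub bounded_linear_ident bCD)
  have "((\<lambda>y. y - ?y0) has_derivative (\<lambda>v. v)) (at ?y0)" by (auto intro!: derivative_eq_intros)
  from D1_eqI[OF bounded_linear.has_derivative[OF b this]] show ?thesis by simp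
 qed
 \<comment> \<open>The second summand of \<open>\<Theta>\<close> projects to the kernel of
   \<open>?D\<close> and completes the first to a map with identity derivative, while
   \<open>D\<Theta>F\<close> shows that \<open>?D \<circ> \<Theta>\<close> is \<open>F\<close> up to
   a translation.\<close>
 have D\<Theta>: "D1 \<Theta> ?y0 v = v" for v unfolding \<Theta>_def D1_add[OF s1 s2] d1 d2 by simp
 have D\<Theta>F: "?D (\<Theta> y) = ?F y - ?z0" for y
  unfolding \<Theta>_def by (simp add: linear_add[OF lD] linear_diff[OF lD] DC)
 have \<Theta>0: "\<Theta> ?y0 = 0" by (simp add: \<Theta>_def F0 linear_0[OF C(1)] linear_0[OF lD])
 have "eventually (\<lambda>q. F q \<in> W) (nhds p)"
  by (rule eventually_compose_filterlim[OF eventually_nhds_in_open[OF is_chartD(1)[OF cW] d(2)] smooth_mapD(2)[OF sF A pc, unfolded isCont_def tendsto_at_iff_tendsto_nhds]])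
 from eventually_conj[OF R(6) eventually_chart[OF cV c(2) this]] obtain N where N: "open N" "?y0 \<in> N"
  "\<And>y. y \<in> N ==> (inv_into V \<psi> y \<in> L \<longleftrightarrow> \<rho> y = 0) \<and> F (inv_into V \<psi> y) \<in> W"
  unfolding eventually_nhds by blast
 have inj: "v = 0" if "D1 \<Theta> ?y0 v = 0" for v using that D\<Theta> by simp
 obtain U h where U: "(U, \<lambda>q. \<Theta> (\<psi> q)) \<in> smooth_charts A" "p \<in> U" "U \<subseteq> V" "\<psi> ` U \<subseteq> N"
  "\<And>q. q \<in> U ==> h (\<Theta> (\<psi> q)) = \<psi> q" "\<And>q. q \<in> U ==> smooth_at h (\<Theta> (\<psi> q))"
  by (rule chart_local_diffeo[OF A c(1,2) \<Theta>s _ N(1,2)], erule inj) (rule that, (assumption | blast)+)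
 note cU = smooth_charts_is_chart[OF U(1)]
 have hs: "smooth_at h 0" "h 0 = ?y0" using U(5,6)[OF U(2)] \<Theta>0 by auto
 have O: "open ((\<lambda>q. \<Theta> (\<psi> q)) ` U)" "0 \<in> (\<lambda>q. \<Theta> (\<psi> q)) ` U"
  using is_chartD(2)[OF cU] U(2) \<Theta>0 by (auto intro!: image_eqI[of _ _ p])
 have Dh: "D1 h 0 v = v" for v
 proof -
  have "eventually (\<lambda>x. \<Theta> (h x) = x) (nhds 0)"
   by (rule eventually_mono[OF eventually_nhds_in_open[OF O]]) (use U(5) in auto)
  from D1_cong_ev[OF this] have "D1 (\<lambda>x. \<Theta> (h x)) 0 v = v" by (simp add: D1_linear)
  then show ?thesis using D1_compose[of h 0 \<Theta> v] hs \<Theta>s by (simp add: smooth_at_diffble D\<Theta>)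
 qed
 have point: "\<exists>q\<in>U. h x = \<psi> q \<and> inv_into V \<psi> (h x) = q \<and> ?F (h x) = ?z0 + ?D x \<and> F q \<in> W \<and> (q \<in> L \<longleftrightarrow> \<rho> (h x) = 0)"
  if x: "x \<in> (\<lambda>q. \<Theta> (\<psi> q)) ` U" for x
 proof -
  obtain q where q: "q \<in> U" "x = \<Theta> (\<psi> q)" using x by blast
  have hx: "h x = \<psi> q" using q U(5) by simp
  have iq: "inv_into V \<psi> (\<psi> q) = q" using q U(3) is_chartD(6)[OF cV] by auto
  have "\<psi> q \<in> N" using q U(4) by auto
  with N(3) iq have "F q \<in> W" "q \<in> L \<longleftrightarrow> \<rho> (\<psi> q) = 0" by metis+
  moreover have "?F (\<psi> q) = ?z0 + ?D x" using D\<Theta>F[of "\<psi> q"] q by simp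
  ultimately show ?thesis using q hx iq by metis
 qed
 have projL: "q \<in> L \<longleftrightarrow> F q \<in> F ` L" if "q \<in> carrier A" for q
  using L(2) that unfolding projected_def by blast
 have UA: "U \<subseteq> carrier A" using smooth_charts_carrier[OF U(1)] .
 \<comment> \<open>A local section of \<open>F\<close> in coordinates: \<open>h\<close> undoes
   \<open>\<Theta>\<close>, and \<open>?D\<close> undoes \<open>C\<close>.\<close>
 define s where "s z = h (C (z - ?z0))" for z
 have Cs: "smooth_at (\<lambda>z. C (z - ?z0)) ?z0" by (intro smooth_at_linear_compose[OF bC] smooth_intros)
 have DCs: "D1 (\<lambda>z. C (z - ?z0)) ?z0 v = C v" for v
 proof -
  have "((\<lambda>z. z - ?z0) has_derivative (\<lambda>v. v)) (at ?z0)" by (auto intro!: derivative_eq_intros)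
  from D1_eqI[OF bounded_linear.has_derivative[OF bC this]] show ?thesis by simp
 qed
 have C0: "C (?z0 - ?z0) = 0" by (simp add: linear_0[OF C(1)])
 have ss: "smooth_at s ?z0" unfolding s_def by (rule smooth_at_compose[OF Cs]) (simp only: C0 hs)
 have Ds: "D1 s ?z0 v = C v" for v
  unfolding s_def using D1_compose[of "\<lambda>z. C (z - ?z0)" ?z0 h v] Cs hs(1)
  by (simp only: C0 DCs Dh smooth_at_diffble)
 have s0: "s ?z0 = ?y0" by (simp add: s_def C0 hs linear_0[OF C(1)])
 have sg: "smooth_at (\<lambda>z. \<rho> (s z)) ?z0" by (rule smooth_at_compose[OF ss]) (simp only: s0 R(4))
 have Dg: "D1 (\<lambda>z. \<rho> (s z)) ?z0 v = D1 \<rho> ?y0 (C v)" for v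
  using D1_compose[of s ?z0 \<rho> v] ss R(4) by (simp add: s0 Ds smooth_at_diffble)
 \<comment> \<open>The curve \<open>h (r *\<^sub>R v)\<close> stays in the fibre of \<open>F\<close>
   through \<open>p\<close>, hence in \<open>L\<close> because \<open>L\<close> is projected; so
   \<open>\<rho>\<close> vanishes along it.\<close>
 have ker: "D1 \<rho> ?y0 v = 0" if v: "?D v = 0" for v
 proof -
  have ls: "smooth_at (\<lambda>r::real. r *\<^sub>R v) 0" by (intro smooth_intros)
  have hl: "smooth_at (\<lambda>r::real. h (r *\<^sub>R v)) 0" by (rule smooth_at_compose[OF ls]) (simp add: hs)
  have D1l: "D1 (\<lambda>r::real. r *\<^sub>R v) 0 1 = v"
   by (subst D1_eqI[of _ "\<lambda>t. t *\<^sub>R v"]) (auto intro!: derivative_eq_intros)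
  have dh: "D1 (\<lambda>r::real. h (r *\<^sub>R v)) 0 1 = v"
   using D1_compose[of "\<lambda>r::real. r *\<^sub>R v" 0 h 1] ls hs(1) by (simp add: smooth_at_diffble D1l Dh)
  have "eventually (\<lambda>x. \<forall>r::real. x = r *\<^sub>R v --> \<rho> (h x) = 0) (nhds 0)"
  proof (rule eventually_mono[OF eventually_nhds_in_open[OF O]], intro allI impI)
   fix x and r :: real assume x: "x \<in> (\<lambda>q. \<Theta> (\<psi> q)) ` U" "x = r *\<^sub>R v"
   then obtain q where q: "q \<in> U" "h x = \<psi> q" "inv_into V \<psi> (h x) = q" "?F (h x) = ?z0 + ?D x" "F q \<in> W" "q \<in> L \<longleftrightarrow> \<rho> (h x) = 0"
    using point by blast
   have "\<kappa> (F q) = \<kappa> (F p)" using q(3,4) x(2) v by (simp add: linear_cmul[OF lD])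
   then have "F q = F p" using q(5) d(2) is_chartD(4)[OF cW] by (auto dest: inj_onD)
   then have "q \<in> L" using projL q(1) UA p by (metis image_eqI subsetD)
   then show "\<rho> (h x) = 0" using q(6) by simp
  qed
  then have "eventually (\<lambda>r::real. \<rho> (h (r *\<^sub>R v)) = 0) (nhds 0)"
   using eventually_smooth_at_compose[OF ls, of "\<lambda>x. \<forall>r::real. x = r *\<^sub>R v --> \<rho> (h x) = 0"]
   by (simp, elim eventually_mono) blast
  from D1_cong_ev[OF this] have "D1 (\<lambda>r::real. \<rho> (h (r *\<^sub>R v))) 0 1 = 0" by (simp add: D1_const)
  then show ?thesis
   using D1_compose[of "\<lambda>r::real. h (r *\<^sub>R v)" 0 \<rho> 1] hl R(4) by (simp add: hs(2) smooth_at_diffble dh)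
 qed
 \<comment> \<open>Otherwise the derivative of \<open>\<rho>\<close> would vanish on the image of
   \<open>C\<close> and on the kernel of \<open>?D\<close>, which together span the space.\<close>
 have "\<exists>v. D1 (\<lambda>z. \<rho> (s z)) ?z0 v \<noteq> 0"
 proof (rule ccontr)
  assume "\<not> ?thesis"
  then have 0: "D1 \<rho> ?y0 (C v) = 0" for v by (simp add: Dg)
  have "D1 \<rho> ?y0 v = 0" for v
  proof -
   have "D1 \<rho> ?y0 (v - C (?D v)) = 0" by (rule ker) (simp add: linear_diff[OF lD] DC)
   then show ?thesis using 0[of "?D v"] by (simp add: linear_diff[OF linear_D1[OF R(4)]])
  qed
  then show False using R(5) by blast
 qed
 moreover have "eventually (\<lambda>z. inv_into W \<kappa> z \<in> F ` L \<longleftrightarrow> \<rho> (s z) = 0) (nhds ?z0)"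
 proof -
  have "eventually (\<lambda>z. C (z - ?z0) \<in> (\<lambda>q. \<Theta> (\<psi> q)) ` U) (nhds ?z0)"
   by (rule eventually_smooth_at_compose[OF Cs]) (unfold C0, rule eventually_nhds_in_open[OF O])
  then show ?thesis
  proof (rule eventually_mono)
   fix z assume "C (z - ?z0) \<in> (\<lambda>q. \<Theta> (\<psi> q)) ` U"
   then obtain q where q: "q \<in> U" "s z = \<psi> q" "inv_into V \<psi> (s z) = q" "?F (s z) = ?z0 + ?D (C (z - ?z0))" "F q \<in> W" "q \<in> L \<longleftrightarrow> \<rho> (s z) = 0"
    using point unfolding s_def by blast
   have "\<kappa> (F q) = z" using q(3,4) by (simp add: DC)
   then have "inv_into W \<kappa> z = F q" using is_chartD(6)[OF cW q(5)] by simp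
   then show "inv_into W \<kappa> z \<in> F ` L \<longleftrightarrow> \<rho> (s z) = 0" using q projL UA by auto
  qed
 qed
 ultimately have "defining B W \<kappa> (F ` L) (F p) (\<lambda>z. \<rho> (s z))"
  unfolding defining_def using d sg p by blast
 then show ?thesis by (rule that)
qed

lemma projected_image_submanifold:
 fixes A :: "('a::{t2_space,second_countable_topology}, 'e::euclidean_space) chart set"
  and B :: "('b::{t2_space,second_countable_topology}, 'f::euclidean_space) chart set"
 assumes A: "smooth_manifold A" and B: "smooth_manifold B" and F: "submersion A B F"
  and m: "DIM('e) = m + 1" "DIM('f) = m' + 1" and L: "submanifold A m L" "projected A F L"
 shows "submanifold B m' (F ` L)"
proof (rule submanifoldI_defining[OF B m(2)])
 fix q assume "q \<in> F ` L"
 then obtain p where p: "p \<in> L" "q = F p" by blast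
 then have "F p \<in> carrier B" using L(1) smooth_mapD(1)[of A B F p] F by (auto simp: submanifold_def submersion_def)
 then obtain W \<kappa> where "(W, \<kappa>) \<in> smooth_charts B" "F p \<in> W" using chart_at_point[OF B] by metis
 from projected_image_defining[OF A B F m(1) L p(1) this] show "\<exists>V \<psi> \<rho>. defining B V \<psi> (F ` L) q \<rho>"
  using p(2) by metis
qed

text \<open>Makes \<open>jet_map\<close> well defined. Defining functions of the images pull back to
  defining functions of \<open>L\<close> and \<open>M\<close>; the relation between those descends
  because the derivative of \<open>F\<close> is surjective, the terms with its second derivative
  being multiplied by the same factor.\<close>

lemma projected_image_jet:
 fixes A :: "('a::{t2_space,second_countable_topology}, 'e::euclidean_space) chart set"
  and B :: "('b::{t2_space,second_countable_topology}, 'f::euclidean_space) chart set"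
 assumes A: "smooth_manifold A" and B: "smooth_manifold B" and F: "submersion A B F"
  and m: "DIM('e) = m + 1" "DIM('f) = m' + 1"
  and L: "submanifold A m L" "projected A F L" "p \<in> L" and M: "submanifold A m M" "projected A F M" "p \<in> M"
  and e: "jet A 2 m p L = jet A 2 m p M"
 shows "jet B 2 m' (F p) (F ` L) = jet B 2 m' (F p) (F ` M)"
proof -
 have sF: "smooth_map A B F" using F by (simp add: submersion_def)
 have pc: "p \<in> carrier A" using L(1,3) by (auto simp: submanifold_def)
 obtain V \<psi> where c: "(V, \<psi>) \<in> smooth_charts A" "p \<in> V" using chart_at_point[OF A pc] by metis
 obtain W \<kappa> where d: "(W, \<kappa>) \<in> smooth_charts B" "F p \<in> W" using chart_at_point[OF B smooth_mapD(1)[OF sF pc]] by metis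
 obtain g where g: "defining B W \<kappa> (F ` L) (F p) g" using projected_image_defining[OF A B F m(1) L d] .
 obtain k where k: "defining B W \<kappa> (F ` M) (F p) k" using projected_image_defining[OF A B F m(1) M d] .
 note pg = pullback_defining[OF A B F g c] and pk = pullback_defining[OF A B F k c]
 have Lp: "carrier A \<inter> F -` (F ` L) = L" "carrier A \<inter> F -` (F ` M) = M" using L(2) M(2) by (auto simp: projected_def)
 let ?F = "\<lambda>y. \<kappa> (F (inv_into V \<psi> y))"
 have "jet_eq (D1 (\<lambda>y. g (?F y)) (\<psi> p)) (D2 (\<lambda>y. g (?F y)) (\<psi> p)) (D1 (\<lambda>y. k (?F y)) (\<psi> p)) (D2 (\<lambda>y. k (?F y)) (\<psi> p))"
  using jet_eq_iff[OF A m(1) pg(1)[unfolded Lp] pk(1)[unfolded Lp] M(1)] e by blast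
 then obtain c' where c': "c' \<noteq> 0" "\<And>v. D1 (\<lambda>y. k (?F y)) (\<psi> p) v = c' * D1 (\<lambda>y. g (?F y)) (\<psi> p) v"
  "\<And>v w. D1 (\<lambda>y. g (?F y)) (\<psi> p) v = 0 ==> D1 (\<lambda>y. g (?F y)) (\<psi> p) w = 0 ==> D2 (\<lambda>y. k (?F y)) (\<psi> p) v w = c' * D2 (\<lambda>y. g (?F y)) (\<psi> p) v w"
  unfolding jet_eq_def by blast
 have sur: "\<exists>u. v = D1 ?F (\<psi> p) u" for v
  using submersion_at[OF A B F c(1) d(1) c(2) d(2)] by (meson surjD)
 have 1: "D1 k (\<kappa> (F p)) v = c' * D1 g (\<kappa> (F p)) v" for v
  using sur[of v] c'(2) unfolding pg(2) pk(2) by auto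
 have 2: "D2 k (\<kappa> (F p)) v w = c' * D2 g (\<kappa> (F p)) v w" if "D1 g (\<kappa> (F p)) v = 0" "D1 g (\<kappa> (F p)) w = 0" for v w
 proof -
  obtain a b where "v = D1 ?F (\<psi> p) a" "w = D1 ?F (\<psi> p) b" using sur by metis
  then show ?thesis using c'(3)[of a b] that unfolding pg(2,3) pk(2,3) 1 by (simp add: algebra_simps)
 qed
 have "jet_eq (D1 g (\<kappa> (F p))) (D2 g (\<kappa> (F p))) (D1 k (\<kappa> (F p))) (D2 k (\<kappa> (F p)))"
  unfolding jet_eq_def using c'(1) 1 2 by blast
 then show ?thesis
  using jet_eq_iff[OF B m(2) g k projected_image_submanifold[OF A B F m M(1,2)]] by blast
qed

lemma jet_map_jet:
 fixes A :: "('a::{t2_space,second_countable_topology}, 'e::euclidean_space) chart set"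
  and B :: "('b::{t2_space,second_countable_topology}, 'f::euclidean_space) chart set"
 assumes A: "smooth_manifold A" and B: "smooth_manifold B" and F: "submersion A B F"
  and m: "DIM('e) = m + 1" "DIM('f) = m' + 1"
  and L: "submanifold A m L" "projected A F L" "p \<in> L"
 shows "jet_map A B F 2 m m' (jet A 2 m p L) = jet B 2 m' (F p) (F ` L)"
 unfolding jet_map_def
proof (rule the_equality)
 show "\<exists>x M. submanifold A m M \<and> projected A F M \<and> x \<in> M \<and> jet A 2 m p L = jet A 2 m x M \<and>
   jet B 2 m' (F p) (F ` L) = jet B 2 m' (F x) (F ` M)"
  using L by blast
 fix j assume "\<exists>x M. submanifold A m M \<and> projected A F M \<and> x \<in> M \<and> jet A 2 m p L = jet A 2 m x M \<and> j = jet B 2 m' (F x) (F ` M)"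
 then obtain x M where M: "submanifold A m M" "projected A F M" "x \<in> M" "jet A 2 m p L = jet A 2 m x M" "j = jet B 2 m' (F x) (F ` M)"
  by blast
 have "x = p" using M(4) by (simp add: jet_def)
 then show "j = jet B 2 m' (F p) (F ` L)"
  using projected_image_jet[OF A B F m L, of M] M by simp
qed

section \<open>Morphisms tested on hypersurfaces\<close>

text \<open>The dimension \<open>m'\<close> is forced by the two model spaces, and with
  \<open>jet_map\<close> known on jets the equality of sets of jets becomes an equivalence for each
  projected hypersurface.\<close>

lemma pde_morphism_iff:
 fixes A :: "('a::{t2_space,second_countable_topology}, 'e::euclidean_space) chart set"
  and B :: "('b::{t2_space,second_countable_topology}, 'f::euclidean_space) chart set"
 assumes m: "DIM('e) = m + 1" "DIM('f) = m' + 1"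
 shows "pde_morphism A E B E' 2 m F \<longleftrightarrow>
  pde_object A 2 m E \<and> submersion A B F \<and> F ` carrier A = carrier B \<and> pde_object B 2 m' E' \<and>
  (\<forall>p L. submanifold A m L --> projected A F L --> p \<in> L --> (jet A 2 m p L \<in> E \<longleftrightarrow> jet B 2 m' (F p) (F ` L) \<in> E'))"
 (is "_ \<longleftrightarrow> ?R")
proof -
 have m': "k + DIM('e) = m + DIM('f) \<longleftrightarrow> k = m'" for k using m by auto
 have "(E \<inter> projected_jet_space A F 2 m = {j \<in> projected_jet_space A F 2 m. jet_map A B F 2 m m' j \<in> E'}) \<longleftrightarrow>
  (\<forall>p L. submanifold A m L --> projected A F L --> p \<in> L --> (jet A 2 m p L \<in> E \<longleftrightarrow> jet B 2 m' (F p) (F ` L) \<in> E'))"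
  if "smooth_manifold A" "smooth_manifold B" "submersion A B F"
 proof -
  have "(E \<inter> projected_jet_space A F 2 m = {j \<in> projected_jet_space A F 2 m. jet_map A B F 2 m m' j \<in> E'}) \<longleftrightarrow>
   (\<forall>j\<in>projected_jet_space A F 2 m. j \<in> E \<longleftrightarrow> jet_map A B F 2 m m' j \<in> E')" by blast
  also have "\<dots> \<longleftrightarrow> (\<forall>p L. submanifold A m L --> projected A F L --> p \<in> L --> (jet A 2 m p L \<in> E \<longleftrightarrow> jet_map A B F 2 m m' (jet A 2 m p L) \<in> E'))"
   unfolding projected_jet_space_def by blast
  finally show ?thesis using jet_map_jet[OF that m] by simp
 qed
 then show ?thesis unfolding pde_morphism_def m' pde_object_def by auto
qed

text \<open>As \<open>F\<close> is onto, the preimage of any hypersurface of the target is projected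
  and has that hypersurface as its image, so a morphism can be tested on arbitrary jets of the
  target.\<close>

lemma pullback_jet_iff:
 fixes A :: "('a::{t2_space,second_countable_topology}, 'e::euclidean_space) chart set"
  and B :: "('b::{t2_space,second_countable_topology}, 'f::euclidean_space) chart set"
 assumes m: "DIM('e) = m + 1" "DIM('f) = m' + 1" and F: "pde_morphism A E B E' 2 m F"
  and L: "submanifold B m' L'" "F p \<in> L'" "p \<in> carrier A"
 shows "submanifold A m (carrier A \<inter> F -` L')"
  "jet A 2 m p (carrier A \<inter> F -` L') \<in> E \<longleftrightarrow> jet B 2 m' (F p) L' \<in> E'"
proof -
 note F' = F[unfolded pde_morphism_iff[OF m]]
 have A: "smooth_manifold A" and B: "smooth_manifold B" and sub: "submersion A B F" and sur: "F ` carrier A = carrier B"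
  using F' by (auto simp: pde_object_def)
 show sm: "submanifold A m (carrier A \<inter> F -` L')"
 proof (rule submanifoldI_defining[OF A m(1)])
  fix q assume q: "q \<in> carrier A \<inter> F -` L'"
  obtain V \<psi> where c: "(V, \<psi>) \<in> smooth_charts A" "q \<in> V" using chart_at_point[OF A] q by blast
  have "F q \<in> carrier B" using sur q by blast
  then obtain W \<kappa> where d: "(W, \<kappa>) \<in> smooth_charts B" "F q \<in> W" using chart_at_point[OF B] by blast
  obtain g where "defining B W \<kappa> L' (F q) g" using submanifold_defining[OF B L(1) m(2) d(1) _ d(2)] q by blast
  from pullback_defining(1)[OF A B sub this c] show "\<exists>V \<psi> \<rho>. defining A V \<psi> (carrier A \<inter> F -` L') q \<rho>" by blast
 qed
 have im: "F ` (carrier A \<inter> F -` L') = L'"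
 proof -
  have "L' \<subseteq> F ` carrier A" using L(1) sur by (simp add: submanifold_def)
  then show ?thesis by blast
 qed
 then have "projected A F (carrier A \<inter> F -` L')" by (simp add: projected_def)
 then show "jet A 2 m p (carrier A \<inter> F -` L') \<in> E \<longleftrightarrow> jet B 2 m' (F p) L' \<in> E'"
  using F' sm im L(2,3) by (metis IntI vimageI2)
qed

section \<open>Products and local functions\<close>

lemma inv_into_map_prod:
 assumes "inj_on \<phi> U" "inj_on \<psi> V" "a \<in> \<phi> ` U" "b \<in> \<psi> ` V"
 shows "inv_into (U \<times> V) (map_prod \<phi> \<psi>) (a, b) = (inv_into U \<phi> a, inv_into V \<psi> b)"
proof -
 obtain u v where uv: "u \<in> U" "v \<in> V" "a = \<phi> u" "b = \<psi> v" using assms by blast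
 have "inv_into (U \<times> V) (map_prod \<phi> \<psi>) (map_prod \<phi> \<psi> (u, v)) = (u, v)"
  by (rule inv_into_f_f) (use assms uv in \<open>auto intro: map_prod_inj_on\<close>)
 then show ?thesis using uv assms by simp
qed

lemma is_chart_prod:
 assumes c: "is_chart (U, \<phi>)" and d: "is_chart (V, \<psi>)"
 shows "is_chart (U \<times> V, map_prod \<phi> \<psi>)"
proof -
 note C = is_chartD[OF c] and D = is_chartD[OF d]
 have im: "(\<lambda>p. (\<phi> (fst p), \<psi> (snd p))) ` (U \<times> V) = \<phi> ` U \<times> \<psi> ` V" by force
 have "continuous_on (U \<times> V) (\<lambda>p. (\<phi> (fst p), \<psi> (snd p)))"
  by (intro continuous_on_Pair continuous_on_compose2[OF C(3)] continuous_on_compose2[OF D(3)] continuous_intros) auto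
 moreover have "continuous_on (\<phi> ` U \<times> \<psi> ` V) (\<lambda>p. (inv_into U \<phi> (fst p), inv_into V \<psi> (snd p)))"
  by (intro continuous_on_Pair continuous_on_compose2[OF C(5)] continuous_on_compose2[OF D(5)] continuous_intros) auto
 ultimately have "is_chart (U \<times> V, \<lambda>p. (\<phi> (fst p), \<psi> (snd p)))"
  by (intro is_chartI[of _ _ "\<lambda>p. (inv_into U \<phi> (fst p), inv_into V \<psi> (snd p))"])
   (use C D in \<open>auto simp: im intro!: open_Times\<close>)
 then show ?thesis by (simp add: map_prod_def split_beta')
qed

lemma smooth_at_map_prod:
 fixes f :: "'a::euclidean_space => 'c::euclidean_space" and g :: "'b::euclidean_space => 'd::euclidean_space"
 assumes "smooth_at f a" "smooth_at g b"
 shows "smooth_at (\<lambda>p. (f (fst p), g (snd p))) (a, b)"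
 by (intro smooth_intros smooth_at_compose[of fst _ f] smooth_at_compose[of snd _ g])
  (auto simp: assms intro!: smooth_intros)

lemma smooth_compatible_prod:
 fixes \<phi> \<phi>' :: "'a::{t2_space,second_countable_topology} => 'c::euclidean_space"
  and \<psi> \<psi>' :: "'b::{t2_space,second_countable_topology} => 'd::euclidean_space"
 assumes c: "is_chart (U, \<phi>)" "is_chart (U', \<phi>')" "smooth_compatible (U, \<phi>) (U', \<phi>')"
  and d: "is_chart (V, \<psi>)" "is_chart (V', \<psi>')" "smooth_compatible (V, \<psi>) (V', \<psi>')"
 shows "smooth_compatible (U \<times> V, map_prod \<phi> \<psi>) (U' \<times> V', map_prod \<phi>' \<psi>')"
proof -
 have *: "smooth_at (\<lambda>y. map_prod \<phi>' \<psi>' (inv_into (U \<times> V) (map_prod \<phi> \<psi>) y)) (map_prod \<phi> \<psi> p)"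
  if c: "is_chart (U, \<phi>)" and d: "is_chart (V, \<psi>)" and p: "p \<in> U \<times> V"
   and s: "smooth_at (\<lambda>y. \<phi>' (inv_into U \<phi> y)) (\<phi> (fst p))" "smooth_at (\<lambda>y. \<psi>' (inv_into V \<psi> y)) (\<psi> (snd p))"
  for U V p and \<phi> \<phi>' :: "'a => 'c" and \<psi> \<psi>' :: "'b => 'd"
 proof -
  have "eventually (\<lambda>y. y \<in> \<phi> ` U \<times> \<psi> ` V) (nhds (\<phi> (fst p), \<psi> (snd p)))"
   using is_chartD(2)[OF c] is_chartD(2)[OF d] p by (intro eventually_nhds_in_open open_Times) auto
  then have "eventually (\<lambda>y. (\<phi>' (inv_into U \<phi> (fst y)), \<psi>' (inv_into V \<psi> (snd y))) = map_prod \<phi>' \<psi>' (inv_into (U \<times> V) (map_prod \<phi> \<psi>) y)) (nhds (\<phi> (fst p), \<psi> (snd p)))"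
   by (rule eventually_mono) (auto simp: inv_into_map_prod is_chartD(4)[OF c] is_chartD(4)[OF d])
  from smooth_at_transform[OF smooth_at_map_prod[OF s] this] show ?thesis
   by (simp add: map_prod_def split_beta')
 qed
 show ?thesis
  using smooth_compatible_iff[OF c(1,2)] smooth_compatible_iff[OF d(1,2)] c(3) d(3)
  by (auto simp: smooth_compatible_iff[OF is_chart_prod[OF c(1) d(1)] is_chart_prod[OF c(2) d(2)]]
    intro!: *[OF c(1) d(1)] *[OF c(2) d(2)])
qed

lemma carrier_iff: "p \<in> carrier A \<longleftrightarrow> (\<exists>U \<phi>. (U, \<phi>) \<in> A \<and> p \<in> U)"
 by (force simp: carrier_def)

lemma carrier_prod: "carrier (prod_manifold A B) = carrier A \<times> carrier B"
 by (rule set_eqI) (auto simp: carrier_iff prod_manifold_def; blast)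

lemma smooth_manifold_prod:
 assumes "smooth_manifold A" "smooth_manifold B" shows "smooth_manifold (prod_manifold A B)"
 using assms unfolding smooth_manifold_def prod_manifold_def
 by (auto intro!: is_chart_prod smooth_compatible_prod)

lemma smooth_charts_prod:
 assumes A: "smooth_manifold A" and B: "smooth_manifold B"
  and c: "(U, \<phi>) \<in> smooth_charts A" "(V, \<psi>) \<in> smooth_charts B"
 shows "(U \<times> V, map_prod \<phi> \<psi>) \<in> smooth_charts (prod_manifold A B)"
 using c A B smooth_charts_carrier[OF c(1)] smooth_charts_carrier[OF c(2)]
 unfolding smooth_charts_def prod_manifold_def smooth_manifold_def carrier_prod[unfolded prod_manifold_def]
 by (auto intro!: is_chart_prod smooth_compatible_prod)

lemma is_chart_id: "open S ==> is_chart (S, \<lambda>x. x)"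
 by (rule is_chartI[of _ _ "\<lambda>x. x"]) auto

lemma open_set_manifold_facts:
 assumes "open S"
 shows "smooth_manifold (open_set_manifold S)" "carrier (open_set_manifold S) = S"
  "(S, \<lambda>x. x) \<in> smooth_charts (open_set_manifold S)"
proof -
 have ev: "eventually (\<lambda>y. y = inv_into S (\<lambda>x. x) y) (nhds x)" if "x \<in> S" for x
  by (rule eventually_mono[OF eventually_nhds_in_open[OF assms that]]) (metis f_inv_into_f image_ident)
 have "smooth_compatible (S, \<lambda>x. x) (S, \<lambda>x. x)"
  by (subst smooth_compatible_iff[OF is_chart_id[OF assms] is_chart_id[OF assms]])
   (auto intro: smooth_at_transform[OF smooth_at_ident ev])
 then show m: "smooth_manifold (open_set_manifold S)"
  using is_chart_id[OF assms] by (simp add: smooth_manifold_def open_set_manifold_def)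
 show "carrier (open_set_manifold S) = S" by (simp add: carrier_def open_set_manifold_def)
 show "(S, \<lambda>x. x) \<in> smooth_charts (open_set_manifold S)"
  using atlas_subset_smooth_charts[OF m] by (auto simp: open_set_manifold_def)
qed

lemma inv_into_ident: "y \<in> S ==> inv_into S (\<lambda>x. x) y = y"
 by (metis f_inv_into_f image_ident)

lemma open_submanifold_facts:
 assumes A: "smooth_manifold A" and D: "open D"
 shows "smooth_manifold (open_submanifold A D)" "carrier (open_submanifold A D) = carrier A \<inter> D"
  "(U, \<phi>) \<in> smooth_charts A ==> (U \<inter> D, \<phi>) \<in> smooth_charts (open_submanifold A D)"
  "is_chart (U, \<phi>) ==> y \<in> \<phi> ` (U \<inter> D) ==> inv_into (U \<inter> D) \<phi> y = inv_into U \<phi> y"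
proof -
 have ch: "is_chart (U \<inter> D, \<phi>)" if c: "is_chart (U, \<phi>)" for U and \<phi> :: "'a => 'b"
  by (rule is_chartI[of _ _ "inv_into U \<phi>"])
   (use is_chartD[OF c] chart_image_open[OF c D] D in \<open>auto intro: continuous_on_subset\<close>)
 have inv: "inv_into (U \<inter> D) \<phi> y = inv_into U \<phi> y" if c: "is_chart (U, \<phi>)" "y \<in> \<phi> ` (U \<inter> D)" for U y and \<phi> :: "'a => 'b"
  using c is_chartD(6)[OF c(1)] is_chartD(6)[OF ch[OF c(1)]] by auto
 show "is_chart (U, \<phi>) ==> y \<in> \<phi> ` (U \<inter> D) ==> inv_into (U \<inter> D) \<phi> y = inv_into U \<phi> y" by (rule inv)
 have comp: "smooth_compatible (U \<inter> D, \<phi>) (V \<inter> D, \<psi>)"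
  if c: "is_chart (U, \<phi>)" "is_chart (V, \<psi>)" "smooth_compatible (U, \<phi>) (V, \<psi>)" for U V and \<phi> \<psi> :: "'a => 'b"
 proof -
  have *: "smooth_at (\<lambda>y. \<psi> (inv_into (U \<inter> D) \<phi> y)) (\<phi> p)"
   if c: "is_chart (U, \<phi>)" and p: "p \<in> U" "p \<in> D" and s: "smooth_at (\<lambda>y. \<psi> (inv_into U \<phi> y)) (\<phi> p)" for U p and \<phi> \<psi> :: "'a => 'b"
  proof (rule smooth_at_transform[OF s])
   have "eventually (\<lambda>y. y \<in> \<phi> ` (U \<inter> D)) (nhds (\<phi> p))"
    using chart_image_open[OF c D] p by (intro eventually_nhds_in_open) auto
   then show "eventually (\<lambda>y. \<psi> (inv_into U \<phi> y) = \<psi> (inv_into (U \<inter> D) \<phi> y)) (nhds (\<phi> p))"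
    by (rule eventually_mono) (simp add: inv[OF c])
  qed
  show ?thesis using smooth_compatible_iff[OF c(1,2)] c(3)
   by (auto simp: smooth_compatible_iff[OF ch[OF c(1)] ch[OF c(2)]] intro!: *[OF c(1)] *[OF c(2)])
 qed
 show "smooth_manifold (open_submanifold A D)"
  using A unfolding smooth_manifold_def open_submanifold_def by (auto intro!: ch comp)
 show c: "carrier (open_submanifold A D) = carrier A \<inter> D"
  by (rule set_eqI) (auto simp: carrier_iff open_submanifold_def; blast)
 show "(U \<inter> D, \<phi>) \<in> smooth_charts (open_submanifold A D)" if u: "(U, \<phi>) \<in> smooth_charts A"
  using u A smooth_charts_carrier[OF u] unfolding smooth_charts_def c
  by (auto simp: open_submanifold_def smooth_manifold_def intro!: ch comp)
qed

section \<open>The manifolds \<open>T \<times> X\<close> and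
  \<open>T \<times> X \<times> \<Omega>\<close>\<close>

abbreviation tchart :: "('a => 'e) => real \<times> 'a \<times> real => real \<times> 'e \<times> real" where
 "tchart \<phi> \<equiv> map_prod (\<lambda>x. x) (map_prod \<phi> (\<lambda>x. x))"

lemma total_space_facts:
 assumes A: "smooth_manifold A" and T: "open T" and O: "open \<Omega>"
 shows "smooth_manifold (total_space T A \<Omega>)" "carrier (total_space T A \<Omega>) = T \<times> carrier A \<times> \<Omega>"
  "(U, \<phi>) \<in> smooth_charts A ==> (T \<times> U \<times> \<Omega>, tchart \<phi>) \<in> smooth_charts (total_space T A \<Omega>)"
 unfolding total_space_def
 by (auto intro!: smooth_manifold_prod smooth_charts_prod open_set_manifold_facts A T O
   simp: carrier_prod open_set_manifold_facts(2) T O)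

lemma time_space_facts:
 assumes A: "smooth_manifold A" and T: "open T"
 shows "smooth_manifold (time_space T A)" "carrier (time_space T A) = T \<times> carrier A"
  "(U, \<phi>) \<in> smooth_charts A ==> (T \<times> U, map_prod (\<lambda>x. x) \<phi>) \<in> smooth_charts (time_space T A)"
 unfolding time_space_def
 by (auto intro!: smooth_manifold_prod smooth_charts_prod open_set_manifold_facts A T
   simp: carrier_prod open_set_manifold_facts(2) T)

lemma inv_into_tchart:
 assumes "is_chart (U, \<phi>)" "t \<in> T" "y \<in> \<phi> ` U" "z \<in> \<Omega>"
 shows "inv_into (T \<times> U \<times> \<Omega>) (tchart \<phi>) (t, y, z) = (t, inv_into U \<phi> y, z)"
 using assms is_chartD(4)[OF assms(1)]
 by (subst inv_into_map_prod, auto intro!: map_prod_inj_on simp: inv_into_ident)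
  (subst inv_into_map_prod, auto simp: inv_into_ident)

lemma inv_into_time_chart:
 assumes "is_chart (U, \<phi>)" "t \<in> T" "y \<in> \<phi> ` U"
 shows "inv_into (T \<times> U) (map_prod (\<lambda>x. x) \<phi>) (t, y) = (t, inv_into U \<phi> y)"
 using assms is_chartD(4)[OF assms(1)] by (subst inv_into_map_prod) (auto simp: inv_into_ident)

lemma isCont_chart: "is_chart (U, \<phi>) ==> p \<in> U ==> isCont \<phi> p"
 using is_chartD(1,3) continuous_on_eq_continuous_at by blast

section \<open>Local functions and their graphs\<close>

definition lrep :: "'a set => ('a => 'e) => (real \<times> 'a => real) => real \<times> 'e => real" where
 "lrep U \<phi> u = (\<lambda>p. u (fst p, inv_into U \<phi> (snd p)))"

lemma local_functionD:
 assumes A: "smooth_manifold A" and T: "open T" and O: "open \<Omega>" and u: "local_function T A \<Omega> D u" and x: "(t, x) \<in> D"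
 shows "open D" "t \<in> T" "x \<in> carrier A" "u (t, x) \<in> \<Omega>"
  "(U, \<phi>) \<in> smooth_charts A ==> x \<in> U ==> smooth_at (lrep U \<phi> u) (t, \<phi> x)"
proof -
 note ts = time_space_facts[OF A T] and os = open_set_manifold_facts[OF O]
 show D: "open D" and tx: "t \<in> T" "x \<in> carrier A" using u x by (auto simp: local_function_def ts(2))
 note sub = open_submanifold_facts[OF ts(1) D]
 have s: "smooth_map (open_submanifold (time_space T A) D) (open_set_manifold \<Omega>) u"
  using u by (simp add: local_function_def)
 show uO: "u (t, x) \<in> \<Omega>" using smooth_mapD(1)[OF s, of "(t, x)"] tx x by (simp add: sub(2) ts(2) os(2))
 assume c: "(U, \<phi>) \<in> smooth_charts A" "x \<in> U"
 note cU = smooth_charts_is_chart[OF c(1)]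
 note c2 = smooth_charts_is_chart[OF ts(3)[OF c(1)]]
 have "smooth_at (\<lambda>y. u (inv_into ((T \<times> U) \<inter> D) (map_prod (\<lambda>x. x) \<phi>) y)) (map_prod (\<lambda>x. x) \<phi> (t, x))"
  using smooth_map_at[OF sub(1) os(1) s sub(3)[OF ts(3)[OF c(1)]] os(3), of "(t, x)"] c(2) tx x uO by auto
 then have s2: "smooth_at (\<lambda>y. u (inv_into ((T \<times> U) \<inter> D) (map_prod (\<lambda>x. x) \<phi>) y)) (t, \<phi> x)" by simp
 have "eventually (\<lambda>y. y \<in> map_prod (\<lambda>x. x) \<phi> ` ((T \<times> U) \<inter> D)) (nhds (t, \<phi> x))"
  using chart_image_open[OF c2 D] c(2) tx x by (intro eventually_nhds_in_open) auto
 then have "eventually (\<lambda>y. u (inv_into ((T \<times> U) \<inter> D) (map_prod (\<lambda>x. x) \<phi>) y) = lrep U \<phi> u y) (nhds (t, \<phi> x))"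
  by (rule eventually_mono) (auto simp: sub(4)[OF c2] lrep_def inv_into_time_chart[OF cU])
 from smooth_at_transform[OF s2 this] show "smooth_at (lrep U \<phi> u) (t, \<phi> x)" .
qed

lemma local_functionI:
 assumes A: "smooth_manifold A" and T: "open T" and O: "open \<Omega>" and D: "open D"
  and ex: "\<And>t x. (t, x) \<in> D ==> t \<in> T \<and> u (t, x) \<in> \<Omega> \<and>
   (\<exists>U \<phi>. (U, \<phi>) \<in> smooth_charts A \<and> x \<in> U \<and> smooth_at (lrep U \<phi> u) (t, \<phi> x))"
 shows "local_function T A \<Omega> D u"
proof -
 note ts = time_space_facts[OF A T] and os = open_set_manifold_facts[OF O]
 note sub = open_submanifold_facts[OF ts(1) D]
 have Dc: "D \<subseteq> carrier (time_space T A)" using ex smooth_charts_carrier by (fastforce simp: ts(2))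
 have "smooth_map (open_submanifold (time_space T A) D) (open_set_manifold \<Omega>) u"
 proof (rule smooth_mapI[OF sub(1) os(1)])
  fix p assume "p \<in> carrier (open_submanifold (time_space T A) D)"
  then obtain t x where p: "p = (t, x)" "(t, x) \<in> D" unfolding sub(2) by (cases p) auto
  then show "u p \<in> carrier (open_set_manifold \<Omega>)" using ex by (simp add: os(2))
  obtain U \<phi> where c: "(U, \<phi>) \<in> smooth_charts A" "x \<in> U" "smooth_at (lrep U \<phi> u) (t, \<phi> x)" using ex p by blast
  note cU = smooth_charts_is_chart[OF c(1)]
  note c2 = smooth_charts_is_chart[OF ts(3)[OF c(1)]]
  have tT: "t \<in> T" using ex p by blast
  have "isCont (\<lambda>p. (fst p, \<phi> (snd p))) (t, x)"
   by (intro isCont_Pair isCont_o2[of _ snd \<phi>] continuous_intros) (simp add: isCont_chart[OF cU c(2)])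
  then have "isCont (\<lambda>p. lrep U \<phi> u (fst p, \<phi> (snd p))) (t, x)"
   by (rule isCont_o2) (simp add: smooth_at_isCont[OF c(3)])
  moreover have "eventually (\<lambda>p. lrep U \<phi> u (fst p, \<phi> (snd p)) = u p) (nhds (t, x))"
   by (rule eventually_mono[OF eventually_nhds_in_open[of "UNIV \<times> U"]])
    (use c(2) is_chartD(1)[OF cU] in \<open>auto simp: lrep_def is_chartD(6)[OF cU] intro!: open_Times\<close>)
  ultimately show "isCont u p" unfolding p(1) by (rule isCont_cong[THEN iffD1, rotated])
  show "\<exists>Ua \<phi> V \<psi>. (Ua, \<phi>) \<in> smooth_charts (open_submanifold (time_space T A) D) \<and>
    (V, \<psi>) \<in> smooth_charts (open_set_manifold \<Omega>) \<and> p \<in> Ua \<and> u p \<in> V \<and> smooth_at (\<lambda>y. \<psi> (u (inv_into Ua \<phi> y))) (\<phi> p)"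
  proof (intro exI conjI)
   show "(T \<times> U \<inter> D, map_prod (\<lambda>x. x) \<phi>) \<in> smooth_charts (open_submanifold (time_space T A) D)"
    by (rule sub(3)[OF ts(3)[OF c(1)]])
   show "(\<Omega>, \<lambda>x. x) \<in> smooth_charts (open_set_manifold \<Omega>)" by (rule os(3))
   show "p \<in> T \<times> U \<inter> D" "u p \<in> \<Omega>" using p tT c(2) ex by auto
   have "eventually (\<lambda>y. y \<in> map_prod (\<lambda>x. x) \<phi> ` ((T \<times> U) \<inter> D)) (nhds (t, \<phi> x))"
    using chart_image_open[OF c2 D] c(2) tT p by (intro eventually_nhds_in_open) auto
   then have "eventually (\<lambda>y. lrep U \<phi> u y = u (inv_into ((T \<times> U) \<inter> D) (map_prod (\<lambda>x. x) \<phi>) y)) (nhds (t, \<phi> x))"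
    by (rule eventually_mono) (auto simp: sub(4)[OF c2] lrep_def inv_into_time_chart[OF cU])
   from smooth_at_transform[OF c(3) this]
   show "smooth_at (\<lambda>y. u (inv_into (T \<times> U \<inter> D) (map_prod (\<lambda>x. x) \<phi>) y)) (map_prod (\<lambda>x. x) \<phi> p)" by (simp add: p)
  qed
 qed
 then show ?thesis using D Dc by (simp add: local_function_def)
qed

lemma deriv_eq_D1: "f differentiable (at t) ==> deriv f t = D1 f t (1::real)"
proof (rule DERIV_imp_deriv)
 assume "f differentiable (at t)"
 then have h: "(f has_derivative D1 f t) (at t)" by (rule D1_works)
 have l: "linear (D1 f t)" using h has_derivative_linear by blast
 have "D1 f t s = D1 f t 1 * s" for s
  using linear_cmul[OF l, of s 1] by simp
 then show "(f has_field_derivative D1 f t 1) (at t)"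
  using h unfolding has_field_derivative_def by (metis (no_types, lifting) ext)
qed

lemma D1_Pair_const: "D1 (\<lambda>y. (c, y)) y v = (0, v)" "D1 (\<lambda>s. (s, c)) s w = (w, 0)" "D2 (\<lambda>y. (c, y)) y v v' = 0"
proof -
 show *: "D1 (\<lambda>y. (c, y)) y v = (0, v)" for y v
  by (subst D1_eqI[of _ "\<lambda>v. (0, v)"]) (auto intro!: derivative_eq_intros)
 show "D1 (\<lambda>s. (s, c)) s w = (w, 0)"
  by (subst D1_eqI[of _ "\<lambda>v. (v, 0)"]) (auto intro!: derivative_eq_intros)
 show "D2 (\<lambda>y. (c, y)) y v v' = 0" by (simp add: D2_def * D1_const)
qed

lemma lrep_derivs:
 assumes c: "is_chart (U, \<phi>)" "x \<in> U" and s: "smooth_at (lrep U \<phi> u) (t, \<phi> x)"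
 shows "deriv (\<lambda>s. u (s, x)) t = D1 (lrep U \<phi> u) (t, \<phi> x) (1, 0)"
  "space_deriv (U, \<phi>) [i] u t x = D1 (lrep U \<phi> u) (t, \<phi> x) (0, i)"
  "space_deriv (U, \<phi>) [i, j] u t x = D2 (lrep U \<phi> u) (t, \<phi> x) (0, i) (0, j)"
proof -
 let ?l = "lrep U \<phi> u"
 have 1: "(\<lambda>s. u (s, x)) = (\<lambda>s. ?l (s, \<phi> x))" by (simp add: lrep_def is_chartD(6)[OF c])
 have s1: "smooth_at (\<lambda>s::real. (s, \<phi> x)) t" and s2: "smooth_at (\<lambda>y. (t, y)) (\<phi> x)" by (intro smooth_intros)+
 have "smooth_at (\<lambda>s. ?l (s, \<phi> x)) t" by (rule smooth_at_compose[OF s1 s])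
 then show "deriv (\<lambda>s. u (s, x)) t = D1 ?l (t, \<phi> x) (1, 0)"
  unfolding 1 using D1_compose[of "\<lambda>s::real. (s, \<phi> x)" t ?l 1] s1 s
  by (simp add: deriv_eq_D1 smooth_at_diffble D1_Pair_const)
 have 2: "(\<lambda>y. u (t, inv_into U \<phi> y)) = (\<lambda>y. ?l (t, y))" by (simp add: lrep_def)
 show "space_deriv (U, \<phi>) [i] u t x = D1 ?l (t, \<phi> x) (0, i)"
  unfolding space_deriv_def prod.case 2 iter_deriv_1 using D1_compose[of "\<lambda>y. (t, y)" "\<phi> x" ?l i] s2 s
  by (simp add: smooth_at_diffble D1_Pair_const)
 show "space_deriv (U, \<phi>) [i, j] u t x = D2 ?l (t, \<phi> x) (0, i) (0, j)"
  unfolding space_deriv_def prod.case 2 iter_deriv_2 using D2_compose[OF s2, of ?l i j] s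
  by (simp add: D1_Pair_const linear_0[OF linear_D1[OF s]])
qed

text \<open>The graph is the zero set of \<open>z - u(t, y)\<close>, whose derivative along
  \<open>\<partial>\<^sub>u\<close> is 1. The difference is written as a sum to fit
  \<open>D1_add\<close> and \<open>D2_add\<close>.\<close>

lemma graph_defining:
 fixes A :: "('a::{t2_space,second_countable_topology}, 'e::euclidean_space) chart set"
 assumes A: "smooth_manifold A" and T: "open T" and O: "open \<Omega>" and u: "local_function T A \<Omega> D u" and x: "(t, x) \<in> D"
  and c: "(U, \<phi>) \<in> smooth_charts A" "x \<in> U"
 defines "\<rho> \<equiv> \<lambda>w. snd (snd w) + - lrep U \<phi> u (fst w, fst (snd w))"
 shows "defining (total_space T A \<Omega>) (T \<times> U \<times> \<Omega>) (tchart \<phi>) (graph D u) (t, x, u (t, x)) \<rho>"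
  "D1 \<rho> (t, \<phi> x, u (t, x)) (a, v, r) = r - D1 (lrep U \<phi> u) (t, \<phi> x) (a, v)"
  "D2 \<rho> (t, \<phi> x, u (t, x)) (a, v, r) (a', v', r') = - D2 (lrep U \<phi> u) (t, \<phi> x) (a, v) (a', v')"
proof -
 note tt = total_space_facts[OF A T O] and lf = local_functionD[OF A T O u x]
 note cU = smooth_charts_is_chart[OF c(1)]
 let ?l = "lrep U \<phi> u" and ?w = "(t, \<phi> x, u (t, x))"
 let ?\<Pi> = "\<lambda>w::real \<times> 'e \<times> real. (fst w, fst (snd w))"
 have ls: "smooth_at ?l (t, \<phi> x)" using lf(5)[OF c] .
 have b1: "bounded_linear (\<lambda>w::real \<times> 'e \<times> real. snd (snd w))"
  by (intro bounded_linear_compose[OF bounded_linear_snd] bounded_linear_snd)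
 have b2: "bounded_linear ?\<Pi>"
  by (intro bounded_linear_Pair bounded_linear_compose[OF bounded_linear_fst] bounded_linear_fst bounded_linear_snd)
 have bm: "bounded_linear (\<lambda>r::real. - r)" by (intro bounded_linear_minus bounded_linear_ident)
 have s1: "smooth_at (\<lambda>w::real \<times> 'e \<times> real. snd (snd w)) ?w" by (rule smooth_at_linear[OF b1])
 have s2: "smooth_at (\<lambda>w. ?l (?\<Pi> w)) ?w"
  by (rule smooth_at_compose[OF smooth_at_linear[OF b2]]) (simp add: ls)
 have s3: "smooth_at (\<lambda>w. - ?l (?\<Pi> w)) ?w" by (intro smooth_intros s2)
 have \<rho>s: "smooth_at \<rho> ?w" unfolding \<rho>_def by (intro smooth_at_add s1 s3)
 have dl: "D1 (\<lambda>w. ?l (?\<Pi> w)) ?w v = D1 ?l (t, \<phi> x) (?\<Pi> v)" for v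
  using D1_compose[of ?\<Pi> ?w ?l v] smooth_at_linear[OF b2, of ?w] ls by (simp add: smooth_at_diffble D1_linear[OF b2])
 show d1: "D1 \<rho> ?w (a, v, r) = r - D1 ?l (t, \<phi> x) (a, v)" for a v r
  unfolding \<rho>_def D1_add[OF s1 s3] D1_linear_compose[OF bm s2] D1_linear[OF b1] dl by simp
 have ddl: "D2 (\<lambda>w. ?l (?\<Pi> w)) ?w v v' = D2 ?l (t, \<phi> x) (?\<Pi> v) (?\<Pi> v')" for v v'
  using D2_compose[OF smooth_at_linear[OF b2, of ?w], of ?l v v'] ls
  by (simp add: D1_linear[OF b2] D2_linear[OF b2] linear_0[OF linear_D1[OF ls]] zero_prod_def[symmetric])
 show "D2 \<rho> ?w (a, v, r) (a', v', r') = - D2 ?l (t, \<phi> x) (a, v) (a', v')"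
  unfolding \<rho>_def D2_add[OF s1 s3] D2_linear_compose[OF bm s2] D2_linear[OF b1] ddl by simp
 have nz: "D1 \<rho> ?w (0, 0, 1) \<noteq> 0" using d1[of 0 0 1] linear_0[OF linear_D1[OF ls]] by (simp add: zero_prod_def)
 have "eventually (\<lambda>y. y \<in> map_prod (\<lambda>x. x) \<phi> ` ((T \<times> U) \<inter> D)) (nhds (t, \<phi> x))"
  using chart_image_open[OF smooth_charts_is_chart[OF time_space_facts(3)[OF A T c(1)]] lf(1)] c(2) lf(2) x
  by (intro eventually_nhds_in_open) auto
 then have "eventually (\<lambda>w. ?\<Pi> w \<in> map_prod (\<lambda>x. x) \<phi> ` ((T \<times> U) \<inter> D)) (nhds ?w)"
  using eventually_smooth_at_compose[OF smooth_at_linear[OF b2, of ?w]] by simp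
 moreover have "eventually (\<lambda>w. snd (snd w) \<in> \<Omega>) (nhds ?w)"
  using eventually_smooth_at_compose[OF s1, of "\<lambda>r. r \<in> \<Omega>"] eventually_nhds_in_open[OF O lf(4)] by simp
 ultimately have "eventually (\<lambda>w. inv_into (T \<times> U \<times> \<Omega>) (tchart \<phi>) w \<in> graph D u \<longleftrightarrow> \<rho> w = 0) (nhds ?w)"
 proof eventually_elim
  case (elim w)
  then obtain s y where sy: "(s, y) \<in> D" "s \<in> T" "y \<in> U" "fst w = s" "fst (snd w) = \<phi> y" by auto
  then have w: "w = (s, \<phi> y, snd (snd w))" by (metis prod.collapse)
  have "inv_into (T \<times> U \<times> \<Omega>) (tchart \<phi>) (s, \<phi> y, snd (snd w)) = (s, y, snd (snd w))"
   using sy elim by (subst inv_into_tchart[OF cU]) (auto simp: is_chartD(6)[OF cU])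
  then have "inv_into (T \<times> U \<times> \<Omega>) (tchart \<phi>) w = (s, y, snd (snd w))" using w by simp
  moreover have "\<rho> w = snd (snd w) - u (s, y)" using sy by (simp add: \<rho>_def lrep_def is_chartD(6)[OF cU])
  ultimately show ?case using sy(1) by (auto simp: graph_def)
 qed
 then show "defining (total_space T A \<Omega>) (T \<times> U \<times> \<Omega>) (tchart \<phi>) (graph D u) (t, x, u (t, x)) \<rho>"
  unfolding defining_def using tt(3)[OF c(1)] lf c(2) x \<rho>s nz by (auto simp: graph_def)
qed

lemma graph_submanifold:
 fixes A :: "('a::{t2_space,second_countable_topology}, 'e::euclidean_space) chart set"
 assumes A: "smooth_manifold A" and T: "open T" and O: "open \<Omega>" and u: "local_function T A \<Omega> D u"
 shows "submanifold (total_space T A \<Omega>) (DIM('e) + 1) (graph D u)"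
proof (rule submanifoldI_defining[OF total_space_facts(1)[OF A T O]])
 fix p assume "p \<in> graph D u"
 then obtain t x where p: "p = (t, x, u (t, x))" "(t, x) \<in> D" by (auto simp: graph_def)
 obtain U \<phi> where "(U, \<phi>) \<in> smooth_charts A" "x \<in> U"
  using chart_at_point[OF A local_functionD(3)[OF A T O u p(2)]] by metis
 from graph_defining(1)[OF A T O u p(2) this] show "\<exists>V \<psi> \<rho>. defining (total_space T A \<Omega>) V \<psi> (graph D u) p \<rho>"
  unfolding p by blast
qed simp

section \<open>The equation as a set of jets of hypersurfaces\<close>

text \<open>For the graph of \<open>u\<close>, with defining function \<open>z - u(t, y)\<close>, this is \<open>u\<^sub>t - L u\<close>. It is homogeneous
 of degree 3 in \<open>(\<alpha>, H)\<close>; the arguments of \<open>H\<close> are tangent to the hypersurface.\<close>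

definition pol ::
 "('e => 'e => real \<times> 'e \<times> real => real) => ('e => 'e => real \<times> 'e \<times> real => real) =>
 ('e => real \<times> 'e \<times> real => real) => (real \<times> 'e \<times> real => real) => real \<times> 'e::euclidean_space \<times> real =>
 (real \<times> 'e \<times> real => real) => (real \<times> 'e \<times> real => real \<times> 'e \<times> real => real) => real" where
 "pol b c d q w \<alpha> H =
  - \<alpha> (1, 0, 0) * (\<alpha> (0, 0, 1))\<^sup>2 +
  (\<Sum>i\<in>Basis. \<Sum>j\<in>Basis. b i j w *
    H (0, \<alpha> (0, 0, 1) *\<^sub>R i, - \<alpha> (0, i, 0)) (0, \<alpha> (0, 0, 1) *\<^sub>R j, - \<alpha> (0, j, 0))) -
  \<alpha> (0, 0, 1) * (\<Sum>i\<in>Basis. \<Sum>j\<in>Basis. c i j w * \<alpha> (0, i, 0) * \<alpha> (0, j, 0)) +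
  (\<alpha> (0, 0, 1))\<^sup>2 * (\<Sum>i\<in>Basis. d i w * \<alpha> (0, i, 0)) - q w * (\<alpha> (0, 0, 1)) ^ 3"

text \<open>Taking \<open>r\<close> and \<open>s\<close> as in \<open>pol\<close> shows that the
  arguments of \<open>H\<close> there lie in the kernel of \<open>\<alpha>\<close>.\<close>

lemma pol_tangent:
 fixes \<alpha> :: "real \<times> 'e::euclidean_space \<times> real => real"
 assumes "linear \<alpha>"
 shows "\<alpha> (0, r *\<^sub>R i, s) = r * \<alpha> (0, i, 0) + s * \<alpha> (0, 0, 1)"
proof -
 have "((0::real), r *\<^sub>R i, s) = r *\<^sub>R (0, i, 0) + s *\<^sub>R (0, 0, 1)" by simp
 then show ?thesis by (simp only: linear_add[OF assms] linear_cmul[OF assms] real_scaleR_def)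
qed

text \<open>Passing to an equivalent pair multiplies each argument of \<open>H\<close>, and
  \<open>H\<close> itself on the kernel, by \<open>k\<close>; so whether \<open>pol\<close> vanishes
  depends on the jet alone.\<close>

lemma pol_jet_eq:
 fixes \<alpha> :: "real \<times> 'e::euclidean_space \<times> real => real"
 assumes l: "linear \<alpha>" and b: "\<And>v. linear (H' v)" "\<And>w. linear (\<lambda>v. H' v w)" and e: "jet_eq \<alpha> H \<alpha>' H'"
 obtains k where "k \<noteq> 0" "\<And>v. \<alpha>' v = k * \<alpha> v" "pol b c d q w \<alpha>' H' = k ^ 3 * pol b c d q w \<alpha> H"
proof -
 obtain k where k: "k \<noteq> 0" "\<And>v. \<alpha>' v = k * \<alpha> v" "\<And>v w. \<alpha> v = 0 ==> \<alpha> w = 0 ==> H' v w = k * H v w"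
  using e unfolding jet_eq_def by blast
 let ?X = "\<lambda>i::'e. ((0::real), \<alpha> (0, 0, 1) *\<^sub>R i, - \<alpha> (0, i, 0))"
 have X0: "\<alpha> (?X i) = 0" for i by (simp add: pol_tangent[OF l])
 have X': "(0, \<alpha>' (0, 0, 1) *\<^sub>R i, - \<alpha>' (0, i, 0)) = k *\<^sub>R ?X i" for i by (simp add: k(2))
 have "H' (0, \<alpha>' (0, 0, 1) *\<^sub>R i, - \<alpha>' (0, i, 0)) (0, \<alpha>' (0, 0, 1) *\<^sub>R j, - \<alpha>' (0, j, 0)) = k ^ 3 * H (?X i) (?X j)" for i j
  unfolding X' by (simp add: linear_cmul[OF b(1)] linear_cmul[OF b(2)] k(3)[OF X0 X0] power3_eq_cube del: scaleR_Pair)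
 then have "pol b c d q w \<alpha>' H' = k ^ 3 * pol b c d q w \<alpha> H"
  unfolding pol_def k(2)
  by (simp add: algebra_simps sum_distrib_left power2_eq_square power3_eq_cube)
 then show ?thesis using k that by blast
qed

section \<open>Local coefficients of the operator\<close>

text \<open>The body of the existential statement in \<open>parabolic_operator\<close>, named so
  that one choice of chart and coefficients can be passed on.\<close>

definition local_form where
 "local_form T A \<Omega> L U \<phi> W b c d q \<longleftrightarrow>
  (U, \<phi>) \<in> smooth_charts A \<and> open W \<and> W \<subseteq> T \<times> \<phi> ` U \<times> \<Omega> \<and>
  (\<forall>i\<in>Basis. \<forall>j\<in>Basis. smooth_on W (b i j) \<and> smooth_on W (c i j)) \<and>
  (\<forall>i\<in>Basis. smooth_on W (d i)) \<and> smooth_on W q \<and>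
  (\<forall>w\<in>W. \<forall>i\<in>Basis. \<forall>j\<in>Basis. b i j w = b j i w \<and> c i j w = c j i w) \<and>
  (\<forall>w\<in>W. \<forall>\<xi>. \<xi> \<noteq> 0 --> (\<Sum>i\<in>Basis. \<Sum>j\<in>Basis. b i j w * (\<xi> \<bullet> i) * (\<xi> \<bullet> j)) > 0) \<and>
  (\<forall>D u t x. local_function T A \<Omega> D u \<and> (t, x) \<in> D \<and> x \<in> U \<and> (t, \<phi> x, u (t, x)) \<in> W -->
   L u t x =
    (\<Sum>i\<in>Basis. \<Sum>j\<in>Basis. b i j (t, \<phi> x, u (t, x)) * space_deriv (U, \<phi>) [i, j] u t x) +
    (\<Sum>i\<in>Basis. \<Sum>j\<in>Basis. c i j (t, \<phi> x, u (t, x)) *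
      space_deriv (U, \<phi>) [i] u t x * space_deriv (U, \<phi>) [j] u t x) +
    (\<Sum>i\<in>Basis. d i (t, \<phi> x, u (t, x)) * space_deriv (U, \<phi>) [i] u t x) +
    q (t, \<phi> x, u (t, x)))"

lemma parabolic_operator_iff:
 "parabolic_operator T A \<Omega> L \<longleftrightarrow>
  (\<forall>t\<^sub>0\<in>T. \<forall>x\<^sub>0\<in>carrier A. \<forall>u\<^sub>0\<in>\<Omega>. \<exists>U \<phi> W b c d q.
   local_form T A \<Omega> L U \<phi> W b c d q \<and> x\<^sub>0 \<in> U \<and> (t\<^sub>0, \<phi> x\<^sub>0, u\<^sub>0) \<in> W)"
 unfolding parabolic_operator_def local_form_def by (intro ball_cong refl ex_cong1) (simp only: conj_ac)

lemma local_formD: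
 assumes "local_form T A \<Omega> L U \<phi> W b c d q"
 shows "(U, \<phi>) \<in> smooth_charts A" "open W" "W \<subseteq> T \<times> \<phi> ` U \<times> \<Omega>"
  "\<And>i j w. i \<in> Basis ==> j \<in> Basis ==> w \<in> W ==> smooth_at (b i j) w \<and> smooth_at (c i j) w"
  "\<And>i w. i \<in> Basis ==> w \<in> W ==> smooth_at (d i) w" "\<And>w. w \<in> W ==> smooth_at q w"
  "\<And>w \<xi>. w \<in> W ==> \<xi> \<noteq> 0 ==> (\<Sum>i\<in>Basis. \<Sum>j\<in>Basis. b i j w * (\<xi> \<bullet> i) * (\<xi> \<bullet> j)) > 0"
 using assms by (auto simp: local_form_def smooth_on_iff)

lemma pe_manifoldD:
 assumes "pe_manifold T A \<Omega>"
 shows "smooth_manifold A" "open T" "open \<Omega>" "smooth_manifold (total_space T A \<Omega>)"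
  "carrier (total_space T A \<Omega>) = T \<times> carrier A \<times> \<Omega>"
proof -
 show "smooth_manifold A" "open T" "open \<Omega>"
  using assms by (auto simp: pe_manifold_def nonempty_open_interval_def connected_manifold_def)
 then show "smooth_manifold (total_space T A \<Omega>)" "carrier (total_space T A \<Omega>) = T \<times> carrier A \<times> \<Omega>"
  using total_space_facts by blast+
qed

lemma bilinear_D2:
 assumes "smooth_at f x" shows "linear (D2 f x v)" "linear (\<lambda>v. D2 f x v w)"
 using linear_D2_1[OF assms] linear_D2_2[OF assms] by auto

text \<open>Computed for the defining function \<open>\<sigma>\<close> of
  \<open>graph_defining\<close>, for which \<open>pol\<close> is the difference of the two sides of
  the equation; any other \<open>\<rho>\<close> changes \<open>pol\<close> by a nonzero
  factor.\<close>

lemma pol_graph: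
 fixes A :: "('a::{t2_space,second_countable_topology}, 'e::euclidean_space) chart set"
 assumes pm: "pe_manifold T A \<Omega>" and lf: "local_form T A \<Omega> L U \<phi> W b c d q"
  and u: "local_function T A \<Omega> D u" "(t, x) \<in> D" "x \<in> U" "(t, \<phi> x, u (t, x)) \<in> W"
  and \<rho>: "defining (total_space T A \<Omega>) (T \<times> U \<times> \<Omega>) (tchart \<phi>) (graph D u) (t, x, u (t, x)) \<rho>"
 shows "pol b c d q (t, \<phi> x, u (t, x)) (D1 \<rho> (t, \<phi> x, u (t, x))) (D2 \<rho> (t, \<phi> x, u (t, x))) = 0 \<longleftrightarrow>
  deriv (\<lambda>s. u (s, x)) t = L u t x"
proof -
 note P = pe_manifoldD[OF pm] and F = local_formD[OF lf]
 let ?w = "(t, \<phi> x, u (t, x))"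
 define \<sigma> where "\<sigma> = (\<lambda>w. snd (snd w) + - lrep U \<phi> u (fst w, fst (snd w)))"
 note g = graph_defining[OF P(1-3) u(1,2) F(1) u(3), folded \<sigma>_def]
 have ls: "smooth_at (lrep U \<phi> u) (t, \<phi> x)" by (rule local_functionD(5)[OF P(1-3) u(1,2) F(1) u(3)])
 note ld = lrep_derivs[OF smooth_charts_is_chart[OF F(1)] u(3) ls]
 let ?l1 = "D1 (lrep U \<phi> u) (t, \<phi> x)" and ?l2 = "D2 (lrep U \<phi> u) (t, \<phi> x)"
 have l0: "?l1 (0, 0) = 0" using linear_0[OF linear_D1[OF ls]] by (simp add: zero_prod_def)
 have Lu: "L u t x = (\<Sum>i\<in>Basis. \<Sum>j\<in>Basis. b i j ?w * ?l2 (0, i) (0, j)) +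
   (\<Sum>i\<in>Basis. \<Sum>j\<in>Basis. c i j ?w * ?l1 (0, i) * ?l1 (0, j)) + (\<Sum>i\<in>Basis. d i ?w * ?l1 (0, i)) + q ?w"
  using lf u ld unfolding local_form_def by simp
 have "pol b c d q ?w (D1 \<sigma> ?w) (D2 \<sigma> ?w) = deriv (\<lambda>s. u (s, x)) t - L u t x"
  unfolding pol_def Lu ld g(2,3) by (simp add: l0 sum_negf)
 moreover have s: "smooth_at \<rho> ?w" "smooth_at \<sigma> ?w" using definingD(4)[OF \<rho>] definingD(4)[OF g(1)] by auto
 moreover have "jet_eq (D1 \<sigma> ?w) (D2 \<sigma> ?w) (D1 \<rho> ?w) (D2 \<rho> ?w)"
  using defining_unique[OF P(4) g(1) \<rho>] by simp
 then obtain k where "k \<noteq> 0" "pol b c d q ?w (D1 \<rho> ?w) (D2 \<rho> ?w) = k ^ 3 * pol b c d q ?w (D1 \<sigma> ?w) (D2 \<sigma> ?w)"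
  using pol_jet_eq[OF linear_D1[OF s(2)] bilinear_D2[OF s(1)]] by metis
 ultimately show ?thesis by auto
qed

section \<open>Limits of jets and openness of the condition \<open>pol \<noteq> 0\<close>\<close>

lemma tendsto_D1:
 fixes f :: "'a::euclidean_space => 'b::euclidean_space"
 assumes f: "smooth_at f x" and "(y \<longlongrightarrow> x) F" "(v \<longlongrightarrow> v0) F"
 shows "((\<lambda>k. D1 f (y k) (v k)) \<longlongrightarrow> D1 f x v0) F"
proof -
 have "smooth_at (\<lambda>p. D1 f (fst p) (snd p)) (x, v0)" by (intro smooth_intros) (simp add: f)
 from isCont_tendsto_compose[OF smooth_at_isCont[OF this] tendsto_Pair[OF assms(2,3)]] show ?thesis by simp
qed

lemma tendsto_D2:
 fixes f :: "'a::euclidean_space => 'b::euclidean_space"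
 assumes f: "smooth_at f x" and y: "(y \<longlongrightarrow> x) F" and v: "(v \<longlongrightarrow> v0) F" and w: "(w \<longlongrightarrow> w0) F"
 shows "((\<lambda>k. D2 f (y k) (v k) (w k)) \<longlongrightarrow> D2 f x v0 w0) F"
proof -
 have "eventually (\<lambda>k. smooth_at f (y k)) F"
  using eventually_compose_filterlim[OF smooth_at_eventually[OF f] y] .
 then have "eventually (\<lambda>k. (\<Sum>i\<in>Basis. \<Sum>j\<in>Basis. ((v k \<bullet> i) * (w k \<bullet> j)) *\<^sub>R D2 f (y k) i j) = D2 f (y k) (v k) (w k)) F"
  by (rule eventually_mono) (simp add: D2_basis_sum[symmetric])
 moreover have "((\<lambda>k. D2 f (y k) i j) \<longlongrightarrow> D2 f x i j) F" for i j
  by (rule isCont_tendsto_compose[OF smooth_at_isCont y, of "\<lambda>y. D2 f y i j"]) (intro smooth_intros f)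
 then have "((\<lambda>k. \<Sum>i\<in>Basis. \<Sum>j\<in>Basis. ((v k \<bullet> i) * (w k \<bullet> j)) *\<^sub>R D2 f (y k) i j) \<longlongrightarrow>
   (\<Sum>i\<in>Basis. \<Sum>j\<in>Basis. ((v0 \<bullet> i) * (w0 \<bullet> j)) *\<^sub>R D2 f x i j)) F"
  by (intro tendsto_sum tendsto_scaleR tendsto_mult tendsto_inner v w tendsto_const)
 ultimately show ?thesis using D2_basis_sum[OF f, of v0 w0] by (simp add: tendsto_cong)
qed

text \<open>In finite dimension pointwise convergence to the identity is convergence in norm. Once
  the distance is below 1/2 the maps are injective, thus invertible, and their inverses are close to
  the identity too.\<close>

lemma near_identity:
 fixes M :: "nat => 'v::euclidean_space => 'v"
 assumes l: "\<And>k. linear (M k)" and lim: "\<And>x. (\<lambda>k. M k x) \<longlonglongrightarrow> x"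
 obtains J where "eventually (\<lambda>k. \<forall>y. M k (J k y) = y) sequentially"
  "\<And>y y0. y \<longlonglongrightarrow> y0 ==> (\<lambda>k. J k (y k)) \<longlonglongrightarrow> y0"
proof -
 \<comment> \<open>An upper bound for the operator norm of \<open>M k - id\<close>, computed on the
   basis.\<close>
 define \<epsilon> where "\<epsilon> k = (\<Sum>b\<in>Basis. norm (M k b - b))" for k
 have "\<epsilon> \<longlonglongrightarrow> (\<Sum>b\<in>(Basis::'v set). norm (b - b))" unfolding \<epsilon>_def
  by (intro tendsto_sum tendsto_norm tendsto_diff lim tendsto_const)
 then have \<epsilon>0: "\<epsilon> \<longlonglongrightarrow> 0" by simp
 have bd: "norm (M k x - x) \<le> \<epsilon> k * norm x" for k x
 proof -
  have "M k x - x = M k (\<Sum>b\<in>Basis. (x \<bullet> b) *\<^sub>R b) - (\<Sum>b\<in>Basis. (x \<bullet> b) *\<^sub>R b)" by (simp add: euclidean_representation)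
  also have "\<dots> = (\<Sum>b\<in>Basis. (x \<bullet> b) *\<^sub>R (M k b - b))"
   by (simp add: linear_sum[OF l] linear_cmul[OF l] sum_subtractf scaleR_diff_right del: euclidean_representation)
  also have "norm \<dots> \<le> (\<Sum>b\<in>Basis. norm (M k b - b) * norm x)"
   by (rule sum_norm_le) (simp add: mult.commute mult_right_mono Basis_le_norm)
  finally show ?thesis by (simp add: \<epsilon>_def sum_distrib_right)
 qed
 have ev: "eventually (\<lambda>k. \<epsilon> k < 1/2) sequentially" by (rule order_tendstoD(2)[OF \<epsilon>0]) simp
 have lower: "norm x \<le> 2 * norm (M k x)" if "\<epsilon> k < 1/2" for k x
 proof -
  have "norm x \<le> norm (M k x) + norm (M k x - x)" by (metis norm_minus_commute norm_triangle_sub)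
  also have "norm (M k x - x) \<le> 1/2 * norm x" using bd[of k x] that by (meson mult_right_mono norm_ge_zero order_trans less_imp_le)
  finally show ?thesis by simp
 qed
 have sur: "M k (inv (M k) y) = y" if "\<epsilon> k < 1/2" for k y
 proof -
  have "inj (M k)" using lower[OF that] linear_injective_0[OF l] by (metis mult_zero_right norm_eq_zero norm_le_zero_iff)
  then have "surj (M k)" using linear_injective_imp_surjective[OF l] by blast
  then show ?thesis by (rule surj_f_inv_f)
 qed
 show ?thesis
 proof (rule that[of "\<lambda>k. inv (M k)"])
  show "eventually (\<lambda>k. \<forall>y. M k (inv (M k) y) = y) sequentially" using ev sur by (auto elim: eventually_mono)
  fix y y0 assume y: "y \<longlonglongrightarrow> (y0::'v)"
  have "eventually (\<lambda>k. norm (inv (M k) (y k) - y k) \<le> \<epsilon> k * (2 * norm (y k))) sequentially"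
   using ev
  proof (rule eventually_mono)
   fix k assume k: "\<epsilon> k < 1/2"
   let ?x = "inv (M k) (y k)"
   have "norm (?x - y k) \<le> \<epsilon> k * norm ?x" using bd[of k ?x] sur[OF k] by (simp add: norm_minus_commute)
   also have "\<dots> \<le> \<epsilon> k * (2 * norm (y k))"
    using lower[OF k, of ?x] sur[OF k] by (intro mult_left_mono) (auto simp: \<epsilon>_def intro!: sum_nonneg)
   finally show "norm (?x - y k) \<le> \<epsilon> k * (2 * norm (y k))" .
  qed
  moreover have "(\<lambda>k. \<epsilon> k * (2 * norm (y k))) \<longlonglongrightarrow> 0 * (2 * norm y0)"
   by (intro tendsto_mult \<epsilon>0 tendsto_norm y tendsto_const)
  ultimately have "(\<lambda>k. inv (M k) (y k) - y k) \<longlonglongrightarrow> 0" using Lim_null_comparison by fastforce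
  from tendsto_add[OF this y] show "(\<lambda>k. inv (M k) (y k)) \<longlonglongrightarrow> y0" by simp
 qed
qed

text \<open>Of \<open>H\<close> only the values at the tangent vectors that enter \<open>pol\<close>
  have to converge, since a jet does not control the Hessian off the tangent space.\<close>

lemma pol_tendsto:
 fixes \<alpha> :: "'k => real \<times> 'e::euclidean_space \<times> real => real"
 assumes w: "(w \<longlongrightarrow> w0) F"
  and co: "\<And>i j. i \<in> Basis ==> j \<in> Basis ==> isCont (b i j) w0 \<and> isCont (c i j) w0" "\<And>i. i \<in> Basis ==> isCont (d i) w0" "isCont q w0"
  and \<alpha>: "\<And>v. ((\<lambda>k. \<alpha> k v) \<longlongrightarrow> \<alpha>0 v) F"
  and H: "\<And>i j. i \<in> Basis ==> j \<in> Basis ==>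
   ((\<lambda>k. H k (0, \<alpha> k (0, 0, 1) *\<^sub>R i, - \<alpha> k (0, i, 0)) (0, \<alpha> k (0, 0, 1) *\<^sub>R j, - \<alpha> k (0, j, 0))) \<longlongrightarrow>
    H0 (0, \<alpha>0 (0, 0, 1) *\<^sub>R i, - \<alpha>0 (0, i, 0)) (0, \<alpha>0 (0, 0, 1) *\<^sub>R j, - \<alpha>0 (0, j, 0))) F"
 shows "((\<lambda>k. pol b c d q (w k) (\<alpha> k) (H k)) \<longlongrightarrow> pol b c d q w0 \<alpha>0 H0) F"
 unfolding pol_def
 by (intro tendsto_add tendsto_diff tendsto_mult tendsto_minus tendsto_power tendsto_sum \<alpha> H)
  (use co w in \<open>auto intro: isCont_tendsto_compose\<close>)

abbreviation total_jet where
 "total_jet T A \<Omega> \<equiv> jet (total_space T A \<Omega>) 2 (DIM('e) + 1)"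
 for A :: "('a::{t2_space,second_countable_topology}, 'e::euclidean_space) chart set"

abbreviation total_defining where
 "total_defining T A \<Omega> U \<phi> \<equiv> defining (total_space T A \<Omega>) (T \<times> U \<times> \<Omega>) (tchart \<phi>)"

text \<open>The open set that keeps jets with \<open>pol \<noteq> 0\<close> outside the closure. It
  asks for the existence of a defining function; by \<open>bad_jets_iff\<close> any one will
  do.\<close>

definition bad_jets where
 "bad_jets T A \<Omega> U \<phi> W b c d q =
  {total_jet T A \<Omega> p L | p L \<rho>.
   submanifold (total_space T A \<Omega>) (DIM('e) + 1) L \<and>
   total_defining T A \<Omega> U \<phi> L p \<rho> \<and> tchart \<phi> p \<in> W \<and>
   D1 \<rho> (tchart \<phi> p) (0, 0, 1) \<noteq> 0 \<and> pol b c d q (tchart \<phi> p) (D1 \<rho> (tchart \<phi> p)) (D2 \<rho> (tchart \<phi> p)) \<noteq> 0}"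
 for A :: "('a::{t2_space,second_countable_topology}, 'e::euclidean_space) chart set"

lemma bad_jets_iff:
 fixes A :: "('a::{t2_space,second_countable_topology}, 'e::euclidean_space) chart set"
 assumes pm: "pe_manifold T A \<Omega>" and L: "submanifold (total_space T A \<Omega>) (DIM('e) + 1) L"
  and \<rho>: "total_defining T A \<Omega> U \<phi> L p \<rho>"
 shows "total_jet T A \<Omega> p L \<in> bad_jets T A \<Omega> U \<phi> W b c d q \<longleftrightarrow>
  tchart \<phi> p \<in> W \<and> D1 \<rho> (tchart \<phi> p) (0, 0, 1) \<noteq> 0 \<and>
  pol b c d q (tchart \<phi> p) (D1 \<rho> (tchart \<phi> p)) (D2 \<rho> (tchart \<phi> p)) \<noteq> 0" (is "?j \<in> ?B \<longleftrightarrow> ?R")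
proof
 note P = pe_manifoldD[OF pm]
 have m: "DIM(real \<times> 'e \<times> real) = DIM('e) + 1 + 1" by simp
 assume "?j \<in> ?B"
 then obtain p' M \<sigma> where M: "?j = total_jet T A \<Omega> p' M"
  "submanifold (total_space T A \<Omega>) (DIM('e) + 1) M"
  "total_defining T A \<Omega> U \<phi> M p' \<sigma>" "tchart \<phi> p' \<in> W"
  "D1 \<sigma> (tchart \<phi> p') (0, 0, 1) \<noteq> 0" "pol b c d q (tchart \<phi> p') (D1 \<sigma> (tchart \<phi> p')) (D2 \<sigma> (tchart \<phi> p')) \<noteq> 0"
  unfolding bad_jets_def by blast
 have p': "p' = p" using M(1) by (simp add: jet_def)
 have e: "jet_eq (D1 \<sigma> (tchart \<phi> p)) (D2 \<sigma> (tchart \<phi> p)) (D1 \<rho> (tchart \<phi> p)) (D2 \<rho> (tchart \<phi> p))"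
  using jet_eq_iff[OF P(4) m M(3)[unfolded p'] \<rho> L] M(1) p' by simp
 note s = definingD(4)[OF \<rho>] and s' = definingD(4)[OF M(3)[unfolded p']]
 obtain k where "k \<noteq> 0" "\<And>v. D1 \<rho> (tchart \<phi> p) v = k * D1 \<sigma> (tchart \<phi> p) v"
  "pol b c d q (tchart \<phi> p) (D1 \<rho> (tchart \<phi> p)) (D2 \<rho> (tchart \<phi> p)) = k ^ 3 * pol b c d q (tchart \<phi> p) (D1 \<sigma> (tchart \<phi> p)) (D2 \<sigma> (tchart \<phi> p))"
  using pol_jet_eq[OF linear_D1[OF s'] bilinear_D2[OF s] e, of b c d q "tchart \<phi> p"] by metis
 then show ?R using M p' by simp
next
 assume ?R then show "?j \<in> ?B" unfolding bad_jets_def using L \<rho> by blast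
qed

text \<open>If the parametrization of \<open>L\<^sub>k\<close> converges in the \<open>C\<^sup>2\<close> sense to that of \<open>L\<close>, then, with suitable scaling,
 so do the pairs \<open>(\<alpha>, H)\<close>. Here \<open>a\<^sub>k\<close> and \<open>A\<^sub>k\<close> are the first and second derivatives of the parametrizations, and
 the kernel of \<open>\<alpha>\<^sub>k\<close> is compared with that of \<open>\<alpha>\<close> by means of the maps \<open>x \<mapsto> a\<^sub>k (\<xi> x) + \<alpha>(x) e\<close>, which
 tend to the identity.\<close>

lemma jet_limit:
 fixes \<alpha> :: "real \<times> 'e::euclidean_space \<times> real => real"
  and a :: "nat => real \<times> 'e \<times> real => real \<times> 'e \<times> real"
 defines "e \<equiv> (0, 0, 1) :: real \<times> 'e \<times> real"
 assumes \<alpha>: "linear \<alpha>" "\<alpha> e = 1" and \<xi>: "linear \<xi>" "\<And>x. \<xi> x \<in> S" "\<And>x. a0 (\<xi> x) = x - \<alpha> x *\<^sub>R e"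
  and H: "\<And>v w. v \<in> S ==> w \<in> S ==> H (a0 v) (a0 w) = - \<alpha> (A0 v w)"
  and a: "\<And>k. linear (a k)" and \<alpha>k: "\<And>k. linear (\<alpha>k k)" "\<And>k. \<exists>v. \<alpha>k k v \<noteq> 0" "\<And>k v. v \<in> S ==> \<alpha>k k (a k v) = 0"
  and Hk: "\<And>k v. linear (Hk k v)" "\<And>k w. linear (\<lambda>v. Hk k v w)" "\<And>k v w. v \<in> S ==> w \<in> S ==> Hk k (a k v) (a k w) = - \<alpha>k k (A k v w)"
  and lim: "\<And>v v0. (\<And>k. v k \<in> S) ==> v \<longlonglongrightarrow> v0 ==> v0 \<in> S ==> (\<lambda>k. a k (v k)) \<longlonglongrightarrow> a0 v0"
   "\<And>v v0 w w0. (\<And>k. v k \<in> S) ==> v \<longlonglongrightarrow> v0 ==> v0 \<in> S ==> (\<And>k. w k \<in> S) ==> w \<longlonglongrightarrow> w0 ==> w0 \<in> S ==>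
    (\<lambda>k. A k (v k) (w k)) \<longlonglongrightarrow> A0 v0 w0"
  and w: "w \<longlonglongrightarrow> w0"
  and co: "\<And>i j. i \<in> Basis ==> j \<in> Basis ==> isCont (b i j) w0 \<and> isCont (c i j) w0" "\<And>i. i \<in> Basis ==> isCont (d i) w0" "isCont q w0"
  and nz: "pol b c d q w0 \<alpha> H \<noteq> 0"
 shows "eventually (\<lambda>k. \<alpha>k k e \<noteq> 0 \<and> pol b c d q (w k) (\<alpha>k k) (Hk k) \<noteq> 0) sequentially"
proof -
 define M where "M k x = a k (\<xi> x) + \<alpha> x *\<^sub>R e" for k x
 have Ml: "linear (M k)" for k
  unfolding M_def by (intro linearI) (simp_all add: linear_add[OF a] linear_add[OF \<xi>(1)] linear_add[OF \<alpha>(1)]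
    linear_cmul[OF a] linear_cmul[OF \<xi>(1)] linear_cmul[OF \<alpha>(1)] algebra_simps)
 have Mlim: "(\<lambda>k. M k x) \<longlonglongrightarrow> x" for x
 proof -
  have "(\<lambda>k. a k (\<xi> x) + \<alpha> x *\<^sub>R e) \<longlonglongrightarrow> a0 (\<xi> x) + \<alpha> x *\<^sub>R e"
   by (intro tendsto_add tendsto_const lim(1) \<xi>(2))
  then show ?thesis by (simp add: M_def \<xi>(3))
 qed
 obtain J where J: "eventually (\<lambda>k. \<forall>y. M k (J k y) = y) sequentially"
  "\<And>y y0. y \<longlonglongrightarrow> y0 ==> (\<lambda>k. J k (y k)) \<longlonglongrightarrow> y0" by (rule near_identity[OF Ml Mlim]) (rule that, (assumption | blast)+)
 \<comment> \<open>Dividing by \<open>r k\<close> normalizes \<open>\<alpha>k k\<close> to the value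
   1 at \<open>e\<close>, as \<open>\<alpha>\<close> is.\<close>
 define r where "r k = \<alpha>k k e" for k
 \<comment> \<open>\<open>\<alpha>k k\<close> kills the image of \<open>S\<close> under
   \<open>a k\<close>, so on \<open>M k x\<close> only the multiple \<open>\<alpha> x\<close> of
   \<open>e\<close> contributes.\<close>
 have \<alpha>J: "\<alpha>k k y = \<alpha> (J k y) * r k" if "\<forall>y. M k (J k y) = y" for k y
 proof -
  have "\<alpha>k k y = \<alpha>k k (M k (J k y))" by (simp only: that[rule_format])
  also have "\<dots> = \<alpha> (J k y) * r k" unfolding M_def r_def
   by (simp add: linear_add[OF \<alpha>k(1)] linear_cmul[OF \<alpha>k(1)] \<alpha>k(3) \<xi>(2))
  finally show ?thesis .
 qed
 have r0: "r k \<noteq> 0" if "\<forall>y. M k (J k y) = y" for k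
  using \<alpha>J[OF that] \<alpha>k(2)[of k] by (metis mult_zero_right)
 have c\<alpha>: "isCont \<alpha> x" for x using \<alpha>(1) by (simp add: linear_conv_bounded_linear linear_continuous_at)
 have c\<xi>: "isCont \<xi> x" for x using \<xi>(1) by (simp add: linear_conv_bounded_linear linear_continuous_at)
 have \<alpha>lim: "(\<lambda>k. \<alpha>k k (y k) / r k) \<longlonglongrightarrow> \<alpha> y0" if "y \<longlonglongrightarrow> y0" for y y0
 proof -
  have "(\<lambda>k. \<alpha> (J k (y k))) \<longlonglongrightarrow> \<alpha> y0" by (rule isCont_tendsto_compose[OF c\<alpha> J(2)[OF that]])
  moreover have "eventually (\<lambda>k. \<alpha> (J k (y k)) = \<alpha>k k (y k) / r k) sequentially"
   using J(1) by (rule eventually_mono) (use \<alpha>J r0 in simp)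
  ultimately show ?thesis by (rule Lim_transform_eventually)
 qed
 have \<alpha>lim': "(\<lambda>k. \<alpha>k k y / r k) \<longlonglongrightarrow> \<alpha> y" for y by (rule \<alpha>lim) simp
 let ?X = "\<lambda>\<alpha> i. ((0::real), \<alpha> (0, 0, 1) *\<^sub>R i, - \<alpha> (0, i, 0))"
 let ?\<alpha>n = "\<lambda>k v. \<alpha>k k v / r k" and ?Hn = "\<lambda>k v w. Hk k v w / r k"
 have X\<alpha>: "\<beta> (?X \<beta> i) = 0" if "linear \<beta>" for \<beta> and i :: 'e by (simp add: pol_tangent[OF that])
 have ln: "linear (?\<alpha>n k)" for k
  by (intro linearI) (simp_all add: linear_add[OF \<alpha>k(1)] linear_cmul[OF \<alpha>k(1)] add_divide_distrib)
 have Hlim: "(\<lambda>k. ?Hn k (?X (?\<alpha>n k) i) (?X (?\<alpha>n k) j)) \<longlonglongrightarrow> H (?X \<alpha> i) (?X \<alpha> j)" for i j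
 proof -
  have Xlim: "(\<lambda>k. ?X (?\<alpha>n k) i) \<longlonglongrightarrow> ?X \<alpha> i" for i
   by (intro tendsto_Pair tendsto_const tendsto_scaleR tendsto_minus \<alpha>lim')
  \<comment> \<open>For large \<open>k\<close> this is the parameter vector in \<open>S\<close> that
    \<open>a k\<close> maps to the tangent vector of index \<open>i\<close> in \<open>pol\<close>:
    \<open>\<alpha>\<close> vanishes on the preimage of that vector under \<open>M k\<close>, where
    \<open>M k\<close> therefore acts as \<open>a k \<circ> \<xi>\<close>.\<close>
  define z where "z i k = \<xi> (J k (?X (?\<alpha>n k) i))" for i k
  have zlim: "z i \<longlonglongrightarrow> \<xi> (?X \<alpha> i)" for i unfolding z_def by (rule isCont_tendsto_compose[OF c\<xi> J(2)[OF Xlim]])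
  have zS: "z i k \<in> S" for i k by (simp add: z_def \<xi>(2))
  have Alim: "(\<lambda>k. A k (z i k) (z j k)) \<longlonglongrightarrow> A0 (\<xi> (?X \<alpha> i)) (\<xi> (?X \<alpha> j))"
   by (rule lim(2)) (simp_all add: zS zlim \<xi>(2))
  have "(\<lambda>k. - (\<alpha>k k (A k (z i k) (z j k)) / r k)) \<longlonglongrightarrow> - \<alpha> (A0 (\<xi> (?X \<alpha> i)) (\<xi> (?X \<alpha> j)))"
   by (intro tendsto_minus \<alpha>lim Alim)
  also have "- \<alpha> (A0 (\<xi> (?X \<alpha> i)) (\<xi> (?X \<alpha> j))) = H (?X \<alpha> i) (?X \<alpha> j)"
   using H[OF \<xi>(2) \<xi>(2), of "?X \<alpha> i" "?X \<alpha> j"] by (simp add: \<xi>(3) X\<alpha>[OF \<alpha>(1)])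
  finally have l: "(\<lambda>k. - (\<alpha>k k (A k (z i k) (z j k)) / r k)) \<longlonglongrightarrow> H (?X \<alpha> i) (?X \<alpha> j)" .
  have "eventually (\<lambda>k. - (\<alpha>k k (A k (z i k) (z j k)) / r k) = ?Hn k (?X (?\<alpha>n k) i) (?X (?\<alpha>n k) j)) sequentially"
   using J(1)
  proof (rule eventually_mono)
   fix k assume k: "\<forall>y. M k (J k y) = y"
   have az: "a k (z i k) = ?X (?\<alpha>n k) i" for i
   proof -
    let ?x = "?X (?\<alpha>n k) i"
    have "\<alpha>k k ?x = 0" using X\<alpha>[OF ln, of k i] r0[OF k] by simp
    then have "\<alpha> (J k ?x) = 0" using \<alpha>J[OF k, of ?x] r0[OF k] by simp
    then have "M k (J k ?x) = a k (z i k)" by (simp add: M_def z_def)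
    then show ?thesis by (simp only: k[rule_format])
   qed
   show "- (\<alpha>k k (A k (z i k) (z j k)) / r k) = ?Hn k (?X (?\<alpha>n k) i) (?X (?\<alpha>n k) j)"
    using Hk(3)[OF zS zS, of k i k j k] by (simp add: az)
  qed
  with l show ?thesis by (rule Lim_transform_eventually)
 qed
 have "(\<lambda>k. pol b c d q (w k) (?\<alpha>n k) (?Hn k)) \<longlonglongrightarrow> pol b c d q w0 \<alpha> H"
  by (rule pol_tendsto[where \<alpha> = ?\<alpha>n and H = ?Hn and ?\<alpha>0.0 = \<alpha> and ?H0.0 = H, OF w co \<alpha>lim' Hlim])
 then have ev: "eventually (\<lambda>k. pol b c d q (w k) (?\<alpha>n k) (?Hn k) \<noteq> 0) sequentially"
  using nz by (rule tendsto_imp_eventually_ne)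
 show ?thesis using ev J(1)
 proof eventually_elim
  case (elim k)
  have r: "r k \<noteq> 0" using r0 elim by blast
  have je: "jet_eq (?\<alpha>n k) (?Hn k) (\<alpha>k k) (Hk k)"
   unfolding jet_eq_def by (rule exI[of _ "r k"]) (use r in simp)
  obtain l where "l \<noteq> 0" "pol b c d q (w k) (\<alpha>k k) (Hk k) = l ^ 3 * pol b c d q (w k) (?\<alpha>n k) (?Hn k)"
   using pol_jet_eq[OF ln Hk(1,2) je, of b c d q "w k"] by metis
  then show ?case using elim r by (simp add: r_def)
 qed
qed

text \<open>The neighbourhoods of jets bound derivatives on unit vectors only; homogeneity extends
  the bound to all of \<open>S\<close>.\<close>

lemma unit_bound:
 fixes f g :: "'v::euclidean_space => 'w::real_normed_vector"
 assumes "linear f" "linear g" "subspace S" "\<And>v. v \<in> S ==> norm v = 1 ==> norm (f v - g v) \<le> e" "v \<in> S"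
 shows "norm (f v - g v) \<le> e * norm v"
proof (cases "v = 0")
 case True
 then show ?thesis using linear_0 assms(1,2) by (metis diff_zero mult_zero_right norm_zero order_refl)
next
 case False
 let ?u = "(1 / norm v) *\<^sub>R v"
 have 1: "norm (f ?u - g ?u) \<le> e" using assms(3,4,5) False by (simp add: subspace_scale)
 have 2: "f ?u - g ?u = (1 / norm v) *\<^sub>R (f v - g v)"
  by (simp only: linear_cmul[OF assms(1)] linear_cmul[OF assms(2)] scaleR_diff_right)
 have "norm (f v - g v) / norm v \<le> e" using 1 unfolding 2 norm_scaleR by simp
 then show ?thesis using False by (simp add: pos_divide_le_eq)
qed

text \<open>If it were not open at some jet, there would be jets outside it whose parametrizations
  converge to the given one; \<open>jet_limit\<close> shows that these eventually belong to
  it.\<close>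

lemma bad_jets_open:
 fixes A :: "('a::{t2_space,second_countable_topology}, 'e::euclidean_space) chart set"
 assumes pm: "pe_manifold T A \<Omega>" and lf: "local_form T A \<Omega> L U \<phi> W b c d q"
 shows "jet_open (total_space T A \<Omega>) 2 (DIM('e) + 1) (bad_jets T A \<Omega> U \<phi> W b c d q)"
 unfolding jet_open_def
proof (intro conjI allI impI)
 note P = pe_manifoldD[OF pm] and F = local_formD[OF lf]
 have m: "DIM(real \<times> 'e \<times> real) = DIM('e) + 1 + 1" by simp
 let ?N = "total_space T A \<Omega>" and ?V0 = "T \<times> U \<times> \<Omega>" and ?\<psi>0 = "tchart \<phi>" and ?m = "DIM('e) + 1"
 let ?B = "bad_jets T A \<Omega> U \<phi> W b c d q"
 show "?B \<subseteq> jet_space ?N 2 ?m" unfolding bad_jets_def jet_space_def using definingD(3) by fast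
 fix S L1 x1 U1 \<phi>1 V1 \<psi>1
 assume "subspace S \<and> submanifold ?N ?m L1 \<and> slice_chart ?N L1 S (U1, \<phi>1) \<and>
  (V1, \<psi>1) \<in> smooth_charts ?N \<and> x1 \<in> L1 \<inter> U1 \<inter> V1 \<and> jet ?N 2 ?m x1 L1 \<in> ?B"
 then have h: "subspace S" "submanifold ?N ?m L1" "slice_chart ?N L1 S (U1, \<phi>1)" "(V1, \<psi>1) \<in> smooth_charts ?N"
  "x1 \<in> L1" "x1 \<in> U1" "x1 \<in> V1" "jet ?N 2 ?m x1 L1 \<in> ?B" by auto
 have c0: "(?V0, ?\<psi>0) \<in> smooth_charts ?N" by (rule total_space_facts(3)[OF P(1-3) F(1)])
 have c1: "(U1, \<phi>1) \<in> smooth_charts ?N" using h(3) by (simp add: slice_chart_def)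
 note C0 = smooth_charts_is_chart[OF c0] and CV1 = smooth_charts_is_chart[OF h(4)] and C1 = smooth_charts_is_chart[OF c1]
 have x1V: "x1 \<in> ?V0" using h(8) definingD(2) unfolding bad_jets_def by (fastforce simp: jet_def)
 obtain \<rho>' where \<rho>': "defining ?N ?V0 ?\<psi>0 L1 x1 \<rho>'" using submanifold_defining[OF P(4) h(2) m c0 h(5) x1V] .
 let ?w0 = "?\<psi>0 x1" and ?e = "(0, 0, 1) :: real \<times> 'e \<times> real"
 have n0: "D1 \<rho>' ?w0 ?e \<noteq> 0" using bad_jets_iff[OF pm h(2) \<rho>'] h(8) by blast
 define \<rho> where "\<rho> = (\<lambda>y. inverse (D1 \<rho>' ?w0 ?e) * \<rho>' y)"
 have i0: "inverse (D1 \<rho>' ?w0 ?e) \<noteq> 0" using n0 by simp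
 have \<rho>: "defining ?N ?V0 ?\<psi>0 L1 x1 \<rho>" "D1 \<rho> ?w0 ?e = 1"
  using defining_scale[OF \<rho>' i0, folded \<rho>_def] n0 by auto
 have W: "?w0 \<in> W" and nz: "pol b c d q ?w0 (D1 \<rho> ?w0) (D2 \<rho> ?w0) \<noteq> 0"
  using bad_jets_iff[OF pm h(2) \<rho>(1)] h(8) by blast+
 let ?k = "\<lambda>y. ?\<psi>0 (inv_into V1 \<psi>1 y)" and ?y1 = "\<psi>1 x1" and ?g = "\<lambda>y. \<psi>1 (inv_into U1 \<phi>1 y)"
 have ks: "smooth_at ?k ?y1" by (rule smooth_charts_transition[OF P(4) h(4) c0 h(7) x1V])
 have k0: "?k ?y1 = ?w0" by (simp add: is_chartD(6)[OF CV1 h(7)])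
 have gs: "smooth_at ?g (\<phi>1 x1)" by (rule smooth_charts_transition[OF P(4) c1 h(4,6,7)])
 have evW: "eventually (\<lambda>y. inv_into V1 \<psi>1 y \<in> ?V0 \<and> ?\<psi>0 (inv_into V1 \<psi>1 y) \<in> W) (nhds ?y1)"
  using eventually_chart[OF CV1 h(7) eventually_chart_pull[OF C0 x1V eventually_nhds_in_open[OF F(2) W]]]
  by (rule eventually_mono) blast
 then obtain \<epsilon>0 where e0: "\<epsilon>0 > 0" "\<And>y. dist ?y1 y < \<epsilon>0 ==> inv_into V1 \<psi>1 y \<in> ?V0 \<and> ?\<psi>0 (inv_into V1 \<psi>1 y) \<in> W"
  unfolding eventually_nhds_metric by (metis dist_commute)
 \<comment> \<open>\<open>R k z\<close> bundles all data of a jet outside \<open>?B\<close> at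
   distance less than \<open>1 / real (Suc k)\<close>, so that a single choice of \<open>z\<close>
   for each \<open>k\<close> gives all the sequences.\<close>
 define R where "R k z \<longleftrightarrow> (case z of (x, L', U', \<phi>', \<sigma>) =>
   submanifold ?N ?m L' \<and> slice_chart ?N L' S (U', \<phi>') \<and> x \<in> L' \<and> x \<in> U' \<and> x \<in> V1 \<and>
   (\<forall>vs. set vs \<subseteq> S \<inter> sphere 0 1 \<and> length vs \<le> 2 -->
     dist (param_deriv \<psi>1 (U1, \<phi>1) x1 vs) (param_deriv \<psi>1 (U', \<phi>') x vs) < 1 / real (Suc k)) \<and>
   defining ?N ?V0 ?\<psi>0 L' x \<sigma> \<and> ?\<psi>0 x \<in> W \<and> jet ?N 2 ?m x L' \<notin> ?B)" for k z
 show "\<exists>\<epsilon>>0. nearby_jets ?N 2 ?m S (V1, \<psi>1) (U1, \<phi>1) x1 \<epsilon> \<subseteq> ?B"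
 proof (rule ccontr)
  assume neg: "\<not> ?thesis"
  have "\<forall>k. \<exists>z. R k z"
  proof
   fix k :: nat
   \<comment> \<open>The bound \<open>\<epsilon>0\<close> forces the base point into the chart
     domain \<open>?V0\<close> and its coordinates into \<open>W\<close>.\<close>
   let ?\<epsilon> = "min \<epsilon>0 (1 / real (Suc k))"
   have "?\<epsilon> > 0" using e0(1) by simp
   then obtain j where j: "j \<in> nearby_jets ?N 2 ?m S (V1, \<psi>1) (U1, \<phi>1) x1 ?\<epsilon>" "j \<notin> ?B" using neg by blast
   from j(1) obtain x L' U' \<phi>' where n: "j = jet ?N 2 ?m x L'" "submanifold ?N ?m L'" "slice_chart ?N L' S (U', \<phi>')"
    "x \<in> L'" "x \<in> U'" "x \<in> V1" "\<And>vs. set vs \<subseteq> S \<inter> sphere 0 1 \<and> length vs \<le> 2 -->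
     dist (param_deriv \<psi>1 (U1, \<phi>1) x1 vs) (param_deriv \<psi>1 (U', \<phi>') x vs) < ?\<epsilon>"
    unfolding nearby_jets_def prod.case by blast
   have "(U', \<phi>') \<in> smooth_charts ?N" using n(3) by (simp add: slice_chart_def)
   then have cU': "is_chart (U', \<phi>')" by (rule smooth_charts_is_chart)
   have "dist ?y1 (\<psi>1 x) < \<epsilon>0"
    using n(7)[of "[]"] by (simp add: param_deriv_simps is_chartD(6)[OF C1 h(6)] is_chartD(6)[OF cU' n(5)])
   from e0(2)[OF this] have xV: "x \<in> ?V0" "?\<psi>0 x \<in> W" by (simp_all add: is_chartD(6)[OF CV1 n(6)])
   obtain \<sigma> where "defining ?N ?V0 ?\<psi>0 L' x \<sigma>" using submanifold_defining[OF P(4) n(2) m c0 n(4) xV(1)] .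
   then have "R k (x, L', U', \<phi>', \<sigma>)" using n xV j(2) by (auto simp: R_def)
   then show "\<exists>z. R k z" ..
  qed
  then obtain z where z: "\<And>k. R k (z k)" by metis
  define x where "x k = fst (z k)" for k
  define L' where "L' k = fst (snd (z k))" for k
  define U' where "U' k = fst (snd (snd (z k)))" for k
  define \<phi>' where "\<phi>' k = fst (snd (snd (snd (z k))))" for k
  define \<sigma> where "\<sigma> k = snd (snd (snd (snd (z k))))" for k
  have zz: "z k = (x k, L' k, U' k, \<phi>' k, \<sigma> k)" for k by (simp add: x_def L'_def U'_def \<phi>'_def \<sigma>_def)
  have r: "submanifold ?N ?m (L' k)" "slice_chart ?N (L' k) S (U' k, \<phi>' k)" "x k \<in> L' k" "x k \<in> U' k" "x k \<in> V1"
   "\<And>vs. set vs \<subseteq> S \<inter> sphere 0 1 ==> length vs \<le> 2 ==>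
     dist (param_deriv \<psi>1 (U1, \<phi>1) x1 vs) (param_deriv \<psi>1 (U' k, \<phi>' k) (x k) vs) < 1 / real (Suc k)"
   "defining ?N ?V0 ?\<psi>0 (L' k) (x k) (\<sigma> k)" "?\<psi>0 (x k) \<in> W" "jet ?N 2 ?m (x k) (L' k) \<notin> ?B" for k
   using z[of k] unfolding R_def zz prod.case by blast+
  have cU': "(U' k, \<phi>' k) \<in> smooth_charts ?N" for k using r(2)[of k] by (simp add: slice_chart_def)
  have xV0: "x k \<in> ?V0" for k by (rule definingD(2)[OF r(7)])
  let ?gk = "\<lambda>k y. \<psi>1 (inv_into (U' k) (\<phi>' k) y)"
  have gks: "smooth_at (?gk k) (\<phi>' k (x k))" for k by (rule smooth_charts_transition[OF P(4) cU' h(4) r(4,5)])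
  define a0 where "a0 = D1 (\<lambda>y. ?\<psi>0 (inv_into U1 \<phi>1 y)) (\<phi>1 x1)"
  define A0 where "A0 = D2 (\<lambda>y. ?\<psi>0 (inv_into U1 \<phi>1 y)) (\<phi>1 x1)"
  define a where "a k = D1 (\<lambda>y. ?\<psi>0 (inv_into (U' k) (\<phi>' k) y)) (\<phi>' k (x k))" for k
  define A' where "A' k = D2 (\<lambda>y. ?\<psi>0 (inv_into (U' k) (\<phi>' k) y)) (\<phi>' k (x k))" for k
  note pc0 = param_change_chart[OF P(4) c1 h(4) c0 h(6,7) x1V, folded a0_def A0_def]
  have pck: "a k v = D1 ?k (\<psi>1 (x k)) (D1 (?gk k) (\<phi>' k (x k)) v)"
   "A' k v w = D2 ?k (\<psi>1 (x k)) (D1 (?gk k) (\<phi>' k (x k)) v) (D1 (?gk k) (\<phi>' k (x k)) w) + D1 ?k (\<psi>1 (x k)) (D2 (?gk k) (\<phi>' k (x k)) v w)" for k v w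
   unfolding a_def A'_def by (rule param_change_chart[OF P(4) cU' h(4) c0 r(4,5) xV0])+
  note st0 = slice_tangent[OF P(4) \<rho>(1) h(3,6,1), folded a0_def A0_def]
  have stk: "D1 (\<sigma> k) (?\<psi>0 (x k)) (a k v) = 0 \<longleftrightarrow> v \<in> S"
   "v \<in> S ==> w \<in> S ==> D2 (\<sigma> k) (?\<psi>0 (x k)) (a k v) (a k w) = - D1 (\<sigma> k) (?\<psi>0 (x k)) (A' k v w)" for k v w
   unfolding a_def A'_def by (rule slice_tangent[OF P(4) r(7) r(2,4) h(1)], assumption?)+
  have inv0: "(\<lambda>k. 1 / real (Suc k)) \<longlonglongrightarrow> 0" by (rule LIMSEQ_Suc[OF lim_const_over_n])
  have ylim: "(\<lambda>k. \<psi>1 (x k)) \<longlonglongrightarrow> ?y1"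
  proof -
   have "dist (\<psi>1 (x k)) ?y1 \<le> 1 / real (Suc k)" for k
    using r(6)[of "[]" k] is_chartD(6)[OF smooth_charts_is_chart[OF cU'] r(4), of k]
    by (simp add: param_deriv_simps is_chartD(6)[OF C1 h(6)] dist_commute)
   then show ?thesis by (intro metric_tendsto_imp_tendsto[OF inv0]) (auto simp: eventually_sequentially)
  qed
  have glin: "linear (D1 ?g (\<phi>1 x1))" "linear (D1 (?gk k) (\<phi>' k (x k)))" for k using linear_D1 gs gks by auto
  have b1: "norm (D1 (?gk k) (\<phi>' k (x k)) v - D1 ?g (\<phi>1 x1) v) \<le> 1 / real (Suc k) * norm v" if "v \<in> S" for k v
  proof (rule unit_bound[OF glin(2,1) h(1) _ that])
   fix v assume v: "v \<in> S" "norm v = 1"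
   show "norm (D1 (?gk k) (\<phi>' k (x k)) v - D1 ?g (\<phi>1 x1) v) \<le> 1 / real (Suc k)"
    using r(6)[of "[v]" k] v by (simp add: param_deriv_simps dist_norm norm_minus_commute)
  qed
  have b2: "norm (D2 (?gk k) (\<phi>' k (x k)) v w - D2 ?g (\<phi>1 x1) v w) \<le> 1 / real (Suc k) * norm w * norm v" if vw: "v \<in> S" "w \<in> S" for k v w
  proof (rule unit_bound[OF bilinear_D2(2)[OF gks] bilinear_D2(2)[OF gs] h(1) _ vw(1)])
   fix v assume v: "v \<in> S" "norm v = 1"
   show "norm (D2 (?gk k) (\<phi>' k (x k)) v w - D2 ?g (\<phi>1 x1) v w) \<le> 1 / real (Suc k) * norm w"
   proof (rule unit_bound[OF bilinear_D2(1)[OF gks] bilinear_D2(1)[OF gs] h(1) _ vw(2)])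
    fix w assume w: "w \<in> S" "norm w = 1"
    show "norm (D2 (?gk k) (\<phi>' k (x k)) v w - D2 ?g (\<phi>1 x1) v w) \<le> 1 / real (Suc k)"
     using r(6)[of "[v, w]" k] v w by (simp add: param_deriv_simps dist_norm norm_minus_commute)
   qed
  qed
  have glim: "(\<lambda>k. D1 (?gk k) (\<phi>' k (x k)) (v k)) \<longlonglongrightarrow> D1 ?g (\<phi>1 x1) v0"
   if v: "\<And>k. v k \<in> S" "v \<longlonglongrightarrow> v0" for v v0
  proof -
   have z: "(\<lambda>k. 1 / real (Suc k) * norm (v k)) \<longlonglongrightarrow> 0"
    using tendsto_mult[OF inv0 tendsto_norm[OF v(2)]] by simp
   have 1: "(\<lambda>k. D1 (?gk k) (\<phi>' k (x k)) (v k) - D1 ?g (\<phi>1 x1) (v k)) \<longlonglongrightarrow> 0"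
    by (rule Lim_null_comparison[OF always_eventually z]) (rule allI, rule b1[OF v(1)])
   have 2: "(\<lambda>k. D1 ?g (\<phi>1 x1) (v k)) \<longlonglongrightarrow> D1 ?g (\<phi>1 x1) v0" by (rule tendsto_D1[OF gs tendsto_const v(2)])
   from tendsto_add[OF 1 2] show ?thesis by (simp only: diff_add_cancel add_0)
  qed
  have g2lim: "(\<lambda>k. D2 (?gk k) (\<phi>' k (x k)) (v k) (w k)) \<longlonglongrightarrow> D2 ?g (\<phi>1 x1) v0 w0"
   if v: "\<And>k. v k \<in> S" "v \<longlonglongrightarrow> v0" "\<And>k. w k \<in> S" "w \<longlonglongrightarrow> w0" for v v0 w w0
  proof -
   have z: "(\<lambda>k. 1 / real (Suc k) * norm (w k) * norm (v k)) \<longlonglongrightarrow> 0"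
    using tendsto_mult[OF tendsto_mult[OF inv0 tendsto_norm[OF v(4)]] tendsto_norm[OF v(2)]] by simp
   have 1: "(\<lambda>k. D2 (?gk k) (\<phi>' k (x k)) (v k) (w k) - D2 ?g (\<phi>1 x1) (v k) (w k)) \<longlonglongrightarrow> 0"
    by (rule Lim_null_comparison[OF always_eventually z]) (rule allI, rule b2[OF v(1,3)])
   have 2: "(\<lambda>k. D2 ?g (\<phi>1 x1) (v k) (w k)) \<longlonglongrightarrow> D2 ?g (\<phi>1 x1) v0 w0" by (rule tendsto_D2[OF gs tendsto_const v(2,4)])
   from tendsto_add[OF 1 2] show ?thesis by (simp only: diff_add_cancel add_0)
  qed
  let ?B0 = "D1 (\<lambda>y. \<phi>1 (inv_into ?V0 ?\<psi>0 y)) ?w0" and ?\<alpha> = "D1 \<rho> ?w0"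
  have lB0: "linear ?B0" by (rule linear_D1[OF smooth_charts_transition[OF P(4) c0 c1 x1V h(6)]])
  have l\<alpha>: "linear ?\<alpha>" by (rule linear_D1[OF definingD(4)[OF \<rho>(1)]])
  \<comment> \<open>Subtracting \<open>?\<alpha> v *\<^sub>R ?e\<close> projects \<open>v\<close> to
    the kernel of \<open>?\<alpha>\<close>; \<open>?B0\<close> inverts \<open>a0\<close>, so
    \<open>\<xi> v\<close> lies in \<open>S\<close>.\<close>
  define \<xi> where "\<xi> v = ?B0 (v - ?\<alpha> v *\<^sub>R ?e)" for v
  have aB: "a0 (?B0 v) = v" for v unfolding a0_def by (rule transition_inverse[OF P(4) c1 c0 h(6) x1V])
  have l\<xi>: "linear \<xi>" unfolding \<xi>_def
   by (intro linearI) (simp_all add: linear_add[OF lB0] linear_diff[OF lB0] linear_cmul[OF lB0] linear_add[OF l\<alpha>] linear_cmul[OF l\<alpha>] algebra_simps del: scaleR_Pair)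
  have a\<xi>: "a0 (\<xi> v) = v - ?\<alpha> v *\<^sub>R ?e" for v unfolding \<xi>_def by (rule aB)
  have \<xi>S: "\<xi> v \<in> S" for v using st0(1)[of "\<xi> v"] \<rho>(2) by (simp add: a\<xi> linear_diff[OF l\<alpha>] linear_cmul[OF l\<alpha>] del: scaleR_Pair)
  have al: "linear (a k)" for k unfolding a_def by (rule linear_D1[OF smooth_charts_transition[OF P(4) cU' c0 r(4) xV0]])
  have \<sigma>s: "smooth_at (\<sigma> k) (?\<psi>0 (x k))" for k by (rule definingD(4)[OF r(7)])
  have wlim: "(\<lambda>k. ?\<psi>0 (x k)) \<longlonglongrightarrow> ?w0"
  proof -
   have "(\<lambda>k. ?k (\<psi>1 (x k))) \<longlonglongrightarrow> ?k ?y1" by (rule isCont_tendsto_compose[OF smooth_at_isCont[OF ks] ylim])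
   then show ?thesis by (simp only: k0 is_chartD(6)[OF CV1 r(5)])
  qed
  have "eventually (\<lambda>k. D1 (\<sigma> k) (?\<psi>0 (x k)) ?e \<noteq> 0 \<and>
    pol b c d q (?\<psi>0 (x k)) (D1 (\<sigma> k) (?\<psi>0 (x k))) (D2 (\<sigma> k) (?\<psi>0 (x k))) \<noteq> 0) sequentially"
  proof (rule jet_limit[OF l\<alpha> \<rho>(2) l\<xi> \<xi>S a\<xi> st0(2) al linear_D1[OF \<sigma>s] definingD(5)[OF r(7)] _ bilinear_D2[OF \<sigma>s] stk(2) _ _ wlim _ _ _ nz])
   show "D1 (\<sigma> k) (?\<psi>0 (x k)) (a k v) = 0" if "v \<in> S" for k v using stk(1) that by blast
   show "(\<lambda>k. a k (v k)) \<longlonglongrightarrow> a0 v0" if "\<And>k. v k \<in> S" "v \<longlonglongrightarrow> v0" for v v0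
    unfolding pck pc0 by (rule tendsto_D1[OF ks ylim glim[OF that]])
   show "(\<lambda>k. A' k (v k) (w k)) \<longlonglongrightarrow> A0 v0 w0"
    if "\<And>k. v k \<in> S" "v \<longlonglongrightarrow> v0" "\<And>k. w k \<in> S" "w \<longlonglongrightarrow> w0" for v v0 w w0
    unfolding pck pc0 by (intro tendsto_add tendsto_D2[OF ks ylim] tendsto_D1[OF ks ylim] glim g2lim that)
   show "isCont (b i j) ?w0 \<and> isCont (c i j) ?w0" if "i \<in> Basis" "j \<in> Basis" for i j
    using F(4)[OF that W] smooth_at_isCont by blast
   show "isCont (d i) ?w0" if "i \<in> Basis" for i using F(5)[OF that W] smooth_at_isCont by blast
   show "isCont q ?w0" using F(6)[OF W] smooth_at_isCont by blast
  qed auto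
  then obtain k where "D1 (\<sigma> k) (?\<psi>0 (x k)) ?e \<noteq> 0" "pol b c d q (?\<psi>0 (x k)) (D1 (\<sigma> k) (?\<psi>0 (x k))) (D2 (\<sigma> k) (?\<psi>0 (x k))) \<noteq> 0"
   unfolding eventually_sequentially by blast
  then show False using bad_jets_iff[OF pm r(1,7)[of k]] r(8,9) by blast
 qed
qed

lemma jet_open_jet_space: "jet_open A k m (jet_space A k m)"
proof -
 have "nearby_jets A k m S (V, \<psi>) (U, \<phi>) x 1 \<subseteq> jet_space A k m" for S V \<psi> U \<phi> x
  unfolding nearby_jets_def jet_space_def by fast
 then show ?thesis unfolding jet_open_def by (meson order_refl zero_less_one)
qed

lemma dim_total: "DIM(real \<times> 'e::euclidean_space \<times> real) = DIM('e) + 1 + 1" by simp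

lemma topspace_jet_topology: "topspace (jet_topology A k m) = jet_space A k m"
 unfolding topspace_def openin_jet_topology using jet_open_jet_space[of A k m] by (auto simp: jet_open_def)

section \<open>Jets inside and outside the equation\<close>

context
 fixes T \<Omega> :: "real set" and A :: "('a::{t2_space,second_countable_topology}, 'e::euclidean_space) chart set"
  and L :: "(real \<times> 'a => real) => real => 'a => real" and U \<phi> W b c d q
 assumes pm: "pe_manifold T A \<Omega>" and lf: "local_form T A \<Omega> L U \<phi> W b c d q"
begin

text \<open>\<open>bad_jets\<close> is an open neighbourhood of the jet; by \<open>pol_graph\<close>
  it contains no jet of a graph that satisfies the equation at the point, so the jet is outside the
  closure.\<close>

lemma not_in_equation:
 assumes L0: "submanifold (total_space T A \<Omega>) (DIM('e) + 1) L0" and \<rho>: "total_defining T A \<Omega> U \<phi> L0 p \<rho>"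
  and w: "tchart \<phi> p \<in> W" "D1 \<rho> (tchart \<phi> p) (0, 0, 1) \<noteq> 0"
  and nz: "pol b c d q (tchart \<phi> p) (D1 \<rho> (tchart \<phi> p)) (D2 \<rho> (tchart \<phi> p)) \<noteq> 0"
 shows "total_jet T A \<Omega> p L0 \<notin> extended_equation T A \<Omega> L"
proof
 note P = pe_manifoldD[OF pm] and F = local_formD[OF lf]
 assume "total_jet T A \<Omega> p L0 \<in> extended_equation T A \<Omega> L"
 moreover have "total_jet T A \<Omega> p L0 \<in> bad_jets T A \<Omega> U \<phi> W b c d q"
  using bad_jets_iff[OF pm L0 \<rho>] w nz by blast
 ultimately obtain y where y: "y \<in> bad_jets T A \<Omega> U \<phi> W b c d q"
  "y \<in> {total_jet T A \<Omega> (t, x, u (t, x)) (graph D u) | D u t x.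
     local_function T A \<Omega> D u \<and> (t, x) \<in> D \<and> deriv (\<lambda>s. u (s, x)) t = L u t x}"
  using bad_jets_open[OF pm lf] unfolding extended_equation_def in_closure_of openin_jet_topology by blast
 then obtain D u t x where u: "y = total_jet T A \<Omega> (t, x, u (t, x)) (graph D u)"
  "local_function T A \<Omega> D u" "(t, x) \<in> D" "deriv (\<lambda>s. u (s, x)) t = L u t x" by blast
 obtain p' M \<sigma> where M: "y = total_jet T A \<Omega> p' M" "total_defining T A \<Omega> U \<phi> M p' \<sigma>"
  using y(1) unfolding bad_jets_def by blast
 have "p' = (t, x, u (t, x))" using M(1) u(1) by (simp add: jet_def)
 then have x: "x \<in> U" using definingD(2)[OF M(2)] by simp
 note g = graph_defining(1)[OF P(1-3) u(2,3) F(1) x]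
 have W: "(t, \<phi> x, u (t, x)) \<in> W" and nz': "pol b c d q (t, \<phi> x, u (t, x)) (D1 (\<lambda>w. snd (snd w) + - lrep U \<phi> u (fst w, fst (snd w))) (t, \<phi> x, u (t, x)))
  (D2 (\<lambda>w. snd (snd w) + - lrep U \<phi> u (fst w, fst (snd w))) (t, \<phi> x, u (t, x))) \<noteq> 0"
  using bad_jets_iff[OF pm graph_submanifold[OF P(1-3) u(2)] g] y(1) u(1) by simp_all
 show False using pol_graph[OF pm lf u(2,3) x W g] nz' u(4) by blast
qed

text \<open>As the derivative of \<open>\<rho>\<close> along \<open>\<partial>\<^sub>u\<close> is
  nonzero, \<open>(t, x, u) \<mapsto> (t, x, \<rho>)\<close> is a local diffeomorphism, and near
  \<open>p\<close> the hypersurface is the graph of the last component of its inverse at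
  \<open>(t, x, 0)\<close>. So the jet is already one of the jets of graphs whose closure is
  taken.\<close>

lemma graph_like_in_equation:
 assumes L0: "submanifold (total_space T A \<Omega>) (DIM('e) + 1) L0" and \<rho>: "total_defining T A \<Omega> U \<phi> L0 p \<rho>"
  and w: "tchart \<phi> p \<in> W" "D1 \<rho> (tchart \<phi> p) (0, 0, 1) \<noteq> 0"
  and z: "pol b c d q (tchart \<phi> p) (D1 \<rho> (tchart \<phi> p)) (D2 \<rho> (tchart \<phi> p)) = 0"
 shows "total_jet T A \<Omega> p L0 \<in> extended_equation T A \<Omega> L"
proof -
 note P = pe_manifoldD[OF pm] and F = local_formD[OF lf] and R = definingD[OF \<rho>]
 note cU = smooth_charts_is_chart[OF F(1)]
 obtain t0 x0 z0 where p: "p = (t0, x0, z0)" by (cases p) auto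
 have pV: "t0 \<in> T" "x0 \<in> U" "z0 \<in> \<Omega>" using R(2) p by auto
 let ?w0 = "tchart \<phi> p" and ?V0 = "T \<times> U \<times> \<Omega>"
 let ?\<Psi> = "\<lambda>w. (fst w, fst (snd w), \<rho> w)"
 have \<Psi>s: "smooth_at ?\<Psi> ?w0" by (intro smooth_intros R(4))
 have inj: "v = 0" if v: "D1 ?\<Psi> ?w0 v = 0" for v
 proof -
  have b1: "bounded_linear (\<lambda>w::real \<times> 'e \<times> real. fst (snd w))"
   by (intro bounded_linear_compose[OF bounded_linear_fst] bounded_linear_snd)
  have b2: "bounded_linear (\<lambda>w::real \<times> 'e \<times> real. snd (snd w))"
   by (intro bounded_linear_compose[OF bounded_linear_snd] bounded_linear_snd)
  have 1: "fst v = 0"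
   using D1_linear_compose[OF bounded_linear_fst \<Psi>s, of v] v by (simp add: D1_linear[OF bounded_linear_fst])
  have 2: "fst (snd v) = 0"
   using D1_linear_compose[OF b1 \<Psi>s, of v] v by (simp add: D1_linear[OF b1])
  have 3: "D1 \<rho> ?w0 v = 0"
   using D1_linear_compose[OF b2 \<Psi>s, of v] v by (simp add: zero_prod_def)
  have v3: "v = snd (snd v) *\<^sub>R (0, 0, 1)" using 1 2 by (simp add: prod_eq_iff)
  have "snd (snd v) * D1 \<rho> ?w0 (0, 0, 1) = 0"
   using 3 linear_cmul[OF linear_D1[OF R(4)], of "snd (snd v)" "(0, 0, 1)"] v3 by (metis real_scaleR_def)
  then show "v = 0" using w(2) v3 by (metis mult_eq_0_iff scaleR_zero_left)
 qed
 have ev: "eventually (\<lambda>y. y \<in> T \<times> \<phi> ` U \<times> \<Omega> \<and> (inv_into ?V0 (tchart \<phi>) y \<in> L0 \<longleftrightarrow> \<rho> y = 0)) (nhds ?w0)"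
  using R(6) eventually_nhds_in_open[of "T \<times> \<phi> ` U \<times> \<Omega>" ?w0] P(2,3) is_chartD(2)[OF cU] pV
  by (auto simp: p open_Times intro: eventually_conj)
 then obtain N where N: "open N" "?w0 \<in> N" "\<And>y. y \<in> N ==> y \<in> T \<times> \<phi> ` U \<times> \<Omega> \<and> (inv_into ?V0 (tchart \<phi>) y \<in> L0 \<longleftrightarrow> \<rho> y = 0)"
  unfolding eventually_nhds by blast
 obtain O' h where O: "open O'" "?w0 \<in> O'" "O' \<subseteq> N" "open (?\<Psi> ` O')"
  "\<And>x. x \<in> O' ==> h (?\<Psi> x) = x" "\<And>y. y \<in> ?\<Psi> ` O' ==> smooth_at h y"
  by (rule smooth_inverse_function[OF \<Psi>s _ N(1,2)], erule inj) (rule that, (assumption | blast)+)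
 define D where "D = {(s, r). s \<in> T \<and> r \<in> U \<and> (s, \<phi> r, 0) \<in> ?\<Psi> ` O'}"
 define u where "u = (\<lambda>(s, r). snd (snd (h (s, \<phi> r, 0))))"
 have tc: "is_chart (T \<times> U, map_prod (\<lambda>x. x) \<phi>)"
  by (rule smooth_charts_is_chart[OF time_space_facts(3)[OF P(1,2) F(1)]])
 have "open ((\<lambda>y. (fst y, snd y, 0)) -` (?\<Psi> ` O'))"
  by (intro open_vimage O(4) continuous_intros)
 then have "open (map_prod (\<lambda>x. x) \<phi> -` ((\<lambda>y. (fst y, snd y, 0)) -` (?\<Psi> ` O')) \<inter> T \<times> U)"
  using is_chartD(1,3)[OF tc] continuous_on_open_vimage by blast
 moreover have "map_prod (\<lambda>x. x) \<phi> -` ((\<lambda>y. (fst y, snd y, 0)) -` Z) \<inter> T \<times> U = {(s, r). s \<in> T \<and> r \<in> U \<and> (s, \<phi> r, 0) \<in> Z}"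
  for Z :: "(real \<times> 'e \<times> real) set" by auto
 note this[of "?\<Psi> ` O'"]
 ultimately have Do: "open D" unfolding D_def by (simp only:)
 have hD: "h (s, \<phi> r, 0) = (s, \<phi> r, u (s, r)) \<and> (s, \<phi> r, u (s, r)) \<in> O' \<and> \<rho> (s, \<phi> r, u (s, r)) = 0"
  if sr: "(s, r) \<in> D" for s r
 proof -
  obtain w where w: "w \<in> O'" "?\<Psi> w = (s, \<phi> r, 0)" using sr unfolding D_def by force
  then have "h (s, \<phi> r, 0) = w" using O(5)[OF w(1)] by simp
  moreover have "w = (s, \<phi> r, snd (snd w))" using w(2) by (simp add: prod_eq_iff)
  ultimately show ?thesis using w by (simp add: u_def)
 qed
 have uloc: "local_function T A \<Omega> D u"
 proof (rule local_functionI[OF P(1-3) Do], intro conjI exI)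
  fix s r assume sr: "(s, r) \<in> D"
  then show "s \<in> T" and r: "r \<in> U" by (auto simp: D_def)
  show "u (s, r) \<in> \<Omega>" using hD[OF sr] O(3) N(3) by blast
  show "(U, \<phi>) \<in> smooth_charts A" by (rule F(1))
  have sh: "smooth_at h (s, \<phi> r, 0)" using O(6) sr by (auto simp: D_def)
  have "smooth_at (\<lambda>p::real \<times> 'e. h (fst p, snd p, 0)) (s, \<phi> r)"
   by (rule smooth_at_compose[of "\<lambda>p. (fst p, snd p, 0)" _ h]) (auto intro!: smooth_intros sh)
  then have "smooth_at (\<lambda>p::real \<times> 'e. snd (snd (h (fst p, snd p, 0)))) (s, \<phi> r)"
   by (intro smooth_at_snd)
  moreover have "eventually (\<lambda>p::real \<times> 'e. snd p \<in> \<phi> ` U) (nhds (s, \<phi> r))"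
   using eventually_smooth_at_compose[OF smooth_at_snd[OF smooth_at_ident], where x = "(s, \<phi> r)" and P = "\<lambda>y. y \<in> \<phi> ` U"]
    eventually_nhds_in_open[OF is_chartD(2)[OF cU], of "\<phi> r"] r by simp
  then have "eventually (\<lambda>p. snd (snd (h (fst p, snd p, 0))) = lrep U \<phi> u p) (nhds (s, \<phi> r))"
   by (rule eventually_mono) (auto simp: lrep_def u_def is_chartD(6)[OF cU])
  ultimately show "smooth_at (lrep U \<phi> u) (s, \<phi> r)" by (rule smooth_at_transform)
 qed
 note C0 = R(7)
 have Go: "open (tchart \<phi> -` O' \<inter> ?V0)" using is_chartD(1,3)[OF C0] O(1) continuous_on_open_vimage by blast
 have pG: "p \<in> tchart \<phi> -` O' \<inter> ?V0" using O(2) R(2) by auto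
 have germ: "p' \<in> L0 \<longleftrightarrow> p' \<in> graph D u" if p': "p' \<in> tchart \<phi> -` O' \<inter> ?V0" for p'
 proof -
  obtain s r z where srz: "p' = (s, r, z)" by (cases p') auto
  have m: "s \<in> T" "r \<in> U" "z \<in> \<Omega>" "(s, \<phi> r, z) \<in> O'" using p' srz by auto
  have "inv_into ?V0 (tchart \<phi>) (s, \<phi> r, z) = p'"
   using m by (subst inv_into_tchart[OF cU]) (auto simp: is_chartD(6)[OF cU] srz)
  then have "p' \<in> L0 \<longleftrightarrow> \<rho> (s, \<phi> r, z) = 0" using N(3)[of "(s, \<phi> r, z)"] O(3) m(4) by auto
  also have "\<dots> \<longleftrightarrow> (s, r) \<in> D \<and> z = u (s, r)"
  proof
   assume 0: "\<rho> (s, \<phi> r, z) = 0"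
   then have \<Psi>: "?\<Psi> (s, \<phi> r, z) = (s, \<phi> r, 0)" by simp
   have "(s, \<phi> r, 0) \<in> ?\<Psi> ` O'" by (rule image_eqI[where f = ?\<Psi> and x = "(s, \<phi> r, z)", OF \<Psi>[symmetric] m(4)])
   then have D: "(s, r) \<in> D" using m by (simp add: D_def)
   have "h (s, \<phi> r, 0) = (s, \<phi> r, z)" using O(5)[OF m(4)] unfolding \<Psi> .
   then show "(s, r) \<in> D \<and> z = u (s, r)" using D by (simp add: u_def)
  next
   assume "(s, r) \<in> D \<and> z = u (s, r)"
   then show "\<rho> (s, \<phi> r, z) = 0" using hD by blast
  qed
  also have "\<dots> \<longleftrightarrow> p' \<in> graph D u" by (auto simp: graph_def srz)
  finally show ?thesis .
 qed
 have g: "defining (total_space T A \<Omega>) ?V0 (tchart \<phi>) (graph D u) p \<rho>" by (rule defining_germ[OF \<rho> Go pG germ])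
 have "p \<in> graph D u" using germ[OF pG] R(3) by simp
 then have D0: "(t0, x0) \<in> D" "z0 = u (t0, x0)" by (auto simp: graph_def p)
 have je: "total_jet T A \<Omega> p L0 = total_jet T A \<Omega> p (graph D u)"
  using jet_eq_iff[OF P(4) dim_total \<rho> g graph_submanifold[OF P(1-3) uloc]] jet_eq_refl by blast
 have "deriv (\<lambda>s. u (s, x0)) t0 = L u t0 x0"
  using pol_graph[OF pm lf uloc D0(1) pV(2), of \<rho>] w z g by (simp add: p D0(2))
 then have mem: "total_jet T A \<Omega> p L0 \<in> {total_jet T A \<Omega> (t, x, u (t, x)) (graph D u) | D u t x.
     local_function T A \<Omega> D u \<and> (t, x) \<in> D \<and> deriv (\<lambda>s. u (s, x)) t = L u t x}"
  unfolding je unfolding p D0(2) using uloc D0 by blast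
 have sub: "{total_jet T A \<Omega> (t, x, u (t, x)) (graph D u) | D u t x.
     local_function T A \<Omega> D u \<and> (t, x) \<in> D \<and> deriv (\<lambda>s. u (s, x)) t = L u t x} \<subseteq> jet_space (total_space T A \<Omega>) 2 (DIM('e) + 1)"
 proof
  fix j assume "j \<in> {total_jet T A \<Omega> (t, x, u (t, x)) (graph D u) | D u t x.
     local_function T A \<Omega> D u \<and> (t, x) \<in> D \<and> deriv (\<lambda>s. u (s, x)) t = L u t x}"
  then obtain D u t x where u: "local_function T A \<Omega> D u" "(t, x) \<in> D"
   "j = total_jet T A \<Omega> (t, x, u (t, x)) (graph D u)" by blast
  have "(t, x, u (t, x)) \<in> graph D u" using u(2) by (auto simp: graph_def)
  then show "j \<in> jet_space (total_space T A \<Omega>) 2 (DIM('e) + 1)"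
   unfolding jet_space_def u(3) using graph_submanifold[OF P(1-3) u(1)] by blast
 qed
 show ?thesis unfolding extended_equation_def
  by (rule subsetD[OF closure_of_subset mem]) (simp only: topspace_jet_topology sub)
qed

text \<open>At a jet with \<open>\<alpha>(\<partial>\<^sub>u) = 0\<close> and \<open>H(\<partial>\<^sub>u, \<cdot>) = 0\<close>, perturbing the defining function by
 \<open>s (u - u\<^sub>0) + \<delta> (u - u\<^sub>0)\<^sup>2 / 2\<close> gives a graph, which satisfies the equation for a suitable
 \<open>\<delta> = O(s)\<close> since \<open>\<Sum> b\<^sup>i\<^sup>j \<alpha>\<^sub>i \<alpha>\<^sub>j > 0\<close>.\<close>

lemma vertical_in_equation:
 assumes L0: "submanifold (total_space T A \<Omega>) (DIM('e) + 1) L0" and \<rho>: "total_defining T A \<Omega> U \<phi> L0 p \<rho>"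
  and w: "tchart \<phi> p \<in> W" "D1 \<rho> (tchart \<phi> p) (0, 0, 1) = 0"
  and Hu: "\<And>v. D2 \<rho> (tchart \<phi> p) (0, 0, 1) v = 0" "\<And>v. D2 \<rho> (tchart \<phi> p) v (0, 0, 1) = 0"
  and i0: "i0 \<in> Basis" "D1 \<rho> (tchart \<phi> p) (0, i0, 0) \<noteq> 0"
 shows "total_jet T A \<Omega> p L0 \<in> extended_equation T A \<Omega> L"
proof -
 note P = pe_manifoldD[OF pm] and F = local_formD[OF lf] and R = definingD[OF \<rho>]
 let ?w0 = "tchart \<phi> p" and ?V0 = "T \<times> U \<times> \<Omega>" and ?e = "(0, 0, 1) :: real \<times> 'e \<times> real"
 let ?\<alpha> = "D1 \<rho> ?w0" and ?H = "D2 \<rho> ?w0" and ?z0 = "snd (snd p)"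
 have l\<alpha>: "linear ?\<alpha>" by (rule linear_D1[OF R(4)])
 note lH = bilinear_D2[OF R(4)]
 \<comment> \<open>A vector with \<open>?\<alpha> n = 1\<close> and no component along
   \<open>\<partial>\<^sub>u\<close>: the perturbation below depends on \<open>u\<close> only and
   does not change the derivative along \<open>n\<close>.\<close>
 define n where "n = (1 / ?\<alpha> (0, i0, 0)) *\<^sub>R (0 :: real, i0, 0 :: real)"
 have n: "?\<alpha> n = 1" "snd (snd n) = 0" unfolding n_def using i0 by (simp_all add: linear_cmul[OF l\<alpha>] del: scaleR_Pair)
 let ?S = "{v. ?\<alpha> v = 0}"
 have S: "subspace ?S" by (rule dim_kernel(1)[OF l\<alpha> n(1)])
 obtain U1 \<phi>1 where 1: "slice_chart (total_space T A \<Omega>) L0 ?S (U1, \<phi>1)" "(U1, \<phi>1) \<in> smooth_charts (total_space T A \<Omega>)" "p \<in> U1"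
  "\<And>v. D1 (tchart \<phi> \<circ> inv_into U1 \<phi>1) (\<phi>1 p) v = v - (?\<alpha> v - ?\<alpha> v) *\<^sub>R n"
  "\<And>v w. D2 (tchart \<phi> \<circ> inv_into U1 \<phi>1) (\<phi>1 p) v w = - ?H (v - (?\<alpha> v - ?\<alpha> v) *\<^sub>R n) (w - (?\<alpha> w - ?\<alpha> w) *\<^sub>R n) *\<^sub>R n"
  by (rule normal_slice[OF P(4) \<rho> l\<alpha> n(1) n(1)]) (rule that, (assumption | blast)+)
 let ?E = "extended_equation T A \<Omega> L"
 have "\<exists>y. y \<in> ?E \<and> y \<in> Q" if Q: "total_jet T A \<Omega> p L0 \<in> Q" "jet_open (total_space T A \<Omega>) 2 (DIM('e) + 1) Q" for Q
 proof -
  obtain \<epsilon> where \<epsilon>: "\<epsilon> > 0" "nearby_jets (total_space T A \<Omega>) 2 (DIM('e) + 1) ?S (?V0, tchart \<phi>) (U1, \<phi>1) p \<epsilon> \<subseteq> Q"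
   using jet_openD[OF Q(2) S L0 1(1) R(1) _ Q(1)] R(2,3) 1(3) by blast
  obtain K where K: "\<And>v w. \<bar>?H v w\<bar> \<le> K * norm v * norm w" "K \<ge> 0"
  proof -
   have "bilinear ?H" unfolding bilinear_def using lH by blast
   then have "bounded_bilinear ?H" by (simp add: bilinear_conv_bounded_bilinear)
   from bounded_bilinear.nonneg_bounded[OF this] show ?thesis
    using that by (auto simp: mult.assoc mult.left_commute mult.commute)
  qed
  define B where "B = (\<Sum>i\<in>Basis. \<Sum>j\<in>Basis. b i j ?w0 * ?\<alpha> (0, i, 0) * ?\<alpha> (0, j, 0))"
  have B: "B > 0"
  proof -
   define \<xi> where "\<xi> = (\<Sum>i\<in>Basis. ?\<alpha> (0, i, 0) *\<^sub>R i)"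
   have \<xi>i: "\<xi> \<bullet> i = ?\<alpha> (0, i, 0)" if "i \<in> Basis" for i
    using that by (simp add: \<xi>_def inner_sum_left inner_Basis if_distrib sum.delta cong: if_cong)
   have "\<xi> \<noteq> 0" using \<xi>i[OF i0(1)] i0(2) by auto
   from F(7)[OF w(1) this] show ?thesis unfolding B_def by (simp add: \<xi>i)
  qed
  define b0 where "b0 = (\<Sum>i\<in>Basis. \<Sum>j\<in>Basis. b i j ?w0 * ?H (0, i, 0) (0, j, 0))"
  define c0 where "c0 = (\<Sum>i\<in>Basis. \<Sum>j\<in>Basis. c i j ?w0 * ?\<alpha> (0, i, 0) * ?\<alpha> (0, j, 0))"
  define d0 where "d0 = (\<Sum>i\<in>Basis. d i ?w0 * ?\<alpha> (0, i, 0))"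
  \<comment> \<open>The solution of \<open>pol = 0\<close> for the perturbed function, an equation
    that is linear in \<open>\<delta>\<close> with coefficient \<open>B\<close>.\<close>
  define \<delta> where "\<delta> s = s * (?\<alpha> (1, 0, 0) * s - s * b0 + c0 - s * d0 + q ?w0 * s\<^sup>2) / B" for s
  \<comment> \<open>Bounds the distance between the parametrizations of the original and the
    perturbed hypersurface: the first summand serves the first derivatives, the other one the second
    derivatives. It tends to 0 with \<open>s\<close>.\<close>
  define G where "G s = s * norm n + (2 * s * (K * norm n) + s\<^sup>2 * (K * norm n * norm n) + \<bar>\<delta> s\<bar>) * norm n" for s
  have "isCont G 0" unfolding G_def \<delta>_def using B by (intro continuous_intros) auto
  moreover have "G 0 = 0" by (simp add: G_def \<delta>_def)
  ultimately have "eventually (\<lambda>s. G s < \<epsilon>) (at 0)" using \<epsilon>(1) unfolding isCont_def by (metis order_tendstoD(2))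
  then have "eventually (\<lambda>s. G s < \<epsilon> \<and> s > 0) (at_right 0)"
   by (intro eventually_conj) (auto simp: eventually_at_right_less eventually_at_split)
  then obtain s where s: "G s < \<epsilon>" "s > 0" using eventually_happens'[OF trivial_limit_at_right_real] by blast
  define f where "f y = s * (snd (snd y) - ?z0) + \<delta> s / 2 * ((snd (snd y) - ?z0) * (snd (snd y) - ?z0))" for y :: "real \<times> 'e \<times> real"
  have fs: "smooth_at f y" for y unfolding f_def by (intro smooth_intros)
  have D1f: "D1 f y v = (s + \<delta> s * (snd (snd y) - ?z0)) * snd (snd v)" for y v
   unfolding f_def by (subst D1_eqI) (auto intro!: derivative_eq_intros simp: field_simps)
  have D2f: "D2 f y v w = \<delta> s * snd (snd v) * snd (snd w)" for y v w
   unfolding D2_def D1f by (subst D1_eqI) (auto intro!: derivative_eq_intros simp: field_simps)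
  define \<rho>s where "\<rho>s = (\<lambda>y. \<rho> y + f y)"
  have \<rho>ss: "smooth_at \<rho>s ?w0" unfolding \<rho>s_def by (intro smooth_intros R(4) fs)
  have z0: "snd (snd ?w0) = ?z0" by (cases p) simp
  have D1s: "D1 \<rho>s ?w0 v = ?\<alpha> v + s * snd (snd v)" for v
   unfolding \<rho>s_def D1_add[OF R(4) fs] D1f z0 by simp
  have D2s: "D2 \<rho>s ?w0 v w = ?H v w + \<delta> s * snd (snd v) * snd (snd w)" for v w
   unfolding \<rho>s_def D2_add[OF R(4) fs] D2f by simp
  have \<rho>s0: "\<rho>s ?w0 = 0" using R(8) z0 by (simp add: \<rho>s_def f_def)
  have n1: "D1 \<rho>s ?w0 n = 1" using n by (simp add: D1s)
  then have nz: "D1 \<rho>s ?w0 n \<noteq> 0" by simp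
  obtain Ls where Ls: "submanifold (total_space T A \<Omega>) (DIM('e) + 1) Ls" "defining (total_space T A \<Omega>) ?V0 (tchart \<phi>) Ls p \<rho>s"
   using zero_set_submanifold[OF P(4) dim_total R(1,2) \<rho>ss \<rho>s0 nz] by blast
  have "total_jet T A \<Omega> p Ls \<in> ?E"
  proof (rule graph_like_in_equation[OF Ls w(1)])
   show "D1 \<rho>s ?w0 (0, 0, 1) \<noteq> 0" using s w(2) by (simp add: D1s)
   \<comment> \<open>\<open>?H\<close> vanishes on \<open>\<partial>\<^sub>u\<close>, so only the
     spatial parts of the tangent vectors contribute, each with the factor \<open>s\<close>.\<close>
   have HX: "?H (0, s *\<^sub>R i, - a) (0, s *\<^sub>R j, - a') = s\<^sup>2 * ?H (0, i, 0) (0, j, 0)" for i j a a'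
   proof -
    have X: "(0, s *\<^sub>R i, - a) = s *\<^sub>R (0, i, 0) + (- a) *\<^sub>R ?e" for i a by simp
    show ?thesis unfolding X
     by (simp only: linear_add[OF lH(1)] linear_add[OF lH(2)] linear_cmul[OF lH(1)] linear_cmul[OF lH(2)] Hu)
      (simp add: power2_eq_square)
   qed
   have "pol b c d q ?w0 (D1 \<rho>s ?w0) (D2 \<rho>s ?w0) =
    - ?\<alpha> (1, 0, 0) * s\<^sup>2 + (s\<^sup>2 * b0 + \<delta> s * B) - s * c0 + s\<^sup>2 * d0 - q ?w0 * s ^ 3"
    unfolding pol_def D1s D2s b0_def B_def c0_def d0_def
    by (simp add: w(2) HX sum.distrib sum_distrib_left algebra_simps)
   also have "\<dots> = 0" using B by (simp add: \<delta>_def field_simps power2_eq_square power3_eq_cube)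
   finally show "pol b c d q ?w0 (D1 \<rho>s ?w0) (D2 \<rho>s ?w0) = 0" .
  qed
  moreover have "total_jet T A \<Omega> p Ls \<in> Q"
  proof -
   \<comment> \<open>The perturbed hypersurface has another tangent space but is charted along the
     same \<open>?S\<close>, as \<open>nearby_jets\<close> requires.\<close>
   obtain U2 \<phi>2 where 2: "slice_chart (total_space T A \<Omega>) Ls ?S (U2, \<phi>2)" "(U2, \<phi>2) \<in> smooth_charts (total_space T A \<Omega>)" "p \<in> U2"
    "\<And>v. D1 (tchart \<phi> \<circ> inv_into U2 \<phi>2) (\<phi>2 p) v = v - (D1 \<rho>s ?w0 v - ?\<alpha> v) *\<^sub>R n"
    "\<And>v w. D2 (tchart \<phi> \<circ> inv_into U2 \<phi>2) (\<phi>2 p) v w =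
     - D2 \<rho>s ?w0 (v - (D1 \<rho>s ?w0 v - ?\<alpha> v) *\<^sub>R n) (w - (D1 \<rho>s ?w0 w - ?\<alpha> w) *\<^sub>R n) *\<^sub>R n"
    by (rule normal_slice[OF P(4) Ls(2) l\<alpha> n(1) n1]) (rule that, (assumption | blast)+)
   have sn: "\<bar>snd (snd v)\<bar> \<le> norm v" for v :: "real \<times> 'e \<times> real"
    by (metis norm_snd_le order_trans prod.collapse real_norm_def)
   have "dist (param_deriv (tchart \<phi>) (U1, \<phi>1) p vs) (param_deriv (tchart \<phi>) (U2, \<phi>2) p vs) < \<epsilon>"
    if vs: "set vs \<subseteq> ?S \<inter> sphere 0 1" "length vs \<le> 2" for vs
    using vs(2)
   proof (cases rule: length_le_2_cases)
    case 1
    then show ?thesis using is_chartD(6)[OF smooth_charts_is_chart[OF \<open>(U1, \<phi>1) \<in> smooth_charts (total_space T A \<Omega>)\<close>] \<open>p \<in> U1\<close>]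
      is_chartD(6)[OF smooth_charts_is_chart[OF 2(2)] 2(3)] \<epsilon>(1) by (simp add: param_deriv_simps)
   next
    case (2 v)
    then have v: "norm v = 1" using vs by auto
    have "dist (param_deriv (tchart \<phi>) (U1, \<phi>1) p vs) (param_deriv (tchart \<phi>) (U2, \<phi>2) p vs) = norm ((s * snd (snd v)) *\<^sub>R n)"
     using \<open>vs = [v]\<close> \<open>\<And>v. D1 (tchart \<phi> \<circ> inv_into U1 \<phi>1) (\<phi>1 p) v = v - (?\<alpha> v - ?\<alpha> v) *\<^sub>R n\<close>[of v]
      \<open>\<And>v. D1 (tchart \<phi> \<circ> inv_into U2 \<phi>2) (\<phi>2 p) v = v - (D1 \<rho>s ?w0 v - ?\<alpha> v) *\<^sub>R n\<close>[of v]
     by (simp add: param_deriv_simps o_def D1s dist_norm)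
    also have "\<dots> \<le> s * norm n" using s sn[of v] v by (simp add: abs_mult mult_right_mono mult_left_le)
    also have "\<dots> \<le> G s" unfolding G_def using s K(2) by simp
    finally show ?thesis using s by simp
   next
    case (3 v w)
    then have v: "norm v = 1" "norm w = 1" using vs by auto
    let ?a = "snd (snd v)" and ?b = "snd (snd w)"
    have ab: "\<bar>?a\<bar> \<le> 1" "\<bar>?b\<bar> \<le> 1" using sn[of v] sn[of w] v by auto
    have H2: "?H (v - (s * ?a) *\<^sub>R n) (w - (s * ?b) *\<^sub>R n) =
     ?H v w - s * ?a * ?H n w - s * ?b * ?H v n + s\<^sup>2 * (?a * ?b) * ?H n n"
     by (simp add: linear_diff[OF lH(1)] linear_diff[OF lH(2)] linear_cmul[OF lH(1)] linear_cmul[OF lH(2)] algebra_simps power2_eq_square)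
    define r where "r = - s * ?a * ?H n w - s * ?b * ?H v n + s\<^sup>2 * (?a * ?b) * ?H n n + \<delta> s * ?a * ?b"
    have "D2 \<rho>s ?w0 (v - (s * ?a) *\<^sub>R n) (w - (s * ?b) *\<^sub>R n) = ?H v w + r"
     unfolding D2s H2 r_def using n(2) by simp
    moreover have nr: "- (h *\<^sub>R n) - (- h - r) *\<^sub>R n = r *\<^sub>R n" for h by (simp add: scaleR_left_diff_distrib)
    ultimately have "dist (param_deriv (tchart \<phi>) (U1, \<phi>1) p vs) (param_deriv (tchart \<phi>) (U2, \<phi>2) p vs) = norm (r *\<^sub>R n)"
     using \<open>vs = [v, w]\<close> \<open>\<And>v w. D2 (tchart \<phi> \<circ> inv_into U1 \<phi>1) (\<phi>1 p) v w = - ?H (v - (?\<alpha> v - ?\<alpha> v) *\<^sub>R n) (w - (?\<alpha> w - ?\<alpha> w) *\<^sub>R n) *\<^sub>R n\<close>[of v w]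
      \<open>\<And>v w. D2 (tchart \<phi> \<circ> inv_into U2 \<phi>2) (\<phi>2 p) v w =
     - D2 \<rho>s ?w0 (v - (D1 \<rho>s ?w0 v - ?\<alpha> v) *\<^sub>R n) (w - (D1 \<rho>s ?w0 w - ?\<alpha> w) *\<^sub>R n) *\<^sub>R n\<close>[of v w]
     by (simp add: param_deriv_simps o_def D1s dist_norm nr)
    also have "\<dots> = \<bar>r\<bar> * norm n" by simp
    also have "\<bar>r\<bar> \<le> 2 * s * (K * norm n) + s\<^sup>2 * (K * norm n * norm n) + \<bar>\<delta> s\<bar>"
    proof -
     have "\<bar>s * ?a * ?H n w\<bar> \<le> s * 1 * (K * norm n)" using K(1)[of n w] v ab s
      unfolding abs_mult by (intro mult_mono) auto
     moreover have "\<bar>s * ?b * ?H v n\<bar> \<le> s * 1 * (K * norm n)" using K(1)[of v n] v ab s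
      unfolding abs_mult by (intro mult_mono) auto
     moreover have "\<bar>s\<^sup>2 * (?a * ?b) * ?H n n\<bar> \<le> s\<^sup>2 * (1 * 1) * (K * norm n * norm n)" using K(1)[of n n] ab s
      unfolding abs_mult by (intro mult_mono) auto
     moreover have "\<bar>\<delta> s * ?a * ?b\<bar> \<le> \<bar>\<delta> s\<bar> * 1 * 1" using ab
      unfolding abs_mult by (intro mult_mono) auto
     ultimately show ?thesis unfolding r_def by linarith
    qed
    then have "\<bar>r\<bar> * norm n \<le> (2 * s * (K * norm n) + s\<^sup>2 * (K * norm n * norm n) + \<bar>\<delta> s\<bar>) * norm n"
     by (rule mult_right_mono) simp
    also have "\<dots> \<le> G s" unfolding G_def using s by simp
    finally show ?thesis using s by simp
   qed
   then have "total_jet T A \<Omega> p Ls \<in> nearby_jets (total_space T A \<Omega>) 2 (DIM('e) + 1) ?S (?V0, tchart \<phi>) (U1, \<phi>1) p \<epsilon>"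
    unfolding nearby_jets_def prod.case using Ls(1) 2(1,3) definingD(2,3)[OF Ls(2)] by blast
   then show ?thesis using \<epsilon>(2) by blast
  qed
  ultimately show ?thesis by blast
 qed
 moreover have "total_jet T A \<Omega> p L0 \<in> jet_space (total_space T A \<Omega>) 2 (DIM('e) + 1)" unfolding jet_space_def using L0 R(3) by blast
 ultimately have "total_jet T A \<Omega> p L0 \<in> jet_topology (total_space T A \<Omega>) 2 (DIM('e) + 1) closure_of ?E"
  unfolding in_closure_of topspace_jet_topology openin_jet_topology by blast
 then show ?thesis unfolding extended_equation_def by (simp add: closure_of_closure_of)
qed

end

section \<open>The symbol of a morphism\<close>

abbreviation local_rep where
 "local_rep F U \<phi> \<phi>' \<equiv> \<lambda>y. tchart \<phi>' (F (fst y, inv_into U \<phi> (fst (snd y)), snd (snd y)))"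

text \<open>The form \<open>\<kappa> dt'\<^sup>2 + \<sigma> (dx'\<^sup>k)\<^sup>2\<close>, the
  Hessian of the test functions on the target.\<close>

definition quad :: "real => real => 'f::euclidean_space => real \<times> 'f \<times> real => real \<times> 'f \<times> real => real" where
 "quad \<kappa> \<sigma> k v w = \<kappa> * fst v * fst w + \<sigma> * (fst (snd v) \<bullet> k) * (fst (snd w) \<bullet> k)"

definition posdef :: "('e::euclidean_space => 'e => 'w => real) => 'w => bool" where
 "posdef b w \<longleftrightarrow> (\<forall>\<xi>. \<xi> \<noteq> 0 --> (\<Sum>i\<in>Basis. \<Sum>j\<in>Basis. b i j w * (\<xi> \<bullet> i) * (\<xi> \<bullet> j)) > 0)"

lemma posdefD:
 "posdef b w ==> \<xi> \<noteq> 0 ==> (\<Sum>i\<in>Basis. \<Sum>j\<in>Basis. b i j w * (\<xi> \<bullet> i) * (\<xi> \<bullet> j)) > 0"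
 unfolding posdef_def by blast

lemma posdef_zero:
 fixes t :: "'e::euclidean_space => real"
 assumes "posdef b w" "(\<Sum>i\<in>Basis. \<Sum>j\<in>Basis. b i j w * t i * t j) = 0" "i \<in> Basis"
 shows "t i = 0"
proof -
 define \<xi> where "\<xi> = (\<Sum>i\<in>Basis. t i *\<^sub>R i)"
 have \<xi>: "\<xi> \<bullet> i = t i" if "i \<in> Basis" for i
  using that by (simp add: \<xi>_def)
 have 0: "(\<Sum>i\<in>Basis. \<Sum>j\<in>Basis. b i j w * (\<xi> \<bullet> i) * (\<xi> \<bullet> j)) = 0" using assms(2) by (simp add: \<xi>)
 have "\<xi> = 0"
 proof (rule ccontr)
  assume "\<xi> \<noteq> 0" from posdefD[OF assms(1) this] 0 show False by simp
 qed
 then show ?thesis using \<xi>[OF assms(3)] by simp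
qed

lemma posdef_diag:
 fixes k :: "'e::euclidean_space"
 assumes "posdef b w" "k \<in> Basis" shows "b k k w > 0"
proof -
 have "(\<Sum>i\<in>Basis. \<Sum>j\<in>Basis. b i j w * (k \<bullet> i) * (k \<bullet> j)) =
   (\<Sum>i\<in>Basis. \<Sum>j\<in>Basis. if j = k then (if i = k then b k k w else 0) else 0)"
  by (intro sum.cong refl) (use assms(2) in \<open>auto simp: inner_Basis\<close>)
 also have "\<dots> = b k k w" using assms(2) by (simp add: sum.delta)
 finally have 1: "(\<Sum>i\<in>Basis. \<Sum>j\<in>Basis. b i j w * (k \<bullet> i) * (k \<bullet> j)) = b k k w" .
 have "k \<noteq> 0" using assms(2) by auto
 from posdefD[OF assms(1) this] 1 show ?thesis by simp
qed

lemma pol_add: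
 "pol b c d q w \<alpha> (\<lambda>v v'. H v v' + K v v') = pol b c d q w \<alpha> H +
  (\<Sum>i\<in>Basis. \<Sum>j\<in>Basis. b i j w * K (0, \<alpha> (0, 0, 1) *\<^sub>R i, - \<alpha> (0, i, 0)) (0, \<alpha> (0, 0, 1) *\<^sub>R j, - \<alpha> (0, j, 0)))"
 unfolding pol_def by (simp add: distrib_left sum.distrib)

text \<open>The tangent vectors in \<open>pol\<close> have no time component, so
  \<open>\<kappa>\<close> drops out. The time component of \<open>\<beta>\<close> and the number
  \<open>\<sigma>\<close> enter only linearly, so that a change of one can be compensated by the
  other.\<close>

lemma pol_quad:
 fixes \<beta> :: "real \<times> 'f::euclidean_space \<times> real"
 assumes k: "k \<in> Basis"
 shows "pol b c d q w ((\<bullet>) \<beta>) (quad \<kappa> \<sigma> k) =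
  - fst \<beta> * (snd (snd \<beta>))\<^sup>2 + \<sigma> * (snd (snd \<beta>))\<^sup>2 * b k k w + pol b c d q w ((\<bullet>) (0, snd \<beta>)) (\<lambda>_ _. 0)"
proof -
 obtain \<beta>1 \<beta>2 \<beta>3 where \<beta>: "\<beta> = (\<beta>1, \<beta>2, \<beta>3)" by (cases \<beta>) auto
 have "(\<Sum>i\<in>Basis. \<Sum>j\<in>Basis. b i j w * (\<sigma> * (\<beta>3 * (i \<bullet> k)) * (\<beta>3 * (j \<bullet> k)))) =
   (\<Sum>i\<in>Basis. \<Sum>j\<in>Basis. if j = k then (if i = k then \<sigma> * \<beta>3\<^sup>2 * b k k w else 0) else 0)"
  by (intro sum.cong refl) (use k in \<open>auto simp: inner_Basis power2_eq_square\<close>)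
 also have "\<dots> = \<sigma> * \<beta>3\<^sup>2 * b k k w" using k by (simp add: sum.delta)
 finally have "(\<Sum>i\<in>Basis. \<Sum>j\<in>Basis. b i j w * (\<sigma> * (\<beta>3 * (i \<bullet> k)) * (\<beta>3 * (j \<bullet> k)))) = \<sigma> * \<beta>3\<^sup>2 * b k k w" .
 then show ?thesis unfolding pol_def quad_def by (simp add: \<beta>)
qed

text \<open>If \<open>a\<close> and \<open>b\<close> are orthogonal their sum works, otherwise
  \<open>a\<close> does. Membership in the span keeps orthogonality to a vector that is orthogonal
  to both.\<close>

lemma two_functionals:
 fixes a b :: "'v::real_inner"
 assumes "a \<noteq> 0" "b \<noteq> 0"
 obtains \<beta> where "\<beta> \<in> span {a, b}" "\<beta> \<bullet> a \<noteq> 0" "\<beta> \<bullet> b \<noteq> 0"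
proof (cases "a \<bullet> b = 0")
 case True
 then have "(a + b) \<bullet> a \<noteq> 0" "(a + b) \<bullet> b \<noteq> 0" using assms by (simp_all add: inner_add_left inner_add_right inner_commute)
 moreover have "a + b \<in> span {a, b}" by (intro span_add span_base) auto
 ultimately show ?thesis by (rule that[rotated])
next
 case False
 moreover have "a \<in> span {a, b}" by (intro span_base) auto
 ultimately show ?thesis using that[of a] assms by simp
qed

abbreviation eu :: "real \<times> 'e::euclidean_space \<times> real" where "eu \<equiv> (0, 0, 1)"

text \<open>\<open>D\<close> and \<open>B\<close> play the role of the first and second derivative of a morphism at a point, and
 \<open>\<beta>\<close>, \<open>quad \<kappa> \<sigma> k\<close> that of the derivatives of a function on the target manifold.\<close>

definition transfer ::
 "(real \<times> 'e::euclidean_space \<times> real => real \<times> 'f::euclidean_space \<times> real) =>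
 (real \<times> 'e \<times> real => real \<times> 'e \<times> real => real \<times> 'f \<times> real) => _" where
 "transfer D B b c d q w b' c' d' q' w' \<longleftrightarrow>
  (\<forall>\<beta> \<kappa> \<sigma> k. k \<in> Basis --> snd (snd \<beta>) \<noteq> 0 --> \<beta> \<bullet> D eu \<noteq> 0 -->
  (pol b c d q w (\<lambda>v. \<beta> \<bullet> D v) (\<lambda>v v'. quad \<kappa> \<sigma> k (D v) (D v') + \<beta> \<bullet> B v v') = 0 \<longleftrightarrow>
   pol b' c' d' q' w' ((\<bullet>) \<beta>) (quad \<kappa> \<sigma> k) = 0))"

context
 fixes D :: "real \<times> 'e::euclidean_space \<times> real => real \<times> 'f::euclidean_space \<times> real"
  and B :: "real \<times> 'e \<times> real => real \<times> 'e \<times> real => real \<times> 'f \<times> real"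
  and b c :: "'e => 'e => real \<times> 'e \<times> real => real" and d :: "'e => real \<times> 'e \<times> real => real" and q :: "real \<times> 'e \<times> real => real" and w
  and b' c' :: "'f => 'f => real \<times> 'f \<times> real => real" and d' :: "'f => real \<times> 'f \<times> real => real" and q' :: "real \<times> 'f \<times> real => real" and w'
 assumes D: "linear D" "surj D" and pos: "posdef b w" and pos': "posdef b' w'"
begin

lemma D_decomp: "D v = fst v *\<^sub>R D (1, 0, 0) + D (0, fst (snd v), 0) + snd (snd v) *\<^sub>R D eu"
proof -
 have "v = fst v *\<^sub>R (1, 0, 0) + (0, fst (snd v), 0) + snd (snd v) *\<^sub>R eu" by (simp add: prod_eq_iff)
 then have "D v = D (fst v *\<^sub>R (1, 0, 0) + (0, fst (snd v), 0) + snd (snd v) *\<^sub>R eu)" by simp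
 then show ?thesis by (simp only: linear_add[OF D(1)] linear_cmul[OF D(1)])
qed

text \<open>The target has a time, a value and at least one space dimension, so the image of
  \<open>D\<close> has dimension at least 3.\<close>

lemma not_spanned: "\<not> (\<forall>v. D v \<in> span {a, z})"
proof
 assume "\<forall>v. D v \<in> span {a, z}"
 then have "(UNIV :: (real \<times> 'f \<times> real) set) \<subseteq> span {a, z}" using D(2) by (metis subsetI surjD)
 then have "dim (UNIV :: (real \<times> 'f \<times> real) set) \<le> card {a, z}" by (intro dim_le_card) auto
 also have "\<dots> \<le> 2" by (rule order_trans[OF card_insert_le_m1]) auto
 finally have "DIM('f) + 2 \<le> 2" by simp
 then show False using DIM_positive[where 'a='f] by linarith
qed

text \<open>By \<open>pol_quad\<close> the condition is affine in \<open>\<sigma>\<close> with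
  positive slope, so it has exactly one root. Adding \<open>r\<close> to the time component of
  \<open>\<beta>\<close> shifts the root by \<open>r / b' k k w'\<close>.\<close>

lemma choose_\<sigma>:
 assumes "k \<in> Basis" "snd (snd \<beta>) \<noteq> 0"
 obtains \<sigma> where "\<And>\<kappa>. pol b' c' d' q' w' ((\<bullet>) \<beta>) (quad \<kappa> \<sigma> k) = 0"
  "\<And>\<kappa>. pol b' c' d' q' w' ((\<bullet>) \<beta>) (quad \<kappa> (\<sigma> + 1) k) \<noteq> 0"
  "\<And>\<kappa> r. pol b' c' d' q' w' ((\<bullet>) (\<beta> + (r, 0, 0))) (quad \<kappa> (\<sigma> + r / b' k k w') k) = 0"
proof -
 have p: "b' k k w' > 0" by (rule posdef_diag[OF pos' assms(1)])
 define R where "R = pol b' c' d' q' w' ((\<bullet>) (0, snd \<beta>)) (\<lambda>_ _. 0)"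
 define \<sigma> where "\<sigma> = (fst \<beta> * (snd (snd \<beta>))\<^sup>2 - R) / ((snd (snd \<beta>))\<^sup>2 * b' k k w')"
 have 0: "\<sigma> * (snd (snd \<beta>))\<^sup>2 * b' k k w' = fst \<beta> * (snd (snd \<beta>))\<^sup>2 - R" using assms p by (simp add: \<sigma>_def)
 show ?thesis
 proof (rule that)
  show "pol b' c' d' q' w' ((\<bullet>) \<beta>) (quad \<kappa> \<sigma> k) = 0" for \<kappa>
   unfolding pol_quad[OF assms(1)] R_def[symmetric] 0 by simp
  show "pol b' c' d' q' w' ((\<bullet>) \<beta>) (quad \<kappa> (\<sigma> + 1) k) \<noteq> 0" for \<kappa>
   unfolding pol_quad[OF assms(1)] R_def[symmetric] distrib_right 0 using assms p by simp
  show "pol b' c' d' q' w' ((\<bullet>) (\<beta> + (r, 0, 0))) (quad \<kappa> (\<sigma> + r / b' k k w') k) = 0" for \<kappa> r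
  proof -
   have s: "snd (\<beta> + (r, 0, 0)) = snd \<beta>" "fst (\<beta> + (r, 0, 0)) = fst \<beta> + r" by (cases \<beta>, simp)+
   show ?thesis unfolding pol_quad[OF assms(1)] s R_def[symmetric] distrib_right 0 using p by (simp add: algebra_simps)
  qed
 qed
qed

lemma covector_linear: "linear (\<lambda>v. \<beta> \<bullet> D v)"
 by (intro linearI) (simp_all add: linear_add[OF D(1)] linear_cmul[OF D(1)] inner_add_right)

text \<open>If some \<open>D (0, y, s)\<close> has a time component, choose \<open>\<beta>\<close>
  that annihilates it, so that \<open>(0, y, s)\<close> is tangent to the pulled back hypersurface.
  On the target \<open>pol = 0\<close> holds for \<open>\<kappa> = 0\<close> and
  \<open>\<kappa> = 1\<close> alike; the difference of the two conditions on the source is the form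
  \<open>b\<close> at the time components of the images of the tangent vectors in
  \<open>pol\<close>. Positivity makes these vanish, and \<open>(0, y, s)\<close> is a combination
  of those vectors up to a factor.\<close>

lemma time_component:
 assumes tr: "transfer D B b c d q w b' c' d' q' w'" and nz: "D eu \<noteq> 0"
 shows "fst (D (0, x, u)) = 0"
proof (rule ccontr)
 assume v1: "fst (D (0, x, u)) \<noteq> 0"
 \<comment> \<open>\<open>\<beta>\<close> must not vanish on \<open>D eu\<close>, so a vector off
   the line of \<open>D eu\<close> is needed. If there were none, adding \<open>(0, x, u)\<close>
   would put all \<open>D (0, y, s)\<close> on this line, and \<open>D\<close> would have rank at
   most two.\<close>
 have "\<exists>y s. fst (D (0, y, s)) \<noteq> 0 \<and> D (0, y, s) \<notin> span {D eu}"
 proof (rule ccontr)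
  assume neg: "\<not> ?thesis"
  have 0: "D (0, y, s) \<in> span {D eu}" for y s
  proof (cases "fst (D (0, y, s)) = 0")
   case True
   have e: "D (0, y + x, s + u) = D (0, y, s) + D (0, x, u)" by (simp add: linear_add[OF D(1), symmetric])
   then have "fst (D (0, y + x, s + u)) \<noteq> 0" using True v1 by simp
   then have "D (0, y + x, s + u) \<in> span {D eu}" "D (0, x, u) \<in> span {D eu}" using neg v1 by blast+
   then show ?thesis using e by (metis add_diff_cancel_right' span_diff)
  qed (use neg in blast)
  have "D v \<in> span {D (1, 0, 0), D eu}" for v
  proof -
   have 1: "D (0, fst (snd v), 0) \<in> span {D (1, 0, 0), D eu}" using 0[of "fst (snd v)" 0] span_mono[of "{D eu}" "{D (1,0,0), D eu}"] by blast
   show ?thesis using D_decomp[of v]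
     span_add[OF span_add[OF span_scale[OF span_base] 1] span_scale[OF span_base], of "D (1, 0, 0)" "D eu"] by simp
  qed
  then show False using not_spanned by blast
 qed
 then obtain y s where ys: "fst (D (0, y, s)) \<noteq> 0" "D (0, y, s) \<notin> span {D eu}" by blast
 let ?W = "D (0, y, s)" and ?e = "(0, 0, 1) :: real \<times> 'f \<times> real"
 have W0: "?W \<bullet> ?W \<noteq> 0" using ys(1) by auto
 define P where "P z = z - ((z \<bullet> ?W) / (?W \<bullet> ?W)) *\<^sub>R ?W" for z
 have PW: "P z \<bullet> ?W = 0" for z using W0 by (simp add: P_def inner_diff_left)
 have Pe: "P ?e \<noteq> 0"
 proof
  assume "P ?e = 0"
  then obtain r where e: "?e = r *\<^sub>R ?W" by (auto simp: P_def)
  from arg_cong[OF e, of fst] have "r * fst ?W = 0" by simp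
  then have "?e = 0" using e ys(1) by simp
  then show False by (simp add: zero_prod_def)
 qed
 have Pz: "P (D eu) \<noteq> 0"
 proof
  assume "P (D eu) = 0"
  then have e: "D eu = ((D eu \<bullet> ?W) / (?W \<bullet> ?W)) *\<^sub>R ?W" by (simp add: P_def)
  let ?r = "(D eu \<bullet> ?W) / (?W \<bullet> ?W)"
  have r: "?r \<noteq> 0" using e nz by (metis scaleR_zero_left)
  have "?W = (1 / ?r) *\<^sub>R (?r *\<^sub>R ?W)" using r by simp
  also have "\<dots> = (1 / ?r) *\<^sub>R D eu" using e by simp
  finally have "?W \<in> span {D eu}" by (metis insertI1 span_base span_scale)
  then show False using ys(2) by blast
 qed
 obtain \<beta> where \<beta>: "\<beta> \<in> span {P ?e, P (D eu)}" "\<beta> \<bullet> P ?e \<noteq> 0" "\<beta> \<bullet> P (D eu) \<noteq> 0"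
  using two_functionals[OF Pe Pz] .
 have \<beta>W: "\<beta> \<bullet> ?W = 0"
  using \<beta>(1) by (induction rule: span_induct_alt) (auto simp: inner_add_left PW)
 have \<beta>P: "\<beta> \<bullet> P z = \<beta> \<bullet> z" for z by (simp add: P_def inner_diff_right \<beta>W)
 have \<beta>e: "snd (snd \<beta>) \<noteq> 0" using \<beta>(2) unfolding \<beta>P by (cases \<beta>) simp
 have \<alpha>u: "\<beta> \<bullet> D eu \<noteq> 0" using \<beta>(3) unfolding \<beta>P .
 obtain k :: 'f where k: "k \<in> Basis" using nonempty_Basis by blast
 obtain \<sigma> where \<sigma>: "\<And>\<kappa>. pol b' c' d' q' w' ((\<bullet>) \<beta>) (quad \<kappa> \<sigma> k) = 0" using choose_\<sigma>[OF k \<beta>e] by metis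
 let ?\<alpha> = "\<lambda>v. \<beta> \<bullet> D v"
 let ?X = "\<lambda>i. (0, ?\<alpha> (0, 0, 1) *\<^sub>R i, - ?\<alpha> (0, i, 0))"
 have z: "pol b c d q w ?\<alpha> (\<lambda>v v'. quad \<kappa> \<sigma> k (D v) (D v') + \<beta> \<bullet> B v v') = 0" for \<kappa>
  using tr \<sigma>[of \<kappa>] k \<beta>e \<alpha>u unfolding transfer_def by blast
 have "(\<lambda>v v'. quad 1 \<sigma> k (D v) (D v') + \<beta> \<bullet> B v v') = (\<lambda>v v'. (quad 0 \<sigma> k (D v) (D v') + \<beta> \<bullet> B v v') + fst (D v) * fst (D v'))"
  by (simp add: quad_def fun_eq_iff)
 then have "(\<Sum>i\<in>Basis. \<Sum>j\<in>Basis. b i j w * (fst (D (?X i)) * fst (D (?X j)))) = 0"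
  using z[of 1] z[of 0] by (simp only: pol_add add_0)
 then have "(\<Sum>i\<in>Basis. \<Sum>j\<in>Basis. b i j w * fst (D (?X i)) * fst (D (?X j))) = 0"
  by (simp only: mult.assoc)
 then have X0: "fst (D (?X i)) = 0" if "i \<in> Basis" for i
  using posdef_zero[OF pos _ that, of "\<lambda>i. fst (D (?X i))"] by blast
 have "?\<alpha> eu *\<^sub>R (0, y, s) = (\<Sum>i\<in>Basis. (y \<bullet> i) *\<^sub>R ?X i)"
 proof -
  have a: "(\<Sum>i\<in>Basis. (y \<bullet> i) *\<^sub>R ?X i) = (0, ?\<alpha> eu *\<^sub>R (\<Sum>i\<in>Basis. (y \<bullet> i) *\<^sub>R i), - (\<Sum>i\<in>Basis. (y \<bullet> i) * ?\<alpha> (0, i, 0)))"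
   by (simp add: sum_prod scaleR_sum_right sum_negf mult.commute)
  have y: "(0, y, 0) = (\<Sum>i\<in>Basis. (y \<bullet> i) *\<^sub>R (0 :: real, i, 0 :: real))"
   by (simp add: sum_prod euclidean_representation)
  have "(\<Sum>i\<in>Basis. (y \<bullet> i) * ?\<alpha> (0, i, 0)) = ?\<alpha> (0, y, 0)"
   by (subst y) (simp only: linear_sum[OF covector_linear] linear_cmul[OF covector_linear] real_scaleR_def)
  moreover have "?\<alpha> (0, y, 0) + s * ?\<alpha> eu = 0"
   using \<beta>W D_decomp[of "(0, y, s)"] by (simp add: inner_add_right)
  ultimately show ?thesis unfolding a by (simp add: euclidean_representation mult.commute add_eq_0_iff)
 qed
 from arg_cong[OF this, of "\<lambda>v. fst (D v)"] have "?\<alpha> eu * fst ?W = fst (D (\<Sum>i\<in>Basis. (y \<bullet> i) *\<^sub>R ?X i))"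
  by (simp only: linear_cmul[OF D(1)] fst_scaleR real_scaleR_def)
 also have "\<dots> = (\<Sum>i\<in>Basis. (y \<bullet> i) * fst (D (?X i)))"
  by (simp only: linear_sum[OF D(1)] linear_cmul[OF D(1)] fst_sum fst_scaleR real_scaleR_def)
 also have "\<dots> = 0" by (simp add: X0)
 finally show False using \<alpha>u ys(1) by simp
qed

text \<open>Suppose \<open>dx'\<^sup>k\<close> is nonzero on \<open>D eu\<close>. Adding
  \<open>dt'\<close> to \<open>\<beta>\<close> and \<open>1 / b' k k w'\<close> to
  \<open>\<sigma>\<close> keeps the condition on the target; on the source the difference is the
  identity \<open>key\<close>. In the limit where \<open>\<beta>\<close> annihilates
  \<open>D eu\<close>, it says that \<open>b\<close> vanishes at the values of
  \<open>dx'\<^sup>k\<close> on the images of the tangent vectors, and positivity leads to a nonzero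
  covector that annihilates the image of \<open>D\<close>.\<close>

lemma space_component:
 assumes tr: "transfer D B b c d q w b' c' d' q' w'" and t0: "\<And>x u. fst (D (0, x, u)) = 0" and B0: "\<And>x u y s. fst (B (0, x, u) (0, y, s)) = 0"
 shows "fst (snd (D eu)) = 0"
proof (rule ccontr)
 assume "fst (snd (D eu)) \<noteq> 0"
 then obtain k where k: "k \<in> Basis" "fst (snd (D eu)) \<bullet> k \<noteq> 0" using euclidean_all_zero_iff by blast
 let ?W = "D eu"
 let ?\<chi> = "\<lambda>v. fst (snd (D v)) \<bullet> k" and ?c = "fst (D (1, 0, 0))"
 have W0: "?W \<bullet> ?W \<noteq> 0" using k(2) by auto
 have fstD: "fst (D v) = fst v * ?c" for v
  by (subst D_decomp) (use t0 in simp)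
 have c0: "?c \<noteq> 0"
 proof
  assume "?c = 0"
  then have "fst (D v) = 0" for v by (subst fstD) simp
  moreover obtain v where "D v = (1, 0, 0)" using D(2) by (metis surjD)
  ultimately show False by (metis fst_conv zero_neq_one)
 qed
 let ?X = "\<lambda>\<beta> i. (0, (\<beta> \<bullet> D (0, 0, 1)) *\<^sub>R i, - (\<beta> \<bullet> D (0, i, 0)))"
 have \<chi>l: "linear ?\<chi>" by (intro linearI) (simp_all add: linear_add[OF D(1)] linear_cmul[OF D(1)] inner_add_left)
 have \<chi>X: "?\<chi> (?X \<beta> i) = (\<beta> \<bullet> ?W) * ?\<chi> (0, i, 0) - (\<beta> \<bullet> D (0, i, 0)) * ?\<chi> eu" for \<beta> i
  using pol_tangent[OF \<chi>l, of "\<beta> \<bullet> ?W" i "- (\<beta> \<bullet> D (0, i, 0))"] by (simp)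
 have key: "- ?c * (\<beta> \<bullet> ?W)\<^sup>2 + (1 / b' k k w') * (\<Sum>i\<in>Basis. \<Sum>j\<in>Basis. b i j w * ?\<chi> (?X \<beta> i) * ?\<chi> (?X \<beta> j)) = 0"
  if \<beta>: "snd (snd \<beta>) \<noteq> 0" "\<beta> \<bullet> ?W \<noteq> 0" for \<beta>
 proof -
  obtain \<sigma> where \<sigma>: "\<And>\<kappa>. pol b' c' d' q' w' ((\<bullet>) \<beta>) (quad \<kappa> \<sigma> k) = 0"
   "\<And>\<kappa> r. pol b' c' d' q' w' ((\<bullet>) (\<beta> + (r, 0, 0))) (quad \<kappa> (\<sigma> + r / b' k k w') k) = 0"
   using choose_\<sigma>[OF k(1) \<beta>(1)] by metis
  define \<beta>1 where "\<beta>1 = \<beta> + (1, 0, 0)"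
  have in1: "\<beta>1 \<bullet> z = \<beta> \<bullet> z + fst z" for z by (cases z) (simp add: \<beta>1_def inner_add_left)
  have D1: "\<beta>1 \<bullet> D (0, x, u) = \<beta> \<bullet> D (0, x, u)" for x u using t0 by (simp add: in1)
  have \<beta>1: "snd (snd \<beta>1) \<noteq> 0" "\<beta>1 \<bullet> ?W \<noteq> 0" using \<beta> D1 by (simp_all add: \<beta>1_def)
  have z0: "pol b c d q w (\<lambda>v. \<beta> \<bullet> D v) (\<lambda>v v'. quad 0 \<sigma> k (D v) (D v') + \<beta> \<bullet> B v v') = 0"
   using tr \<sigma>(1) k(1) \<beta> unfolding transfer_def by blast
  have z1: "pol b c d q w (\<lambda>v. \<beta>1 \<bullet> D v) (\<lambda>v v'. quad 0 (\<sigma> + 1 / b' k k w') k (D v) (D v') + \<beta>1 \<bullet> B v v') = 0"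
   using tr \<sigma>(2)[of 1 0, folded \<beta>1_def] k(1) \<beta>1 unfolding transfer_def by blast
  have e: "(\<lambda>v v'. quad 0 (\<sigma> + 1 / b' k k w') k (D v) (D v') + \<beta>1 \<bullet> B v v') =
   (\<lambda>v v'. (quad 0 \<sigma> k (D v) (D v') + \<beta> \<bullet> B v v') + ((1 / b' k k w') * (?\<chi> v * ?\<chi> v') + fst (B v v')))"
   by (simp add: quad_def fun_eq_iff in1 algebra_simps add_divide_distrib)
  have pt: "pol b c d q w (\<lambda>v. \<beta>1 \<bullet> D v) H = pol b c d q w (\<lambda>v. \<beta> \<bullet> D v) H - ?c * (\<beta> \<bullet> D (0, 0, 1))\<^sup>2" for H
   unfolding pol_def D1 in1[of "D (1, 0, 0)"] by (simp add: algebra_simps)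
  have "- ?c * (\<beta> \<bullet> D (0, 0, 1))\<^sup>2 + (\<Sum>i\<in>Basis. \<Sum>j\<in>Basis. b i j w * ((1 / b' k k w') * (?\<chi> (?X \<beta> i) * ?\<chi> (?X \<beta> j)))) = 0"
   using z1 z0 unfolding e pol_add pt by (simp add: D1 B0)
  then show ?thesis by (simp add: sum_distrib_left mult.left_commute mult.assoc)
 qed
 \<comment> \<open>The combination of \<open>dx'\<^sup>k\<close> and \<open>du'\<close> that
   annihilates \<open>?W\<close>; its \<open>du'\<close> coefficient is nonzero by the choice of
   \<open>k\<close>.\<close>
 define \<beta>0 where "\<beta>0 = (0 :: real, snd (snd ?W) *\<^sub>R k, - (fst (snd ?W) \<bullet> k))"
 have \<beta>0: "snd (snd \<beta>0) \<noteq> 0" using k by (simp add: \<beta>0_def)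
 have \<beta>0W: "\<beta>0 \<bullet> ?W = 0"
  by (cases "?W") (simp add: \<beta>0_def inner_commute)
 \<comment> \<open>\<open>key\<close> needs \<open>\<beta> \<bullet> ?W \<noteq> 0\<close> and so
   excludes \<open>\<beta>0\<close>; it is applied to \<open>\<beta>0 + s *\<^sub>R ?W\<close>, and
   continuity gives it at \<open>s = 0\<close>.\<close>
 define f where "f s = - ?c * ((\<beta>0 + s *\<^sub>R ?W) \<bullet> ?W)\<^sup>2 + (1 / b' k k w') *
  (\<Sum>i\<in>Basis. \<Sum>j\<in>Basis. b i j w * ?\<chi> (?X (\<beta>0 + s *\<^sub>R ?W) i) * ?\<chi> (?X (\<beta>0 + s *\<^sub>R ?W) j))" for s
 have "isCont f 0" unfolding f_def \<chi>X by (intro continuous_intros)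
 then have f1: "f \<midarrow>0\<rightarrow> f 0" by (simp add: isCont_def)
 have "eventually (\<lambda>s. snd (snd (\<beta>0 + s *\<^sub>R ?W)) \<noteq> 0) (at 0)"
 proof -
  have "((\<lambda>s. snd (snd (\<beta>0 + s *\<^sub>R ?W))) \<longlongrightarrow> snd (snd (\<beta>0 + 0 *\<^sub>R ?W))) (at 0)" by (intro tendsto_intros)
  then show ?thesis using \<beta>0 tendsto_imp_eventually_ne by fastforce
 qed
 moreover have "eventually (\<lambda>s::real. s \<noteq> 0) (at 0)" by (simp add: eventually_at_filter)
 ultimately have "eventually (\<lambda>s. 0 = f s) (at 0)"
 proof eventually_elim
  case (elim s)
  have "(\<beta>0 + s *\<^sub>R ?W) \<bullet> ?W \<noteq> 0" using elim(2) W0 \<beta>0W by (simp add: inner_add_left)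
  from key[OF elim(1) this] show ?case by (simp add: f_def)
 qed
 then have "f \<midarrow>0\<rightarrow> 0" using tendsto_const Lim_transform_eventually by blast
 then have "f 0 = 0" using f1 LIM_unique by blast
 then have "(\<Sum>i\<in>Basis. \<Sum>j\<in>Basis. b i j w * ?\<chi> (?X \<beta>0 i) * ?\<chi> (?X \<beta>0 j)) = 0"
  using \<beta>0W posdef_diag[OF pos' k(1)] by (simp add: f_def)
 then have zX: "?\<chi> (?X \<beta>0 i) = 0" if "i \<in> Basis" for i using posdef_zero[OF pos _ that, of "\<lambda>i. ?\<chi> (?X \<beta>0 i)"] by blast
 have z: "\<beta>0 \<bullet> D (0, i, 0) = 0" if "i \<in> Basis" for i
  using \<chi>X[of \<beta>0 i] zX[OF that] \<beta>0W k(2) by simp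
 have z': "\<beta>0 \<bullet> D (0, y, 0) = 0" for y
 proof -
  have y: "(0, y, 0) = (\<Sum>i\<in>Basis. (y \<bullet> i) *\<^sub>R (0 :: real, i, 0 :: real))"
   by (simp add: sum_prod euclidean_representation)
  show ?thesis by (subst y) (simp only: linear_sum[OF covector_linear] linear_cmul[OF covector_linear], simp add: z)
 qed
 \<comment> \<open>Chosen so that subtracting \<open>r\<close> times \<open>dt'\<close> also kills
   \<open>D (1, 0, 0)\<close>; the vectors killed before have no time component and stay
   killed.\<close>
 define r where "r = \<beta>0 \<bullet> D (1, 0, 0) / ?c"
 have "(\<beta>0 - (r, 0, 0)) \<bullet> D v = 0" for v
 proof -
  have "\<beta>0 \<bullet> D v = fst v * (\<beta>0 \<bullet> D (1, 0, 0))"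
   by (subst D_decomp) (simp add: inner_add_right z' \<beta>0W)
  moreover have "(r, 0, 0) \<bullet> D v = r * fst (D v)" by (cases "D v") simp
  then have "(r, 0, 0) \<bullet> D v = r * (fst v * ?c)" by (simp only: fstD[of v])
  ultimately show ?thesis using c0 by (simp add: inner_diff_left r_def)
 qed
 then have "\<beta>0 - (r, 0, 0) = 0" using D(2) by (metis inner_eq_zero_iff surjD)
 then have "snd (snd \<beta>0) = 0" by (metis eq_iff_diff_eq_0 snd_conv)
 then show False using \<beta>0 by blast
qed

end

section \<open>From the symbol to the local form of a morphism\<close>

text \<open>The two orders have different reasons: \<open>D1 f z e = 0\<close> may be differentiated
  in \<open>z\<close>; and \<open>f\<close> is constant along \<open>e\<close>, so it is invariant
  under small translations by multiples of \<open>e\<close>, and so is its derivative in direction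
  \<open>v\<close>.\<close>

lemma D2_vanish:
 fixes f :: "'a::euclidean_space => 'b::euclidean_space"
 assumes Y: "open Y" "y \<in> Y" and f: "\<And>z. z \<in> Y ==> smooth_at f z" "\<And>z. z \<in> Y ==> D1 f z e = 0"
 shows "D2 f y v e = 0" "D2 f y e v = 0"
proof -
 have "eventually (\<lambda>z. D1 f z e = 0) (nhds y)"
  by (rule eventually_mono[OF eventually_nhds_in_open[OF Y]]) (rule f(2))
 from D1_cong_ev[OF this] show "D2 f y v e = 0" by (simp add: D2_def D1_const)
 have l: "smooth_at (\<lambda>p::'a \<times> real. fst p + snd p *\<^sub>R e) q" for q by (intro smooth_intros)
 have "eventually (\<lambda>z. z \<in> Y) (nhds (fst (y, 0::real) + snd (y, 0::real) *\<^sub>R e))"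
  using eventually_nhds_in_open[OF Y] by simp
 from eventually_smooth_at_compose[OF l this]
 have "eventually (\<lambda>p. fst p + snd p *\<^sub>R e \<in> Y) (nhds (y, 0::real))" .
 then obtain P where P: "open P" "(y, 0) \<in> P" "\<And>p. p \<in> P ==> fst p + snd p *\<^sub>R e \<in> Y"
  unfolding eventually_nhds by blast
 obtain Pa Pb where ab: "open Pa" "open Pb" "y \<in> Pa" "0 \<in> Pb" "Pa \<times> Pb \<subseteq> P"
  using open_prod_elim[OF P(1,2)] by (metis mem_Sigma_iff)
 obtain r where r: "r > 0" "ball (0::real) r \<subseteq> Pb" using ab(2,4) open_contains_ball by blast
 have inY: "z + s *\<^sub>R e \<in> Y" if "z \<in> Pa" "s \<in> ball 0 r" for z s
 proof -
  have "(z, s) \<in> P" using ab(5) r(2) that by blast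
  from P(3)[OF this] show ?thesis by simp
 qed
 have const: "f (z + s *\<^sub>R e) = f z" if z: "z \<in> Pa" and s: "s \<in> ball (0::real) r" for z s
 proof -
  have hd: "((\<lambda>s. f (z + s *\<^sub>R e)) has_derivative (\<lambda>h. 0)) (at s within ball 0 r)" if s: "s \<in> ball 0 r" for s
  proof -
   note sf = f[OF inY[OF z s]]
   have "((\<lambda>s. z + s *\<^sub>R e) has_derivative (\<lambda>h. h *\<^sub>R e)) (at s)" by (auto intro!: derivative_eq_intros)
   from diff_chain_at[OF this smooth_at_D1_works[OF sf(1)]]
   have "((\<lambda>s. f (z + s *\<^sub>R e)) has_derivative (\<lambda>h. D1 f (z + s *\<^sub>R e) (h *\<^sub>R e))) (at s)" by (simp add: o_def)
   then have "((\<lambda>s. f (z + s *\<^sub>R e)) has_derivative (\<lambda>h. 0)) (at s)"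
    by (simp add: linear_cmul[OF linear_D1[OF sf(1)]] sf(2))
   then show ?thesis by (rule has_derivative_at_withinI)
  qed
  have "f (z + s *\<^sub>R e) = f (z + 0 *\<^sub>R e)"
   by (rule has_derivative_zero_unique[OF convex_ball hd s, of 0]) (use r in auto)
  then show ?thesis by simp
 qed
 have ev: "eventually (\<lambda>s. D1 f (y + s *\<^sub>R e) v = D1 f y v) (nhds (0::real))"
 proof (rule eventually_mono[OF eventually_nhds_in_open[of "ball 0 r"]])
  fix s :: real assume s: "s \<in> ball 0 r"
  have "eventually (\<lambda>z. f (z + s *\<^sub>R e) = f z) (nhds y)"
   by (rule eventually_mono[OF eventually_nhds_in_open[OF ab(1,3)]]) (rule const[OF _ s])
  from D1_cong_ev[OF this] have "D1 (\<lambda>z. f (z + s *\<^sub>R e)) y v = D1 f y v" by simp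
  moreover have "D1 (\<lambda>z. z + s *\<^sub>R e) y v = v"
   by (subst D1_eqI[of _ "\<lambda>v. v"]) (auto intro!: derivative_eq_intros)
  moreover have "(\<lambda>z. z + s *\<^sub>R e) differentiable (at y)" by (intro smooth_at_diffble smooth_intros)
  ultimately show "D1 f (y + s *\<^sub>R e) v = D1 f y v"
   using D1_compose[of "\<lambda>z. z + s *\<^sub>R e" y f v] smooth_at_diffble[OF f(1)[OF inY[OF ab(3) s]]] by simp
 qed (use r in auto)
 have "D1 (\<lambda>s::real. y + s *\<^sub>R e) 0 1 = e"
  by (subst D1_eqI[of _ "\<lambda>h. h *\<^sub>R e"]) (auto intro!: derivative_eq_intros)
 moreover have "(\<lambda>s::real. y + s *\<^sub>R e) differentiable (at 0)" by (intro smooth_at_diffble smooth_intros)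
 moreover have "D1 (\<lambda>s. D1 f (y + s *\<^sub>R e) v) (0::real) 1 = 0" using D1_cong_ev[OF ev] by (simp add: D1_const)
 ultimately show "D2 f y e v = 0"
  using D1_compose[of "\<lambda>s::real. y + s *\<^sub>R e" 0 "\<lambda>z. D1 f z v" 1] smooth_at_diffble[OF smooth_at_D1[OF f(1)[OF Y(2)], of v]]
  by (simp add: D2_def)
qed

lemma quad_function:
 fixes w \<beta> :: "real \<times> 'f::euclidean_space \<times> real" and \<kappa> \<sigma> :: real and k :: 'f
 defines "g \<equiv> \<lambda>y. \<beta> \<bullet> (y - w) + (\<kappa> * ((fst y - fst w) * (fst y - fst w)) +
   \<sigma> * (((fst (snd y) - fst (snd w)) \<bullet> k) * ((fst (snd y) - fst (snd w)) \<bullet> k))) / 2"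
 shows "smooth_at g y" "g w = 0" "D1 g w = (\<bullet>) \<beta>" "D2 g w = quad \<kappa> \<sigma> k"
proof -
 show "smooth_at g y" unfolding g_def by (intro smooth_intros) auto
 show "g w = 0" by (simp add: g_def)
 have D1g: "D1 g y v = \<beta> \<bullet> v + (\<kappa> * (fst y - fst w) * fst v + \<sigma> * ((fst (snd y) - fst (snd w)) \<bullet> k) * (fst (snd v) \<bullet> k))" for y v
  unfolding g_def by (subst D1_eqI) (auto intro!: derivative_eq_intros simp: field_simps)
 show "D1 g w = (\<bullet>) \<beta>" by (rule ext) (simp add: D1g)
 have "D2 g w v u = quad \<kappa> \<sigma> k v u" for v u
  unfolding D2_def D1g quad_def by (subst D1_eqI) (auto intro!: derivative_eq_intros)
 then show "D2 g w = quad \<kappa> \<sigma> k" by (intro ext)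
qed

context
 fixes T T' \<Omega> \<Omega>' :: "real set"
  and A :: "('a::{t2_space,second_countable_topology}, 'e::euclidean_space) chart set"
  and A' :: "('b::{t2_space,second_countable_topology}, 'f::euclidean_space) chart set"
  and L L' F U \<phi> W b c d q U' \<phi>' W' b' c' d' q'
 assumes pm: "pe_manifold T A \<Omega>" and pm': "pe_manifold T' A' \<Omega>'"
  and mor: "pde_morphism (total_space T A \<Omega>) (extended_equation T A \<Omega> L)
   (total_space T' A' \<Omega>') (extended_equation T' A' \<Omega>' L') 2 (DIM('e) + 1) F"
  and lf: "local_form T A \<Omega> L U \<phi> W b c d q" and lf': "local_form T' A' \<Omega>' L' U' \<phi>' W' b' c' d' q'"
begin

abbreviation (input) "Fc \<equiv> \<lambda>y. tchart \<phi>' (F (inv_into (T \<times> U \<times> \<Omega>) (tchart \<phi>) y))"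

lemma morphism_facts:
 "submersion (total_space T A \<Omega>) (total_space T' A' \<Omega>') F" "smooth_map (total_space T A \<Omega>) (total_space T' A' \<Omega>') F"
 "(T \<times> U \<times> \<Omega>, tchart \<phi>) \<in> smooth_charts (total_space T A \<Omega>)"
 "(T' \<times> U' \<times> \<Omega>', tchart \<phi>') \<in> smooth_charts (total_space T' A' \<Omega>')"
proof -
 note P = pe_manifoldD[OF pm] and P' = pe_manifoldD[OF pm']
 have m: "DIM(real \<times> 'e \<times> real) = (DIM('e) + 1) + 1" "DIM(real \<times> 'f \<times> real) = (DIM('f) + 1) + 1" by simp_all
 show "submersion (total_space T A \<Omega>) (total_space T' A' \<Omega>') F" using mor pde_morphism_iff[OF m] by blast
 then show "smooth_map (total_space T A \<Omega>) (total_space T' A' \<Omega>') F" by (simp add: submersion_def)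
 show "(T \<times> U \<times> \<Omega>, tchart \<phi>) \<in> smooth_charts (total_space T A \<Omega>)"
  by (rule total_space_facts(3)[OF P(1-3) local_formD(1)[OF lf]])
 show "(T' \<times> U' \<times> \<Omega>', tchart \<phi>') \<in> smooth_charts (total_space T' A' \<Omega>')"
  by (rule total_space_facts(3)[OF P'(1-3) local_formD(1)[OF lf']])
qed

text \<open>The test hypersurface is the zero set of the polynomial of \<open>quad_function\<close>.
  It is not vertical in the target, where \<open>pol\<close> decides. Its preimage is decided by
  \<open>pol\<close> if it is not vertical, and lies in the equation by
  \<open>vertical_in_equation\<close> if \<open>D\<close> and \<open>B\<close> vanish on
  \<open>eu\<close> and some space derivative is nonzero.\<close>

lemma morphism_jets:
 assumes p: "p \<in> T \<times> U \<times> \<Omega>" "F p \<in> T' \<times> U' \<times> \<Omega>'" "tchart \<phi> p \<in> W" "tchart \<phi>' (F p) \<in> W'"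
  and \<beta>: "snd (snd \<beta>) \<noteq> 0"
 defines "D \<equiv> D1 Fc (tchart \<phi> p)" and "B \<equiv> D2 Fc (tchart \<phi> p)"
 shows "\<beta> \<bullet> D eu \<noteq> 0 ==>
   pol b c d q (tchart \<phi> p) (\<lambda>v. \<beta> \<bullet> D v) (\<lambda>v v'. quad \<kappa> \<sigma> k (D v) (D v') + \<beta> \<bullet> B v v') = 0 \<longleftrightarrow>
   pol b' c' d' q' (tchart \<phi>' (F p)) ((\<bullet>) \<beta>) (quad \<kappa> \<sigma> k) = 0"
  "D eu = 0 ==> (\<And>v. B eu v = 0) ==> (\<And>v. B v eu = 0) ==> i \<in> Basis ==> \<beta> \<bullet> D (0, i, 0) \<noteq> 0 ==>
   pol b' c' d' q' (tchart \<phi>' (F p)) ((\<bullet>) \<beta>) (quad \<kappa> \<sigma> k) = 0"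
proof -
 note P = pe_manifoldD[OF pm] and P' = pe_manifoldD[OF pm'] and mf = morphism_facts
 have m: "DIM(real \<times> 'e \<times> real) = (DIM('e) + 1) + 1" "DIM(real \<times> 'f \<times> real) = (DIM('f) + 1) + 1" by simp_all
 let ?N = "total_space T A \<Omega>" and ?N' = "total_space T' A' \<Omega>'" and ?w' = "tchart \<phi>' (F p)"
 define g where "g = (\<lambda>y. \<beta> \<bullet> (y - ?w') + (\<kappa> * ((fst y - fst ?w') * (fst y - fst ?w')) +
   \<sigma> * (((fst (snd y) - fst (snd ?w')) \<bullet> k) * ((fst (snd y) - fst (snd ?w')) \<bullet> k))) / 2)"
 have g: "smooth_at g ?w'" "g ?w' = 0" "D1 g ?w' = (\<bullet>) \<beta>" "D2 g ?w' = quad \<kappa> \<sigma> k"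
  unfolding g_def by (rule quad_function)+
 have \<beta>u: "\<beta> \<bullet> (0, 0, 1) = snd (snd \<beta>)" by (cases \<beta>) simp
 have nz: "D1 g ?w' (0, 0, 1) \<noteq> 0" using \<beta> by (simp add: g(3) \<beta>u)
 obtain L0 where L0: "submanifold ?N' (DIM('f) + 1) L0" "defining ?N' (T' \<times> U' \<times> \<Omega>') (tchart \<phi>') L0 (F p) g"
  using zero_set_submanifold[OF P'(4) m(2) mf(4) p(2) g(1,2) nz] by blast
 note pb = pullback_defining[OF P(4) P'(4) mf(1) L0(2) mf(3) p(1)]
 have pc: "p \<in> carrier ?N" using p(1) smooth_charts_carrier[OF mf(3)] by blast
 note pj = pullback_jet_iff[OF m mor L0(1) definingD(3)[OF L0(2)] pc]
 let ?\<rho> = "\<lambda>y. g (Fc y)"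
 have D1\<rho>: "D1 ?\<rho> (tchart \<phi> p) = (\<lambda>v. \<beta> \<bullet> D v)" unfolding D_def by (rule ext) (simp only: pb(2) g(3))
 have D2\<rho>: "D2 ?\<rho> (tchart \<phi> p) = (\<lambda>v v'. quad \<kappa> \<sigma> k (D v) (D v') + \<beta> \<bullet> B v v')"
  unfolding D_def B_def by (intro ext) (simp only: pb(3) g(3,4))
 have E': "jet ?N' 2 (DIM('f) + 1) (F p) L0 \<in> extended_equation T' A' \<Omega>' L' \<longleftrightarrow>
   pol b' c' d' q' ?w' ((\<bullet>) \<beta>) (quad \<kappa> \<sigma> k) = 0"
  using not_in_equation[OF pm' lf' L0 p(4) nz] graph_like_in_equation[OF pm' lf' L0 p(4) nz] unfolding g(3,4) by blast
 show "pol b c d q (tchart \<phi> p) (\<lambda>v. \<beta> \<bullet> D v) (\<lambda>v v'. quad \<kappa> \<sigma> k (D v) (D v') + \<beta> \<bullet> B v v') = 0 \<longleftrightarrow>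
   pol b' c' d' q' ?w' ((\<bullet>) \<beta>) (quad \<kappa> \<sigma> k) = 0" if u: "\<beta> \<bullet> D eu \<noteq> 0"
 proof -
  have u': "D1 ?\<rho> (tchart \<phi> p) eu \<noteq> 0" unfolding D1\<rho> by (rule u)
  have "jet ?N 2 (DIM('e) + 1) p (carrier ?N \<inter> F -` L0) \<in> extended_equation T A \<Omega> L \<longleftrightarrow>
   pol b c d q (tchart \<phi> p) (\<lambda>v. \<beta> \<bullet> D v) (\<lambda>v v'. quad \<kappa> \<sigma> k (D v) (D v') + \<beta> \<bullet> B v v') = 0"
   using not_in_equation[OF pm lf pj(1) pb(1) p(3) u'] graph_like_in_equation[OF pm lf pj(1) pb(1) p(3) u']
   unfolding D1\<rho> D2\<rho> by blast
  then show ?thesis using pj(2) E' by blast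
 qed
 show "pol b' c' d' q' ?w' ((\<bullet>) \<beta>) (quad \<kappa> \<sigma> k) = 0"
  if v: "D eu = 0" "\<And>v. B eu v = 0" "\<And>v. B v eu = 0" "i \<in> Basis" "\<beta> \<bullet> D (0, i, 0) \<noteq> 0"
 proof -
  have "jet ?N 2 (DIM('e) + 1) p (carrier ?N \<inter> F -` L0) \<in> extended_equation T A \<Omega> L"
   by (rule vertical_in_equation[OF pm lf pj(1) pb(1) p(3) _ _ _ v(4)])
    (use v in \<open>simp_all add: D1\<rho> D2\<rho> quad_def\<close>)
  then show ?thesis using pj(2) E' by blast
 qed
qed

text \<open>\<open>time_component\<close> needs \<open>D eu \<noteq> 0\<close>; the steps
  \<open>ii\<close> and \<open>iii\<close> remove this condition by passing to open sets, and
  \<open>iv\<close> differentiates the result to provide the hypothesis of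
  \<open>space_component\<close> on second derivatives.\<close>

lemma morphism_local:
 assumes p0: "p0 \<in> T \<times> U \<times> \<Omega>" "F p0 \<in> T' \<times> U' \<times> \<Omega>'" "tchart \<phi> p0 \<in> W" "tchart \<phi>' (F p0) \<in> W'"
 obtains Y where "open Y" "tchart \<phi> p0 \<in> Y" "Y \<subseteq> T \<times> \<phi> ` U \<times> \<Omega>"
  "\<And>y. y \<in> Y ==> F (inv_into (T \<times> U \<times> \<Omega>) (tchart \<phi>) y) \<in> T' \<times> U' \<times> \<Omega>'"
  "\<And>y. y \<in> Y ==> smooth_at Fc y" "\<And>y. y \<in> Y ==> surj (D1 Fc y)"
  "\<And>y x u. y \<in> Y ==> fst (D1 Fc y (0, x, u)) = 0" "\<And>y. y \<in> Y ==> fst (snd (D1 Fc y eu)) = 0"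
proof -
 note P = pe_manifoldD[OF pm] and P' = pe_manifoldD[OF pm'] and mf = morphism_facts
 note f = local_formD[OF lf] and f' = local_formD[OF lf']
 note C = smooth_charts_is_chart[OF mf(3)] and C' = smooth_charts_is_chart[OF mf(4)] and cU = smooth_charts_is_chart[OF f(1)]
 let ?N = "total_space T A \<Omega>" and ?N' = "total_space T' A' \<Omega>'" and ?V = "T \<times> U \<times> \<Omega>" and ?V' = "T' \<times> U' \<times> \<Omega>'"
 have pc: "p0 \<in> carrier ?N" using p0(1) smooth_charts_carrier[OF mf(3)] by blast
 have cont: "isCont F p0" by (rule smooth_mapD(2)[OF mf(2) P(4) pc])
 have "eventually (\<lambda>r. r \<in> ?V' \<and> tchart \<phi>' r \<in> W') (nhds (F p0))"
  by (rule eventually_chart_pull[OF C' p0(2) eventually_nhds_in_open[OF f'(2) p0(4)]])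
 then have "eventually (\<lambda>p. F p \<in> ?V' \<and> tchart \<phi>' (F p) \<in> W') (nhds p0)"
  by (rule eventually_compose_filterlim[OF _ cont[unfolded isCont_def tendsto_at_iff_tendsto_nhds]])
 from eventually_conj[OF eventually_nhds_in_open[OF f(2) p0(3)] eventually_chart[OF C p0(1) this]]
 obtain Y where Y: "open Y" "tchart \<phi> p0 \<in> Y" "\<And>y. y \<in> Y ==> y \<in> W \<and>
  (F (inv_into ?V (tchart \<phi>) y) \<in> ?V' \<and> Fc y \<in> W') \<and> inv_into ?V (tchart \<phi>) y \<in> ?V \<and> tchart \<phi> (inv_into ?V (tchart \<phi>) y) = y"
  unfolding eventually_nhds by blast
 have sm: "smooth_at Fc y" "surj (D1 Fc y)" if "y \<in> Y" for y
  using smooth_map_at[OF P(4) P'(4) mf(2,3,4), of "inv_into ?V (tchart \<phi>) y"]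
   submersion_at[OF P(4) P'(4) mf(1,3,4), of "inv_into ?V (tchart \<phi>) y"] Y(3)[OF that] by simp_all
 have pos: "posdef b y" "posdef b' (Fc y)" if "y \<in> Y" for y
 proof -
  have "y \<in> W" "Fc y \<in> W'" using Y(3)[OF that] by simp_all
  then show "posdef b y" "posdef b' (Fc y)" unfolding posdef_def by (auto intro: f(7) f'(7))
 qed
 have lin: "linear (D1 Fc y)" if "y \<in> Y" for y by (rule linear_D1[OF sm(1)[OF that]])
 have jets: "snd (snd \<beta>) \<noteq> 0 ==> \<beta> \<bullet> D1 Fc y eu \<noteq> 0 ==>
   pol b c d q y (\<lambda>v. \<beta> \<bullet> D1 Fc y v) (\<lambda>v v'. quad \<kappa> \<sigma> k (D1 Fc y v) (D1 Fc y v') + \<beta> \<bullet> D2 Fc y v v') = 0 \<longleftrightarrow>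
   pol b' c' d' q' (Fc y) ((\<bullet>) \<beta>) (quad \<kappa> \<sigma> k) = 0"
  "snd (snd \<beta>) \<noteq> 0 ==> D1 Fc y eu = 0 ==> (\<And>v. D2 Fc y eu v = 0) ==> (\<And>v. D2 Fc y v eu = 0) ==> i \<in> Basis ==>
   \<beta> \<bullet> D1 Fc y (0, i, 0) \<noteq> 0 ==> pol b' c' d' q' (Fc y) ((\<bullet>) \<beta>) (quad \<kappa> \<sigma> k) = 0"
  if y: "y \<in> Y" for y \<beta> \<kappa> \<sigma> k i
 proof -
  let ?p = "inv_into ?V (tchart \<phi>) y"
  have p: "?p \<in> ?V" "F ?p \<in> ?V'" "tchart \<phi> ?p \<in> W" "tchart \<phi>' (F ?p) \<in> W'" "tchart \<phi> ?p = y" using Y(3)[OF y] by simp_all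
  note mj = morphism_jets[OF p(1-4), unfolded p(5)]
  show "snd (snd \<beta>) \<noteq> 0 ==> \<beta> \<bullet> D1 Fc y eu \<noteq> 0 ==>
   pol b c d q y (\<lambda>v. \<beta> \<bullet> D1 Fc y v) (\<lambda>v v'. quad \<kappa> \<sigma> k (D1 Fc y v) (D1 Fc y v') + \<beta> \<bullet> D2 Fc y v v') = 0 \<longleftrightarrow>
   pol b' c' d' q' (Fc y) ((\<bullet>) \<beta>) (quad \<kappa> \<sigma> k) = 0" by (rule mj(1))
  show "snd (snd \<beta>) \<noteq> 0 ==> D1 Fc y eu = 0 ==> (\<And>v. D2 Fc y eu v = 0) ==> (\<And>v. D2 Fc y v eu = 0) ==> i \<in> Basis ==>
   \<beta> \<bullet> D1 Fc y (0, i, 0) \<noteq> 0 ==> pol b' c' d' q' (Fc y) ((\<bullet>) \<beta>) (quad \<kappa> \<sigma> k) = 0" by (rule mj(2))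
 qed
 have tr: "transfer (D1 Fc y) (D2 Fc y) b c d q y b' c' d' q' (Fc y)" if y: "y \<in> Y" for y
  unfolding transfer_def using jets(1)[OF y] by blast
 have i: "fst (D1 Fc y (0, x, u)) = 0" if y: "y \<in> Y" "D1 Fc y eu \<noteq> 0" for y x u
  by (rule time_component[OF lin[OF y(1)] sm(2)[OF y(1)] pos[OF y(1)] tr[OF y(1)] y(2)])
 \<comment> \<open>If \<open>D eu\<close> vanished on an open set, the second derivatives would
   vanish on \<open>eu\<close> too, and the pulled back jets would be in the equation for every
   \<open>\<sigma>\<close>, contrary to \<open>choose_\<sigma>\<close>.\<close>
 have ii: False if Y1: "open Y1" "y1 \<in> Y1" "Y1 \<subseteq> Y" "\<And>y. y \<in> Y1 ==> D1 Fc y eu = 0" for Y1 y1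
 proof -
  have y1: "y1 \<in> Y" using Y1 by blast
  have smY: "smooth_at Fc z" if "z \<in> Y1" for z using sm(1) Y1(3) that by blast
  note v = D2_vanish[OF Y1(1,2) smY Y1(4)]
  note l = lin[OF y1]
  have "\<exists>i\<in>Basis. D1 Fc y1 (0, i, 0) \<noteq> 0"
  proof (rule ccontr)
   assume neg: "\<not> ?thesis"
   have "D1 Fc y1 (0, x, 0) = 0" for x
   proof -
    have x: "(0, x, 0) = (\<Sum>i\<in>Basis. (x \<bullet> i) *\<^sub>R (0 :: real, i, 0 :: real))"
     by (simp add: sum_prod euclidean_representation)
    show ?thesis by (subst x) (use neg in \<open>simp add: linear_sum[OF l] linear_cmul[OF l] del: scaleR_Pair\<close>)
   qed
   then have dec: "D1 Fc y1 v = fst v *\<^sub>R D1 Fc y1 (1, 0, 0) + snd (snd v) *\<^sub>R D1 Fc y1 eu" for v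
    using D_decomp[OF l sm(2)[OF y1] pos[OF y1], of v] by simp
   have "D1 Fc y1 v \<in> span {D1 Fc y1 (1, 0, 0), D1 Fc y1 eu}" for v
    by (subst dec[of v]) (intro span_add span_scale span_base insertI1 insertI2)
   then show False using not_spanned[OF l sm(2)[OF y1] pos[OF y1]] by blast
  qed
  then obtain i where i: "i \<in> Basis" "D1 Fc y1 (0, i, 0) \<noteq> 0" by blast
  have e0: "((0, 0, 1) :: real \<times> 'f \<times> real) \<noteq> 0" by (simp add: zero_prod_def)
  obtain \<beta> where \<beta>: "\<beta> \<bullet> (0, 0, 1) \<noteq> 0" "\<beta> \<bullet> D1 Fc y1 (0, i, 0) \<noteq> 0" using two_functionals[OF e0 i(2)] by metis
  have \<beta>u: "snd (snd \<beta>) \<noteq> 0" using \<beta>(1) by (cases \<beta>) simp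
  obtain k :: 'f where k: "k \<in> Basis" using nonempty_Basis by blast
  obtain \<sigma> where "\<And>\<kappa>. pol b' c' d' q' (Fc y1) ((\<bullet>) \<beta>) (quad \<kappa> (\<sigma> + 1) k) \<noteq> 0"
   using choose_\<sigma>[OF l sm(2)[OF y1] pos[OF y1] k \<beta>u, of c' d' q'] by metis
  then show False using jets(2)[OF y1 \<beta>u Y1(4)[OF Y1(2)] v(2,1) i(1) \<beta>(2)] by blast
 qed
 \<comment> \<open>A nonzero value persists nearby; there \<open>i\<close> forces
   \<open>D eu = 0\<close> on an open set, which \<open>ii\<close> excludes.\<close>
 have iii: "fst (D1 Fc y (0, x, u)) = 0" if y: "y \<in> Y" for y x u
 proof (rule ccontr)
  assume n: "fst (D1 Fc y (0, x, u)) \<noteq> 0"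
  have s: "smooth_at (\<lambda>z. fst (D1 Fc z (0, x, u))) y" by (intro smooth_at_fst smooth_at_D1 sm(1)[OF y])
  have "eventually (\<lambda>r::real. r \<in> - {0}) (nhds (fst (D1 Fc y (0, x, u))))" using n by (intro eventually_nhds_in_open) auto
  from eventually_conj[OF eventually_smooth_at_compose[OF s this] eventually_nhds_in_open[OF Y(1) y]]
  obtain Y1 where Y1: "open Y1" "y \<in> Y1" "\<And>z. z \<in> Y1 ==> fst (D1 Fc z (0, x, u)) \<noteq> 0 \<and> z \<in> Y"
   unfolding eventually_nhds by auto
  have "D1 Fc z eu = 0" if "z \<in> Y1" for z using i[of z x u] Y1(3)[OF that] by blast
  then show False using ii[OF Y1(1,2)] Y1(3) by blast
 qed
 have iv: "fst (D2 Fc y v (0, x, u)) = 0" if y: "y \<in> Y" for y v x u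
 proof -
  have "eventually (\<lambda>z. fst (D1 Fc z (0, x, u)) = 0) (nhds y)"
   by (rule eventually_mono[OF eventually_nhds_in_open[OF Y(1) y]]) (rule iii)
  from D1_cong_ev[OF this] have "D1 (\<lambda>z. fst (D1 Fc z (0, x, u))) y v = 0" by (simp add: D1_const)
  then show ?thesis using D1_linear_compose[OF bounded_linear_fst smooth_at_D1[OF sm(1)[OF y]]] by (simp add: D2_def)
 qed
 have v: "fst (snd (D1 Fc y eu)) = 0" if y: "y \<in> Y" for y
  by (rule space_component[OF lin[OF y] sm(2)[OF y] pos[OF y] tr[OF y] iii[OF y] iv[OF y]])
 show ?thesis
 proof (rule that[OF Y(1,2)])
  show "Y \<subseteq> T \<times> \<phi> ` U \<times> \<Omega>" using Y(3) f(3) by blast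
 qed (use Y(3) sm iii v in blast)+
qed

end

section \<open>Morphisms are triangular\<close>

lemma smooth_at_D1_zero_const:
 fixes f :: "'a::euclidean_space => 'b::euclidean_space"
 assumes "convex S" "\<And>y. y \<in> S ==> smooth_at f y" "\<And>y v. y \<in> S ==> D1 f y v = 0" "x \<in> S" "y \<in> S"
 shows "f x = f y"
proof (rule has_derivative_zero_unique[OF assms(1) _ assms(4,5)])
 fix z assume "z \<in> S"
 then have "(f has_derivative D1 f z) (at z)" "D1 f z = (\<lambda>_. 0)"
  using assms(2,3) by (auto intro: smooth_at_D1_works)
 then show "(f has_derivative (\<lambda>h. 0)) (at z within S)" by (simp add: has_derivative_at_withinI)
qed

text \<open>What the symbol computations yield near a point, free of the equations: from here on
  only connectedness and surjectivity of derivatives are at work.\<close>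

definition local_triangular where
 "local_triangular T A \<Omega> T' A' \<Omega>' F U \<phi> U' \<phi>' Y \<longleftrightarrow>
  (U, \<phi>) \<in> smooth_charts A \<and> (U', \<phi>') \<in> smooth_charts A' \<and> open Y \<and> Y \<subseteq> T \<times> \<phi> ` U \<times> \<Omega> \<and>
  (\<forall>t x u. (t, \<phi> x, u) \<in> Y --> x \<in> U --> F (t, x, u) \<in> T' \<times> U' \<times> \<Omega>') \<and>
  (\<forall>y\<in>Y. smooth_at (local_rep F U \<phi> \<phi>') y \<and> surj (D1 (local_rep F U \<phi> \<phi>') y) \<and> (\<forall>x u. fst (D1 (local_rep F U \<phi> \<phi>') y (0, x, u)) = 0) \<and> fst (snd (D1 (local_rep F U \<phi> \<phi>') y eu)) = 0)"

lemma local_triangularD: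
 assumes "local_triangular T A \<Omega> T' A' \<Omega>' F U \<phi> U' \<phi>' Y"
 shows "(U, \<phi>) \<in> smooth_charts A" "(U', \<phi>') \<in> smooth_charts A'"
  "open Y" "Y \<subseteq> T \<times> \<phi> ` U \<times> \<Omega>"
  "\<And>t x u. (t, \<phi> x, u) \<in> Y ==> x \<in> U ==> F (t, x, u) \<in> T' \<times> U' \<times> \<Omega>'"
  "\<And>y. y \<in> Y ==> smooth_at (local_rep F U \<phi> \<phi>') y" "\<And>y. y \<in> Y ==> surj (D1 (local_rep F U \<phi> \<phi>') y)"
  "\<And>y x u. y \<in> Y ==> fst (D1 (local_rep F U \<phi> \<phi>') y (0, x, u)) = 0" "\<And>y. y \<in> Y ==> fst (snd (D1 (local_rep F U \<phi> \<phi>') y eu)) = 0"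
 using assms unfolding local_triangular_def by blast+

context
 fixes T T' \<Omega> \<Omega>' :: "real set"
  and A :: "('a::{t2_space,second_countable_topology}, 'e::euclidean_space) chart set"
  and A' :: "('b::{t2_space,second_countable_topology}, 'f::euclidean_space) chart set"
  and E E' F
 assumes pe: "pe_morphism T A \<Omega> E T' A' \<Omega>' E' F"
begin

lemma pe_facts:
 "pe_manifold T A \<Omega>" "pe_manifold T' A' \<Omega>'" "smooth_map (total_space T A \<Omega>) (total_space T' A' \<Omega>') F"
 "submersion (total_space T A \<Omega>) (total_space T' A' \<Omega>') F"
proof -
 show pm: "pe_manifold T A \<Omega>" "pe_manifold T' A' \<Omega>'" using pe by (auto simp: pe_morphism_def pe_object_def)
 show "submersion (total_space T A \<Omega>) (total_space T' A' \<Omega>') F"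
  using pe by (auto simp: pe_morphism_def pde_morphism_def)
 then show "smooth_map (total_space T A \<Omega>) (total_space T' A' \<Omega>') F" by (simp add: submersion_def)
qed

lemma local_structure:
 assumes t0: "t0 \<in> T" and x0: "x0 \<in> carrier A" and u0: "u0 \<in> \<Omega>"
 obtains U \<phi> U' \<phi>' Y where "local_triangular T A \<Omega> T' A' \<Omega>' F U \<phi> U' \<phi>' Y" "x0 \<in> U" "(t0, \<phi> x0, u0) \<in> Y"
proof -
 note P = pe_manifoldD[OF pe_facts(1)] and P' = pe_manifoldD[OF pe_facts(2)]
 let ?p0 = "(t0, x0, u0)" and ?m = "DIM('e) + 1"
 obtain L L' where L: "parabolic_operator T A \<Omega> L" "E = extended_equation T A \<Omega> L"
  "parabolic_operator T' A' \<Omega>' L'" "E' = extended_equation T' A' \<Omega>' L'"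
  using pe by (auto simp: pe_morphism_def pe_object_def)
 have mor: "pde_morphism (total_space T A \<Omega>) (extended_equation T A \<Omega> L)
   (total_space T' A' \<Omega>') (extended_equation T' A' \<Omega>' L') 2 ?m F"
  using pe L by (simp add: pe_morphism_def)
 obtain U \<phi> W b c d q where lf: "local_form T A \<Omega> L U \<phi> W b c d q" "x0 \<in> U" "(t0, \<phi> x0, u0) \<in> W"
  using L(1) t0 x0 u0 unfolding parabolic_operator_iff by blast
 have "?p0 \<in> carrier (total_space T A \<Omega>)" using t0 x0 u0 by (simp add: P(5))
 then have "F ?p0 \<in> T' \<times> carrier A' \<times> \<Omega>'" using smooth_mapD(1)[OF pe_facts(3)] by (simp add: P'(5))
 then obtain t' x' u' where F0: "F ?p0 = (t', x', u')" "t' \<in> T'" "x' \<in> carrier A'" "u' \<in> \<Omega>'" by (cases "F ?p0") auto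
 obtain U' \<phi>' W' b' c' d' q' where lf': "local_form T' A' \<Omega>' L' U' \<phi>' W' b' c' d' q'" "x' \<in> U'" "(t', \<phi>' x', u') \<in> W'"
  using L(3) F0(2-4) unfolding parabolic_operator_iff by blast
 have c: "(U, \<phi>) \<in> smooth_charts A" "(U', \<phi>') \<in> smooth_charts A'" using local_formD(1) lf lf' by blast+
 note cU = smooth_charts_is_chart[OF c(1)]
 let ?Fc = "\<lambda>y. tchart \<phi>' (F (inv_into (T \<times> U \<times> \<Omega>) (tchart \<phi>) y))"
 let ?F = "local_rep F U \<phi> \<phi>'"
 obtain Y where Y: "open Y" "tchart \<phi> ?p0 \<in> Y" "Y \<subseteq> T \<times> \<phi> ` U \<times> \<Omega>"
  "\<And>y. y \<in> Y ==> F (inv_into (T \<times> U \<times> \<Omega>) (tchart \<phi>) y) \<in> T' \<times> U' \<times> \<Omega>'"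
  "\<And>y. y \<in> Y ==> smooth_at ?Fc y" "\<And>y. y \<in> Y ==> surj (D1 ?Fc y)"
  "\<And>y x u. y \<in> Y ==> fst (D1 ?Fc y (0, x, u)) = 0" "\<And>y. y \<in> Y ==> fst (snd (D1 ?Fc y eu)) = 0"
  by (rule morphism_local[OF pe_facts(1,2) mor lf(1) lf'(1), of ?p0])
   (use t0 u0 lf(2,3) F0 lf'(2,3) in \<open>auto\<close>)
 have eq: "inv_into (T \<times> U \<times> \<Omega>) (tchart \<phi>) y = (fst y, inv_into U \<phi> (fst (snd y)), snd (snd y))" if "y \<in> Y" for y
  using inv_into_tchart[OF cU, of "fst y" T "fst (snd y)" "snd (snd y)" \<Omega>] that Y(3) by auto
 have ev: "eventually (\<lambda>z. ?Fc z = ?F z) (nhds y)" if "y \<in> Y" for y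
  by (rule eventually_mono[OF eventually_nhds_in_open[OF Y(1) that]]) (simp only: eq)
 note D = D1_cong_ev[OF ev]
 have lt: "local_triangular T A \<Omega> T' A' \<Omega>' F U \<phi> U' \<phi>' Y"
  unfolding local_triangular_def
 proof (intro conjI allI impI ballI c Y(1,3))
  show "F (t, x, u) \<in> T' \<times> U' \<times> \<Omega>'" if "(t, \<phi> x, u) \<in> Y" "x \<in> U" for t x u
   using Y(4)[OF that(1)] unfolding eq[OF that(1)] by (simp add: is_chartD(6)[OF cU that(2)])
  fix y assume y: "y \<in> Y"
  show "smooth_at ?F y" by (rule smooth_at_transform[OF Y(5)[OF y] ev[OF y]])
  show "surj (D1 ?F y)" using Y(6)[OF y] by (simp only: D[OF y])
  show "fst (D1 ?F y (0, x, u)) = 0" for x u using Y(7)[OF y] by (simp only: D[OF y])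
  show "fst (snd (D1 ?F y eu)) = 0" using Y(8)[OF y] by (simp only: D[OF y])
 qed
 show ?thesis by (rule that[OF lt lf(2)]) (use Y(2) in simp)
qed

section \<open>From the local to the global triangular form\<close>

text \<open>The time component is locally constant in \<open>(x, u)\<close> as its derivative
  vanishes, and \<open>X \<times> \<Omega>\<close> is connected.\<close>

lemma time_independent:
 assumes t: "t \<in> T" and x: "x \<in> carrier A" "x' \<in> carrier A" and u: "u \<in> \<Omega>" "u' \<in> \<Omega>"
 shows "fst (F (t, x, u)) = fst (F (t, x', u'))"
proof -
 have "connected (carrier A \<times> \<Omega>)"
  using pe_facts(1) by (auto simp: pe_manifold_def connected_manifold_def nonempty_open_interval_def is_interval_connected intro!: connected_Times)
 then have "fst (F (t, (x, u))) = fst (F (t, (x', u')))"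
 proof (rule connected_local_const)
  show "\<forall>a\<in>carrier A \<times> \<Omega>. eventually (\<lambda>b. fst (F (t, a)) = fst (F (t, b))) (at a within carrier A \<times> \<Omega>)"
  proof
   fix a assume "a \<in> carrier A \<times> \<Omega>"
   then obtain x0 u0 where a: "a = (x0, u0)" "x0 \<in> carrier A" "u0 \<in> \<Omega>" by blast
   obtain U \<phi> U' \<phi>' Y where lt: "local_triangular T A \<Omega> T' A' \<Omega>' F U \<phi> U' \<phi>' Y" "x0 \<in> U" "(t, \<phi> x0, u0) \<in> Y"
    using local_structure[OF t a(2,3)] .
   note ltD = local_triangularD[OF lt(1)]
   note l = ltD(1) lt(2) ltD(3) lt(3) ltD(4,6,8)
   note cU = smooth_charts_is_chart[OF l(1)]
   let ?F = "local_rep F U \<phi> \<phi>'"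
   obtain e where e: "e > 0" "ball (t, \<phi> x0, u0) e \<subseteq> Y" using l(3,4) open_contains_ball by blast
   have sub: "(t, z) \<in> Y" if "z \<in> ball (\<phi> x0, u0) e" for z
   proof -
    have "(t, z) \<in> ball (t, \<phi> x0, u0) e" using that dist_Pair_Pair[of t "(\<phi> x0, u0)" t z] by simp
    then show ?thesis using e(2) by blast
   qed
   have const: "fst (?F (t, z)) = fst (?F (t, z'))" if z: "z \<in> ball (\<phi> x0, u0) e" "z' \<in> ball (\<phi> x0, u0) e" for z z'
   proof (rule smooth_at_D1_zero_const[OF convex_ball _ _ z])
    fix y v assume y: "y \<in> ball (\<phi> x0, u0) e"
    have s: "smooth_at (\<lambda>z. (t, z)) y" by (intro smooth_intros)
    have s2: "smooth_at (\<lambda>z. ?F (t, z)) y" by (rule smooth_at_compose[OF s l(6)[OF sub[OF y]]])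
    then show "smooth_at (\<lambda>z. fst (?F (t, z))) y" by (rule smooth_at_fst)
    have "D1 (\<lambda>z. ?F (t, z)) y v = D1 ?F (t, y) (0, v)"
     using D1_chain[of "\<lambda>z. (t, z)" y ?F v] s l(6)[OF sub[OF y]]
     by (simp only: D1_Pair_const)
    then show "D1 (\<lambda>z. fst (?F (t, z))) y v = 0"
     using D1_linear_compose[OF bounded_linear_fst s2, of v] l(7)[OF sub[OF y], of "fst v" "snd v"] by simp
   qed
   have "isCont (\<lambda>b. (\<phi> (fst b), snd b)) (x0, u0)"
    by (intro isCont_Pair isCont_o2[of _ fst \<phi>] continuous_intros) (simp add: isCont_chart[OF cU l(2)])
   then have "eventually (\<lambda>b. (\<phi> (fst b), snd b) \<in> ball (\<phi> x0, u0) e) (nhds (x0, u0))"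
    unfolding isCont_def by (rule tendsto_at_iff_tendsto_nhds[of "\<lambda>b. (\<phi> (fst b), snd b)", THEN iffD1, THEN topological_tendstoD]) (use e(1) in auto)
   moreover have "eventually (\<lambda>b. b \<in> U \<times> UNIV) (nhds (x0, u0))"
    using is_chartD(1)[OF cU] l(2) by (intro eventually_nhds_in_open open_Times) auto
   ultimately have "eventually (\<lambda>b. fst (F (t, (x0, u0))) = fst (F (t, b))) (nhds (x0, u0))"
   proof eventually_elim
    case (elim b)
    have "fst (?F (t, (\<phi> x0, u0))) = fst (?F (t, (\<phi> (fst b), snd b)))"
     by (rule const) (use elim e(1) in auto)
    then show ?case using elim is_chartD(6)[OF cU] l(2) by auto
   qed
   then show "eventually (\<lambda>b. fst (F (t, a)) = fst (F (t, b))) (at a within carrier A \<times> \<Omega>)"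
    unfolding a(1) eventually_at_filter by (rule eventually_mono) simp
  qed
 qed (use x u in auto)
 then show ?thesis by simp
qed

text \<open>For fixed \<open>x\<close> the coordinates \<open>\<phi>'\<close> of the space component
  are locally constant in \<open>u\<close>; \<open>\<phi>'\<close> is injective on its domain and
  \<open>\<Omega>\<close> is connected.\<close>

lemma space_independent:
 assumes t: "t \<in> T" and x: "x \<in> carrier A" and u: "u \<in> \<Omega>" "u' \<in> \<Omega>"
 shows "fst (snd (F (t, x, u))) = fst (snd (F (t, x, u')))"
proof -
 have "connected \<Omega>"
  using pe_facts(1) by (auto simp: pe_manifold_def nonempty_open_interval_def is_interval_connected)
 then show ?thesis
 proof (rule connected_local_const[where f = "\<lambda>u. fst (snd (F (t, x, u)))"])
  show "\<forall>a\<in>\<Omega>. eventually (\<lambda>b. fst (snd (F (t, x, a))) = fst (snd (F (t, x, b)))) (at a within \<Omega>)"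
  proof
   fix u0 assume u0: "u0 \<in> \<Omega>"
   obtain U \<phi> U' \<phi>' Y where lt: "local_triangular T A \<Omega> T' A' \<Omega>' F U \<phi> U' \<phi>' Y" "x \<in> U" "(t, \<phi> x, u0) \<in> Y"
    using local_structure[OF t x u0] .
   note ltD = local_triangularD[OF lt(1)]
   note l = ltD(1) lt(2) ltD(3) lt(3) ltD(4,6,9,5,2)
   note cU = smooth_charts_is_chart[OF l(1)] and cU' = smooth_charts_is_chart[OF l(9)]
   let ?F = "local_rep F U \<phi> \<phi>'"
   obtain e where e: "e > 0" "ball (t, \<phi> x, u0) e \<subseteq> Y" using l(3,4) open_contains_ball by blast
   have sub: "(t, \<phi> x, z) \<in> Y" if "z \<in> ball u0 e" for z
    using that e(2) by (auto simp: subset_iff dist_Pair_Pair)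
   have const: "fst (snd (?F (t, \<phi> x, z))) = fst (snd (?F (t, \<phi> x, z')))" if z: "z \<in> ball u0 e" "z' \<in> ball u0 e" for z z'
   proof (rule smooth_at_D1_zero_const[OF convex_ball _ _ z])
    fix y v assume y: "y \<in> ball u0 e"
    have s: "smooth_at (\<lambda>z. (t, \<phi> x, z)) y" by (intro smooth_intros)
    have s2: "smooth_at (\<lambda>z. ?F (t, \<phi> x, z)) y" by (rule smooth_at_compose[OF s l(6)[OF sub[OF y]]])
    then show "smooth_at (\<lambda>z. fst (snd (?F (t, \<phi> x, z)))) y" by (intro smooth_at_fst smooth_at_snd)
    have b: "bounded_linear (\<lambda>p::real \<times> 'f \<times> real. fst (snd p))"
     by (intro bounded_linear_compose[OF bounded_linear_fst] bounded_linear_snd)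
    have "D1 (\<lambda>z. (t, \<phi> x, z)) y v = v *\<^sub>R (0, 0, 1)"
     by (subst D1_eqI[of _ "\<lambda>v. (0, 0, v)"]) (auto intro!: derivative_eq_intros)
    then have "D1 (\<lambda>z. ?F (t, \<phi> x, z)) y v = v *\<^sub>R D1 ?F (t, \<phi> x, y) eu"
     using D1_chain[of "\<lambda>z. (t, \<phi> x, z)" y ?F v] s l(6)[OF sub[OF y]]
     by (simp only: linear_cmul[OF linear_D1[OF l(6)[OF sub[OF y]]]])
    then show "D1 (\<lambda>z. fst (snd (?F (t, \<phi> x, z)))) y v = 0"
     using D1_linear_compose[OF b s2, of v] l(7)[OF sub[OF y]] by simp
   qed
   have "eventually (\<lambda>z. z \<in> ball u0 e) (nhds u0)" using e(1) by (intro eventually_nhds_in_open) auto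
   then show "eventually (\<lambda>b. fst (snd (F (t, x, u0))) = fst (snd (F (t, x, b)))) (at u0 within \<Omega>)"
    unfolding eventually_at_filter
   proof (rule eventually_mono)
    fix z assume z: "z \<in> ball u0 e"
    have "fst (snd (?F (t, \<phi> x, u0))) = fst (snd (?F (t, \<phi> x, z)))" by (rule const) (use z e(1) in auto)
    then have "\<phi>' (fst (snd (F (t, x, u0)))) = \<phi>' (fst (snd (F (t, x, z))))"
     by (simp add: is_chartD(6)[OF cU l(2)])
    moreover have "fst (snd (F (t, x, z))) \<in> U'" "fst (snd (F (t, x, u0))) \<in> U'"
     using l(8)[OF sub[OF z] l(2)] l(8)[OF l(4,2)] by auto
    ultimately show "z \<noteq> u0 --> z \<in> \<Omega> --> fst (snd (F (t, x, u0))) = fst (snd (F (t, x, z)))"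
     using is_chartD(4)[OF cU'] by (auto dest: inj_onD)
   qed
  qed
 qed (use u in auto)
qed

text \<open>\<open>\<tau>\<close> and \<open>\<theta>\<close> are read off with the remaining
  variables frozen at \<open>xs\<close> and \<open>us\<close>. They are submersions because the
  derivative of \<open>F\<close> is onto, its time component ignores the \<open>x\<close> and
  \<open>u\<close> directions, and its space component ignores the \<open>u\<close>
  direction.\<close>

lemma morphism_triangular: "\<exists>\<tau> \<theta> \<eta>. triangular_form T A \<Omega> T' A' \<Omega>' F \<tau> \<theta> \<eta>"
proof -
 note P = pe_manifoldD[OF pe_facts(1)] and P' = pe_manifoldD[OF pe_facts(2)]
 obtain xs us where s: "xs \<in> carrier A" "us \<in> \<Omega>"
  using pe_facts(1) by (auto simp: pe_manifold_def connected_manifold_def nonempty_open_interval_def)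
 define \<tau> where "\<tau> t = fst (F (t, xs, us))" for t
 define \<theta> where "\<theta> p = fst (snd (F (fst p, snd p, us)))" for p
 define \<eta> where "\<eta> p = snd (snd (F p))" for p
 note oT = open_set_manifold_facts[OF P(2)] and oT' = open_set_manifold_facts[OF P'(2)]
  and oO' = open_set_manifold_facts[OF P'(3)] and ts = time_space_facts[OF P(1,2)] and tt = total_space_facts[OF P(1-3)]
 have Fc: "F (t, x, u) \<in> T' \<times> carrier A' \<times> \<Omega>'" if "t \<in> T" "x \<in> carrier A" "u \<in> \<Omega>" for t x u
  using smooth_mapD(1)[OF pe_facts(3), of "(t, x, u)"] that by (simp add: P(5) P'(5))
 have Fcont: "isCont F (t, x, u)" if "t \<in> T" "x \<in> carrier A" "u \<in> \<Omega>" for t x u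
  using smooth_mapD(2)[OF pe_facts(3) P(4), of "(t, x, u)"] that by (simp add: P(5))
 have b1: "bounded_linear (\<lambda>p::real \<times> 'f \<times> real. fst (snd p))" and b2: "bounded_linear (\<lambda>p::real \<times> 'f \<times> real. snd (snd p))"
  by (intro bounded_linear_compose[OF bounded_linear_fst] bounded_linear_compose[OF bounded_linear_snd] bounded_linear_snd)+
 have F\<tau>: "F (t, x, u) = (\<tau> t, \<theta> (t, x), \<eta> (t, x, u))" if "t \<in> T" "x \<in> carrier A" "u \<in> \<Omega>" for t x u
  using time_independent[OF that(1,2) s(1) that(3) s(2)] space_independent[OF that s(2)]
  by (simp add: \<tau>_def \<theta>_def \<eta>_def prod_eq_iff)
 have s\<tau>: "submersion (open_set_manifold T) (open_set_manifold T') \<tau>"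
 proof -
  have loc: "smooth_at (\<lambda>y. \<tau> (inv_into T (\<lambda>x. x) y)) t \<and> surj (D1 (\<lambda>y. \<tau> (inv_into T (\<lambda>x. x) y)) t)" if t: "t \<in> T" for t
  proof -
   obtain U \<phi> U' \<phi>' Y where lt: "local_triangular T A \<Omega> T' A' \<Omega>' F U \<phi> U' \<phi>' Y" "xs \<in> U" "(t, \<phi> xs, us) \<in> Y"
    using local_structure[OF t s] .
   note ltD = local_triangularD[OF lt(1)]
   note l = ltD(1) lt(2,3) ltD(6,7,8)
   note cU = smooth_charts_is_chart[OF l(1)]
   let ?F = "local_rep F U \<phi> \<phi>'"
   note ly = l(4-6)[OF l(3)]
   have si: "smooth_at (\<lambda>r. (r, \<phi> xs, us)) t" by (intro smooth_intros)
   have sF: "smooth_at (\<lambda>r. ?F (r, \<phi> xs, us)) t" by (rule smooth_at_compose[OF si ly(1)])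
   have eq: "\<tau> = (\<lambda>r. fst (?F (r, \<phi> xs, us)))" by (simp add: fun_eq_iff \<tau>_def is_chartD(6)[OF cU l(2)])
   have sm: "smooth_at \<tau> t" unfolding eq by (rule smooth_at_fst[OF sF])
   have ev: "eventually (\<lambda>y. \<tau> y = \<tau> (inv_into T (\<lambda>x. x) y)) (nhds t)"
    by (rule eventually_mono[OF eventually_nhds_in_open[OF P(2) t]]) (simp add: inv_into_ident)
   have "D1 (\<lambda>r. (r, \<phi> xs, us)) t r = (r, 0, 0)" for r
    by (subst D1_eqI[of _ "\<lambda>v. (v, 0, 0)"]) (auto intro!: derivative_eq_intros simp: zero_prod_def)
   then have "D1 (\<lambda>r. ?F (r, \<phi> xs, us)) t r = D1 ?F (t, \<phi> xs, us) (r, 0, 0)" for r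
    using D1_chain[of "\<lambda>r. (r, \<phi> xs, us)" t ?F r] si ly(1) by simp
   then have D\<tau>: "D1 \<tau> t r = fst (D1 ?F (t, \<phi> xs, us) (r, 0, 0))" for r
    unfolding eq using D1_linear_compose[OF bounded_linear_fst sF, of r] by simp
   have "\<exists>r. z = D1 \<tau> t r" for z
   proof -
    obtain v where v: "(z, 0, 0) = D1 ?F (t, \<phi> xs, us) v" using surjD[OF ly(2), of "(z, 0, 0)"] by blast
    obtain r x u where "v = (r, 0, 0) + (0, x, u)" by (cases v) (simp add: that)
    then have "(z, 0, 0) = D1 ?F (t, \<phi> xs, us) (r, 0, 0) + D1 ?F (t, \<phi> xs, us) (0, x, u)"
     using v linear_add[OF linear_D1[OF ly(1)]] by (simp del: add_Pair)
    from arg_cong[where f = fst, OF this] have "z = D1 \<tau> t r" unfolding fst_add D\<tau> ly(3) by simp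
    then show ?thesis ..
   qed
   then have "surj (D1 \<tau> t)" unfolding surj_def by blast
   then show ?thesis using smooth_at_transform[OF sm ev] D1_cong_ev[OF ev] by simp
  qed
  show ?thesis
  proof (rule submersion_localI[OF oT(1) oT'(1)])
   fix t assume t: "t \<in> carrier (open_set_manifold T)"
   then have tT: "t \<in> T" by (simp add: oT(2))
   show \<tau>T: "\<tau> t \<in> carrier (open_set_manifold T')" using Fc[OF tT s] by (auto simp: \<tau>_def oT'(2))
   have "isCont (\<lambda>t. F (t, xs, us)) t" by (rule isCont_o2[of t "\<lambda>t. (t, xs, us)" F]) (auto intro!: Fcont[OF tT s] continuous_intros)
   then show "isCont \<tau> t" unfolding \<tau>_def by (rule continuous_fst)
   show "\<exists>U \<phi> V \<psi>. (U, \<phi>) \<in> smooth_charts (open_set_manifold T) \<and> (V, \<psi>) \<in> smooth_charts (open_set_manifold T') \<and> t \<in> U \<and> \<tau> t \<in> V \<and>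
     smooth_at (\<lambda>y. \<psi> (\<tau> (inv_into U \<phi> y))) (\<phi> t) \<and> surj (D1 (\<lambda>y. \<psi> (\<tau> (inv_into U \<phi> y))) (\<phi> t))"
    using oT(3) oT'(3) tT \<tau>T loc[OF tT] unfolding oT'(2) by blast
  qed
 qed
 have s\<theta>: "submersion (time_space T A) A' \<theta>"
 proof -
  have loc: "\<exists>U \<phi> V \<psi>. (U, \<phi>) \<in> smooth_charts (time_space T A) \<and> (V, \<psi>) \<in> smooth_charts A' \<and>
     p \<in> U \<and> \<theta> p \<in> V \<and> smooth_at (\<lambda>y. \<psi> (\<theta> (inv_into U \<phi> y))) (\<phi> p) \<and> surj (D1 (\<lambda>y. \<psi> (\<theta> (inv_into U \<phi> y))) (\<phi> p))"
   if p: "p \<in> carrier (time_space T A)" for p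
  proof -
   obtain t x where tx: "p = (t, x)" "t \<in> T" "x \<in> carrier A" using p unfolding ts(2) by blast
   obtain U \<phi> U' \<phi>' Y where lt: "local_triangular T A \<Omega> T' A' \<Omega>' F U \<phi> U' \<phi>' Y" "x \<in> U" "(t, \<phi> x, us) \<in> Y"
    using local_structure[OF tx(2,3) s(2)] .
   note ltD = local_triangularD[OF lt(1)]
   note l = ltD(1) lt(2,3) ltD(6,7,9,2,5)
   note cU = smooth_charts_is_chart[OF l(1)]
   let ?F = "local_rep F U \<phi> \<phi>'"
   let ?i = "\<lambda>r::real \<times> 'e. (fst r, snd r, us)"
   let ?\<theta> = "\<lambda>y. \<phi>' (\<theta> (inv_into (T \<times> U) (map_prod (\<lambda>x. x) \<phi>) y))"
   note ly = l(4-6)[OF l(3)]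
   have si: "smooth_at ?i (t, \<phi> x)" by (intro smooth_intros)
   have sF: "smooth_at (\<lambda>r. ?F (?i r)) (t, \<phi> x)" by (rule smooth_at_compose[OF si]) (simp add: ly(1))
   have sm: "smooth_at (\<lambda>r. fst (snd (?F (?i r)))) (t, \<phi> x)" by (intro smooth_at_fst smooth_at_snd sF)
   have "eventually (\<lambda>r. r \<in> T \<times> \<phi> ` U) (nhds (t, \<phi> x))"
    using P(2) is_chartD(2)[OF cU] tx l(2) by (intro eventually_nhds_in_open open_Times) auto
   then have ev: "eventually (\<lambda>r. fst (snd (?F (?i r))) = ?\<theta> r) (nhds (t, \<phi> x))"
    by (rule eventually_mono) (auto simp: \<theta>_def inv_into_time_chart[OF cU])
   have "D1 ?i (t, \<phi> x) r = (fst r, snd r, 0)" for r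
    by (subst D1_eqI[of _ "\<lambda>r. (fst r, snd r, 0)"]) (auto intro!: derivative_eq_intros)
   then have "D1 (\<lambda>r. ?F (?i r)) (t, \<phi> x) r = D1 ?F (t, \<phi> x, us) (fst r, snd r, 0)" for r
    using D1_chain[of ?i "(t, \<phi> x)" ?F r] si ly(1) by simp
   then have D\<theta>: "D1 (\<lambda>r. fst (snd (?F (?i r)))) (t, \<phi> x) r = fst (snd (D1 ?F (t, \<phi> x, us) (fst r, snd r, 0)))" for r
    using D1_linear_compose[OF b1 sF, of r] by simp
   have "\<exists>r. z = D1 (\<lambda>r. fst (snd (?F (?i r)))) (t, \<phi> x) r" for z
   proof -
    obtain v where v: "(0, z, 0) = D1 ?F (t, \<phi> x, us) v" using surjD[OF ly(2), of "(0, z, 0)"] by blast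
    obtain r x' u where "v = (r, x', 0) + u *\<^sub>R (0, 0, 1)" by (cases v) (simp add: that)
    then have "(0, z, 0) = D1 ?F (t, \<phi> x, us) (r, x', 0) + u *\<^sub>R D1 ?F (t, \<phi> x, us) eu"
     using v linear_add[OF linear_D1[OF ly(1)]] linear_cmul[OF linear_D1[OF ly(1)]] by (simp del: add_Pair scaleR_Pair)
    from arg_cong[where f = "\<lambda>x. fst (snd x)", OF this]
    have "z = fst (snd (D1 ?F (t, \<phi> x, us) (r, x', 0) + u *\<^sub>R D1 ?F (t, \<phi> x, us) eu))" by simp
    then have "z = D1 (\<lambda>r. fst (snd (?F (?i r)))) (t, \<phi> x) (r, x')" using D\<theta>[of "(r, x')"] ly(3) by simp
    then show ?thesis ..
   qed
   then have "surj (D1 (\<lambda>r. fst (snd (?F (?i r)))) (t, \<phi> x))" unfolding surj_def by blast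
   then have "smooth_at ?\<theta> (t, \<phi> x) \<and> surj (D1 ?\<theta> (t, \<phi> x))"
    using smooth_at_transform[OF sm ev] D1_cong_ev[OF ev] by simp
   moreover have "\<theta> p \<in> U'" using l(8)[OF l(3,2)] by (auto simp: \<theta>_def tx(1))
   ultimately show ?thesis
    by (intro exI[of _ "T \<times> U"] exI[of _ "map_prod (\<lambda>x. x) \<phi>"] exI[of _ U'] exI[of _ \<phi>'])
     (use ts(3)[OF l(1)] l(2,7) tx in auto)
  qed
  show ?thesis
  proof (rule submersion_localI[OF ts(1) P'(1)])
   fix p assume p: "p \<in> carrier (time_space T A)"
   then obtain t x where tx: "p = (t, x)" "t \<in> T" "x \<in> carrier A" unfolding ts(2) by blast
   show "\<theta> p \<in> carrier A'" using Fc[OF tx(2,3) s(2)] by (auto simp: \<theta>_def tx(1))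
   have "isCont (\<lambda>p. F (fst p, snd p, us)) (t, x)"
    by (rule isCont_o2[of "(t, x)" "\<lambda>p. (fst p, snd p, us)" F]) (auto intro!: Fcont[OF tx(2,3) s(2)] continuous_intros)
   then show "isCont \<theta> p" unfolding \<theta>_def tx(1) by (intro continuous_fst continuous_snd)
  qed (rule loc)
 qed
 have s\<eta>: "submersion (total_space T A \<Omega>) (open_set_manifold \<Omega>') \<eta>"
 proof -
  have loc: "\<exists>U \<phi> V \<psi>. (U, \<phi>) \<in> smooth_charts (total_space T A \<Omega>) \<and> (V, \<psi>) \<in> smooth_charts (open_set_manifold \<Omega>') \<and>
     p \<in> U \<and> \<eta> p \<in> V \<and> smooth_at (\<lambda>y. \<psi> (\<eta> (inv_into U \<phi> y))) (\<phi> p) \<and> surj (D1 (\<lambda>y. \<psi> (\<eta> (inv_into U \<phi> y))) (\<phi> p))"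
   if p: "p \<in> carrier (total_space T A \<Omega>)" for p
  proof -
   obtain V \<psi> where c: "(V, \<psi>) \<in> smooth_charts (total_space T A \<Omega>)" "p \<in> V" using chart_at_point[OF P(4) p] by metis
   have Fp: "F p \<in> T' \<times> carrier A' \<times> \<Omega>'" using smooth_mapD(1)[OF pe_facts(3) p] by (simp add: P'(5))
   then obtain U' \<phi>' where c': "(U', \<phi>') \<in> smooth_charts A'" "fst (snd (F p)) \<in> U'" using chart_at_point[OF P'(1)] by (metis mem_Times_iff)
   have d: "(T' \<times> U' \<times> \<Omega>', tchart \<phi>') \<in> smooth_charts (total_space T' A' \<Omega>')" "F p \<in> T' \<times> U' \<times> \<Omega>'"
    using total_space_facts(3)[OF P'(1-3) c'(1)] Fp c'(2) by (auto simp: mem_Times_iff)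
   have sm: "smooth_at (\<lambda>y. tchart \<phi>' (F (inv_into V \<psi> y))) (\<psi> p)" by (rule smooth_map_at[OF P(4) P'(4) pe_facts(3) c(1) d(1) c(2) d(2)])
   have su: "surj (D1 (\<lambda>y. tchart \<phi>' (F (inv_into V \<psi> y))) (\<psi> p))" by (rule submersion_at[OF P(4) P'(4) pe_facts(4) c(1) d(1) c(2) d(2)])
   have eq: "(\<lambda>y. \<eta> (inv_into V \<psi> y)) = (\<lambda>y. snd (snd (tchart \<phi>' (F (inv_into V \<psi> y)))))"
    by (simp add: fun_eq_iff \<eta>_def)
   have "smooth_at (\<lambda>y. \<eta> (inv_into V \<psi> y)) (\<psi> p)" unfolding eq by (intro smooth_at_snd sm)
   moreover have "D1 (\<lambda>y. \<eta> (inv_into V \<psi> y)) (\<psi> p) = (\<lambda>v. snd (snd (D1 (\<lambda>y. tchart \<phi>' (F (inv_into V \<psi> y))) (\<psi> p) v)))"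
    unfolding eq by (rule ext) (rule D1_linear_compose[OF b2 sm])
   then have "surj (D1 (\<lambda>y. \<eta> (inv_into V \<psi> y)) (\<psi> p))"
    using su unfolding surj_def by (metis snd_conv)
   moreover have "\<eta> p \<in> \<Omega>'" using Fp by (auto simp: \<eta>_def)
   ultimately show ?thesis using c oO'(3) by (intro exI[of _ V] exI[of _ \<psi>] exI[of _ \<Omega>'] exI[of _ "\<lambda>x. x"]) auto
  qed
  show ?thesis
  proof (rule submersion_localI[OF P(4) oO'(1)])
   fix p assume p: "p \<in> carrier (total_space T A \<Omega>)"
   have "F p \<in> T' \<times> carrier A' \<times> \<Omega>'" using smooth_mapD(1)[OF pe_facts(3) p] by (simp add: P'(5))
   then show "\<eta> p \<in> carrier (open_set_manifold \<Omega>')" by (auto simp: \<eta>_def oO'(2))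
   show "isCont \<eta> p" unfolding \<eta>_def by (intro continuous_snd smooth_mapD(2)[OF pe_facts(3) P(4) p])
  qed (rule loc)
 qed
 show ?thesis unfolding triangular_form_def using s\<tau> s\<theta> s\<eta> F\<tau> by blast
qed

end

section \<open>Isomorphisms\<close>

lemma smooth_map_cong:
 assumes A: "smooth_manifold A" and B: "smooth_manifold B" and G: "smooth_map A B G"
  and eq: "\<And>p. p \<in> carrier A ==> F p = G p"
 shows "smooth_map A B F"
proof (rule smooth_mapI[OF A B])
 fix p assume p: "p \<in> carrier A"
 have ev: "eventually (\<lambda>q. F q = G q) (nhds p)"
  by (rule eventually_mono[OF eventually_nhds_in_open[OF open_carrier[OF A] p]]) (rule eq)
 show "F p \<in> carrier B" using smooth_mapD(1)[OF G p] eq[OF p] by simp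
 show "isCont F p" using smooth_mapD(2)[OF G A p] isCont_cong[OF ev] by blast
 obtain U \<phi> where c: "(U, \<phi>) \<in> smooth_charts A" "p \<in> U" using chart_at_point[OF A p] by metis
 obtain V \<psi> where d: "(V, \<psi>) \<in> smooth_charts B" "G p \<in> V" using chart_at_point[OF B smooth_mapD(1)[OF G p]] by metis
 have s: "smooth_at (\<lambda>y. \<psi> (G (inv_into U \<phi> y))) (\<phi> p)" by (rule smooth_map_at[OF A B G c(1) d(1) c(2) d(2)])
 have "eventually (\<lambda>y. \<psi> (G (inv_into U \<phi> y)) = \<psi> (F (inv_into U \<phi> y))) (nhds (\<phi> p))"
  using eventually_chart[OF smooth_charts_is_chart[OF c(1)] c(2) ev] by (rule eventually_mono) simp
 from smooth_at_transform[OF s this]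
 show "\<exists>U \<phi> V \<psi>. (U, \<phi>) \<in> smooth_charts A \<and> (V, \<psi>) \<in> smooth_charts B \<and> p \<in> U \<and> F p \<in> V \<and>
   smooth_at (\<lambda>y. \<psi> (F (inv_into U \<phi> y))) (\<phi> p)"
  using c d eq[OF p] by (intro exI[of _ U] exI[of _ \<phi>] exI[of _ V] exI[of _ \<psi>]) simp
qed

lemma inverse_D1:
 assumes A: "smooth_manifold A" and B: "smooth_manifold B" and F: "smooth_map A B F" and G: "smooth_map B A G"
  and GF: "\<And>p. p \<in> carrier A ==> G (F p) = p" and FG: "\<And>q. q \<in> carrier B ==> F (G q) = q"
  and c: "(U, \<phi>) \<in> smooth_charts A" "p \<in> U" and d: "(V, \<psi>) \<in> smooth_charts B" "F p \<in> V"
 shows "D1 (\<lambda>y. \<psi> (F (inv_into U \<phi> y))) (\<phi> p) (D1 (\<lambda>y. \<phi> (G (inv_into V \<psi> y))) (\<psi> (F p)) v) = v"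
proof -
 have p: "p \<in> carrier A" using smooth_charts_carrier[OF c(1)] c(2) by blast
 note cU = smooth_charts_is_chart[OF c(1)] and cV = smooth_charts_is_chart[OF d(1)]
 let ?F = "\<lambda>y. \<psi> (F (inv_into U \<phi> y))" and ?G = "\<lambda>y. \<phi> (G (inv_into V \<psi> y))"
 have Gp: "G (F p) = p" by (rule GF[OF p])
 have sF: "smooth_at ?F (\<phi> p)" by (rule smooth_map_at[OF A B F c(1) d(1) c(2) d(2)])
 have sG: "smooth_at ?G (\<psi> (F p))" by (rule smooth_map_at[OF B A G d(1) c(1) d(2)]) (simp add: Gp c(2))
 have Fp: "F p \<in> carrier B" by (rule smooth_mapD(1)[OF F p])
 have "eventually (\<lambda>q. G q \<in> U) (nhds (F p))"
  by (rule eventually_compose_filterlim[OF _ smooth_mapD(2)[OF G B Fp, unfolded isCont_def tendsto_at_iff_tendsto_nhds]])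
   (simp add: Gp eventually_nhds_in_open is_chartD(1)[OF cU] c(2))
 from eventually_chart[OF cV d(2) eventually_conj[OF this eventually_nhds_in_open[OF open_carrier[OF B] Fp]]]
 have ev: "eventually (\<lambda>y. ?F (?G y) = y) (nhds (\<psi> (F p)))"
  by (rule eventually_mono) (simp add: is_chartD(6)[OF cU] FG)
 have e: "?G (\<psi> (F p)) = \<phi> p" by (simp add: is_chartD(6)[OF cV d(2)] Gp)
 show ?thesis
  using D1_cong_ev[OF ev] D1_chain[of ?G "\<psi> (F p)" ?F v] sG sF
  by (simp add: e D1_linear)
qed

lemma inverse_submersion:
 assumes A: "smooth_manifold A" and B: "smooth_manifold B" and F: "smooth_map A B F" and G: "smooth_map B A G"
  and GF: "\<And>p. p \<in> carrier A ==> G (F p) = p" and FG: "\<And>q. q \<in> carrier B ==> F (G q) = q"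
 shows "submersion A B F"
proof (rule submersionI[OF A B F])
 fix p assume p: "p \<in> carrier A"
 obtain U \<phi> where c: "(U, \<phi>) \<in> smooth_charts A" "p \<in> U" using chart_at_point[OF A p] by metis
 obtain V \<psi> where d: "(V, \<psi>) \<in> smooth_charts B" "F p \<in> V" using chart_at_point[OF B smooth_mapD(1)[OF F p]] by metis
 have "D1 (\<lambda>y. \<psi> (F (inv_into U \<phi> y))) (\<phi> p) (D1 (\<lambda>y. \<phi> (G (inv_into V \<psi> y))) (\<psi> (F p)) v) = v" for v
  by (rule inverse_D1[OF A B F G GF FG c d])
 then have "surj (D1 (\<lambda>y. \<psi> (F (inv_into U \<phi> y))) (\<phi> p))" by (rule surjI)
 then show "\<exists>U \<phi> V \<psi>. (U, \<phi>) \<in> smooth_charts A \<and> (V, \<psi>) \<in> smooth_charts B \<and> p \<in> U \<and> F p \<in> V \<and>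
   surj (D1 (\<lambda>y. \<psi> (F (inv_into U \<phi> y))) (\<phi> p))" using c d by blast
qed

lemma diffeomorphism_inverse:
 assumes "diffeomorphism A B F"
 shows "smooth_map A B F" "smooth_map B A (inv_into (carrier A) F)" "F ` carrier A = carrier B" "inj_on F (carrier A)"
  "\<And>p. p \<in> carrier A ==> inv_into (carrier A) F (F p) = p" "\<And>q. q \<in> carrier B ==> F (inv_into (carrier A) F q) = q"
  "\<And>q. q \<in> carrier B ==> inv_into (carrier A) F q \<in> carrier A"
proof -
 show "smooth_map A B F" "smooth_map B A (inv_into (carrier A) F)" and i: "F ` carrier A = carrier B" "inj_on F (carrier A)"
  using assms by (auto simp: diffeomorphism_def bij_betw_def)
 show "\<And>p. p \<in> carrier A ==> inv_into (carrier A) F (F p) = p" using i by simp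
 show "\<And>q. q \<in> carrier B ==> F (inv_into (carrier A) F q) = q" using i by (metis f_inv_into_f)
 show "\<And>q. q \<in> carrier B ==> inv_into (carrier A) F q \<in> carrier A" using i by (metis inv_into_into)
qed

text \<open>For a bijection every subset of the carrier is projected, so the equivalence for
  \<open>F\<close> at the preimage of \<open>M\<close> is the one for the inverse map at
  \<open>M\<close>.\<close>

lemma inverse_pde_morphism:
 fixes A :: "('a::{t2_space,second_countable_topology}, 'e::euclidean_space) chart set"
  and B :: "('b::{t2_space,second_countable_topology}, 'f::euclidean_space) chart set"
 assumes m: "DIM('e) = m + 1" "DIM('f) = m' + 1" and F: "pde_morphism A E B E' 2 m F" and dF: "diffeomorphism A B F"
 shows "pde_morphism B E' A E 2 m' (inv_into (carrier A) F)"
proof -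
 note F' = F[unfolded pde_morphism_iff[OF m]]
 have A: "smooth_manifold A" and B: "smooth_manifold B" using F' by (auto simp: pde_object_def)
 note d = diffeomorphism_inverse[OF dF]
 let ?G = "inv_into (carrier A) F"
 have sub: "submersion B A ?G" by (rule inverse_submersion[OF B A d(2,1,6,5)])
 have jets: "jet B 2 m' q M \<in> E' \<longleftrightarrow> jet A 2 m (?G q) (?G ` M) \<in> E" if M: "submanifold B m' M" "projected B ?G M" "q \<in> M" for q M
 proof -
  have Mc: "M \<subseteq> carrier B" using M(1) by (simp add: submanifold_def)
  have L: "submanifold A m (?G ` M)" by (rule projected_image_submanifold[OF B A sub m(2,1) M(1,2)])
  have FL: "F ` (?G ` M) = M" using d(6) Mc by (force simp: image_image)
  have "p \<in> ?G ` M \<longleftrightarrow> p \<in> carrier A \<and> F p \<in> M" for p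
  proof
   assume "p \<in> ?G ` M"
   then obtain q where q: "q \<in> M" "p = ?G q" by blast
   then have "q \<in> carrier B" using Mc by blast
   then show "p \<in> carrier A \<and> F p \<in> M" using d(6,7) q by simp
  next
   assume "p \<in> carrier A \<and> F p \<in> M"
   then show "p \<in> ?G ` M" using d(5)[of p] by (metis imageI)
  qed
  then have "projected A F (?G ` M)" unfolding projected_def FL by blast
  moreover have "?G q \<in> ?G ` M" using M(3) by blast
  moreover have "F (?G q) = q" using d(6) Mc M(3) by blast
  moreover have "\<forall>p L. submanifold A m L --> projected A F L --> p \<in> L --> (jet A 2 m p L \<in> E \<longleftrightarrow> jet B 2 m' (F p) (F ` L) \<in> E')"
   using F' by blast
  ultimately show ?thesis using L FL by auto
 qed
 have "?G ` carrier B = carrier A"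
 proof
  show "?G ` carrier B \<subseteq> carrier A" using d(7) by blast
  show "carrier A \<subseteq> ?G ` carrier B" using d(5) d(3) by (metis image_eqI subsetI)
 qed
 moreover have "pde_object A 2 m E" "pde_object B 2 m' E'" using F' by auto
 ultimately show ?thesis unfolding pde_morphism_iff[OF m(2,1)] by (intro conjI allI impI sub jets)
qed

text \<open>A morphism inverse to \<open>F\<close> agrees with \<open>inv_into\<close> on the
  carrier, which makes \<open>F\<close> a diffeomorphism; conversely
  \<open>inverse_pde_morphism\<close> supplies the inverse morphism.\<close>

lemma pe_isomorphism_iff:
 fixes A :: "('a::{t2_space,second_countable_topology}, 'e::euclidean_space) chart set"
  and A' :: "('b::{t2_space,second_countable_topology}, 'f::euclidean_space) chart set"
 shows "pe_isomorphism T A \<Omega> E T' A' \<Omega>' E' F \<longleftrightarrow>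
  pe_morphism T A \<Omega> E T' A' \<Omega>' E' F \<and> diffeomorphism (total_space T A \<Omega>) (total_space T' A' \<Omega>') F"
proof
 let ?N = "total_space T A \<Omega>" and ?N' = "total_space T' A' \<Omega>'"
 have m: "DIM(real \<times> 'e \<times> real) = (DIM('e) + 1) + 1" "DIM(real \<times> 'f \<times> real) = (DIM('f) + 1) + 1" by simp_all
 show "pe_morphism T A \<Omega> E T' A' \<Omega>' E' F \<and> diffeomorphism ?N ?N' F" if i: "pe_isomorphism T A \<Omega> E T' A' \<Omega>' E' F"
 proof -
  obtain G where G: "pe_morphism T' A' \<Omega>' E' T A \<Omega> E G" "\<And>p. p \<in> carrier ?N ==> G (F p) = p"
   "\<And>p. p \<in> carrier ?N' ==> F (G p) = p" and F: "pe_morphism T A \<Omega> E T' A' \<Omega>' E' F"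
   using i unfolding pe_isomorphism_def by blast
  note f = pe_facts[OF F] and g = pe_facts[OF G(1)]
  note P = pe_manifoldD[OF f(1)] and P' = pe_manifoldD[OF f(2)]
  have inj: "inj_on F (carrier ?N)" using G(2) by (metis inj_on_inverseI)
  have im: "F ` carrier ?N = carrier ?N'" using smooth_mapD(1)[OF f(3)] smooth_mapD(1)[OF g(3)] G(3) by (metis (no_types, lifting) image_eqI subsetI subset_antisym image_subsetI)
  have "inv_into (carrier ?N) F q = G q" if "q \<in> carrier ?N'" for q
   using inv_into_f_f[OF inj smooth_mapD(1)[OF g(3) that]] G(3)[OF that] by simp
  then have "smooth_map ?N' ?N (inv_into (carrier ?N) F)" by (rule smooth_map_cong[OF P'(4) P(4) g(3)])
  then show ?thesis using F f(3) inj im by (simp add: diffeomorphism_def bij_betw_def)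
 qed
 show "pe_isomorphism T A \<Omega> E T' A' \<Omega>' E' F" if h: "pe_morphism T A \<Omega> E T' A' \<Omega>' E' F \<and> diffeomorphism ?N ?N' F"
 proof -
  have "pe_morphism T' A' \<Omega>' E' T A \<Omega> E (inv_into (carrier ?N) F)"
   using h inverse_pde_morphism[OF m, of ?N E ?N' E' F] by (simp add: pe_morphism_def)
  then show ?thesis unfolding pe_isomorphism_def using h diffeomorphism_inverse(5,6)[of ?N ?N' F] by blast
 qed
qed

section \<open>Pushing an equation forward\<close>

text \<open>Here \<open>D\<close> and \<open>B\<close> are the first and second derivative, at a point, of a diffeomorphism of triangular form, and
 \<open>b\<close>, \<open>c\<close>, \<open>d\<close>, \<open>q\<close> the values of the coefficients there. The formulas result from expressing the
 derivatives of a defining function \<open>g \<circ> F\<close> by those of \<open>g\<close>.\<close>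

abbreviation ex :: "'e::euclidean_space => real \<times> 'e \<times> real" where "ex i \<equiv> (0, i, 0)"
abbreviation "comp_x D i \<equiv> fst (snd (D (ex i)))"
abbreviation "comp_u D i \<equiv> snd (snd (D (ex i)))"
abbreviation "comp_t D \<equiv> fst (D (1, 0, 0))"
abbreviation "comp_h D \<equiv> snd (snd (D eu))"

definition push_b where
 "push_b D b k l = (\<Sum>i\<in>Basis. \<Sum>j\<in>Basis. b i j * ((comp_x D i \<bullet> k) * (comp_x D j \<bullet> l))) / comp_t D"

definition push_c where
 "push_c D B b c k l = (\<Sum>i\<in>Basis. \<Sum>j\<in>Basis. (comp_h D * c i j - snd (snd (B eu eu)) * b i j) *
  ((comp_x D i \<bullet> k) * (comp_x D j \<bullet> l))) / ((comp_h D)\<^sup>2 * comp_t D)"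

definition push_d where
 "push_d D B b c d = (inverse ((comp_h D)\<^sup>2 * comp_t D)) *\<^sub>R
  ((\<Sum>i\<in>Basis. \<Sum>j\<in>Basis. b i j *\<^sub>R ((comp_h D)\<^sup>2 *\<^sub>R fst (snd (B (ex i) (ex j)))
    + (- comp_h D * snd (snd (B (ex i) eu)) + snd (snd (B eu eu)) * comp_u D i) *\<^sub>R comp_x D j
    + (- comp_h D * snd (snd (B eu (ex j))) + snd (snd (B eu eu)) * comp_u D j) *\<^sub>R comp_x D i))
   + (- comp_h D) *\<^sub>R (\<Sum>i\<in>Basis. \<Sum>j\<in>Basis. c i j *\<^sub>R (comp_u D i *\<^sub>R comp_x D j + comp_u D j *\<^sub>R comp_x D i))
   + (comp_h D)\<^sup>2 *\<^sub>R (\<Sum>i\<in>Basis. d i *\<^sub>R comp_x D i)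
   + (- ((comp_h D)\<^sup>2)) *\<^sub>R fst (snd (D (1, 0, 0))))"

definition push_q where
 "push_q D B b c d q = - ((\<Sum>i\<in>Basis. \<Sum>j\<in>Basis. b i j * ((comp_h D)\<^sup>2 * snd (snd (B (ex i) (ex j)))
    - comp_h D * comp_u D j * snd (snd (B (ex i) eu)) - comp_h D * comp_u D i * snd (snd (B eu (ex j)))
    + comp_u D i * comp_u D j * snd (snd (B eu eu))))
   - comp_h D * (\<Sum>i\<in>Basis. \<Sum>j\<in>Basis. c i j * (comp_u D i * comp_u D j))
   + (comp_h D)\<^sup>2 * (\<Sum>i\<in>Basis. d i * comp_u D i) - q * comp_h D ^ 3
   - (comp_h D)\<^sup>2 * snd (snd (D (1, 0, 0)))) / ((comp_h D)\<^sup>2 * comp_t D)"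

text \<open>Moves the sums over the target basis inside, so that a contraction with pushed
  coefficients becomes one with the original coefficients.\<close>

lemma sum_push:
 fixes m :: "'i => 'i => real" and y :: "'i => 'f::euclidean_space"
 shows "(\<Sum>k\<in>Basis. \<Sum>l\<in>Basis. (\<Sum>i\<in>I. \<Sum>j\<in>I. m i j * ((y i \<bullet> k) * (y j \<bullet> l))) * f k l) =
  (\<Sum>i\<in>I. \<Sum>j\<in>I. m i j * (\<Sum>k\<in>Basis. \<Sum>l\<in>Basis. (y i \<bullet> k) * (y j \<bullet> l) * f k l))"
proof -
 have "(\<Sum>k\<in>Basis. \<Sum>l\<in>Basis. (\<Sum>i\<in>I. \<Sum>j\<in>I. m i j * ((y i \<bullet> k) * (y j \<bullet> l))) * f k l) =
  (\<Sum>k\<in>Basis. \<Sum>l\<in>Basis. \<Sum>i\<in>I. \<Sum>j\<in>I. m i j * ((y i \<bullet> k) * (y j \<bullet> l) * f k l))"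
  by (simp add: sum_distrib_right mult.assoc)
 also have "\<dots> = (\<Sum>k\<in>Basis. \<Sum>i\<in>I. \<Sum>l\<in>Basis. \<Sum>j\<in>I. m i j * ((y i \<bullet> k) * (y j \<bullet> l) * f k l))"
  by (intro sum.cong refl) (rule sum.swap)
 also have "\<dots> = (\<Sum>i\<in>I. \<Sum>k\<in>Basis. \<Sum>j\<in>I. \<Sum>l\<in>Basis. m i j * ((y i \<bullet> k) * (y j \<bullet> l) * f k l))"
  by (subst sum.swap, intro sum.cong refl) (rule sum.swap)
 also have "\<dots> = (\<Sum>i\<in>I. \<Sum>j\<in>I. \<Sum>k\<in>Basis. \<Sum>l\<in>Basis. m i j * ((y i \<bullet> k) * (y j \<bullet> l) * f k l))"
  by (intro sum.cong refl) (rule sum.swap)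
 finally show ?thesis by (simp add: sum_distrib_left)
qed

lemma linear_basis_sum:
 fixes f :: "'f::euclidean_space => real"
 assumes "linear f" shows "(\<Sum>k\<in>Basis. (y \<bullet> k) * f k) = f y"
 using linear_sum[OF assms, of "\<lambda>k. (y \<bullet> k) *\<^sub>R k" Basis] linear_cmul[OF assms] by (simp add: euclidean_representation)

text \<open>Both sides are sorted by powers of \<open>a\<close>, the value of
  \<open>\<alpha>\<close> on \<open>eu\<close>. The term with \<open>H\<close> gives
  \<open>b'\<close>. The second derivatives \<open>B\<close> contribute in degrees 1, 2 and 3 and
  are absorbed by \<open>c'\<close>, \<open>d'\<close> and \<open>q'\<close>; the space and value
  components of \<open>D (1, 0, 0)\<close> go into \<open>d'\<close> and \<open>q'\<close>.\<close>

lemma pol_push: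
 fixes D :: "real \<times> 'e::euclidean_space \<times> real => real \<times> 'f::euclidean_space \<times> real"
  and \<alpha> :: "real \<times> 'f \<times> real => real"
 assumes D: "linear D" "\<And>x u. fst (D (0, x, u)) = 0" "fst (snd (D eu)) = 0" and nz: "comp_h D \<noteq> 0" "comp_t D \<noteq> 0"
  and B: "\<And>v. linear (B v)" "\<And>v. linear (\<lambda>w. B w v)" "\<And>x u x' u'. fst (B (0, x, u) (0, x', u')) = 0"
   "\<And>x u. fst (snd (B (0, x, u) eu)) = 0" "\<And>x u. fst (snd (B eu (0, x, u))) = 0"
  and \<alpha>: "linear \<alpha>" and H: "\<And>v. linear (H v)" "\<And>v. linear (\<lambda>w. H w v)"
  and b': "\<And>k l. b' k l w' = push_b D (\<lambda>i j. b i j w) k l"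
  and c': "\<And>k l. c' k l w' = push_c D B (\<lambda>i j. b i j w) (\<lambda>i j. c i j w) k l"
  and d': "\<And>k. d' k w' = push_d D B (\<lambda>i j. b i j w) (\<lambda>i j. c i j w) (\<lambda>i. d i w) \<bullet> k"
  and q': "q' w' = push_q D B (\<lambda>i j. b i j w) (\<lambda>i j. c i j w) (\<lambda>i. d i w) (q w)"
 shows "pol b c d q w (\<lambda>v. \<alpha> (D v)) (\<lambda>v v'. H (D v) (D v') + \<alpha> (B v v')) =
  (comp_h D)\<^sup>2 * comp_t D * pol b' c' d' q' w' \<alpha> H"
proof -
 define h where "h = comp_h D" define a where "a = \<alpha> eu"
 define \<Theta> where "\<Theta> i = comp_x D i" for i define \<eta> where "\<eta> i = comp_u D i" for i
 define \<beta> where "\<beta> y = \<alpha> (0, y, 0)" for y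
 define P where "P i j = fst (snd (B (ex i) (ex j)))" for i j
 define \<eta>2 where "\<eta>2 i j = snd (snd (B (ex i) (ex j)))" for i j
 define iu where "iu i = snd (snd (B (ex i) eu))" for i define ui where "ui j = snd (snd (B eu (ex j)))" for j
 define uu where "uu = snd (snd (B eu eu))"
 define \<tau> where "\<tau> = comp_t D" define \<Theta>t where "\<Theta>t = fst (snd (D (1,0,0)))" define \<eta>t where "\<eta>t = snd (snd (D (1,0,0)))"
 note defs = h_def[symmetric] \<Theta>_def[symmetric] \<eta>_def[symmetric] P_def[symmetric] \<eta>2_def[symmetric] iu_def[symmetric] ui_def[symmetric]
  uu_def[symmetric] \<tau>_def[symmetric] \<Theta>t_def[symmetric] \<eta>t_def[symmetric]
 have hn: "h \<noteq> 0" "\<tau> \<noteq> 0" using nz by (simp_all add: h_def \<tau>_def)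
 have l\<beta>: "linear \<beta>" unfolding \<beta>_def
  by (rule linear_compose[OF _ \<alpha>, unfolded o_def]) (auto intro!: linearI)
 have \<alpha>3: "\<alpha> (r, y, s) = r * \<alpha> (1, 0, 0) + \<beta> y + s * a" for r y s
 proof -
  have "(r, y, s) = r *\<^sub>R (1, 0, 0) + (0, y, 0) + s *\<^sub>R eu" by simp
  then show ?thesis using linear_add[OF \<alpha>] linear_cmul[OF \<alpha>] by (simp add: a_def \<beta>_def del: add_Pair scaleR_Pair)
 qed
 have Dex: "D (ex i) = (0, \<Theta> i, \<eta> i)" for i by (simp add: \<Theta>_def \<eta>_def prod_eq_iff D(2))
 have Deu: "D eu = (0, 0, h)" using D(2)[of 0 1] D(3) by (simp add: h_def prod_eq_iff)
 have Dt: "D (1, 0, 0) = (\<tau>, \<Theta>t, \<eta>t)" by (simp add: \<tau>_def \<Theta>t_def \<eta>t_def)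
 have Bee: "B (ex i) (ex j) = (0, P i j, \<eta>2 i j)" for i j by (simp add: P_def \<eta>2_def prod_eq_iff B(3))
 have Beu: "B (ex i) eu = (0, 0, iu i)" "B eu (ex i) = (0, 0, ui i)" for i
  by (simp_all add: iu_def ui_def prod_eq_iff B(3) B(4)[of i 0] B(5)[of i 0])
 have Buu: "B eu eu = (0, 0, uu)" by (simp add: uu_def prod_eq_iff B(3) B(4)[of 0 1])
 have X: "(0, r *\<^sub>R i, s) = r *\<^sub>R ex i + s *\<^sub>R eu" for r s and i :: 'e by simp
 have \<alpha>i: "\<alpha> (D (ex i)) = \<beta> (\<Theta> i) + a * \<eta> i" "\<alpha> (D eu) = a * h" "\<alpha> (D (1, 0, 0)) = \<tau> * \<alpha> (1, 0, 0) + \<beta> \<Theta>t + a * \<eta>t" for i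
  unfolding Dex Deu Dt by (subst \<alpha>3, simp add: linear_0[OF l\<beta>])+
 define Y where "Y i = (0 :: real, a *\<^sub>R \<Theta> i, - \<beta> (\<Theta> i))" for i
 have DX: "D (0, (a * h) *\<^sub>R i, - (\<beta> (\<Theta> i) + a * \<eta> i)) = h *\<^sub>R Y i" for i
  unfolding X linear_add[OF D(1)] linear_cmul[OF D(1)] Dex Deu Y_def by (simp add: algebra_simps)
 have BX: "\<alpha> (B (0, (a * h) *\<^sub>R i, - (\<beta> (\<Theta> i) + a * \<eta> i)) (0, (a * h) *\<^sub>R j, - (\<beta> (\<Theta> j) + a * \<eta> j))) =
   a * (uu * (\<beta> (\<Theta> i) * \<beta> (\<Theta> j))) +
   a\<^sup>2 * (h\<^sup>2 * \<beta> (P i j) + (- h * iu i + uu * \<eta> i) * \<beta> (\<Theta> j) + (- h * ui j + uu * \<eta> j) * \<beta> (\<Theta> i)) +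
   a ^ 3 * (h\<^sup>2 * \<eta>2 i j - h * \<eta> j * iu i - h * \<eta> i * ui j + \<eta> i * \<eta> j * uu)" for i j
  unfolding X linear_add[OF B(1)] linear_cmul[OF B(1)] linear_add[OF B(2)] linear_cmul[OF B(2)] Bee Beu Buu
   linear_add[OF \<alpha>] linear_cmul[OF \<alpha>] \<alpha>3[of 0] linear_0[OF l\<beta>]
  by (simp add: algebra_simps power2_eq_square power3_eq_cube)
 have HX: "H (h *\<^sub>R Y i) (h *\<^sub>R Y j) = h\<^sup>2 * H (Y i) (Y j)" for i j
  using linear_cmul[OF H(1)] linear_cmul[OF H(2)] by (simp add: power2_eq_square)
 define Z where "Z k = (0 :: real, a *\<^sub>R k, - \<beta> k)" for k
 have lZ: "linear Z" unfolding Z_def using linear_add[OF l\<beta>] linear_cmul[OF l\<beta>]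
  by (intro linearI) (simp_all add: algebra_simps)
 have HY: "(\<Sum>k\<in>Basis. \<Sum>l\<in>Basis. (y \<bullet> k) * (z \<bullet> l) * H (Z k) (Z l)) = H (Z y) (Z z)" for y z
 proof -
  have "(\<Sum>k\<in>Basis. \<Sum>l\<in>Basis. (y \<bullet> k) * (z \<bullet> l) * H (Z k) (Z l)) = (\<Sum>k\<in>Basis. (y \<bullet> k) * (\<Sum>l\<in>Basis. (z \<bullet> l) * H (Z k) (Z l)))"
   by (simp add: sum_distrib_left mult.assoc)
  also have "\<dots> = (\<Sum>k\<in>Basis. (y \<bullet> k) * H (Z k) (Z z))"
   by (intro sum.cong refl arg_cong[where f = "\<lambda>x. _ * x"] linear_basis_sum[of "\<lambda>l. H (Z _) (Z l)"] linear_compose[OF lZ H(1), unfolded o_def])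
  also have "\<dots> = H (Z y) (Z z)" by (rule linear_basis_sum) (rule linear_compose[OF lZ H(2), unfolded o_def])
  finally show ?thesis .
 qed
 have \<beta>\<beta>: "(\<Sum>k\<in>Basis. \<Sum>l\<in>Basis. (y \<bullet> k) * (z \<bullet> l) * (\<beta> k * \<beta> l)) = \<beta> y * \<beta> z" for y z
  unfolding linear_basis_sum[OF l\<beta>, of y, symmetric] linear_basis_sum[OF l\<beta>, of z, symmetric] sum_product
  by (simp add: algebra_simps)
 let ?b = "\<lambda>i j. b i j w" and ?c = "\<lambda>i j. c i j w" and ?d = "\<lambda>i. d i w"
 let ?S = "\<lambda>m f. \<Sum>i\<in>Basis. \<Sum>j\<in>Basis. m i j * f i j :: real"
 define SbH where "SbH = ?S ?b (\<lambda>i j. H (Y i) (Y j))" define Sb1 where "Sb1 = ?S ?b (\<lambda>i j. \<beta> (\<Theta> i) * \<beta> (\<Theta> j))"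
 define Sb2 where "Sb2 = ?S ?b (\<lambda>i j. h\<^sup>2 * \<beta> (P i j) + (- h * iu i + uu * \<eta> i) * \<beta> (\<Theta> j) + (- h * ui j + uu * \<eta> j) * \<beta> (\<Theta> i))"
 define Sb3 where "Sb3 = ?S ?b (\<lambda>i j. h\<^sup>2 * \<eta>2 i j - h * \<eta> j * iu i - h * \<eta> i * ui j + \<eta> i * \<eta> j * uu)"
 define Sc1 where "Sc1 = ?S ?c (\<lambda>i j. \<beta> (\<Theta> i) * \<beta> (\<Theta> j))"
 define Sc2 where "Sc2 = ?S ?c (\<lambda>i j. \<eta> i * \<beta> (\<Theta> j) + \<eta> j * \<beta> (\<Theta> i))"
 define Sc3 where "Sc3 = ?S ?c (\<lambda>i j. \<eta> i * \<eta> j)"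
 define Sd1 where "Sd1 = (\<Sum>i\<in>Basis. ?d i * \<beta> (\<Theta> i))" define Sd2 where "Sd2 = (\<Sum>i\<in>Basis. ?d i * \<eta> i)"
 have e1: "?S ?b (\<lambda>i j. h\<^sup>2 * H (Y i) (Y j) + (a * (uu * (\<beta> (\<Theta> i) * \<beta> (\<Theta> j))) +
   a\<^sup>2 * (h\<^sup>2 * \<beta> (P i j) + (- h * iu i + uu * \<eta> i) * \<beta> (\<Theta> j) + (- h * ui j + uu * \<eta> j) * \<beta> (\<Theta> i)) +
   a ^ 3 * (h\<^sup>2 * \<eta>2 i j - h * \<eta> j * iu i - h * \<eta> i * ui j + \<eta> i * \<eta> j * uu))) = h\<^sup>2 * SbH + a * uu * Sb1 + a\<^sup>2 * Sb2 + a ^ 3 * Sb3"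
  unfolding SbH_def Sb1_def Sb2_def Sb3_def sum_distrib_left sum.distrib[symmetric]
  by (intro sum.cong refl) (simp add: algebra_simps)
 have e2: "(\<Sum>i\<in>Basis. \<Sum>j\<in>Basis. ?c i j * (\<beta> (\<Theta> i) + a * \<eta> i) * (\<beta> (\<Theta> j) + a * \<eta> j)) = Sc1 + a * Sc2 + a\<^sup>2 * Sc3"
  unfolding Sc1_def Sc2_def Sc3_def sum_distrib_left sum.distrib[symmetric]
  by (intro sum.cong refl) (simp add: algebra_simps power2_eq_square)
 have e3: "(\<Sum>i\<in>Basis. ?d i * (\<beta> (\<Theta> i) + a * \<eta> i)) = Sd1 + a * Sd2"
  unfolding Sd1_def Sd2_def sum_distrib_left sum.distrib[symmetric]
  by (intro sum.cong refl) (simp add: algebra_simps)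
 have lhs: "pol b c d q w (\<lambda>v. \<alpha> (D v)) (\<lambda>v v'. H (D v) (D v') + \<alpha> (B v v')) =
  - (\<tau> * \<alpha> (1, 0, 0) + \<beta> \<Theta>t + a * \<eta>t) * (a * h)\<^sup>2 + (h\<^sup>2 * SbH + a * uu * Sb1 + a\<^sup>2 * Sb2 + a ^ 3 * Sb3)
  - a * h * (Sc1 + a * Sc2 + a\<^sup>2 * Sc3) + (a * h)\<^sup>2 * (Sd1 + a * Sd2) - q w * (a * h) ^ 3"
  unfolding pol_def \<alpha>i DX HX BX e1 e2 e3 ..
 have r1: "(\<Sum>k\<in>Basis. \<Sum>l\<in>Basis. b' k l w' * H (0, a *\<^sub>R k, - \<alpha> (0, k, 0)) (0, a *\<^sub>R l, - \<alpha> (0, l, 0))) = SbH / \<tau>"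
  unfolding b' push_b_def defs \<beta>_def[symmetric] Z_def[symmetric] times_divide_eq_left sum_divide_distrib[symmetric] sum_push HY
  by (simp add: SbH_def Y_def Z_def)
 have "?S (\<lambda>i j. h * ?c i j - uu * ?b i j) (\<lambda>i j. \<beta> (\<Theta> i) * \<beta> (\<Theta> j)) = h * Sc1 - uu * Sb1"
  unfolding Sc1_def Sb1_def sum_distrib_left sum_subtractf[symmetric] by (intro sum.cong refl) (simp add: algebra_simps)
 then have r2: "(\<Sum>k\<in>Basis. \<Sum>l\<in>Basis. c' k l w' * \<alpha> (0, k, 0) * \<alpha> (0, l, 0)) = (h * Sc1 - uu * Sb1) / (h\<^sup>2 * \<tau>)"
  unfolding c' push_c_def defs \<beta>_def[symmetric] mult.assoc[of _ "\<beta> _" "\<beta> _"] times_divide_eq_left sum_divide_distrib[symmetric] sum_push \<beta>\<beta> by simp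
 have "(\<Sum>k\<in>Basis. d' k w' * \<alpha> (0, k, 0)) = \<beta> (push_d D B ?b ?c ?d)"
  unfolding d' \<beta>_def[symmetric] by (rule linear_basis_sum[OF l\<beta>])
 also have "\<dots> = inverse (h\<^sup>2 * \<tau>) * (Sb2 + (- h) * Sc2 + h\<^sup>2 * Sd1 + (- (h\<^sup>2)) * \<beta> \<Theta>t)"
  unfolding push_d_def defs Sb2_def Sc2_def Sd1_def linear_add[OF l\<beta>] linear_cmul[OF l\<beta>] linear_sum[OF l\<beta>] real_scaleR_def ..
 finally have r3: "(\<Sum>k\<in>Basis. d' k w' * \<alpha> (0, k, 0)) = (Sb2 - h * Sc2 + h\<^sup>2 * Sd1 - h\<^sup>2 * \<beta> \<Theta>t) / (h\<^sup>2 * \<tau>)"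
  by (simp add: divide_inverse_commute)
 have r4: "q' w' = - (Sb3 - h * Sc3 + h\<^sup>2 * Sd2 - q w * h ^ 3 - h\<^sup>2 * \<eta>t) / (h\<^sup>2 * \<tau>)"
  unfolding q' push_q_def defs Sb3_def Sc3_def Sd2_def ..
 have rhs: "pol b' c' d' q' w' \<alpha> H = - \<alpha> (1, 0, 0) * a\<^sup>2 + SbH / \<tau> - a * ((h * Sc1 - uu * Sb1) / (h\<^sup>2 * \<tau>)) +
  a\<^sup>2 * ((Sb2 - h * Sc2 + h\<^sup>2 * Sd1 - h\<^sup>2 * \<beta> \<Theta>t) / (h\<^sup>2 * \<tau>)) - - (Sb3 - h * Sc3 + h\<^sup>2 * Sd2 - q w * h ^ 3 - h\<^sup>2 * \<eta>t) / (h\<^sup>2 * \<tau>) * a ^ 3"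
  unfolding pol_def a_def[symmetric] r1 r2 r3 r4 ..
 have can: "h\<^sup>2 * \<tau> * (x / (h\<^sup>2 * \<tau>)) = x" "h\<^sup>2 * \<tau> * (x / \<tau>) = h\<^sup>2 * x" for x using hn by simp_all
 have "h\<^sup>2 * \<tau> * pol b' c' d' q' w' \<alpha> H = - \<alpha> (1, 0, 0) * a\<^sup>2 * (h\<^sup>2 * \<tau>) + h\<^sup>2 * \<tau> * (SbH / \<tau>) - a * (h\<^sup>2 * \<tau> * ((h * Sc1 - uu * Sb1) / (h\<^sup>2 * \<tau>))) +
  a\<^sup>2 * (h\<^sup>2 * \<tau> * ((Sb2 - h * Sc2 + h\<^sup>2 * Sd1 - h\<^sup>2 * \<beta> \<Theta>t) / (h\<^sup>2 * \<tau>))) - a ^ 3 * (h\<^sup>2 * \<tau> * (- (Sb3 - h * Sc3 + h\<^sup>2 * Sd2 - q w * h ^ 3 - h\<^sup>2 * \<eta>t) / (h\<^sup>2 * \<tau>)))"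
  unfolding rhs by (simp only: algebra_simps)
 also have "\<dots> = pol b c d q w (\<lambda>v. \<alpha> (D v)) (\<lambda>v v'. H (D v) (D v') + \<alpha> (B v v'))"
  unfolding can lhs by (simp add: algebra_simps power2_eq_square power3_eq_cube)
 finally show ?thesis unfolding h_def \<tau>_def by simp
qed

text \<open>If \<open>f\<close> factors near \<open>y0\<close> through the projection
  \<open>Q\<close>, its derivatives see only the projected directions. With \<open>Q\<close> the
  projection to \<open>t\<close>, or to \<open>(t, x)\<close>, this gives the zero entries in the
  derivatives of a triangular map.\<close>

lemma factor_derivs:
 fixes f :: "'e::euclidean_space => 'f::real_normed_vector"
 assumes f: "smooth_at f y0" and Q: "bounded_linear Q" and ev: "eventually (\<lambda>y. f y = f (y0 + Q (y - y0))) (nhds y0)"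
 shows "D1 f y0 v = D1 f y0 (Q v)" "D2 f y0 v w = D2 f y0 (Q v) (Q w)"
proof -
 interpret Q: bounded_linear Q by (rule Q)
 let ?g = "\<lambda>y. Q y + (y0 - Q y0)"
 have g: "smooth_at ?g y" for y by (intro smooth_intros smooth_at_linear Q)
 have g0: "?g y0 = y0" by simp
 have Dg: "D1 ?g y = Q" for y by (rule D1_eqI) (auto intro!: derivative_eq_intros Q.has_derivative[OF has_derivative_ident, simplified])
 have D2g: "D2 ?g y v w = 0" for y v w
  using D2_add[OF smooth_at_linear[OF Q] smooth_at_const, of y "y0 - Q y0" v w] D2_linear[OF Q] by (simp add: D2_def Dg D1_const)
 have ev': "eventually (\<lambda>y. f y = f (?g y)) (nhds y0)" using ev by (rule eventually_mono) (simp add: Q.diff algebra_simps)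
 show "D1 f y0 v = D1 f y0 (Q v)"
  using D1_cong_ev[OF ev'] D1_chain[of ?g y0 f v] g f by (simp add: g0 Dg)
 show "D2 f y0 v w = D2 f y0 (Q v) (Q w)"
  using D2_cong_ev[OF ev'] D2_compose[OF g, of f y0 v w] f linear_0[OF linear_D1[OF f]] by (simp add: g0 Dg D2g)
qed

section \<open>Diffeomorphisms act on jets\<close>

text \<open>The isometry \<open>J\<close> of the model spaces, with inverse \<open>K\<close>, turns a chart \<open>\<phi>\<close> of \<open>A\<close> into the chart
 \<open>J \<circ> \<phi> \<circ> G\<close> of \<open>B\<close>. As parametrizations transported in this way have derivatives of the same size,
 open sets of jets correspond to open sets of jets.\<close>

context
 fixes A :: "('a::{t2_space,second_countable_topology}, 'e::euclidean_space) chart set"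
  and B :: "('b::{t2_space,second_countable_topology}, 'f::euclidean_space) chart set"
  and F G and J :: "'e => 'f" and K
 assumes A: "smooth_manifold A" and B: "smooth_manifold B" and F: "smooth_map A B F" and G: "smooth_map B A G"
  and GF: "\<And>p. p \<in> carrier A ==> G (F p) = p" and FG: "\<And>q. q \<in> carrier B ==> F (G q) = q"
  and J: "linear J" "\<And>x. norm (J x) = norm x" and K: "linear K" "\<And>y. norm (K y) = norm y"
  and KJ: "\<And>x. K (J x) = x" and JK: "\<And>y. J (K y) = y"
begin

lemma bounded_linear_JK: "bounded_linear J" "bounded_linear K"
 using J(1) K(1) by (simp_all add: linear_conv_bounded_linear)

lemma image_diffeo: "L \<subseteq> carrier A ==> q \<in> F ` L \<longleftrightarrow> q \<in> carrier B \<and> G q \<in> L"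
proof
 assume L: "L \<subseteq> carrier A" and q: "q \<in> F ` L"
 then obtain p where p: "p \<in> L" "q = F p" by blast
 then have "p \<in> carrier A" using L by blast
 then show "q \<in> carrier B \<and> G q \<in> L" using p GF smooth_mapD(1)[OF F] by simp
next
 assume "q \<in> carrier B \<and> G q \<in> L"
 then show "q \<in> F ` L" using FG[of q] by (intro image_eqI[of _ _ "G q"]) auto
qed

lemma image_JK: "J ` S = K -` S"
proof (intro equalityI subsetI)
 fix y assume "y \<in> K -` S"
 then show "y \<in> J ` S" using JK[of y] by (intro image_eqI[of _ _ "K y"]) auto
qed (auto simp: KJ)

lemma transport_inv_into:
 assumes c: "(U, \<phi>) \<in> smooth_charts A" and y: "y \<in> J ` \<phi> ` U"
 shows "inv_into (F ` U) (\<lambda>q. J (\<phi> (G q))) y = F (inv_into U \<phi> (K y))"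
proof -
 note U = smooth_charts_carrier[OF c] and cU = smooth_charts_is_chart[OF c]
 obtain p where p: "p \<in> U" "y = J (\<phi> p)" using y by blast
 have inj: "inj_on (\<lambda>q. J (\<phi> (G q))) (F ` U)"
 proof (rule inj_on_inverseI)
  fix q assume "q \<in> F ` U"
  then obtain p where "p \<in> U" "q = F p" by blast
  moreover from this have "G (F p) = p" using U GF by blast
  ultimately show "F (inv_into U \<phi> (K (J (\<phi> (G q))))) = q" using is_chartD(6)[OF cU] by (simp add: KJ)
 qed
 have "G (F p) = p" using U p(1) GF by blast
 then have "y = J (\<phi> (G (F p)))" by (simp add: p(2))
 then have "inv_into (F ` U) (\<lambda>q. J (\<phi> (G q))) y = F p" using inv_into_f_eq[OF inj, of "F p" y] p(1) by simp
 then show ?thesis using p is_chartD(6)[OF cU] by (simp add: KJ)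
qed

lemma transport_chart:
 assumes c: "(U, \<phi>) \<in> smooth_charts A"
 shows "(F ` U, \<lambda>q. J (\<phi> (G q))) \<in> smooth_charts B"
proof (rule smooth_chartsI[OF B])
 note U = smooth_charts_carrier[OF c] and cU = smooth_charts_is_chart[OF c]
 have GFU: "G (F p) = p" if "p \<in> U" for p using that U GF by blast
 have eq: "F ` U = carrier B \<inter> G -` U" using image_diffeo[OF U] by blast
 have "open (carrier B \<inter> G -` U)"
  by (rule continuous_open_preimage[OF _ open_carrier[OF B] is_chartD(1)[OF cU]]) (use G in \<open>simp add: smooth_map_def\<close>)
 then have oU: "open (F ` U)" unfolding eq .
 have im: "(\<lambda>q. J (\<phi> (G q))) ` F ` U = J ` \<phi> ` U" using GFU by (force simp: image_iff)
 have oJ: "open (J ` \<phi> ` U)" unfolding image_JK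
  by (rule open_vimage[OF is_chartD(2)[OF cU]]) (rule linear_continuous_on[OF bounded_linear_JK(2)])
 have cont: "continuous_on (J ` \<phi> ` U) (\<lambda>y. F (inv_into U \<phi> (K y)))"
 proof (rule continuous_on_compose2[of "carrier A" F])
  show "continuous_on (carrier A) F" using F by (simp add: smooth_map_def)
  show "continuous_on (J ` \<phi> ` U) (\<lambda>y. inv_into U \<phi> (K y))"
   by (rule continuous_on_compose2[OF is_chartD(5)[OF cU] linear_continuous_on[OF bounded_linear_JK(2)]]) (auto simp: KJ)
  show "(\<lambda>y. inv_into U \<phi> (K y)) ` J ` \<phi> ` U \<subseteq> carrier A" using U is_chartD(6)[OF cU] by (auto simp: KJ)
 qed
 have cont2: "continuous_on (F ` U) (\<lambda>q. J (\<phi> (G q)))"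
 proof (rule continuous_on_compose2[OF linear_continuous_on[OF bounded_linear_JK(1), of UNIV]])
  show "continuous_on (F ` U) (\<lambda>q. \<phi> (G q))"
   by (rule continuous_on_compose2[OF is_chartD(3)[OF cU] continuous_on_subset[of "carrier B" G]])
    (use G eq in \<open>auto simp: smooth_map_def\<close>)
 qed simp
 show "is_chart (F ` U, \<lambda>q. J (\<phi> (G q)))"
  by (rule is_chartI[OF oU _ cont2, of "\<lambda>y. F (inv_into U \<phi> (K y))"])
   (use oJ cont is_chartD(6)[OF cU] in \<open>auto simp: im KJ GFU\<close>)
 show "F ` U \<subseteq> carrier B" using eq by blast
 fix q assume q: "q \<in> F ` U"
 then have qB: "q \<in> carrier B" and Gq: "G q \<in> U" using eq by blast+
 obtain V \<psi> where d: "(V, \<psi>) \<in> smooth_charts B" "q \<in> V" using chart_at_point[OF B qB] by metis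
 note cV = smooth_charts_is_chart[OF d(1)]
 have FGq: "F (G q) = q" by (rule FG[OF qB])
 have s1: "smooth_at (\<lambda>y. \<psi> (F (inv_into U \<phi> y))) (\<phi> (G q))"
  using smooth_map_at[OF A B F c d(1) Gq] d(2) FGq by simp
 have "smooth_at (\<lambda>y. \<psi> (F (inv_into U \<phi> (K y)))) (J (\<phi> (G q)))"
  by (rule smooth_at_compose[OF smooth_at_linear[OF bounded_linear_JK(2)]]) (simp add: KJ s1)
 moreover have "eventually (\<lambda>y. \<psi> (F (inv_into U \<phi> (K y))) = \<psi> (inv_into (F ` U) (\<lambda>q. J (\<phi> (G q))) y)) (nhds (J (\<phi> (G q))))"
  by (rule eventually_mono[OF eventually_nhds_in_open[OF oJ]]) (use Gq in \<open>auto simp: transport_inv_into[OF c]\<close>)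
 ultimately have "smooth_at (\<lambda>y. \<psi> (inv_into (F ` U) (\<lambda>q. J (\<phi> (G q))) y)) (J (\<phi> (G q)))" by (rule smooth_at_transform)
 moreover have "smooth_at (\<lambda>y. J (\<phi> (G (inv_into V \<psi> y)))) (\<psi> q)"
  by (rule smooth_at_linear_compose[OF bounded_linear_JK(1) smooth_map_at[OF B A G d(1) c d(2) Gq]])
 ultimately show "\<exists>V \<psi>. (V, \<psi>) \<in> smooth_charts B \<and> q \<in> V \<and>
   smooth_at (\<lambda>y. \<psi> (inv_into (F ` U) (\<lambda>q. J (\<phi> (G q))) y)) (J (\<phi> (G q))) \<and>
   smooth_at (\<lambda>y. J (\<phi> (G (inv_into V \<psi> y)))) (\<psi> q)" using d by blast
qed

lemma transport_slice_chart:
 assumes L: "L \<subseteq> carrier A" and s: "slice_chart A L S (U, \<phi>)"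
 shows "slice_chart B (F ` L) (J ` S) (F ` U, \<lambda>q. J (\<phi> (G q)))"
proof -
 have c: "(U, \<phi>) \<in> smooth_charts A" and e: "\<phi> ` (U \<inter> L) = \<phi> ` U \<inter> S" using s by (auto simp: slice_chart_def)
 note U = smooth_charts_carrier[OF c]
 have im: "(\<lambda>q. J (\<phi> (G q))) ` F ` M = J ` \<phi> ` M" if "M \<subseteq> carrier A" for M
 proof -
  have "(\<lambda>p. J (\<phi> (G (F p)))) ` M = (\<lambda>p. J (\<phi> p)) ` M" by (rule image_cong) (use that GF in auto)
  then show ?thesis by (simp add: image_image)
 qed
 have "F ` U \<inter> F ` L = F ` (U \<inter> L)" using image_diffeo[OF U] image_diffeo[OF L] image_diffeo[of "U \<inter> L"] U by blast
 then have "(\<lambda>q. J (\<phi> (G q))) ` (F ` U \<inter> F ` L) = J ` (\<phi> ` U \<inter> S)" using im[of "U \<inter> L"] U e by (simp add: le_infI1)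
 also have "\<dots> = (\<lambda>q. J (\<phi> (G q))) ` F ` U \<inter> J ` S" unfolding im[OF U] image_JK by blast
 finally show ?thesis using transport_chart[OF c] by (simp add: slice_chart_def)
qed

text \<open>In the transported charts the parametrization \<open>\<gamma>\<close> becomes
  \<open>J \<circ> \<gamma> \<circ> K\<close> with linear \<open>J\<close> and \<open>K\<close>, so
  no derivatives of \<open>F\<close> appear.\<close>

lemma transport_param_deriv:
 assumes c: "(U, \<phi>) \<in> smooth_charts A" and d: "(V, \<psi>) \<in> smooth_charts A" and x: "x \<in> U" "x \<in> V" and vs: "length vs \<le> 2"
 shows "param_deriv (\<lambda>q. J (\<psi> (G q))) (F ` U, \<lambda>q. J (\<phi> (G q))) (F x) vs = J (param_deriv \<psi> (U, \<phi>) x (map K vs))"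
proof -
 note U = smooth_charts_carrier[OF c] and cU = smooth_charts_is_chart[OF c]
 have Gx: "G (F x) = x" using U x GF by blast
 let ?\<gamma> = "\<lambda>y. \<psi> (inv_into U \<phi> y)"
 let ?\<delta> = "\<lambda>y. J (\<psi> (G (inv_into (F ` U) (\<lambda>q. J (\<phi> (G q))) y)))"
 have s: "smooth_at ?\<gamma> (\<phi> x)" by (rule smooth_charts_transition[OF A c d x])
 have oJ: "open (J ` \<phi> ` U)" unfolding image_JK
  by (rule open_vimage[OF is_chartD(2)[OF cU]]) (rule linear_continuous_on[OF bounded_linear_JK(2)])
 have ev: "eventually (\<lambda>y. ?\<delta> y = J (?\<gamma> (K y))) (nhds (J (\<phi> x)))"
 proof (rule eventually_mono[OF eventually_nhds_in_open[OF oJ]])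
  fix y assume "y \<in> J ` \<phi> ` U"
  then show "?\<delta> y = J (?\<gamma> (K y))"
   using U GF is_chartD(6)[OF cU] by (auto simp: transport_inv_into[OF c] KJ subset_iff)
 qed (use x in auto)
 have sK: "smooth_at (\<lambda>y. K y) y" for y by (rule smooth_at_linear[OF bounded_linear_JK(2)])
 have s': "smooth_at ?\<gamma> (K (J (\<phi> x)))" using s by (simp add: KJ)
 have si: "smooth_at (\<lambda>y. ?\<gamma> (K y)) (J (\<phi> x))" by (rule smooth_at_compose[OF sK s'])
 have 0: "?\<delta> (J (\<phi> x)) = J (?\<gamma> (\<phi> x))" using eventually_nhds_x_imp_x[OF ev] by (simp add: KJ)
 have 1: "D1 ?\<delta> (J (\<phi> x)) v = J (D1 ?\<gamma> (\<phi> x) (K v))" for v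
  using D1_cong_ev[OF ev] D1_linear_compose[OF bounded_linear_JK(1) si, of v]
   D1_compose[OF smooth_at_diffble[OF sK] smooth_at_diffble[OF s'], of v]
  by (simp add: D1_linear[OF bounded_linear_JK(2)] KJ)
 have 2: "D2 ?\<delta> (J (\<phi> x)) v w = J (D2 ?\<gamma> (\<phi> x) (K v) (K w))" for v w
  using D2_cong_ev[OF ev] D2_linear_compose[OF bounded_linear_JK(1) si, of v w] D2_compose[OF sK s', of v w] linear_0[OF linear_D1[OF s]]
  by (simp add: D1_linear[OF bounded_linear_JK(2)] D2_linear[OF bounded_linear_JK(2)] KJ)
 show ?thesis
  by (rule length_le_2_cases[OF vs]) (simp_all only: list.map param_deriv_simps Gx 0 1 2)
qed

lemma diffeo_submersion: "submersion A B F" "submersion B A G"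
 using inverse_submersion[OF A B F G GF FG] inverse_submersion[OF B A G F FG GF] by blast+

lemma diffeo_projected: "L \<subseteq> carrier A ==> projected A F L"
proof -
 assume L: "L \<subseteq> carrier A"
 have "x \<in> L \<longleftrightarrow> x \<in> carrier A \<and> F x \<in> F ` L" for x
  using image_diffeo[OF L, of "F x"] GF[of x] smooth_mapD(1)[OF F, of x] L by auto
 then show ?thesis unfolding projected_def by blast
qed

text \<open>\<open>J\<close> and \<open>K\<close> preserve unit vectors and distances, so the same
  \<open>\<epsilon>\<close> works on both sides.\<close>

lemma jet_open_transport:
 assumes m: "DIM('e) = m + 1" "DIM('f) = m + 1" and Q: "jet_open B 2 m Q'"
 shows "jet_open A 2 m {jet A 2 m p L | p L. submanifold A m L \<and> p \<in> L \<and> jet B 2 m (F p) (F ` L) \<in> Q'}" (is "jet_open A 2 m ?Q")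
 unfolding jet_open_def
proof (intro conjI allI impI)
 show "?Q \<subseteq> jet_space A 2 m" by (auto simp: jet_space_def)
 have Fsub: "submanifold B m (F ` L)" if "submanifold A m L" for L
  by (rule projected_image_submanifold[OF A B diffeo_submersion(1) m that diffeo_projected]) (use that in \<open>simp add: submanifold_def\<close>)
 fix S L x U \<phi> V \<psi>
 assume "subspace S \<and> submanifold A m L \<and> slice_chart A L S (U, \<phi>) \<and> (V, \<psi>) \<in> smooth_charts A \<and>
    x \<in> L \<inter> U \<inter> V \<and> jet A 2 m x L \<in> ?Q"
 then have S: "subspace S" and L: "submanifold A m L" and s: "slice_chart A L S (U, \<phi>)" and d: "(V, \<psi>) \<in> smooth_charts A"
  and x: "x \<in> L" "x \<in> U" "x \<in> V" and j: "jet A 2 m x L \<in> ?Q" by auto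
 have Lc: "L \<subseteq> carrier A" using L by (simp add: submanifold_def)
 have c: "(U, \<phi>) \<in> smooth_charts A" using s by (simp add: slice_chart_def)
 obtain p M where pM: "jet A 2 m x L = jet A 2 m p M" "submanifold A m M" "p \<in> M" "jet B 2 m (F p) (F ` M) \<in> Q'" using j by blast
 have px: "p = x" using pM(1) by (simp add: jet_def)
 have Mc: "M \<subseteq> carrier A" using pM(2) by (simp add: submanifold_def)
 have jB: "jet B 2 m (F x) (F ` L) \<in> Q'"
  using projected_image_jet[OF A B diffeo_submersion(1) m L diffeo_projected[OF Lc] x(1) pM(2) diffeo_projected[OF Mc]] pM px by simp
 have "subspace (J ` S)" by (rule linear_subspace_image[OF J(1) S])
 from jet_openD[OF Q this Fsub[OF L] transport_slice_chart[OF Lc s] transport_chart[OF d] _ jB] x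
 obtain \<epsilon> where \<epsilon>: "\<epsilon> > 0" "nearby_jets B 2 m (J ` S) (F ` V, \<lambda>q. J (\<psi> (G q))) (F ` U, \<lambda>q. J (\<phi> (G q))) (F x) \<epsilon> \<subseteq> Q'" by blast
 have "nearby_jets A 2 m S (V, \<psi>) (U, \<phi>) x \<epsilon> \<subseteq> ?Q"
 proof
  fix j assume "j \<in> nearby_jets A 2 m S (V, \<psi>) (U, \<phi>) x \<epsilon>"
  then obtain x' L' U' \<phi>' where n: "j = jet A 2 m x' L'" "submanifold A m L'" "slice_chart A L' S (U', \<phi>')" "x' \<in> L' \<inter> U' \<inter> V"
   "\<forall>vs. set vs \<subseteq> S \<inter> sphere 0 1 \<and> length vs \<le> 2 --> dist (param_deriv \<psi> (U, \<phi>) x vs) (param_deriv \<psi> (U', \<phi>') x' vs) < \<epsilon>"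
   unfolding nearby_jets_def split_beta by auto
  have c': "(U', \<phi>') \<in> smooth_charts A" using n(3) by (simp add: slice_chart_def)
  have L'c: "L' \<subseteq> carrier A" using n(2) by (simp add: submanifold_def)
  have "dist (param_deriv (\<lambda>q. J (\<psi> (G q))) (F ` U, \<lambda>q. J (\<phi> (G q))) (F x) vs)
    (param_deriv (\<lambda>q. J (\<psi> (G q))) (F ` U', \<lambda>q. J (\<phi>' (G q))) (F x') vs) < \<epsilon>"
   if vs: "set vs \<subseteq> J ` S \<inter> sphere 0 1 \<and> length vs \<le> 2" for vs
  proof -
   have "set (map K vs) \<subseteq> S \<inter> sphere 0 1" using vs unfolding image_JK by (auto simp: K(2) subset_iff)
   then have "dist (param_deriv \<psi> (U, \<phi>) x (map K vs)) (param_deriv \<psi> (U', \<phi>') x' (map K vs)) < \<epsilon>" using n(5) vs by simp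
   moreover have "dist (J a) (J b) = dist a b" for a b by (simp add: dist_norm linear_diff[OF J(1), symmetric] J(2))
   ultimately show ?thesis
    using transport_param_deriv[OF c d x(2,3)] transport_param_deriv[OF c' d, of x' vs] n(4) vs by simp
  qed
  then have ex: "\<exists>x'' L'' U'' \<phi>''. jet B 2 m (F x') (F ` L') = jet B 2 m x'' L'' \<and> submanifold B m L'' \<and> slice_chart B L'' (J ` S) (U'', \<phi>'') \<and>
    x'' \<in> L'' \<inter> U'' \<inter> F ` V \<and> (\<forall>vs. set vs \<subseteq> J ` S \<inter> sphere 0 1 \<and> length vs \<le> 2 -->
     dist (param_deriv (\<lambda>q. J (\<psi> (G q))) (F ` U, \<lambda>q. J (\<phi> (G q))) (F x) vs) (param_deriv (\<lambda>q. J (\<psi> (G q))) (U'', \<phi>'') x'' vs) < \<epsilon>)"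
   by (intro exI[of _ "F x'"] exI[of _ "F ` L'"] exI[of _ "F ` U'"] exI[of _ "\<lambda>q. J (\<phi>' (G q))"] conjI allI impI
     Fsub[OF n(2)] transport_slice_chart[OF L'c n(3)] refl IntI imageI) (use n(4) in simp_all)
  have "jet B 2 m (F x') (F ` L') \<in> nearby_jets B 2 m (J ` S) (F ` V, \<lambda>q. J (\<psi> (G q))) (F ` U, \<lambda>q. J (\<phi> (G q))) (F x) \<epsilon>"
   unfolding nearby_jets_def split_beta fst_conv snd_conv by (rule CollectI) (rule ex)
  then show "j \<in> ?Q" using \<epsilon>(2) n by blast
 qed
 then show "\<exists>\<epsilon>>0. nearby_jets A 2 m S (V, \<psi>) (U, \<phi>) x \<epsilon> \<subseteq> ?Q" using \<epsilon>(1) by blast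
qed

text \<open>The complement of the closure of \<open>P'\<close> is open, so its preimage is an open
  set of jets; as it contains no element of \<open>P\<close>, it contains no point of the closure of
  \<open>P\<close>.\<close>

lemma closure_transport:
 assumes m: "DIM('e) = m + 1" "DIM('f) = m + 1" and L: "submanifold A m L" "p \<in> L"
  and j: "jet A 2 m p L \<in> jet_topology A 2 m closure_of P"
  and P: "\<And>p L. submanifold A m L ==> p \<in> L ==> jet A 2 m p L \<in> P ==> jet B 2 m (F p) (F ` L) \<in> jet_topology B 2 m closure_of P'"
 shows "jet B 2 m (F p) (F ` L) \<in> jet_topology B 2 m closure_of P'"
proof (rule ccontr)
 assume n: "jet B 2 m (F p) (F ` L) \<notin> jet_topology B 2 m closure_of P'"
 let ?Q' = "jet_space B 2 m - jet_topology B 2 m closure_of P'"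
 have "submanifold B m (F ` L)"
  by (rule projected_image_submanifold[OF A B diffeo_submersion(1) m L(1) diffeo_projected]) (use L in \<open>simp add: submanifold_def\<close>)
 moreover have "F p \<in> F ` L" using L(2) by blast
 ultimately have "jet B 2 m (F p) (F ` L) \<in> jet_space B 2 m" unfolding jet_space_def by blast
 with n have in': "jet B 2 m (F p) (F ` L) \<in> ?Q'" by blast
 have "jet_open B 2 m ?Q'"
  using openin_diff[OF openin_topspace closedin_closure_of, of "jet_topology B 2 m" P'] by (simp add: openin_jet_topology topspace_jet_topology)
 from jet_open_transport[OF m this]
 have o: "openin (jet_topology A 2 m) {jet A 2 m p L | p L. submanifold A m L \<and> p \<in> L \<and> jet B 2 m (F p) (F ` L) \<in> ?Q'}"
  (is "openin _ ?Q") unfolding openin_jet_topology .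
 have "jet A 2 m p L \<in> ?Q" using L in' by blast
 with j o obtain j where "j \<in> P" "j \<in> ?Q" unfolding in_closure_of by meson
 then obtain p L where "submanifold A m L" "p \<in> L" "jet A 2 m p L \<in> P" "jet B 2 m (F p) (F ` L) \<in> ?Q'" by blast
 from P[OF this(1-3)] this(4) show False by blast
qed

end

section \<open>Properties of the pushed coefficients\<close>

text \<open>The pointwise facts on \<open>D\<close> and \<open>B\<close> for the push forward. The
  last one says that the transpose of the spatial block is injective, which keeps the leading
  coefficients definite; the sign of \<open>comp_t D\<close> keeps them positive.\<close>

definition triangular_derivs ::
 "(real \<times> 'e::euclidean_space \<times> real => real \<times> 'f::euclidean_space \<times> real) =>
 (real \<times> 'e \<times> real => real \<times> 'e \<times> real => real \<times> 'f \<times> real) => bool" where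
 "triangular_derivs D B \<longleftrightarrow> linear D \<and> (\<forall>x u. fst (D (0, x, u)) = 0) \<and> fst (snd (D eu)) = 0 \<and> comp_h D \<noteq> 0 \<and> comp_t D > 0 \<and>
  (\<forall>v. linear (B v)) \<and> (\<forall>v. linear (\<lambda>w. B w v)) \<and> (\<forall>x u x' u'. fst (B (0, x, u) (0, x', u')) = 0) \<and>
  (\<forall>x u. fst (snd (B (0, x, u) eu)) = 0) \<and> (\<forall>x u. fst (snd (B eu (0, x, u))) = 0) \<and>
  (\<forall>\<xi>. \<xi> \<noteq> 0 --> (\<exists>i\<in>Basis. comp_x D i \<bullet> \<xi> \<noteq> 0))"

lemma smooth_at_power [smooth_intros]:
 fixes f :: "'a::euclidean_space => real"
 shows "smooth_at f x ==> smooth_at (\<lambda>x. f x ^ n) x"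
 by (induction n) (simp_all add: smooth_at_const smooth_at_mult)

lemma smooth_at_push:
 fixes b c :: "'e::euclidean_space => 'e => 'w::euclidean_space => real"
  and D :: "'w => real \<times> 'e \<times> real => real \<times> 'f::euclidean_space \<times> real"
  and B :: "'w => real \<times> 'e \<times> real => real \<times> 'e \<times> real => real \<times> 'f \<times> real"
 assumes D: "\<And>v. smooth_at (\<lambda>w. D w v) x" and B: "\<And>v v'. smooth_at (\<lambda>w. B w v v') x"
  and b: "\<And>i j. i \<in> Basis ==> j \<in> Basis ==> smooth_at (b i j) x" "\<And>i j. i \<in> Basis ==> j \<in> Basis ==> smooth_at (c i j) x"
   "\<And>i. i \<in> Basis ==> smooth_at (d i) x" "smooth_at q x"
  and nz: "comp_h (D x) \<noteq> 0" "comp_t (D x) \<noteq> 0"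
 shows "smooth_at (\<lambda>w. push_b (D w) (\<lambda>i j. b i j w) k l) x"
  "smooth_at (\<lambda>w. push_c (D w) (B w) (\<lambda>i j. b i j w) (\<lambda>i j. c i j w) k l) x"
  "smooth_at (\<lambda>w. push_d (D w) (B w) (\<lambda>i j. b i j w) (\<lambda>i j. c i j w) (\<lambda>i. d i w) \<bullet> k) x"
  "smooth_at (\<lambda>w. push_q (D w) (B w) (\<lambda>i j. b i j w) (\<lambda>i j. c i j w) (\<lambda>i. d i w) (q w)) x"
proof -
 show "smooth_at (\<lambda>w. push_b (D w) (\<lambda>i j. b i j w) k l) x"
  unfolding push_b_def by (intro smooth_intros D B b) (use nz in simp_all)
 show "smooth_at (\<lambda>w. push_c (D w) (B w) (\<lambda>i j. b i j w) (\<lambda>i j. c i j w) k l) x"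
  unfolding push_c_def by (intro smooth_intros D B b) (use nz in simp_all)
 show "smooth_at (\<lambda>w. push_d (D w) (B w) (\<lambda>i j. b i j w) (\<lambda>i j. c i j w) (\<lambda>i. d i w) \<bullet> k) x"
  unfolding push_d_def by (intro smooth_intros D B b) (use nz in simp_all)
 show "smooth_at (\<lambda>w. push_q (D w) (B w) (\<lambda>i j. b i j w) (\<lambda>i j. c i j w) (\<lambda>i. d i w) (q w)) x"
  unfolding push_q_def by (intro smooth_intros D B b) (use nz in simp_all)
qed

lemma push_symmetric:
 assumes "\<And>i j. i \<in> Basis ==> j \<in> Basis ==> b i j = b j i \<and> c i j = c j i"
 shows "push_b D b k l = push_b D b l k" "push_c D B b c k l = push_c D B b c l k"
proof -
 have "(\<Sum>i\<in>Basis. \<Sum>j\<in>Basis. m i j * ((comp_x D i \<bullet> k) * (comp_x D j \<bullet> l))) =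
   (\<Sum>i\<in>Basis. \<Sum>j\<in>Basis. m i j * ((comp_x D i \<bullet> l) * (comp_x D j \<bullet> k)))"
  if "\<And>i j. i \<in> Basis ==> j \<in> Basis ==> m i j = m j i" for m :: "'a => 'a => real"
  by (subst sum.swap) (intro sum.cong refl, simp add: that mult.commute)
 from this[of b] this[of "\<lambda>i j. comp_h D * c i j - snd (snd (B eu eu)) * b i j"]
 show "push_b D b k l = push_b D b l k" "push_c D B b c k l = push_c D B b c l k"
  using assms unfolding push_b_def push_c_def by simp_all
qed

text \<open>The pushed form at \<open>\<xi>\<close> is the original form at \<open>\<zeta>\<close>,
  the transposed spatial block applied to \<open>\<xi>\<close>, divided by
  \<open>comp_t D > 0\<close>.\<close>

lemma push_b_pos:
 fixes D :: "real \<times> 'e::euclidean_space \<times> real => real \<times> 'f::euclidean_space \<times> real"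
 assumes b: "\<And>\<xi>. \<xi> \<noteq> 0 ==> (\<Sum>i\<in>Basis. \<Sum>j\<in>Basis. b i j * (\<xi> \<bullet> i) * (\<xi> \<bullet> j)) > 0" and D: "triangular_derivs D B" and \<xi>: "\<xi> \<noteq> 0"
 shows "(\<Sum>k\<in>Basis. \<Sum>l\<in>Basis. push_b D b k l * (\<xi> \<bullet> k) * (\<xi> \<bullet> l)) > 0"
proof -
 define \<zeta> where "\<zeta> = (\<Sum>i\<in>Basis. (comp_x D i \<bullet> \<xi>) *\<^sub>R i)"
 have \<zeta>: "\<zeta> \<bullet> i = comp_x D i \<bullet> \<xi>" if "i \<in> Basis" for i using that by (simp add: \<zeta>_def)
 obtain i where "i \<in> Basis" "comp_x D i \<bullet> \<xi> \<noteq> 0" using D \<xi> unfolding triangular_derivs_def by blast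
 then have "\<zeta> \<noteq> 0" using \<zeta>[of i] by auto
 from b[OF this] have p: "(\<Sum>i\<in>Basis. \<Sum>j\<in>Basis. b i j * ((comp_x D i \<bullet> \<xi>) * (comp_x D j \<bullet> \<xi>))) > 0"
  by (simp add: \<zeta> mult.assoc cong: sum.cong)
 have in': "(\<Sum>k\<in>Basis. \<Sum>l\<in>Basis. (y \<bullet> k) * (z \<bullet> l) * ((\<xi> \<bullet> k) * (\<xi> \<bullet> l))) = (y \<bullet> \<xi>) * (z \<bullet> \<xi>)" for y z :: 'f
  unfolding euclidean_inner[of y \<xi>] euclidean_inner[of z \<xi>] sum_product by (simp add: algebra_simps)
 have "(\<Sum>k\<in>Basis. \<Sum>l\<in>Basis. push_b D b k l * (\<xi> \<bullet> k) * (\<xi> \<bullet> l)) =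
   (\<Sum>i\<in>Basis. \<Sum>j\<in>Basis. b i j * ((comp_x D i \<bullet> \<xi>) * (comp_x D j \<bullet> \<xi>))) / comp_t D"
  unfolding push_b_def mult.assoc[of _ "\<xi> \<bullet> _" "\<xi> \<bullet> _"] times_divide_eq_left sum_divide_distrib[symmetric] sum_push in' ..
 then show ?thesis using p D unfolding triangular_derivs_def by simp
qed

section \<open>Generating jets of the equation\<close>

definition graph_jets where
 "graph_jets T A \<Omega> L = {total_jet T A \<Omega> (t, x, u (t, x)) (graph D u) | D u t x.
  local_function T A \<Omega> D u \<and> (t, x) \<in> D \<and> deriv (\<lambda>s. u (s, x)) t = L u t x}"
 for A :: "('a::{t2_space,second_countable_topology}, 'e::euclidean_space) chart set"

lemma extended_equation_graph_jets:
 "extended_equation T A \<Omega> L = jet_topology (total_space T A \<Omega>) 2 (DIM('e) + 1) closure_of graph_jets T A \<Omega> L"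
 for A :: "('a::{t2_space,second_countable_topology}, 'e::euclidean_space) chart set"
 by (simp add: extended_equation_def graph_jets_def)

lemma extended_equation_jet_space:
 fixes A :: "('a::{t2_space,second_countable_topology}, 'e::euclidean_space) chart set"
 shows "extended_equation T A \<Omega> L \<subseteq> jet_space (total_space T A \<Omega>) 2 (DIM('e) + 1)"
 unfolding extended_equation_graph_jets using closure_of_subset_topspace by (metis topspace_jet_topology)

lemma graph_jets_subset:
 fixes A :: "('a::{t2_space,second_countable_topology}, 'e::euclidean_space) chart set"
 assumes pm: "pe_manifold T A \<Omega>"
 shows "graph_jets T A \<Omega> L \<subseteq> extended_equation T A \<Omega> L"
 unfolding extended_equation_graph_jets
proof (rule closure_of_subset, unfold topspace_jet_topology, rule subsetI)
 note P = pe_manifoldD[OF pm]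
 fix j assume "j \<in> graph_jets T A \<Omega> L"
 then obtain D u t x where "j = total_jet T A \<Omega> (t, x, u (t, x)) (graph D u)"
  "local_function T A \<Omega> D u" "(t, x) \<in> D" unfolding graph_jets_def by blast
 moreover from this have "(t, x, u (t, x)) \<in> graph D u" by (auto simp: graph_def)
 ultimately show "j \<in> jet_space (total_space T A \<Omega>) 2 (DIM('e) + 1)"
  using graph_submanifold[OF P(1-3)] unfolding jet_space_def by blast
qed

text \<open>The standard defining function of a graph has derivative 1 along \<open>eu\<close>, and
  defining functions with the same jet have proportional covectors.\<close>

lemma graph_jets_not_vertical:
 fixes A :: "('a::{t2_space,second_countable_topology}, 'e::euclidean_space) chart set"
 assumes pm: "pe_manifold T A \<Omega>" and j: "total_jet T A \<Omega> p L \<in> graph_jets T A \<Omega> Op"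
  and d: "total_defining T A \<Omega> U \<phi> L p \<rho>" and c: "(U, \<phi>) \<in> smooth_charts A"
 shows "D1 \<rho> (tchart \<phi> p) eu \<noteq> 0"
proof -
 note P = pe_manifoldD[OF pm]
 obtain D u t x where u: "total_jet T A \<Omega> p L = total_jet T A \<Omega> (t, x, u (t, x)) (graph D u)"
  "local_function T A \<Omega> D u" "(t, x) \<in> D" using j unfolding graph_jets_def by blast
 have p: "p = (t, x, u (t, x))" using u(1) by (simp add: jet_def)
 then have x: "x \<in> U" using definingD(2)[OF d] by simp
 note g = graph_defining[OF P(1-3) u(2,3) c x]
 have "jet_eq (D1 \<rho> (tchart \<phi> p)) (D2 \<rho> (tchart \<phi> p)) (D1 (\<lambda>w. snd (snd w) + - lrep U \<phi> u (fst w, fst (snd w))) (tchart \<phi> p))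
   (D2 (\<lambda>w. snd (snd w) + - lrep U \<phi> u (fst w, fst (snd w))) (tchart \<phi> p))"
  using jet_eq_iff[OF P(4) dim_total d g(1)[folded p] graph_submanifold[OF P(1-3) u(2)]] u(1) p by simp
 then obtain k where "D1 (\<lambda>w. snd (snd w) + - lrep U \<phi> u (fst w, fst (snd w))) (tchart \<phi> p) eu = k * D1 \<rho> (tchart \<phi> p) eu"
  unfolding jet_eq_def by blast
 moreover have "D1 (\<lambda>w. snd (snd w) + - lrep U \<phi> u (fst w, fst (snd w))) (tchart \<phi> p) eu = 1"
  using g(2)[of 0 0 1] linear_0[OF linear_D1[OF local_functionD(5)[OF P(1-3) u(2,3) c x]]] by (simp add: p zero_prod_def)
 ultimately show ?thesis by auto
qed

text \<open>The value of the operator of the pushed equation at a graph is found by tilting the graph in time direction until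
 its preimage solves the original equation.\<close>

definition pushed_operator where
 "pushed_operator T A \<Omega> E T' A' \<Omega>' F v t x = deriv (\<lambda>s. v (s, x)) t + (THE k. \<exists>D.
  local_function T' A' \<Omega>' D (\<lambda>z. v z + k * (fst z - t)) \<and> (t, x) \<in> D \<and>
  total_jet T A \<Omega> (inv_into (carrier (total_space T A \<Omega>)) F (t, x, v (t, x)))
   (inv_into (carrier (total_space T A \<Omega>)) F ` graph D (\<lambda>z. v z + k * (fst z - t))) \<in> E)"
 for A :: "('a::{t2_space,second_countable_topology}, 'e::euclidean_space) chart set"

section \<open>The pushed equation\<close>

context
 fixes T T' \<Omega> \<Omega>' :: "real set"
  and A :: "('a::{t2_space,second_countable_topology}, 'e::euclidean_space) chart set"
  and A' :: "('b::{t2_space,second_countable_topology}, 'f::euclidean_space) chart set"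
  and F \<tau> \<theta> \<eta> Op
 assumes pm: "pe_manifold T A \<Omega>" and pm': "pe_manifold T' A' \<Omega>'"
  and dF: "diffeomorphism (total_space T A \<Omega>) (total_space T' A' \<Omega>') F"
  and tri: "triangular_form T A \<Omega> T' A' \<Omega>' F \<tau> \<theta> \<eta>" and mono: "strict_mono_on T \<tau>"
  and Op: "parabolic_operator T A \<Omega> Op"
begin

abbreviation (input) "NN \<equiv> total_space T A \<Omega>"
abbreviation (input) "NN' \<equiv> total_space T' A' \<Omega>'"
abbreviation (input) "GG \<equiv> inv_into (carrier NN) F"
abbreviation (input) "EE \<equiv> extended_equation T A \<Omega> Op"
abbreviation (input) "OO' \<equiv> pushed_operator T A \<Omega> EE T' A' \<Omega>' F"

lemmas PN = pe_manifoldD[OF pm] and PN' = pe_manifoldD[OF pm']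
lemmas FG = diffeomorphism_inverse[OF dF]

lemma sub: "submersion NN NN' F" "submersion NN' NN GG"
 using inverse_submersion[OF PN(4) PN'(4) FG(1,2,5,6)] inverse_submersion[OF PN'(4) PN(4) FG(2,1,6,5)] by blast+

text \<open>The zero entries come from \<open>factor_derivs\<close>; \<open>comp_h\<close> is
  nonzero as the derivative of \<open>F\<close> is injective, \<open>comp_t\<close> as it is
  surjective, and the sign of \<open>comp_t\<close> comes from the monotonicity of
  \<open>\<tau>\<close>.\<close>

lemma triangular_local:
 assumes c: "(U, \<phi>) \<in> smooth_charts A" and c': "(U', \<phi>') \<in> smooth_charts A'"
  and p: "p \<in> T \<times> U \<times> \<Omega>" "F p \<in> T' \<times> U' \<times> \<Omega>'"
 defines "Fr \<equiv> \<lambda>y. tchart \<phi>' (F (inv_into (T \<times> U \<times> \<Omega>) (tchart \<phi>) y))"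
 shows "smooth_at Fr (tchart \<phi> p)" "triangular_derivs (D1 Fr (tchart \<phi> p)) (D2 Fr (tchart \<phi> p))"
proof -
 note cU = smooth_charts_is_chart[OF c] and C = total_space_facts(3)[OF PN(1-3) c] and C' = total_space_facts(3)[OF PN'(1-3) c']
 note U = smooth_charts_carrier[OF c]
 show s: "smooth_at Fr (tchart \<phi> p)" unfolding Fr_def by (rule smooth_map_at[OF PN(4) PN'(4) FG(1) C C' p])
 have surj: "surj (D1 Fr (tchart \<phi> p))" unfolding Fr_def by (rule submersion_at[OF PN(4) PN'(4) sub(1) C C' p])
 have pc: "p \<in> carrier NN" using p(1) U unfolding PN(5) by blast
 have "F p \<in> T' \<times> U' \<times> \<Omega>'" "GG (F p) \<in> T \<times> U \<times> \<Omega>" using p FG(5)[OF pc] by simp_all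
 from inverse_D1[OF PN'(4) PN(4) FG(2,1,6,5) C' this(1) C this(2)]
 obtain g where g: "linear g" "\<And>v. g (D1 Fr (tchart \<phi> p) v) = v"
  using linear_D1[OF smooth_map_at[OF PN'(4) PN(4) FG(2) C' C p(2), unfolded FG(5)[OF pc]]] p(1) FG(5)[OF pc] unfolding Fr_def by auto
 have inj: "D1 Fr (tchart \<phi> p) v = 0 ==> v = 0" for v using g(2)[of v] linear_0[OF g(1)] by simp
 obtain t0 x0 u0 where p0: "p = (t0, x0, u0)" "t0 \<in> T" "x0 \<in> U" "u0 \<in> \<Omega>" using p(1) by (cases p) auto
 have y0: "tchart \<phi> p = (t0, \<phi> x0, u0)" by (simp add: p0(1))
 have Fr: "fst (Fr (t, y, z)) = \<tau> t" "fst (snd (Fr (t, y, z))) = \<phi>' (\<theta> (t, inv_into U \<phi> y))"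
  if "t \<in> T" "y \<in> \<phi> ` U" "z \<in> \<Omega>" for t y z
 proof -
  have "inv_into U \<phi> y \<in> carrier A" using that(2) U is_chartD(6)[OF cU] by auto
  then have "F (t, inv_into U \<phi> y, z) = (\<tau> t, \<theta> (t, inv_into U \<phi> y), \<eta> (t, inv_into U \<phi> y, z))"
   using tri that unfolding triangular_form_def by blast
  then show "fst (Fr (t, y, z)) = \<tau> t" "fst (snd (Fr (t, y, z))) = \<phi>' (\<theta> (t, inv_into U \<phi> y))"
   unfolding Fr_def inv_into_tchart[OF cU that] by simp_all
 qed
 have y0U: "\<phi> x0 \<in> \<phi> ` U" using p0(3) by blast
 have ev: "eventually (\<lambda>y. y \<in> T \<times> \<phi> ` U \<times> \<Omega>) (nhds (t0, \<phi> x0, u0))"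
  using PN(2,3) is_chartD(2)[OF cU] p0 by (intro eventually_nhds_in_open open_Times) auto
 let ?D = "D1 Fr (t0, \<phi> x0, u0)" and ?B = "D2 Fr (t0, \<phi> x0, u0)"
 note s = s[unfolded y0] and surj = surj[unfolded y0] and inj = inj[unfolded y0]
 note lD = linear_D1[OF s]
 let ?Q1 = "\<lambda>v::real \<times> 'e \<times> real. (fst v, 0 :: 'e, 0 :: real)" and ?Q2 = "\<lambda>v::real \<times> 'e \<times> real. (fst v, fst (snd v), 0 :: real)"
 have Q: "bounded_linear ?Q1" "bounded_linear ?Q2"
  by (auto intro!: bounded_linear_intros bounded_linear_Pair bounded_linear_fst_comp bounded_linear_snd_comp bounded_linear_zero)
 have b1: "bounded_linear (\<lambda>z::real \<times> 'f \<times> real. fst (snd z))" by (intro bounded_linear_intros)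
 have sf: "smooth_at (\<lambda>y. fst (Fr y)) (t0, \<phi> x0, u0)" "smooth_at (\<lambda>y. fst (snd (Fr y))) (t0, \<phi> x0, u0)"
  by (intro smooth_intros s)+
 have ev1: "eventually (\<lambda>y. fst (Fr y) = fst (Fr ((t0, \<phi> x0, u0) + ?Q1 (y - (t0, \<phi> x0, u0))))) (nhds (t0, \<phi> x0, u0))"
  using ev by (rule eventually_mono) (auto simp: Fr(1) p0)
 have ev2: "eventually (\<lambda>y. fst (snd (Fr y)) = fst (snd (Fr ((t0, \<phi> x0, u0) + ?Q2 (y - (t0, \<phi> x0, u0)))))) (nhds (t0, \<phi> x0, u0))"
  using ev by (rule eventually_mono) (auto simp: Fr(2) p0)
 note d = D1_linear_compose[OF bounded_linear_fst s] D1_linear_compose[OF b1 s] D2_linear_compose[OF bounded_linear_fst s] D2_linear_compose[OF b1 s]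
 have D: "fst (?D v) = fst (?D (?Q1 v))" "fst (snd (?D v)) = fst (snd (?D (?Q2 v)))"
   "fst (?B v w) = fst (?B (?Q1 v) (?Q1 w))" "fst (snd (?B v w)) = fst (snd (?B (?Q2 v) (?Q2 w)))" for v w
  using factor_derivs(1)[OF sf(1) Q(1) ev1, of v] factor_derivs(2)[OF sf(1) Q(1) ev1, of v w]
   factor_derivs(1)[OF sf(2) Q(2) ev2, of v] factor_derivs(2)[OF sf(2) Q(2) ev2, of v w] unfolding d by blast+
 note lB = bilinear_D2[OF s]
 have z: "?D (0, 0, 0) = 0" "?B (0, 0, 0) w = 0" "?B w (0, 0, 0) = 0" for w
  using linear_0[OF lD] linear_0[OF lB(1)] linear_0[OF lB(2)] by (simp_all add: zero_prod_def)
 have 1: "fst (?D (0, x, u)) = 0" for x u using D(1)[of "(0, x, u)"] by (simp add: z)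
 have 2: "fst (snd (?D eu)) = 0" using D(2)[of eu] by (simp add: z)
 have 3: "comp_h ?D \<noteq> 0"
 proof
  assume "comp_h ?D = 0"
  then have "?D eu = 0" using 1[of 0 1] 2 by (simp add: prod_eq_iff)
  from inj[OF this] show False by (simp add: zero_prod_def)
 qed
 have lin: "?D (r, x, u) = r *\<^sub>R ?D (1, 0, 0) + ?D (0, x, u)" for r x u
 proof -
  have "(r, x, u) = r *\<^sub>R (1, 0, 0) + (0, x, u)" by simp
  then show ?thesis using linear_add[OF lD] linear_cmul[OF lD] by (metis (no_types))
 qed
 have t0: "comp_t ?D \<noteq> 0"
 proof
  assume "comp_t ?D = 0"
  then have "fst (?D v) = 0" for v using D(1)[of v] lin[of "fst v" 0 0] by (simp add: z)
  then show False using surjD[OF surj, of "(1, 0, 0)"] by (metis fst_conv zero_neq_one)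
 qed
 let ?\<kappa> = "\<lambda>r. fst (Fr (r, \<phi> x0, u0))"
 have si: "smooth_at (\<lambda>r::real. (r, \<phi> x0, u0)) t0" by (intro smooth_intros)
 have "D1 ?\<kappa> t0 1 = comp_t ?D"
  using D1_compose[OF smooth_at_diffble[OF si] smooth_at_diffble[OF sf(1)], of 1] by (simp add: d D1_Pair_const zero_prod_def)
 moreover have "smooth_at ?\<kappa> t0" by (rule smooth_at_compose[OF si sf(1)])
 ultimately have der: "(?\<kappa> has_real_derivative comp_t ?D) (at t0)"
  using smooth_at_D1_works[of ?\<kappa> t0] linear_D1[of ?\<kappa> t0]
  by (simp add: has_field_derivative_def) (metis (no_types, lifting) has_derivative_eq_rhs linear_cmul mult.commute mult.right_neutral real_scaleR_def ext)
 have "\<not> comp_t ?D < 0"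
 proof
  assume "comp_t ?D < 0"
  from DERIV_neg_dec_right[OF der this] obtain \<delta> where \<delta>: "\<delta> > 0" "\<And>h. 0 < h ==> h < \<delta> ==> ?\<kappa> (t0 + h) < ?\<kappa> t0" by blast
  obtain \<epsilon> where \<epsilon>: "\<epsilon> > 0" "ball t0 \<epsilon> \<subseteq> T" using PN(2) p0(2) open_contains_ball by blast
  define h where "h = min \<delta> \<epsilon> / 2"
  have h: "0 < h" "h < \<delta>" "t0 + h \<in> T" using \<delta>(1) \<epsilon> by (auto simp: h_def dist_real_def intro!: subsetD[OF \<epsilon>(2)])
  then have "\<tau> (t0 + h) < \<tau> t0" using \<delta>(2)[OF h(1,2)] Fr(1)[OF h(3) y0U p0(4)] Fr(1)[OF p0(2) y0U p0(4)] by simp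
  moreover have "\<tau> t0 < \<tau> (t0 + h)" by (rule strict_mono_onD[OF mono p0(2) h(3)]) (simp add: h(1))
  ultimately show False by simp
 qed
 with t0 have 4: "comp_t ?D > 0" by simp
 have 5: "fst (?B (0, x, u) (0, x', u')) = 0" "fst (snd (?B (0, x, u) eu)) = 0" "fst (snd (?B eu (0, x, u))) = 0" for x u x' u'
  using D(3)[of "(0, x, u)" "(0, x', u')"] D(4)[of "(0, x, u)" eu] D(4)[of eu "(0, x, u)"] by (simp_all add: z)
 have 6: "\<exists>i\<in>Basis. comp_x ?D i \<bullet> \<xi> \<noteq> 0" if \<xi>: "\<xi> \<noteq> 0" for \<xi>
 proof (rule ccontr)
  assume "\<not> ?thesis"
  then have n: "comp_x ?D i \<bullet> \<xi> = 0" if "i \<in> Basis" for i using that by blast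
  obtain v where v: "(0, \<xi>, 0) = ?D v" using surjD[OF surj, of "(0, \<xi>, 0)"] by blast
  obtain r x u where rxu: "v = (r, x, u)" by (cases v) auto
  have "0 = r * comp_t ?D" using arg_cong[where f = fst, OF v] lin[of r x u] 1[of x u] unfolding rxu by simp
  then have "r = 0" using t0 by simp
  then have "\<xi> = comp_x ?D x" using arg_cong[where f = "\<lambda>z. fst (snd z)", OF v] D(2)[of "(0, x, u)"] unfolding rxu by simp
  moreover have "linear (\<lambda>x. comp_x ?D x \<bullet> \<xi>)"
   using linear_add[OF lD, of "ex _" "ex _"] linear_cmul[OF lD, of _ "ex _"] by (intro linearI) (simp_all add: inner_add_left)
  from linear_basis_sum[OF this, of x] have "comp_x ?D x \<bullet> \<xi> = 0" by (simp add: n)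
  ultimately show False using \<xi> by simp
 qed
 show "triangular_derivs (D1 Fr (tchart \<phi> p)) (D2 Fr (tchart \<phi> p))"
  unfolding y0 triangular_derivs_def using lD 1 2 3 4 lB 5 6 by blast
qed

text \<open>Characterizes the pushed coefficients by jets alone, without the operator
  \<open>OO'\<close>, so that it can serve to compute this operator.\<close>

definition corresponds where
 "corresponds U' \<phi>' W' b' c' d' q' \<longleftrightarrow> (\<forall>M q \<rho>. submanifold NN' (DIM('f) + 1) M -->
  total_defining T' A' \<Omega>' U' \<phi>' M q \<rho> --> tchart \<phi>' q \<in> W' --> D1 \<rho> (tchart \<phi>' q) eu \<noteq> 0 -->
  (total_jet T A \<Omega> (GG q) (GG ` M) \<in> EE \<longleftrightarrow> pol b' c' d' q' (tchart \<phi>' q) (D1 \<rho> (tchart \<phi>' q)) (D2 \<rho> (tchart \<phi>' q)) = 0))"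

text \<open>Adding \<open>k * (s - t)\<close> to \<open>v\<close> keeps the value and the space
  derivatives at \<open>(t, x)\<close> and adds \<open>k\<close> to the time derivative. So the
  condition in \<open>pushed_operator\<close> holds for exactly one \<open>k\<close>, and this
  \<open>k\<close> plus the time derivative of \<open>v\<close> is the right side.\<close>

lemma pushed_operator_formula:
 assumes c: "(U', \<phi>') \<in> smooth_charts A'" and cor: "corresponds U' \<phi>' W' b' c' d' q'"
  and v: "local_function T' A' \<Omega>' D v" "(t, x) \<in> D" "x \<in> U'" "(t, \<phi>' x, v (t, x)) \<in> W'"
 shows "OO' v t x =
   (\<Sum>i\<in>Basis. \<Sum>j\<in>Basis. b' i j (t, \<phi>' x, v (t, x)) * space_deriv (U', \<phi>') [i, j] v t x) +
   (\<Sum>i\<in>Basis. \<Sum>j\<in>Basis. c' i j (t, \<phi>' x, v (t, x)) * space_deriv (U', \<phi>') [i] v t x * space_deriv (U', \<phi>') [j] v t x) +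
   (\<Sum>i\<in>Basis. d' i (t, \<phi>' x, v (t, x)) * space_deriv (U', \<phi>') [i] v t x) + q' (t, \<phi>' x, v (t, x))" (is "_ = ?R")
proof -
 note cU = smooth_charts_is_chart[OF c]
 note s = local_functionD(5)[OF PN'(1-3) v(1,2) c v(3)]
 note ld = lrep_derivs[OF cU v(3) s]
 let ?l = "lrep U' \<phi>' v" and ?v = "\<lambda>k z. v z + k * (fst z - t)"
 have sk: "smooth_at (\<lambda>y::real \<times> 'f. k * (fst y - t)) z" for k z by (intro smooth_intros)
 have D1k: "D1 (\<lambda>y::real \<times> 'f. k * (fst y - t)) z = (\<lambda>w. k * fst w)" for k z
  by (rule D1_eqI) (auto intro!: derivative_eq_intros)
 have lk: "lrep U' \<phi>' (?v k) = (\<lambda>y. ?l y + k * (fst y - t))" for k by (simp add: lrep_def fun_eq_iff)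
 have D1: "D1 (lrep U' \<phi>' (?v k)) (t, \<phi>' x) w = D1 ?l (t, \<phi>' x) w + k * fst w" for k w
  unfolding lk by (subst D1_add[OF s sk]) (simp add: D1k)
 have D2: "D2 (lrep U' \<phi>' (?v k)) (t, \<phi>' x) w w' = D2 ?l (t, \<phi>' x) w w'" for k w w'
  unfolding lk by (subst D2_add[OF s sk]) (simp add: D2_def D1k D1_const)
 have iff: "total_jet T A \<Omega> (GG (t, x, v (t, x))) (GG ` graph D' (?v k)) \<in> EE \<longleftrightarrow> k = ?R - deriv (\<lambda>s. v (s, x)) t"
  if w: "local_function T' A' \<Omega>' D' (?v k)" "(t, x) \<in> D'" for k D'
 proof -
  let ?\<rho> = "\<lambda>w. snd (snd w) + - lrep U' \<phi>' (?v k) (fst w, fst (snd w))"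
  have vtx: "?v k (t, x) = v (t, x)" by simp
  note g = graph_defining[OF PN'(1-3) w c v(3), unfolded vtx]
  have 1: "D1 ?\<rho> (t, \<phi>' x, v (t, x)) (a, y, r) = r - (D1 ?l (t, \<phi>' x) (a, y) + k * a)" for a y r
   unfolding g(2) D1 by simp
  have 2: "D2 ?\<rho> (t, \<phi>' x, v (t, x)) (a, y, r) (a', y', r') = - D2 ?l (t, \<phi>' x) (a, y) (a', y')" for a y r a' y' r'
   unfolding g(3) D2 ..
  have z: "D1 ?l (t, \<phi>' x) (0, 0) = 0" using linear_0[OF linear_D1[OF s]] by (simp add: zero_prod_def)
  have tc: "tchart \<phi>' (t, x, v (t, x)) = (t, \<phi>' x, v (t, x))" by simp
  have "total_jet T A \<Omega> (GG (t, x, v (t, x))) (GG ` graph D' (?v k)) \<in> EE \<longleftrightarrow>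
    pol b' c' d' q' (t, \<phi>' x, v (t, x)) (D1 ?\<rho> (t, \<phi>' x, v (t, x))) (D2 ?\<rho> (t, \<phi>' x, v (t, x))) = 0"
   using cor[unfolded corresponds_def, rule_format, OF graph_submanifold[OF PN'(1-3) w(1)] g(1), unfolded tc] v(4) 1[of 0 0 1] z by simp
  also have "pol b' c' d' q' (t, \<phi>' x, v (t, x)) (D1 ?\<rho> (t, \<phi>' x, v (t, x))) (D2 ?\<rho> (t, \<phi>' x, v (t, x))) =
    deriv (\<lambda>s. v (s, x)) t + k - ?R"
   unfolding pol_def 1 2 ld by (simp add: z sum_negf mult.assoc)
  finally show ?thesis by auto
 qed
 let ?k = "?R - deriv (\<lambda>s. v (s, x)) t"
 \<comment> \<open>The domain shrinks because the tilted function has to take its values in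
   \<open>\<Omega>'\<close>.\<close>
 let ?D = "D \<inter> ?v ?k -` \<Omega>'"
 have oD: "open D" by (rule local_functionD(1)[OF PN'(1-3) v(1,2)])
 have sub: "D \<subseteq> carrier (time_space T' A')" using v(1) by (simp add: local_function_def)
 have "continuous_on D v"
  using v(1) open_submanifold_facts(2)[OF time_space_facts(1)[OF PN'(1,2)] oD] sub
  by (simp add: local_function_def smooth_map_def Int_absorb1)
 then have "continuous_on D (?v ?k)" by (intro continuous_intros)
 then have oD': "open ?D" by (rule continuous_open_preimage[OF _ oD PN'(3)])
 have lf: "local_function T' A' \<Omega>' ?D (?v ?k)"
 proof (rule local_functionI[OF PN'(1-3) oD'])
  fix s y assume sy: "(s, y) \<in> ?D"
  then have D: "(s, y) \<in> D" by blast
  note l = local_functionD[OF PN'(1-3) v(1) D]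
  obtain V \<psi> where V: "(V, \<psi>) \<in> smooth_charts A'" "y \<in> V" using chart_at_point[OF PN'(1) l(3)] by metis
  have "smooth_at (\<lambda>z. lrep V \<psi> v z + ?k * (fst z - t)) (s, \<psi> y)" by (rule smooth_at_add[OF l(5)[OF V] sk])
  then have "smooth_at (lrep V \<psi> (?v ?k)) (s, \<psi> y)" by (simp add: lrep_def)
  then show "s \<in> T' \<and> ?v ?k (s, y) \<in> \<Omega>' \<and> (\<exists>U \<phi>. (U, \<phi>) \<in> smooth_charts A' \<and> y \<in> U \<and> smooth_at (lrep U \<phi> (?v ?k)) (s, \<phi> y))"
   using l(2) sy V by blast
 qed
 have tx: "(t, x) \<in> ?D" using v(2) local_functionD(4)[OF PN'(1-3) v(1,2)] by simp
 have "(THE k. \<exists>D. local_function T' A' \<Omega>' D (?v k) \<and> (t, x) \<in> D \<and>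
  total_jet T A \<Omega> (GG (t, x, v (t, x))) (GG ` graph D (?v k)) \<in> EE) = ?k"
 proof (rule the_equality)
  show "\<exists>D. local_function T' A' \<Omega>' D (?v ?k) \<and> (t, x) \<in> D \<and> total_jet T A \<Omega> (GG (t, x, v (t, x))) (GG ` graph D (?v ?k)) \<in> EE"
   using iff[OF lf tx] lf tx by blast
 qed (use iff in blast)
 then show ?thesis unfolding pushed_operator_def by simp
qed

text \<open>The coefficients at \<open>w\<close> are those of the given equation at the preimage
  \<open>Gr w\<close>, pushed by the derivatives of \<open>F\<close> there. They are smooth since
  the pushing formulas are rational in these data with nonzero denominators.\<close>

lemma pushed_form:
 assumes q: "q \<in> carrier NN'"
 obtains U' \<phi>' W' b' c' d' q' where "local_form T' A' \<Omega>' OO' U' \<phi>' W' b' c' d' q'" "q \<in> T' \<times> U' \<times> \<Omega>'" "tchart \<phi>' q \<in> W'"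
  "corresponds U' \<phi>' W' b' c' d' q'"
proof -
 have Gq: "GG q \<in> T \<times> carrier A \<times> \<Omega>" using FG(7)[OF q] by (simp add: PN(5))
 then obtain U \<phi> W b c d q0 where lf: "local_form T A \<Omega> Op U \<phi> W b c d q0" and U: "fst (snd (GG q)) \<in> U" and W: "tchart \<phi> (GG q) \<in> W"
  using Op[unfolded parabolic_operator_iff] by (cases "GG q") (auto, blast)
 have q': "q \<in> T' \<times> carrier A' \<times> \<Omega>'" using q by (simp add: PN'(5))
 then obtain U' \<phi>' where c': "(U', \<phi>') \<in> smooth_charts A'" "fst (snd q) \<in> U'" using chart_at_point[OF PN'(1)] by (metis mem_Times_iff)
 note lfD = local_formD[OF lf] and sym = lf[unfolded local_form_def, THEN conjunct2, THEN conjunct2, THEN conjunct2, THEN conjunct2, THEN conjunct2, THEN conjunct2, THEN conjunct1]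
 note C = total_space_facts(3)[OF PN(1-3) lfD(1)] and C' = total_space_facts(3)[OF PN'(1-3) c'(1)]
 note cC = smooth_charts_is_chart[OF C] and cC' = smooth_charts_is_chart[OF C']
 let ?V = "T \<times> U \<times> \<Omega>" and ?V' = "T' \<times> U' \<times> \<Omega>'"
 \<comment> \<open>\<open>O1\<close> is the region where the given local form covers the point,
   \<open>O2\<close> its image under \<open>F\<close>.\<close>
 define O1 where "O1 = ?V \<inter> tchart \<phi> -` W" define O2 where "O2 = carrier NN' \<inter> GG -` O1"
 have "open O1" unfolding O1_def by (rule continuous_open_preimage[OF is_chartD(3,1)[OF cC] lfD(2)])
 then have oO2: "open O2" unfolding O2_def
  by (intro continuous_open_preimage open_carrier PN'(4)) (use FG(2) in \<open>simp add: smooth_map_def\<close>)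
 define W' where "W' = tchart \<phi>' ` (?V' \<inter> O2)"
 have oW': "open W'" unfolding W'_def by (rule chart_image_open[OF cC' oO2])
 define Gr where "Gr w = tchart \<phi> (GG (inv_into ?V' (tchart \<phi>') w))" for w
 define Fr where "Fr = (\<lambda>y. tchart \<phi>' (F (inv_into ?V (tchart \<phi>) y)))"
 define b' where "b' = (\<lambda>k l w. push_b (D1 Fr (Gr w)) (\<lambda>i j. b i j (Gr w)) k l)"
 define cc where "cc = (\<lambda>k l w. push_c (D1 Fr (Gr w)) (D2 Fr (Gr w)) (\<lambda>i j. b i j (Gr w)) (\<lambda>i j. c i j (Gr w)) k l)"
 define d' where "d' = (\<lambda>k w. push_d (D1 Fr (Gr w)) (D2 Fr (Gr w)) (\<lambda>i j. b i j (Gr w)) (\<lambda>i j. c i j (Gr w)) (\<lambda>i. d i (Gr w)) \<bullet> k)"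
 define q1 where "q1 = (\<lambda>w. push_q (D1 Fr (Gr w)) (D2 Fr (Gr w)) (\<lambda>i j. b i j (Gr w)) (\<lambda>i j. c i j (Gr w)) (\<lambda>i. d i (Gr w)) (q0 (Gr w)))"

 have loc: "r \<in> ?V'" "r \<in> carrier NN'" "F (GG r) = r" "GG r \<in> ?V" "Gr (tchart \<phi>' r) = tchart \<phi> (GG r)" "Gr (tchart \<phi>' r) \<in> W"
   "smooth_at Fr (Gr (tchart \<phi>' r))" "triangular_derivs (D1 Fr (Gr (tchart \<phi>' r))) (D2 Fr (Gr (tchart \<phi>' r)))" "smooth_at Gr (tchart \<phi>' r)"
  if r: "r \<in> ?V' \<inter> O2" for r
 proof -
  show 1: "r \<in> ?V'" and 2: "r \<in> carrier NN'" and 4: "GG r \<in> ?V" using r unfolding O1_def O2_def by blast+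
  show 3: "F (GG r) = r" by (rule FG(6)[OF 2])
  show 5: "Gr (tchart \<phi>' r) = tchart \<phi> (GG r)" unfolding Gr_def is_chartD(6)[OF cC' 1] ..
  show "Gr (tchart \<phi>' r) \<in> W" unfolding 5 using r unfolding O1_def O2_def by blast
  have "F (GG r) \<in> ?V'" unfolding 3 by (rule 1)
  from triangular_local[OF lfD(1) c'(1) 4 this]
  show "smooth_at Fr (Gr (tchart \<phi>' r))" "triangular_derivs (D1 Fr (Gr (tchart \<phi>' r))) (D2 Fr (Gr (tchart \<phi>' r)))"
   unfolding 5 Fr_def by blast+
  show "smooth_at Gr (tchart \<phi>' r)" unfolding Gr_def by (rule smooth_map_at[OF PN'(4) PN(4) FG(2) C' C 1 4])
 qed
 have W'D: "\<exists>r. r \<in> ?V' \<inter> O2 \<and> w = tchart \<phi>' r" if w: "w \<in> W'" for w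
 proof -
  from w obtain r where "w = tchart \<phi>' r" "r \<in> ?V' \<inter> O2" unfolding W'_def by (rule imageE)
  then show ?thesis by (intro exI conjI)
 qed
 have cor: "corresponds U' \<phi>' W' b' cc d' q1"
  unfolding corresponds_def
 proof (intro allI impI)
  fix M r \<rho> assume M: "submanifold NN' (DIM('f) + 1) M" and \<rho>: "defining NN' ?V' (tchart \<phi>') M r \<rho>"
   and w: "tchart \<phi>' r \<in> W'" and nv: "D1 \<rho> (tchart \<phi>' r) eu \<noteq> 0"
  obtain s where s: "s \<in> ?V' \<inter> O2" "tchart \<phi>' r = tchart \<phi>' s" using W'D[OF w] by (elim exE conjE) (rule that)
  have "r = s" by (rule inj_onD[OF is_chartD(4)[OF cC'] s(2) definingD(2)[OF \<rho>] IntD1[OF s(1)]])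
  note l = loc[OF s(1)[folded this]]
  have Mc: "M \<subseteq> carrier NN'" using M by (simp add: submanifold_def)
  have GM: "carrier NN \<inter> F -` M = GG ` M"
  proof (intro equalityI subsetI)
   fix p assume "p \<in> carrier NN \<inter> F -` M"
   then show "p \<in> GG ` M" using FG(5)[of p] by (intro image_eqI[of _ _ "F p"]) auto
  next
   fix p assume "p \<in> GG ` M"
   then obtain s where s: "s \<in> M" "p = GG s" by blast
   then have "s \<in> carrier NN'" using Mc by blast
   from FG(6,7)[OF this] s show "p \<in> carrier NN \<inter> F -` M" by simp
  qed
  note pb = pullback_defining[OF PN(4) PN'(4) sub(1) _ C l(4), unfolded l(3), OF \<rho>, unfolded GM, folded Fr_def]
  let ?D = "D1 Fr (tchart \<phi> (GG r))" and ?B = "D2 Fr (tchart \<phi> (GG r))" and ?\<alpha> = "D1 \<rho> (tchart \<phi>' r)" and ?H = "D2 \<rho> (tchart \<phi>' r)"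
  have pb': "D1 (\<lambda>y. \<rho> (Fr y)) (tchart \<phi> (GG r)) = (\<lambda>v. ?\<alpha> (?D v))"
   "D2 (\<lambda>y. \<rho> (Fr y)) (tchart \<phi> (GG r)) = (\<lambda>v w. ?H (?D v) (?D w) + ?\<alpha> (?B v w))"
   using pb(2,3) unfolding Fr_def by (simp_all add: fun_eq_iff)
  have pb1: "defining NN ?V (tchart \<phi>) (GG ` M) (GG r) (\<lambda>y. \<rho> (Fr y))" using pb(1) unfolding Fr_def .
  have td: "triangular_derivs ?D ?B" using l(8) unfolding l(5) .
  note td' = td[unfolded triangular_derivs_def]
  have lB: "linear (?B v)" "linear (\<lambda>w. ?B w v)" for v using td' by blast+
  have l\<alpha>: "linear ?\<alpha>" and lH: "\<And>v. linear (?H v)" "\<And>v. linear (\<lambda>w. ?H w v)"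
   using linear_D1[OF definingD(4)[OF \<rho>]] bilinear_D2[OF definingD(4)[OF \<rho>]] by blast+
  have push: "pol b c d q0 (tchart \<phi> (GG r)) (\<lambda>v. ?\<alpha> (?D v)) (\<lambda>v w. ?H (?D v) (?D w) + ?\<alpha> (?B v w)) =
   (comp_h ?D)\<^sup>2 * comp_t ?D * pol b' cc d' q1 (tchart \<phi>' r) ?\<alpha> ?H"
   by (rule pol_push[where D = ?D and B = ?B and \<alpha> = ?\<alpha> and H = ?H])
    (use td' lB l\<alpha> lH in \<open>simp_all add: b'_def cc_def d'_def q1_def l(5)\<close>)
  have "?D eu = comp_h ?D *\<^sub>R eu" using td' by (simp add: prod_eq_iff)
  then have eu: "?\<alpha> (?D eu) = comp_h ?D * ?\<alpha> eu" using linear_cmul[OF l\<alpha>, of "comp_h ?D" eu] by simp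
  have nv': "D1 (\<lambda>y. \<rho> (Fr y)) (tchart \<phi> (GG r)) eu \<noteq> 0" unfolding pb' eu using td' nv by simp
  have pr: "GG ` M = GG ` M" ..
  have sG: "submanifold NN (DIM('e) + 1) (GG ` M)"
  proof (rule projected_image_submanifold[OF PN'(4) PN(4) sub(2) dim_total dim_total M])
   have "y \<in> M" if y: "y \<in> carrier NN'" "GG y \<in> GG ` M" for y
   proof -
    obtain z where z: "z \<in> M" "GG y = GG z" using y(2) by (rule imageE)
    have "y = z" using arg_cong[OF z(2), of F] unfolding FG(6)[OF y(1)] FG(6)[OF subsetD[OF Mc z(1)]] .
    then show ?thesis using z(1) by simp
   qed
   then show "projected NN' GG M" unfolding projected_def by (intro equalityI subsetI IntI vimageI2 imageI subsetD[OF Mc]) auto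
  qed
  have w: "tchart \<phi> (GG r) \<in> W" using l(6) unfolding l(5) .
  have nz: "(comp_h ?D)\<^sup>2 * comp_t ?D \<noteq> 0" using td' by simp
  have "total_jet T A \<Omega> (GG r) (GG ` M) \<in> EE \<longleftrightarrow>
   pol b c d q0 (tchart \<phi> (GG r)) (D1 (\<lambda>y. \<rho> (Fr y)) (tchart \<phi> (GG r))) (D2 (\<lambda>y. \<rho> (Fr y)) (tchart \<phi> (GG r))) = 0"
   using graph_like_in_equation[OF pm lf sG pb1 w nv'] not_in_equation[OF pm lf sG pb1 w nv'] by blast
  also have "\<dots> \<longleftrightarrow> pol b' cc d' q1 (tchart \<phi>' r) ?\<alpha> ?H = 0" unfolding pb' push using nz by simp
  finally show "total_jet T A \<Omega> (GG r) (GG ` M) \<in> EE \<longleftrightarrow> pol b' cc d' q1 (tchart \<phi>' r) ?\<alpha> ?H = 0" .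
 qed
 have sm: "smooth_at (b' k l) w" "smooth_at (cc k l) w" "smooth_at (d' k) w" "smooth_at q1 w" if w: "w \<in> W'" for k l w
 proof -
  obtain r where r: "r \<in> ?V' \<inter> O2" "w = tchart \<phi>' r" using W'D[OF w] by (elim exE conjE) (rule that)
  note l = loc[OF r(1), folded r(2)]
  note td' = l(8)[unfolded triangular_derivs_def]
  have D: "smooth_at (\<lambda>w. D1 Fr (Gr w) v) w" "smooth_at (\<lambda>w. D2 Fr (Gr w) v v') w" for v v'
   by (rule smooth_at_D1_compose[OF l(7,9) smooth_at_const], rule smooth_at_D2[OF l(7,9)])
  note co = lfD(4)[OF _ _ l(6), THEN conjunct1, THEN smooth_at_compose[OF l(9)]] lfD(4)[OF _ _ l(6), THEN conjunct2, THEN smooth_at_compose[OF l(9)]]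
   lfD(5)[OF _ l(6), THEN smooth_at_compose[OF l(9)]] lfD(6)[OF l(6), THEN smooth_at_compose[OF l(9)]]
  have nz: "comp_h (D1 Fr (Gr w)) \<noteq> 0" "comp_t (D1 Fr (Gr w)) \<noteq> 0" using td' by auto
  note sp = smooth_at_push[of "\<lambda>w. D1 Fr (Gr w)" w "\<lambda>w. D2 Fr (Gr w)" "\<lambda>i j w. b i j (Gr w)" "\<lambda>i j w. c i j (Gr w)" "\<lambda>i w. d i (Gr w)" "\<lambda>w. q0 (Gr w)", OF D co nz]
  show "smooth_at (b' k l) w" "smooth_at (cc k l) w" "smooth_at (d' k) w" "smooth_at q1 w"
   unfolding b'_def cc_def d'_def q1_def by (rule sp; assumption)+
 qed
 have "local_form T' A' \<Omega>' OO' U' \<phi>' W' b' cc d' q1"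
  unfolding local_form_def
 proof (intro conjI ballI allI impI)
  show "W' \<subseteq> T' \<times> \<phi>' ` U' \<times> \<Omega>'" unfolding W'_def by auto
  show "b' i j w = b' j i w" "cc i j w = cc j i w" if w: "w \<in> W'" for i j w
  proof -
   obtain r where r: "r \<in> ?V' \<inter> O2" "w = tchart \<phi>' r" using W'D[OF w] by (elim exE conjE) (rule that)
   have "b i j (Gr w) = b j i (Gr w) \<and> c i j (Gr w) = c j i (Gr w)" if "i \<in> Basis" "j \<in> Basis" for i j
    using sym loc(6)[OF r(1)] that unfolding r(2) by blast
   from push_symmetric[of "\<lambda>i j. b i j (Gr w)" "\<lambda>i j. c i j (Gr w)", OF this]
   show "b' i j w = b' j i w" "cc i j w = cc j i w" unfolding b'_def cc_def by blast+
  qed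
  show "0 < (\<Sum>i\<in>Basis. \<Sum>j\<in>Basis. b' i j w * (\<xi> \<bullet> i) * (\<xi> \<bullet> j))" if w: "w \<in> W'" "\<xi> \<noteq> 0" for w \<xi>
  proof -
   obtain r where r: "r \<in> ?V' \<inter> O2" "w = tchart \<phi>' r" using W'D[OF w(1)] by (elim exE conjE) (rule that)
   show ?thesis unfolding b'_def
    by (rule push_b_pos[OF lfD(7)[OF loc(6)[OF r(1)]] loc(8)[OF r(1)] w(2), folded r(2)])
  qed
 qed (use c' oW' sm pushed_operator_formula[OF c'(1) cor] in \<open>auto simp: smooth_on_iff\<close>)
 moreover have "q \<in> ?V'" using q' c'(2) by (simp add: mem_Times_iff)
 moreover from this have "tchart \<phi>' q \<in> W'"
  unfolding W'_def O2_def O1_def using q U W Gq by (intro imageI) (simp add: mem_Times_iff)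
 ultimately show ?thesis using cor that by blast
qed

lemma pushed_parabolic: "parabolic_operator T' A' \<Omega>' OO'"
 unfolding parabolic_operator_iff
proof (intro ballI)
 fix t x u assume "t \<in> T'" "x \<in> carrier A'" "u \<in> \<Omega>'"
 then have "(t, x, u) \<in> carrier NN'" by (simp add: PN'(5))
 from pushed_form[OF this] show "\<exists>U \<phi> W b c d q. local_form T' A' \<Omega>' OO' U \<phi> W b c d q \<and> x \<in> U \<and> (t, \<phi> x, u) \<in> W"
  by (simp add: mem_Times_iff) metis
qed

abbreviation (input) "EE' \<equiv> extended_equation T' A' \<Omega>' OO'"

text \<open>By \<open>corresponds\<close> for the given equation and the two membership criteria for
  the pushed one, both sides mean that the same polynomial vanishes.\<close>

lemma not_vertical_correspond:
 assumes M: "submanifold NN' (DIM('f) + 1) M" "q \<in> M"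
  and nv: "\<And>U' \<phi>' \<rho>. (U', \<phi>') \<in> smooth_charts A' ==> q \<in> T' \<times> U' \<times> \<Omega>' ==> total_defining T' A' \<Omega>' U' \<phi>' M q \<rho> ==>
   D1 \<rho> (tchart \<phi>' q) eu \<noteq> 0"
 shows "total_jet T A \<Omega> (GG q) (GG ` M) \<in> EE \<longleftrightarrow> total_jet T' A' \<Omega>' q M \<in> EE'"
proof -
 have "q \<in> carrier NN'" using M by (auto simp: submanifold_def)
 from pushed_form[OF this] obtain U' \<phi>' W' b' c' d' q' where lf: "local_form T' A' \<Omega>' OO' U' \<phi>' W' b' c' d' q'"
  and q: "q \<in> T' \<times> U' \<times> \<Omega>'" "tchart \<phi>' q \<in> W'" and cor: "corresponds U' \<phi>' W' b' c' d' q'" .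
 note c = local_formD(1)[OF lf]
 obtain \<rho> where \<rho>: "total_defining T' A' \<Omega>' U' \<phi>' M q \<rho>"
  using submanifold_defining[OF PN'(4) M(1) dim_total total_space_facts(3)[OF PN'(1-3) c] M(2) q(1)] .
 note n = nv[OF c q(1) \<rho>]
 show ?thesis
  using cor[unfolded corresponds_def, rule_format, OF M(1) \<rho> q(2) n]
   graph_like_in_equation[OF pm' lf M(1) \<rho> q(2) n] not_in_equation[OF pm' lf M(1) \<rho> q(2) n] by blast
qed

lemma equal_dims: "DIM('f) = DIM('e)"
proof -
 have le: "DIM('y) \<le> DIM('x)" if "linear f" "surj f" for f :: "'x::euclidean_space => 'y::euclidean_space"
  using dim_image_le[OF that(1), of UNIV] that(2) by simp
 obtain p where p: "p \<in> carrier NN"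
  using pm unfolding PN(5) pe_manifold_def nonempty_open_interval_def connected_manifold_def by blast
 have q: "F p \<in> carrier NN'" by (rule smooth_mapD(1)[OF FG(1) p])
 obtain U \<phi> where c: "(U, \<phi>) \<in> smooth_charts NN" "p \<in> U" using chart_at_point[OF PN(4) p] by metis
 obtain V \<psi> where d: "(V, \<psi>) \<in> smooth_charts NN'" "F p \<in> V" using chart_at_point[OF PN'(4) q] by metis
 have Gq: "GG (F p) \<in> U" using FG(5)[OF p] c(2) by simp
 from le[OF linear_D1[OF smooth_map_at[OF PN(4) PN'(4) FG(1) c(1) d(1) c(2) d(2)]] submersion_at[OF PN(4) PN'(4) sub(1) c(1) d(1) c(2) d(2)]]
  le[OF linear_D1[OF smooth_map_at[OF PN'(4) PN(4) FG(2) d(1) c(1) d(2) Gq]] submersion_at[OF PN'(4) PN(4) sub(2) d(1) c(1) d(2) Gq]]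
 show ?thesis by simp
qed

text \<open>Vertical jets escape \<open>pol\<close>. But both equations are closures of sets of jets
  of graphs, whose counterparts are not vertical either; so these generators correspond, and
  \<open>closure_transport\<close> extends this to the closures in both directions.\<close>

lemma jets_correspond:
 assumes L: "submanifold NN (DIM('e) + 1) L" "p \<in> L"
 shows "total_jet T A \<Omega> p L \<in> EE \<longleftrightarrow> total_jet T' A' \<Omega>' (F p) (F ` L) \<in> EE'"
proof -
 obtain J :: "real \<times> 'e \<times> real => real \<times> 'f \<times> real" and K where JK: "linear J" "linear K" "\<And>x. norm (J x) = norm x" "\<And>x. norm (K x) = norm x"
  "\<And>x. K (J x) = x" "\<And>x. J (K x) = x"
  by (rule isometries_subspaces[of "UNIV :: (real \<times> 'e \<times> real) set" "UNIV :: (real \<times> 'f \<times> real) set"]) (auto simp: equal_dims)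
 note m = dim_total[where 'e = 'e] dim_total[where 'e = 'f, unfolded equal_dims]
 have img: "F ` L \<subseteq> carrier NN'" "GG ` F ` L = L" "GG (F p) = p" "projected NN F L" if "L \<subseteq> carrier NN" "p \<in> L" for L p
 proof -
  have G: "GG (F p) = p" if p: "p \<in> L" for p by (rule FG(5)[OF subsetD[OF \<open>L \<subseteq> carrier NN\<close> p]])
  show "F ` L \<subseteq> carrier NN'" by (intro image_subsetI smooth_mapD(1)[OF FG(1)] subsetD[OF that(1)])
  show "GG ` F ` L = L" "GG (F p) = p" using G that by (simp_all add: image_image)
  have "x \<in> L" if "x \<in> carrier NN" "F x \<in> F ` L" for x
  proof -
   obtain y where "y \<in> L" "F x = F y" using \<open>F x \<in> F ` L\<close> by blast
   then show ?thesis using G[of y] FG(5)[OF \<open>x \<in> carrier NN\<close>] by simp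
  qed
  then show "projected NN F L" unfolding projected_def by (intro equalityI subsetI IntI vimageI2 imageI subsetD[OF that(1)]) auto
 qed
 have sF: "submanifold NN' (DIM('f) + 1) (F ` L)" if "submanifold NN (DIM('e) + 1) L" "p \<in> L" for L p
  by (rule projected_image_submanifold[OF PN(4) PN'(4) sub(1) dim_total dim_total that(1) img(4)[OF _ that(2)]])
   (use that in \<open>simp add: submanifold_def\<close>)
 have 1: "total_jet T' A' \<Omega>' (F p) (F ` L) \<in> EE'"
  if L: "submanifold NN (DIM('e) + 1) L" "p \<in> L" and j: "total_jet T A \<Omega> p L \<in> graph_jets T A \<Omega> Op" for p L
 proof -
  have Lc: "L \<subseteq> carrier NN" using L(1) by (simp add: submanifold_def)
  note i = img[OF Lc L(2)]
  have pc: "p \<in> carrier NN" using Lc L(2) by blast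
  have "total_jet T A \<Omega> (GG (F p)) (GG ` F ` L) \<in> EE \<longleftrightarrow> total_jet T' A' \<Omega>' (F p) (F ` L) \<in> EE'"
  proof (rule not_vertical_correspond[OF sF[OF L] imageI[OF L(2)]])
   fix U' \<phi>' \<rho> assume c': "(U', \<phi>') \<in> smooth_charts A'" "F p \<in> T' \<times> U' \<times> \<Omega>'"
    and \<rho>: "total_defining T' A' \<Omega>' U' \<phi>' (F ` L) (F p) \<rho>"
   have "p \<in> T \<times> carrier A \<times> \<Omega>" using pc by (simp add: PN(5))
   then obtain U \<phi> where c: "(U, \<phi>) \<in> smooth_charts A" "p \<in> T \<times> U \<times> \<Omega>" using chart_at_point[OF PN(1)] by (metis mem_Times_iff)
   let ?\<rho> = "\<lambda>y. \<rho> (tchart \<phi>' (F (inv_into (T \<times> U \<times> \<Omega>) (tchart \<phi>) y)))"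
   let ?D = "D1 (\<lambda>y. tchart \<phi>' (F (inv_into (T \<times> U \<times> \<Omega>) (tchart \<phi>) y))) (tchart \<phi> p)"
   note pb = pullback_defining[OF PN(4) PN'(4) sub(1) \<rho> total_space_facts(3)[OF PN(1-3) c(1)] c(2)]
   have d: "total_defining T A \<Omega> U \<phi> L p ?\<rho>" using pb(1) i(4) unfolding projected_def by simp
   have td: "fst (?D (0, 0, 1)) = 0" "fst (snd (?D eu)) = 0"
    using triangular_local(2)[OF c(1) c'(1) c(2) c'(2)] unfolding triangular_derivs_def by blast+
   \<comment> \<open>A triangular map sends \<open>eu\<close> to a multiple of \<open>eu\<close>, so
     jets that are not vertical have images that are not vertical.\<close>
   then have "?D eu = comp_h ?D *\<^sub>R eu" by (simp add: prod_eq_iff)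
   then have "D1 ?\<rho> (tchart \<phi> p) eu = comp_h ?D * D1 \<rho> (tchart \<phi>' (F p)) eu"
    using linear_cmul[OF linear_D1[OF definingD(4)[OF \<rho>]], of "comp_h ?D" eu] by (simp add: pb(2))
   moreover have "D1 ?\<rho> (tchart \<phi> p) eu \<noteq> 0" by (rule graph_jets_not_vertical[OF pm j d c(1)])
   ultimately show "D1 \<rho> (tchart \<phi>' (F p)) eu \<noteq> 0" by auto
  qed
  then show ?thesis using subsetD[OF graph_jets_subset[OF pm] j] by (simp add: i)
 qed
 have 2: "total_jet T A \<Omega> (GG q) (GG ` M) \<in> EE"
  if M: "submanifold NN' (DIM('f) + 1) M" "q \<in> M" and j: "total_jet T' A' \<Omega>' q M \<in> graph_jets T' A' \<Omega>' OO'" for q M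
 proof -
  have "total_jet T A \<Omega> (GG q) (GG ` M) \<in> EE \<longleftrightarrow> total_jet T' A' \<Omega>' q M \<in> EE'"
   by (rule not_vertical_correspond[OF M]) (rule graph_jets_not_vertical[OF pm' j])
  then show ?thesis using subsetD[OF graph_jets_subset[OF pm'] j] by simp
 qed
 \<comment> \<open>A name for the operator, because it contains \<open>EE\<close> and the rewriting
   with \<open>extended_equation_graph_jets\<close> must not reach inside it.\<close>
 define O' where "O' = OO'"
 have eq': "total_jet T' A' \<Omega>' q M \<in> EE' \<longleftrightarrow>
   jet NN' 2 (DIM('e) + 1) q M \<in> jet_topology NN' 2 (DIM('e) + 1) closure_of graph_jets T' A' \<Omega>' O'" for q M
  unfolding O'_def[symmetric] unfolding extended_equation_graph_jets equal_dims ..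
 have Lc: "L \<subseteq> carrier NN" using L(1) by (simp add: submanifold_def)
 note i = img[OF Lc L(2)]
 show ?thesis
 proof
  assume "total_jet T A \<Omega> p L \<in> EE"
  then have j: "total_jet T A \<Omega> p L \<in> jet_topology NN 2 (DIM('e) + 1) closure_of graph_jets T A \<Omega> Op"
   unfolding extended_equation_graph_jets .
  have "jet NN' 2 (DIM('e) + 1) (F p) (F ` L) \<in> jet_topology NN' 2 (DIM('e) + 1) closure_of graph_jets T' A' \<Omega>' O'"
   by (rule closure_transport[OF PN(4) PN'(4) FG(1,2,5,6) JK(1,3,2,4,5,6) m L], assumption, assumption, rule j, rule 1[unfolded eq'])
  then show "total_jet T' A' \<Omega>' (F p) (F ` L) \<in> EE'" unfolding eq' .
 next
  assume "total_jet T' A' \<Omega>' (F p) (F ` L) \<in> EE'"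
  then have j: "jet NN' 2 (DIM('e) + 1) (F p) (F ` L) \<in> jet_topology NN' 2 (DIM('e) + 1) closure_of graph_jets T' A' \<Omega>' O'" unfolding eq' .
  have "total_jet T A \<Omega> (GG (F p)) (GG ` F ` L) \<in> jet_topology NN 2 (DIM('e) + 1) closure_of graph_jets T A \<Omega> Op"
   by (rule closure_transport[OF PN'(4) PN(4) FG(2,1,6,5) JK(2,4,1,3,6,5) m(2,1) sF[OF L, unfolded equal_dims] imageI[OF L(2)]],
     assumption, assumption, rule j, unfold extended_equation_graph_jets[symmetric], rule 2[folded O'_def, unfolded equal_dims])
  then show "total_jet T A \<Omega> p L \<in> EE" unfolding extended_equation_graph_jets i .
 qed
qed

lemma pushed_isomorphism: "pe_isomorphism T A \<Omega> EE T' A' \<Omega>' EE' F"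
 unfolding pe_isomorphism_iff pe_morphism_def pde_morphism_iff[OF dim_total dim_total]
proof (intro conjI allI impI)
 show "pe_object T A \<Omega> EE" "pe_object T' A' \<Omega>' EE'" using pm pm' Op pushed_parabolic unfolding pe_object_def by blast+
 show "pde_object NN 2 (DIM('e) + 1) EE" "pde_object NN' 2 (DIM('f) + 1) EE'"
  unfolding pde_object_def using PN(4) PN'(4) extended_equation_jet_space by simp_all
qed (use sub(1) FG(3) dF jets_correspond in blast)+

end

text \<open>The word exactly leaves the target equation open: a diffeomorphism of this form
  determines it, so the converse constructs \<open>E'\<close> from \<open>E\<close>. A decreasing
  \<open>\<tau>\<close> would make the pushed leading coefficients negative definite.\<close>

theorem theorem1:
  fixes T T' \<Omega> \<Omega>' :: "real set"
    and A :: "('a::{t2_space,second_countable_topology}, 'e::euclidean_space) chart set"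
    and A' :: "('b::{t2_space,second_countable_topology}, 'f::euclidean_space) chart set"
  shows
    "(\<forall>E E' F. pe_morphism T A \<Omega> E T' A' \<Omega>' E' F \<longrightarrow>
        (\<exists>\<tau> \<theta> \<eta>. triangular_form T A \<Omega> T' A' \<Omega>' F \<tau> \<theta> \<eta>)) \<and>
     (\<forall>E E' F. pe_isomorphism T A \<Omega> E T' A' \<Omega>' E' F \<longleftrightarrow>
        pe_morphism T A \<Omega> E T' A' \<Omega>' E' F \<and>
        diffeomorphism (total_space T A \<Omega>) (total_space T' A' \<Omega>') F \<and>
        (\<exists>\<tau> \<theta> \<eta>. triangular_form T A \<Omega> T' A' \<Omega>' F \<tau> \<theta> \<eta>)) \<and>
     (\<forall>E F \<tau> \<theta> \<eta>.
        pe_object T A \<Omega> E \<and> pe_manifold T' A' \<Omega>' \<and>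
        diffeomorphism (total_space T A \<Omega>) (total_space T' A' \<Omega>') F \<and>
        triangular_form T A \<Omega> T' A' \<Omega>' F \<tau> \<theta> \<eta> \<and> strict_mono_on T \<tau> \<longrightarrow>
        (\<exists>E'. pe_isomorphism T A \<Omega> E T' A' \<Omega>' E' F))"
proof (intro conjI allI impI)
  fix E F \<tau> \<theta> \<eta>
  assume "pe_object T A \<Omega> E \<and> pe_manifold T' A' \<Omega>' \<and>
        diffeomorphism (total_space T A \<Omega>) (total_space T' A' \<Omega>') F \<and>
        triangular_form T A \<Omega> T' A' \<Omega>' F \<tau> \<theta> \<eta> \<and> strict_mono_on T \<tau>"
  then obtain Op where "pe_manifold T A \<Omega>" "pe_manifold T' A' \<Omega>'" "diffeomorphism (total_space T A \<Omega>) (total_space T' A' \<Omega>') F"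
    "triangular_form T A \<Omega> T' A' \<Omega>' F \<tau> \<theta> \<eta>" "strict_mono_on T \<tau>" "parabolic_operator T A \<Omega> Op" and E: "E = extended_equation T A \<Omega> Op"
    unfolding pe_object_def by blast
  from pushed_isomorphism[OF this(1-6)] show "\<exists>E'. pe_isomorphism T A \<Omega> E T' A' \<Omega>' E' F" unfolding E by blast
next
  fix E E' F
  show "\<exists>\<tau> \<theta> \<eta>. triangular_form T A \<Omega> T' A' \<Omega>' F \<tau> \<theta> \<eta>" if "pe_morphism T A \<Omega> E T' A' \<Omega>' E' F"
    using morphism_triangular[OF that] by blast
  then show "pe_isomorphism T A \<Omega> E T' A' \<Omega>' E' F \<longleftrightarrow>
        pe_morphism T A \<Omega> E T' A' \<Omega>' E' F \<and>
        diffeomorphism (total_space T A \<Omega>) (total_space T' A' \<Omega>') F \<and>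
        (\<exists>\<tau> \<theta> \<eta>. triangular_form T A \<Omega> T' A' \<Omega>' F \<tau> \<theta> \<eta>)"
    unfolding pe_isomorphism_iff by blast
qed

end
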